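(* Let $N\ge 2$ and let $\Omega\subset\mathbb{R}^N$ be an open cone, i.e. $\lambda x\in\Omega$ for all $x\in\Omega$ and $\lambda>0$ (in particular, $\Omega=\mathbb{R}^N$ is allowed). Let $p,q,r,\mu,\sigma,s$ be real numbers with $p>1$, $s>0$, $\max\{\sigma,s\}<\mu+p<N$, $r\ge 1$, $1\le q<\min\{p^*,p^*(\sigma,\mu)\}$, $$\max\Big\{\frac{p(\sigma-s)}{N-\mu-p}+q,\ \frac{\sigma-s}{N-\sigma}q+q\Big\}<r<\min\{p^*,p^*(s,\mu)\},$$ and $$\begin{cases} p(s-\sigma)+q(\mu+p-s)<r(\mu+p-\sigma),\\ (Np-Nr+pr)(s-\sigma)>(N\mu-Ns+ps)(r-q).\end{cases}$$ Let $a=\frac{[(N-\sigma)r-(N-s)q]p}{[(N-\sigma)p-(N-\mu-p)q]r}$ and let $C(p,q,r,\mu,\sigma,s)$ be the sharp (smallest) constant in the inequality $$\Big(\int_\Omega\frac{|u|^r}{|x|^s}dx\Big)^{\frac1r}\le C(p,q,r,\mu,\sigma,s)\Big(\int_\Omega\frac{|\nabla u|^p}{|x|^\mu}dx\Big)^{\frac ap}\Big(\int_\Omega\frac{|u|^q}{|x|^\sigma}dx\Big)^{\frac{1-a}q},\qquad u\in E .$$ Then the sharp constant $C(p,q,r,\mu,\sigma,s)$ is achieved (equality holds for some nonzero $u\in E$), and $$C(p,q,r,\mu,\sigma,s)=\Big(\frac1\rho\Big)^{\frac{(\mu+p-\sigma)r+(p-q)(N-s)}{r[(N-\sigma)p-(N-\mu-p)q]}},$$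 where $$\rho:=\inf\Big\{\int_\Omega\frac{|\nabla u|^p}{|x|^\mu}dx+\lambda^*\int_\Omega\frac{|u|^q}{|x|^\sigma}dx\ :\ u\in E,\ \int_\Omega\frac{|u|^r}{|x|^s}dx=1\Big\},$$ this infimum is attained, and $$\lambda^*:=\Big\{\frac{p(N-s)-(N-\mu-p)r}{(\mu+p-\sigma)r+(p-q)(N-s)}\Big\}^{\frac{(\mu+p-\sigma)r+(p-q)(N-s)}{(N-s)p-(N-\mu-p)r}}\cdot\Big\{\frac{(N-\sigma)r-(N-s)q}{p(N-s)-(N-\mu-p)r}\Big\}^{\frac{(N-\sigma)r-(N-s)q}{p(N-s)-(N-\mu-p)r}}.$$
   Context: $p^*:=\frac{Np}{N-p}$ if $p<N$ and $p^*:=\infty$ if $p\ge N$; $p^*(t,\mu):=\frac{p(N-t)}{N-p-\mu}$. $W^{1,p}_\mu(\Omega)$ is the completion of $C_0^\infty(\Omega)$ with respect to the norm $\|u\|:=\big(\int_\Omega\frac{|\nabla u|^p}{|x|^\mu}dx\big)^{1/p}$. $L^q(\Omega,\frac{dx}{|x|^\sigma})$ is the completion of $C_0^\infty(\Omega)$ with respect to $|u|_{q,\sigma}:=\big(\int_\Omega\frac{|u|^q}{|x|^\sigma}dx\big)^{1/q}$. $E:=W^{1,p}_\mu(\Omega)\cap L^q(\Omega,\frac{dx}{|x|^\sigma})$. *)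

theory Defs
  imports "HOL-Analysis.Analysis"
begin

section \<open>Test functions\<close>

text \<open>\<open>Ck k f\<close>: the function \<open>f\<close> is of class \<open>C^k\<close> on the whole space, by iterating
  directional derivatives.\<close>

primrec Ck :: "nat \<Rightarrow> ('a::euclidean_space \<Rightarrow> real) \<Rightarrow> bool" where
  "Ck 0 f \<longleftrightarrow> continuous_on UNIV f"
| "Ck (Suc k) f \<longleftrightarrow> f differentiable_on UNIV \<and>
     (\<forall>v. Ck k (\<lambda>x. frechet_derivative f (at x) v))"

definition C0_infty :: "'a::euclidean_space set \<Rightarrow> ('a \<Rightarrow> real) set" where
  "C0_infty \<Omega> = {\<phi>. (\<forall>k. Ck k \<phi>) \<and> compact (closure {x. \<phi> x \<noteq> 0}) \<and> closure {x. \<phi> x \<noteq> 0} \<subseteq> \<Omega>}"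

definition grad :: "('a::euclidean_space \<Rightarrow> real) \<Rightarrow> 'a \<Rightarrow> 'a" where
  "grad \<phi> x = (THE D. GDERIV \<phi> x :> D)"

section \<open>Weighted integrals\<close>

text \<open>The origin, where the weight is singular, is a null set, so the values that
  division by zero and \<open>0 powr t\<close> take there are irrelevant. Functions on \<open>\<Omega>\<close> are
  represented by total functions whose values off \<open>\<Omega>\<close> are never used.\<close>

definition weighted_int ::
    "'a::euclidean_space set \<Rightarrow> real \<Rightarrow> real \<Rightarrow> ('a \<Rightarrow> 'b::euclidean_space) \<Rightarrow> real" where
  "weighted_int \<Omega> t m f = (LINT x:\<Omega>|lebesgue. norm (f x) powr t / norm x powr m)"

definition weighted_Lp ::
    "'a::euclidean_space set \<Rightarrow> real \<Rightarrow> real \<Rightarrow> ('a \<Rightarrow> 'b::euclidean_space) \<Rightarrow> bool" where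
  "weighted_Lp \<Omega> t m f \<longleftrightarrow> f \<in> borel_measurable (lebesgue_on \<Omega>) \<and>
     set_integrable lebesgue \<Omega> (\<lambda>x. norm (f x) powr t / norm x powr m)"

definition weighted_Lp_converges ::
    "'a::euclidean_space set \<Rightarrow> real \<Rightarrow> real \<Rightarrow> (nat \<Rightarrow> 'a \<Rightarrow> 'b::euclidean_space) \<Rightarrow> ('a \<Rightarrow> 'b) \<Rightarrow> bool" where
  "weighted_Lp_converges \<Omega> t m f g \<longleftrightarrow> (\<forall>n. weighted_Lp \<Omega> t m (\<lambda>x. f n x - g x)) \<and>
     (\<lambda>n. weighted_int \<Omega> t m (\<lambda>x. f n x - g x)) \<longlonglongrightarrow> 0"

definition L1_loc_converges ::
    "'a::euclidean_space set \<Rightarrow> (nat \<Rightarrow> 'a \<Rightarrow> real) \<Rightarrow> ('a \<Rightarrow> real) \<Rightarrow> bool" where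
  "L1_loc_converges \<Omega> f g \<longleftrightarrow> (\<forall>K. compact K \<and> K \<subseteq> \<Omega> \<longrightarrow>
     (\<forall>n. set_integrable lebesgue K (\<lambda>x. f n x - g x)) \<and>
     (\<lambda>n. LINT x:K|lebesgue. \<bar>f n x - g x\<bar>) \<longlonglongrightarrow> 0)"

section \<open>The completions as spaces of functions\<close>

text \<open>The completion of \<open>C_0^\<infinity>(\<Omega>)\<close> for \<open>|u|\<^sub>q\<^sub>,\<^sub>\<sigma>\<close>, realised as the functions
  (representing their a.e. classes) that are limits of test functions in this norm.\<close>

definition Lq_space :: "'a::euclidean_space set \<Rightarrow> real \<Rightarrow> real \<Rightarrow> ('a \<Rightarrow> real) set" where
  "Lq_space \<Omega> q \<sigma> = {u. \<exists>\<phi>. (\<forall>n. \<phi> n \<in> C0_infty \<Omega>) \<and> weighted_Lp_converges \<Omega> q \<sigma> \<phi> u}"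

text \<open>The completion for the gradient norm: a sequence of test functions is Cauchy for this norm
  iff its gradients converge in the weighted Lebesgue space of vector fields, to \<open>G\<close> say.
  The element of the completion it defines is identified with the limit \<open>u\<close> of the sequence in
  \<open>L^1_loc(\<Omega>)\<close>. For \<open>0 < \<mu> + p < N\<close> that limit exists by the weighted Hardy inequality and the
  identification is injective; \<open>G\<close>, which is the weak gradient of \<open>u\<close> off the origin, is then
  determined a.e. by \<open>u\<close>, and the norm of \<open>u\<close> in the completion is the weighted norm of \<open>G\<close>.
  The gradient of \<open>u\<close> is taken as this limit because for \<open>\<mu> < 0\<close> it need not be locally
  integrable at the origin.\<close>

definition is_W_grad ::
    "'a::euclidean_space set \<Rightarrow> real \<Rightarrow> real \<Rightarrow> ('a \<Rightarrow> real) \<Rightarrow> ('a \<Rightarrow> 'a) \<Rightarrow> bool" where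
  "is_W_grad \<Omega> p \<mu> u G \<longleftrightarrow> (\<exists>\<phi>. (\<forall>n. \<phi> n \<in> C0_infty \<Omega>) \<and> L1_loc_converges \<Omega> \<phi> u \<and>
     weighted_Lp_converges \<Omega> p \<mu> (\<lambda>n. grad (\<phi> n)) G)"

definition W_space :: "'a::euclidean_space set \<Rightarrow> real \<Rightarrow> real \<Rightarrow> ('a \<Rightarrow> real) set" where
  "W_space \<Omega> p \<mu> = {u. \<exists>G. is_W_grad \<Omega> p \<mu> u G}"

definition W_grad :: "'a::euclidean_space set \<Rightarrow> real \<Rightarrow> real \<Rightarrow> ('a \<Rightarrow> real) \<Rightarrow> 'a \<Rightarrow> 'a" where
  "W_grad \<Omega> p \<mu> u = (SOME G. is_W_grad \<Omega> p \<mu> u G)"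

definition E_space ::
    "'a::euclidean_space set \<Rightarrow> real \<Rightarrow> real \<Rightarrow> real \<Rightarrow> real \<Rightarrow> ('a \<Rightarrow> real) set" where
  "E_space \<Omega> p q \<mu> \<sigma> = W_space \<Omega> p \<mu> \<inter> Lq_space \<Omega> q \<sigma>"

definition grad_int :: "'a::euclidean_space set \<Rightarrow> real \<Rightarrow> real \<Rightarrow> ('a \<Rightarrow> real) \<Rightarrow> real" where
  "grad_int \<Omega> p \<mu> u = weighted_int \<Omega> p \<mu> (W_grad \<Omega> p \<mu> u)"

section \<open>Exponents and constants\<close>

definition p_star :: "real \<Rightarrow> real \<Rightarrow> ereal" where
  "p_star N p = (if p < N then ereal (N * p / (N - p)) else \<infinity>)"

definition p_star_w :: "real \<Rightarrow> real \<Rightarrow> real \<Rightarrow> real \<Rightarrow> real" where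
  "p_star_w N p t \<mu> = p * (N - t) / (N - p - \<mu>)"

definition a_exp :: "real \<Rightarrow> real \<Rightarrow> real \<Rightarrow> real \<Rightarrow> real \<Rightarrow> real \<Rightarrow> real \<Rightarrow> real" where
  "a_exp N p q r \<mu> \<sigma> s =
     ((N - \<sigma>) * r - (N - s) * q) * p / (((N - \<sigma>) * p - (N - \<mu> - p) * q) * r)"

text \<open>The constants for which the inequality holds. Integrability of \<open>|u|^r/|x|^s\<close> is part of
  the inequality: the Bochner integral of a non-integrable function is \<open>0\<close>.\<close>

definition CKN_constants ::
    "'a::euclidean_space set \<Rightarrow> real \<Rightarrow> real \<Rightarrow> real \<Rightarrow> real \<Rightarrow> real \<Rightarrow> real \<Rightarrow> real set" where
  "CKN_constants \<Omega> p q r \<mu> \<sigma> s =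
     (let a = a_exp (real DIM('a)) p q r \<mu> \<sigma> s in
      {C. \<forall>u \<in> E_space \<Omega> p q \<mu> \<sigma>. weighted_Lp \<Omega> r s u \<and>
            weighted_int \<Omega> r s u powr (1 / r)
              \<le> C * grad_int \<Omega> p \<mu> u powr (a / p) * weighted_int \<Omega> q \<sigma> u powr ((1 - a) / q)})"

definition CKN_sharp ::
    "'a::euclidean_space set \<Rightarrow> real \<Rightarrow> real \<Rightarrow> real \<Rightarrow> real \<Rightarrow> real \<Rightarrow> real \<Rightarrow> real" where
  "CKN_sharp \<Omega> p q r \<mu> \<sigma> s = Inf (CKN_constants \<Omega> p q r \<mu> \<sigma> s)"

definition lambda_star :: "real \<Rightarrow> real \<Rightarrow> real \<Rightarrow> real \<Rightarrow> real \<Rightarrow> real \<Rightarrow> real \<Rightarrow> real" where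
  "lambda_star N p q r \<mu> \<sigma> s =
     ((p * (N - s) - (N - \<mu> - p) * r) / ((\<mu> + p - \<sigma>) * r + (p - q) * (N - s)))
       powr (((\<mu> + p - \<sigma>) * r + (p - q) * (N - s)) / ((N - s) * p - (N - \<mu> - p) * r)) *
     (((N - \<sigma>) * r - (N - s) * q) / (p * (N - s) - (N - \<mu> - p) * r))
       powr (((N - \<sigma>) * r - (N - s) * q) / (p * (N - s) - (N - \<mu> - p) * r))"

text \<open>By the convention for Bochner integrals, \<open>weighted_int \<Omega> r s u = 1\<close> entails
  integrability.\<close>

definition admissible ::
    "'a::euclidean_space set \<Rightarrow> real \<Rightarrow> real \<Rightarrow> real \<Rightarrow> real \<Rightarrow> real \<Rightarrow> real \<Rightarrow> ('a \<Rightarrow> real) set" where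
  "admissible \<Omega> p q r \<mu> \<sigma> s = {u \<in> E_space \<Omega> p q \<mu> \<sigma>. weighted_int \<Omega> r s u = 1}"

definition energy ::
    "'a::euclidean_space set \<Rightarrow> real \<Rightarrow> real \<Rightarrow> real \<Rightarrow> real \<Rightarrow> real \<Rightarrow> real \<Rightarrow> ('a \<Rightarrow> real) \<Rightarrow> real" where
  "energy \<Omega> p q r \<mu> \<sigma> s u =
     grad_int \<Omega> p \<mu> u + lambda_star (real DIM('a)) p q r \<mu> \<sigma> s * weighted_int \<Omega> q \<sigma> u"

definition rho ::
    "'a::euclidean_space set \<Rightarrow> real \<Rightarrow> real \<Rightarrow> real \<Rightarrow> real \<Rightarrow> real \<Rightarrow> real \<Rightarrow> real" where
  "rho \<Omega> p q r \<mu> \<sigma> s = (INF u \<in> admissible \<Omega> p q r \<mu> \<sigma> s. energy \<Omega> p q r \<mu> \<sigma> s u)"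

end

theory Submission
  imports Defs "HOL-Complex_Analysis.Great_Picard"
begin

text \<open>Let \<open>A\<close>, \<open>B\<close> and \<open>D\<close> be the integrals of \<open>\<bar>\<nabla>u\<bar>\<^sup>p / \<bar>x\<bar>\<^sup>\<mu>\<close>, \<open>\<bar>u\<bar>\<^sup>q / \<bar>x\<bar>\<^sup>\<sigma>\<close> and \<open>\<bar>u\<bar>\<^sup>r / \<bar>x\<bar>\<^sup>s\<close>, let
  \<open>\<theta>1 = a * r / p\<close> and \<open>\<theta>2 = (1 - a) * r / q\<close>. Raised to the power \<open>r\<close>, the inequality is
  \<open>D \<le> K * A powr \<theta>1 * B powr \<theta>2\<close> with \<open>K = C powr r\<close>. Multiplication of \<open>u\<close> by constants and, on a
  cone, dilations multiply both sides by the same factor, and together they give \<open>A\<close> and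
  \<open>B\<close> any positive values (\<open>E_normalize\<close>). So the best \<open>K\<close> is the supremum of \<open>D\<close> over
  the functions with \<open>A \<le> 1\<close> and \<open>B \<le> 1\<close>, and the constant is achieved if this supremum is.

  It is, because this set of functions is relatively compact in the space of \<open>D\<close>
  (\<open>embedding_compact\<close>). On a dyadic shell \<open>l \<le> \<bar>x\<bar> < 2 l\<close> the weights are constant up
  to a factor. Interpolation between the exponents \<open>q\<close> and \<open>t = p * \<theta>1 / (1 - \<theta>2)\<close> and the subcritical
  Sobolev inequality for \<open>t\<close> (\<open>shell_Sobolev\<close>) bound the part of \<open>D\<close> on the shell by a multiple of
  \<open>A powr \<theta>1 * B powr \<theta>2\<close> that does not depend on \<open>l\<close>. As the conditions on the exponents are strict,
  \<open>\<theta>1\<close> and \<open>\<theta>2\<close> can be moved in two directions such that only the invariance under dilations is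
  lost: there is now a factor that is a positive, respectively negative power of \<open>l\<close>. This makes the parts of \<open>D\<close> far out
  and near the origin geometrically small (\<open>shells_decay\<close>), and so excludes the loss of
  compactness by dilations. On a fixed shell compactness is Rellich's theorem, proved by comparing functions with
  their averages on small balls (\<open>avg_Poincare\<close>, \<open>shell_compactness\<close>). The limit
  satisfies \<open>A \<le> 1\<close> again because the \<open>p\<close>-th power of the norm is uniformly convex (\<open>is_W_grad_limit\<close>).
  The Hardy inequality is what makes the completions concrete: the abstract limits of test functions are limits in weighted
  Lebesgue spaces (\<open>is_W_grad_iff\<close>).

  With \<open>w1\<close> and \<open>w2\<close> proportional to \<open>\<theta>1\<close> and \<open>\<theta>2\<close> and of sum \<open>1\<close>, the number \<open>\<lambda>\<^sup>*\<close> is the one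
  for which Young's inequality reads \<open>A powr w1 * B powr w2 \<le> A + \<lambda>\<^sup>* * B\<close>
  (\<open>weighted_Young\<close>). For \<open>D = 1\<close> the left-hand side is at least
  \<open>K powr (- 1 / (\<theta>1 + \<theta>2))\<close>. An extremal function, normalised so that Young's inequality
  is an equality, attains this value, which is therefore \<open>\<rho>\<close>.\<close>

section \<open>Integrals of powers\<close>

definition Lp_fun :: "real \<Rightarrow> 'a measure \<Rightarrow> ('a \<Rightarrow> 'b::euclidean_space) \<Rightarrow> bool" where
  "Lp_fun t M f \<longleftrightarrow> f \<in> borel_measurable M \<and> integrable M (\<lambda>x. norm (f x) powr t)"

text \<open>The integral is used instead of its root: the inequality is one between integrals, and
  dilations multiply each of them by a power.\<close>

definition Lp_int :: "real \<Rightarrow> 'a measure \<Rightarrow> ('a \<Rightarrow> 'b::euclidean_space) \<Rightarrow> real" where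
  "Lp_int t M f = (\<integral>x. norm (f x) powr t \<partial>M)"

lemma Lp_funD [dest]: "Lp_fun t M f \<Longrightarrow> f \<in> borel_measurable M"
  "Lp_fun t M f \<Longrightarrow> integrable M (\<lambda>x. norm (f x) powr t)"
  by (auto simp: Lp_fun_def)

lemma Lp_int_nonneg [simp]: "Lp_int t M f \<ge> 0"
  by (simp add: Lp_int_def)

text \<open>Convexity, with weights \<open>1 - s\<close> and \<open>s\<close>. For small \<open>s\<close> the factor of \<open>a powr t\<close> is close to
  \<open>1\<close>; with this freedom the inequality does the work of Minkowski's.\<close>

lemma powr_add_le:
  fixes a b s t :: real
  assumes t: "t \<ge> 1" and s: "0 < s" "s < 1" and ab: "a \<ge> 0" "b \<ge> 0"
  shows "(a + b) powr t \<le> (1 - s) powr (1 - t) * a powr t + s powr (1 - t) * b powr t"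
proof -
  have ge1: "1 \<le> x powr (1 - t)" if "0 < x" "x < 1" for x :: real
    using powr_mono'[of "1 - t" 0 x] that t by simp
  consider "a = 0" | "b = 0" | "a > 0" "b > 0" using ab by linarith
  then show ?thesis
  proof cases
    case 1
    then show ?thesis using mult_right_mono[OF ge1[OF s], of "b powr t"] by simp
  next
    case 2
    then show ?thesis using mult_right_mono[OF ge1[of "1 - s"], of "a powr t"] s by simp
  next
    case 3
    have *: "x * (c / x) powr t = x powr (1 - t) * c powr t" if "x > 0" "c > 0" for x c :: real
      using that by (simp add: powr_divide powr_diff)
    have "((1 - s) *\<^sub>R (a / (1 - s)) + s *\<^sub>R (b / s)) powr t
        \<le> (1 - s) * (a / (1 - s)) powr t + s * (b / s) powr t"
      using convex_onD[OF powr_convex[OF t], of s "a / (1 - s)" "b / s"] s 3 by simp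
    then show ?thesis using s 3 by (simp add: *)
  qed
qed

lemma norm_add_powr_le:
  fixes a b :: "'b::real_normed_vector"
  assumes t: "t \<ge> 1" and s: "0 < s" "s < 1"
  shows "norm (a + b) powr t \<le> (1 - s) powr (1 - t) * norm a powr t + s powr (1 - t) * norm b powr t"
  using powr_add_le[OF assms, of "norm a" "norm b"] powr_mono2[of t "norm (a+b)" "norm a + norm b"]
    norm_triangle_ineq[of a b] t by force

lemma Lp_fun_add:
  fixes f g :: "'a \<Rightarrow> 'b::euclidean_space"
  assumes "t \<ge> 1" "Lp_fun t M f" "Lp_fun t M g"
  shows "Lp_fun t M (\<lambda>x. f x + g x)"
proof -
  have [measurable]: "f \<in> borel_measurable M" "g \<in> borel_measurable M" using assms by auto
  have i: "integrable M (\<lambda>x. (1 - 1/2) powr (1 - t) * norm (f x) powr t + (1/2) powr (1 - t) * norm (g x) powr t)"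
    using assms by (intro Bochner_Integration.integrable_add integrable_mult_right) auto
  have "integrable M (\<lambda>x. norm (f x + g x) powr t)"
    apply (rule Bochner_Integration.integrable_bound[OF i])
     apply measurable
    using norm_add_powr_le[OF assms(1), of "1/2"] by (intro AE_I2) (force intro: order_trans)
  then show ?thesis by (auto simp: Lp_fun_def)
qed

lemma Lp_fun_scaleR:
  fixes f :: "'a \<Rightarrow> 'b::euclidean_space"
  assumes "Lp_fun t M f"
  shows "Lp_fun t M (\<lambda>x. c *\<^sub>R f x)"
  using assms by (auto simp: Lp_fun_def powr_mult)

lemma Lp_int_scaleR: "Lp_int t M (\<lambda>x. c *\<^sub>R f x) = \<bar>c\<bar> powr t * Lp_int t M f"
  by (simp add: Lp_int_def powr_mult)

lemma Lp_fun_uminus: "Lp_fun t M f \<Longrightarrow> Lp_fun t M (\<lambda>x. - f x)"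
  by (auto simp: Lp_fun_def)

lemma Lp_int_uminus: "Lp_int t M (\<lambda>x. - f x) = Lp_int t M f"
  by (simp add: Lp_int_def)

lemma Lp_fun_diff:
  assumes "t \<ge> 1" "Lp_fun t M f" "Lp_fun t M g"
  shows "Lp_fun t M (\<lambda>x. f x - g x)"
  using Lp_fun_add[OF assms(1,2) Lp_fun_uminus[OF assms(3)]] by simp

lemma Lp_int_add_le:
  fixes f g :: "'a \<Rightarrow> 'b::euclidean_space"
  assumes t: "t \<ge> 1" and s: "0 < s" "s < 1" and fg: "Lp_fun t M f" "Lp_fun t M g"
  shows "Lp_int t M (\<lambda>x. f x + g x) \<le> (1 - s) powr (1 - t) * Lp_int t M f + s powr (1 - t) * Lp_int t M g"
proof -
  have "Lp_int t M (\<lambda>x. f x + g x)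
      \<le> (\<integral>x. (1 - s) powr (1 - t) * norm (f x) powr t + s powr (1 - t) * norm (g x) powr t \<partial>M)"
    unfolding Lp_int_def using fg Lp_fun_add[OF t fg] norm_add_powr_le[OF t s]
    by (intro integral_mono Bochner_Integration.integrable_add integrable_mult_right) auto
  also have "\<dots> = (1 - s) powr (1 - t) * Lp_int t M f + s powr (1 - t) * Lp_int t M g"
    unfolding Lp_int_def using fg by (subst Bochner_Integration.integral_add) auto
  finally show ?thesis .
qed

lemma Lp_int_add_le_half:
  assumes t: "t \<ge> 1" and fg: "Lp_fun t M f" "Lp_fun t M g"
  shows "Lp_int t M (\<lambda>x. f x + g x) \<le> 2 powr (t - 1) * (Lp_int t M f + Lp_int t M g)"
proof -
  have "(1/2::real) powr (1 - t) = 2 powr (t - 1)"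
    by (simp add: powr_divide powr_minus_divide[symmetric])
  then show ?thesis using Lp_int_add_le[OF t _ _ fg, of "1/2"] by (simp add: distrib_left)
qed

lemma Lp_int_diff_le_half:
  assumes t: "t \<ge> 1" and fg: "Lp_fun t M f" "Lp_fun t M g"
  shows "Lp_int t M (\<lambda>x. f x - g x) \<le> 2 powr (t - 1) * (Lp_int t M f + Lp_int t M g)"
  using Lp_int_add_le_half[OF t fg(1) Lp_fun_uminus[OF fg(2)]] by (simp add: Lp_int_uminus)

definition Lp_conv :: "real \<Rightarrow> 'a measure \<Rightarrow> (nat \<Rightarrow> 'a \<Rightarrow> 'b::euclidean_space) \<Rightarrow> ('a \<Rightarrow> 'b) \<Rightarrow> bool" where
  "Lp_conv t M f g \<longleftrightarrow> (\<forall>n. Lp_fun t M (\<lambda>x. f n x - g x)) \<and> (\<lambda>n. Lp_int t M (\<lambda>x. f n x - g x)) \<longlonglongrightarrow> 0"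

lemma Lp_conv_fun:
  assumes "t \<ge> 1" "Lp_conv t M f g"
  shows "Lp_fun t M g \<longleftrightarrow> Lp_fun t M (f n)"
proof -
  have d: "Lp_fun t M (\<lambda>x. f n x - g x)" using assms by (auto simp: Lp_conv_def)
  show ?thesis
    using Lp_fun_add[OF assms(1) d, of g] Lp_fun_diff[OF assms(1) _ d, of "f n"] by auto
qed

text \<open>Both bounds come from the weighted inequality: for fixed \<open>s\<close> the difference term vanishes
  as \<open>n\<close> grows, and then \<open>s\<close> tends to \<open>0\<close>.\<close>

lemma Lp_conv_int:
  fixes f :: "nat \<Rightarrow> 'a \<Rightarrow> 'b::euclidean_space"
  assumes t: "t \<ge> 1" and conv: "Lp_conv t M f g" and g: "Lp_fun t M g"
  shows "(\<lambda>n. Lp_int t M (f n)) \<longlonglongrightarrow> Lp_int t M g"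
proof -
  have f: "Lp_fun t M (f n)" for n using Lp_conv_fun[OF t conv] g by auto
  have d: "Lp_fun t M (\<lambda>x. f n x - g x)" "(\<lambda>n. Lp_int t M (\<lambda>x. f n x - g x)) \<longlonglongrightarrow> 0" for n
    using conv by (auto simp: Lp_conv_def)
  define c where "c s = (1 - s) powr (1 - t)" for s :: real
  define I where "I = Lp_int t M g"
  have cpos: "c s > 0" if "0 < s" "s < 1" for s using that by (simp add: c_def)
  have clim: "(c \<longlongrightarrow> 1) (at_right 0)"
  proof -
    have "(c \<longlongrightarrow> (1 - 0) powr (1 - t)) (at_right 0)"
      unfolding c_def by (intro tendsto_intros) auto
    then show ?thesis by simp
  qed
  have up: "Lp_int t M (f n) \<le> c s * I + s powr (1 - t) * Lp_int t M (\<lambda>x. f n x - g x)" if "0 < s" "s < 1" for s n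
    using Lp_int_add_le[OF t that g d(1)[of n]] by (simp add: c_def I_def)
  have lo: "I \<le> c s * Lp_int t M (f n) + s powr (1 - t) * Lp_int t M (\<lambda>x. f n x - g x)" if "0 < s" "s < 1" for s n
    using Lp_int_add_le[OF t that f[of n] Lp_fun_uminus[OF d(1)[of n]]]
    unfolding Lp_int_uminus by (simp add: c_def I_def)
  have ev01: "\<forall>\<^sub>F s in at_right (0::real). 0 < s \<and> s < 1"
    using eventually_at_right_real[of 0 1] by auto
  show ?thesis
    unfolding I_def[symmetric]
  proof (rule order_tendstoI)
    fix a assume a: "a < I"
    have "((\<lambda>s. I / c s) \<longlongrightarrow> I / 1) (at_right 0)" using clim by (intro tendsto_intros) auto
    then have "\<forall>\<^sub>F s in at_right 0. I / c s > a" using a by (simp add: order_tendstoD(1))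
    then have "\<forall>\<^sub>F s in at_right 0. I / c s > a \<and> 0 < s \<and> s < 1" using ev01 by eventually_elim auto
    then obtain s where s: "I / c s > a" "0 < s" "s < 1"
      using eventually_happens[of _ "at_right (0::real)"] by force
    have "(\<lambda>n. (I - s powr (1 - t) * Lp_int t M (\<lambda>x. f n x - g x)) / c s) \<longlonglongrightarrow> (I - s powr (1 - t) * 0) / c s"
      using d(2) cpos[OF s(2,3)] by (intro tendsto_intros) auto
    then have "\<forall>\<^sub>F n in sequentially. (I - s powr (1 - t) * Lp_int t M (\<lambda>x. f n x - g x)) / c s > a"
      using s(1) by (simp add: order_tendstoD(1))
    then show "\<forall>\<^sub>F n in sequentially. a < Lp_int t M (f n)"
    proof eventually_elim
      case (elim n)
      have "(I - s powr (1 - t) * Lp_int t M (\<lambda>x. f n x - g x)) / c s \<le> Lp_int t M (f n)"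
        using lo[OF s(2,3), of n] cpos[OF s(2,3)] by (simp add: field_simps)
      then show ?case using elim by linarith
    qed
  next
    fix a assume a: "a > I"
    have "((\<lambda>s. c s * I) \<longlongrightarrow> 1 * I) (at_right 0)" using clim by (intro tendsto_intros) auto
    then have "\<forall>\<^sub>F s in at_right 0. c s * I < a" using a by (simp add: order_tendstoD(2))
    then have "\<forall>\<^sub>F s in at_right 0. c s * I < a \<and> 0 < s \<and> s < 1" using ev01 by eventually_elim auto
    then obtain s where s: "c s * I < a" "0 < s" "s < 1"
      using eventually_happens[of _ "at_right (0::real)"] by force
    have "(\<lambda>n. c s * I + s powr (1 - t) * Lp_int t M (\<lambda>x. f n x - g x)) \<longlonglongrightarrow> c s * I + s powr (1 - t) * 0"
      using d(2) by (intro tendsto_intros)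
    then have "\<forall>\<^sub>F n in sequentially. c s * I + s powr (1 - t) * Lp_int t M (\<lambda>x. f n x - g x) < a"
      using s(1) by (simp add: order_tendstoD(2))
    then show "\<forall>\<^sub>F n in sequentially. Lp_int t M (f n) < a"
      by eventually_elim (rule le_less_trans[OF up[OF s(2,3)]])
  qed
qed

lemma Lp_conv_AE_subseq:
  fixes f :: "nat \<Rightarrow> 'a \<Rightarrow> 'b::euclidean_space"
  assumes t: "t > 0" and conv: "Lp_conv t M f g"
  obtains r where "strict_mono (r :: nat \<Rightarrow> nat)" "AE x in M. (\<lambda>n. f (r n) x) \<longlonglongrightarrow> g x"
proof -
  have "\<exists>r. strict_mono r \<and> (AE x in M. (\<lambda>n. norm (f (r n) x - g x) powr t) \<longlonglongrightarrow> 0)"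
    using conv by (intro tendsto_L1_AE_subseq) (auto simp: Lp_conv_def Lp_fun_def Lp_int_def)
  then obtain r where r: "strict_mono r" and ae: "AE x in M. (\<lambda>n. norm (f (r n) x - g x) powr t) \<longlonglongrightarrow> 0"
    by auto
  have "AE x in M. (\<lambda>n. f (r n) x) \<longlonglongrightarrow> g x"
    using ae
  proof eventually_elim
    case (elim x)
    have "(\<lambda>n. (norm (f (r n) x - g x) powr t) powr (1 / t)) \<longlonglongrightarrow> 0 powr (1 / t)"
      by (rule tendsto_powr'[OF elim]) (use t in auto)
    then show ?case using t by (simp add: powr_powr LIM_zero_cancel tendsto_norm_zero_iff)
  qed
  with r show ?thesis by (rule that)
qed

lemma Lp_Fatou:
  fixes f :: "nat \<Rightarrow> 'a \<Rightarrow> 'b::euclidean_space"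
  assumes t: "t > 0" and g[measurable]: "g \<in> borel_measurable M"
    and lim: "AE x in M. (\<lambda>n. f n x) \<longlonglongrightarrow> g x"
    and f: "\<And>n. Lp_fun t M (f n)" and c: "\<And>n. Lp_int t M (f n) \<le> c"
  shows "Lp_fun t M g" "Lp_int t M g \<le> c"
proof -
  have [measurable]: "f n \<in> borel_measurable M" for n using f by auto
  have c0: "c \<ge> 0" using c[of 0] order_trans[OF Lp_int_nonneg] by blast
  have "(\<integral>\<^sup>+x. ennreal (norm (g x) powr t) \<partial>M) \<le> (\<integral>\<^sup>+x. liminf (\<lambda>n. ennreal (norm (f n x) powr t)) \<partial>M)"
  proof (rule nn_integral_mono_AE, use lim in eventually_elim)
    case (elim x)
    have "(\<lambda>n. ennreal (norm (f n x) powr t)) \<longlonglongrightarrow> ennreal (norm (g x) powr t)"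
      using elim t by (intro tendsto_ennrealI tendsto_powr' tendsto_norm tendsto_const disjI2) auto
    then show ?case by (metis lim_imp_Liminf order_refl sequentially_bot)
  qed
  also have "\<dots> \<le> liminf (\<lambda>n. \<integral>\<^sup>+x. ennreal (norm (f n x) powr t) \<partial>M)"
    by (rule nn_integral_liminf) measurable
  also have "\<dots> \<le> liminf (\<lambda>n. ennreal c)"
  proof (rule Liminf_mono, rule always_eventually, rule allI)
    fix n
    have "(\<integral>\<^sup>+x. ennreal (norm (f n x) powr t) \<partial>M) = ennreal (Lp_int t M (f n))"
      unfolding Lp_int_def using f[of n] by (intro nn_integral_eq_integral) auto
    then show "(\<integral>\<^sup>+x. ennreal (norm (f n x) powr t) \<partial>M) \<le> ennreal c" using c[of n] by (simp add: ennreal_leI)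
  qed
  also have "\<dots> = ennreal c" by (simp add: Liminf_const)
  finally have le: "(\<integral>\<^sup>+x. ennreal (norm (g x) powr t) \<partial>M) \<le> ennreal c" .
  then have "integrable M (\<lambda>x. norm (g x) powr t)"
    by (intro integrableI_bounded) (auto simp: le_less_trans ennreal_less_top)
  then show "Lp_fun t M g" by (simp add: Lp_fun_def)
  then have "ennreal (Lp_int t M g) \<le> ennreal c"
    using le unfolding Lp_int_def by (subst (asm) nn_integral_eq_integral) auto
  then show "Lp_int t M g \<le> c" using c0 by simp
qed

lemma Lp_Fatou_lim:
  fixes f :: "nat \<Rightarrow> 'a \<Rightarrow> 'b::euclidean_space"
  assumes t: "t > 0" and g: "g \<in> borel_measurable M"
    and lim: "AE x in M. (\<lambda>n. f n x) \<longlonglongrightarrow> g x"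
    and f: "\<And>n. Lp_fun t M (f n)" and c: "\<And>n. Lp_int t M (f n) \<le> c n" "c \<longlonglongrightarrow> c0"
  shows "Lp_fun t M g" "Lp_int t M g \<le> c0"
proof -
  have *: "Lp_fun t M g \<and> Lp_int t M g \<le> c0 + \<delta>" if \<delta>: "\<delta> > 0" for \<delta>
  proof -
    obtain n0 where n0: "\<And>n. n \<ge> n0 \<Longrightarrow> c n < c0 + \<delta>"
      using order_tendstoD(2)[OF c(2), of "c0 + \<delta>"] \<delta> by (auto simp: eventually_sequentially)
    have "AE x in M. (\<lambda>n. f (n + n0) x) \<longlonglongrightarrow> g x"
      using lim by eventually_elim (rule LIMSEQ_ignore_initial_segment)
    moreover have "Lp_int t M (f (n + n0)) \<le> c0 + \<delta>" for n
      using c(1)[of "n + n0"] n0[of "n + n0"] by simp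
    ultimately show ?thesis using Lp_Fatou[of t g M "\<lambda>n. f (n + n0)" "c0 + \<delta>"] t g f by blast
  qed
  show "Lp_fun t M g" using *[of 1] by simp
  show "Lp_int t M g \<le> c0" by (rule field_le_epsilon) (use * in blast)
qed

lemma Lp_complete:
  fixes f :: "nat \<Rightarrow> 'a \<Rightarrow> 'b::euclidean_space"
  assumes t: "t \<ge> 1" and f: "\<And>n. Lp_fun t M (f n)"
    and cauchy: "\<And>e. e > 0 \<Longrightarrow> \<exists>N. \<forall>m\<ge>N. \<forall>n\<ge>N. Lp_int t M (\<lambda>x. f m x - f n x) < e"
  obtains g where "Lp_fun t M g" "Lp_conv t M f g"
proof -
  have [measurable]: "f n \<in> borel_measurable M" for n using f by auto
  have "\<exists>N. \<forall>m\<ge>N. \<forall>n\<ge>N. Lp_int t M (\<lambda>x. f m x - f n x) < (1/2) ^ k * ((1/2) ^ k) powr t" for k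
    by (rule cauchy) simp
  then obtain N where N: "\<And>k m n. m \<ge> N k \<Longrightarrow> n \<ge> N k \<Longrightarrow>
      Lp_int t M (\<lambda>x. f m x - f n x) < (1/2) ^ k * ((1/2) ^ k) powr t" by metis
  define r where "r k = (\<Sum>i\<le>k. N i) + k" for k
  have r: "strict_mono r" by (auto simp: strict_mono_Suc_iff r_def)
  have rN: "r k \<ge> N k" for k
    using member_le_sum[of k "{..k}" N] by (auto simp: r_def)
  have rNS: "r (Suc k) \<ge> N k" for k
    using rN[of k] r by (meson lessI order.strict_implies_order order_trans strict_mono_less)
  \<comment> \<open>The factors \<open>2 powr (k * t)\<close> keep the weighted series integrable, and finiteness of
    its sum at a point bounds the k-th increment there by a multiple of \<open>(1/2)^k\<close>.\<close>
  define d where "d k x = norm (f (r (Suc k)) x - f (r k) x) powr t" for k x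
  have dm [measurable]: "d k \<in> borel_measurable M" for k unfolding d_def by measurable
  have "(\<integral>\<^sup>+x. (\<Sum>k. ennreal (d k x * (2 ^ k) powr t)) \<partial>M) = (\<Sum>k. \<integral>\<^sup>+x. ennreal (d k x * (2 ^ k) powr t) \<partial>M)"
    by (rule nn_integral_suminf) measurable
  also have "\<dots> \<le> (\<Sum>k. ennreal ((1/2) ^ k))"
  proof (rule suminf_le)
    fix k
    have df: "Lp_fun t M (\<lambda>x. f (r (Suc k)) x - f (r k) x)" by (intro Lp_fun_diff t f)
    then have i: "integrable M (d k)" by (auto simp: Lp_fun_def d_def[abs_def])
    have d0: "d k x \<ge> 0" for x by (simp add: d_def)
    have "(\<integral>\<^sup>+x. ennreal (d k x * (2 ^ k) powr t) \<partial>M) = ennreal ((\<integral>x. d k x \<partial>M) * (2 ^ k) powr t)"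
      using i d0 by (subst nn_integral_eq_integral) auto
    also have "(\<integral>x. d k x \<partial>M) = Lp_int t M (\<lambda>x. f (r (Suc k)) x - f (r k) x)"
      by (simp add: Lp_int_def d_def)
    also have "ennreal (Lp_int t M (\<lambda>x. f (r (Suc k)) x - f (r k) x) * (2 ^ k) powr t)
        \<le> ennreal ((1/2) ^ k * ((1/2) ^ k) powr t * (2 ^ k) powr t)"
      using N[OF rNS rN, of k] by (intro ennreal_leI mult_right_mono) auto
    also have "((1/2) ^ k) powr t * (2 ^ k) powr t = (1::real)"
      by (subst powr_mult[symmetric]) (auto simp: power_mult_distrib[symmetric])
    then have "(1/2) ^ k * ((1/2) ^ k) powr t * (2 ^ k) powr t = (1/2 :: real) ^ k"
      by (simp only: mult.assoc mult_1_right)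
    finally show "(\<integral>\<^sup>+x. ennreal (d k x * (2 ^ k) powr t) \<partial>M) \<le> ennreal ((1/2) ^ k)" .
  qed auto
  also have "\<dots> = ennreal (\<Sum>k. (1/2) ^ k)"
    by (rule suminf_ennreal2) (auto simp: summable_geometric)
  also have "\<dots> < \<infinity>" by simp
  finally have fin: "(\<integral>\<^sup>+x. (\<Sum>k. ennreal (d k x * (2 ^ k) powr t)) \<partial>M) \<noteq> \<infinity>" by simp
  have ae: "AE x in M. (\<Sum>k. ennreal (d k x * (2 ^ k) powr t)) \<noteq> \<infinity>"
    by (rule nn_integral_PInf_AE[OF _ fin]) measurable
  have conv: "AE x in M. convergent (\<lambda>k. f (r k) x)"
    using ae
  proof eventually_elim
    case (elim x)
    have "summable (\<lambda>k. d k x * (2 ^ k) powr t)"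
      using elim by (intro summable_suminf_not_top) (auto simp: d_def)
    then have "(\<lambda>k. d k x * (2 ^ k) powr t) \<longlonglongrightarrow> 0" by (rule summable_LIMSEQ_zero)
    then have "Bseq (\<lambda>k. d k x * (2 ^ k) powr t)" using convergentI convergent_imp_Bseq by blast
    then obtain c where c: "c > 0" "\<And>k. norm (d k x * (2 ^ k) powr t) \<le> c" by (auto simp: Bseq_def)
    have "norm (f (r (Suc k)) x - f (r k) x) \<le> c powr (1 / t) * (1/2) ^ k" for k
    proof -
      have "d k x * (2 ^ k) powr t = (norm (f (r (Suc k)) x - f (r k) x) * 2 ^ k) powr t"
        by (simp add: d_def powr_mult)
      then have "(norm (f (r (Suc k)) x - f (r k) x) * 2 ^ k) powr t \<le> c" using c(2)[of k] by auto
      then have "((norm (f (r (Suc k)) x - f (r k) x) * 2 ^ k) powr t) powr (1 / t) \<le> c powr (1 / t)"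
        using t by (intro powr_mono2) auto
      then have "norm (f (r (Suc k)) x - f (r k) x) * 2 ^ k \<le> c powr (1 / t)"
        using t by (simp add: powr_powr)
      then show ?thesis by (simp add: field_simps)
    qed
    then have "summable (\<lambda>k. f (r (Suc k)) x - f (r k) x)"
      by (rule summable_comparison_test'[where N = 0, rotated])
        (auto intro!: summable_mult summable_geometric)
    then have "convergent (\<lambda>n. \<Sum>k<n. f (r (Suc k)) x - f (r k) x)" by (simp add: summable_iff_convergent)
    then have "convergent (\<lambda>n. f (r n) x - f (r 0) x)" by (simp only: sum_lessThan_telescope[of "\<lambda>k. f (r k) x"])
    then have "convergent (\<lambda>n. (f (r n) x - f (r 0) x) + f (r 0) x)" by (intro convergent_add convergent_const)
    then show "convergent (\<lambda>k. f (r k) x)" by simp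
  qed
  define g where "g x = lim (\<lambda>k. f (r k) x)" for x
  have gm [measurable]: "g \<in> borel_measurable M" unfolding g_def by (rule borel_measurable_lim_metric) measurable
  have lim: "AE x in M. (\<lambda>k. f (r k) x) \<longlonglongrightarrow> g x"
    using conv by eventually_elim (simp add: g_def convergent_LIMSEQ_iff)
  have key: "Lp_fun t M (\<lambda>x. f n x - g x) \<and> Lp_int t M (\<lambda>x. f n x - g x) \<le> e"
    if "e > 0" "\<forall>m\<ge>K. \<forall>n\<ge>K. Lp_int t M (\<lambda>x. f m x - f n x) < e" "n \<ge> K" for n e K
  proof -
    have "AE x in M. (\<lambda>k. f n x - f (r (k + K)) x) \<longlonglongrightarrow> f n x - g x"
      using lim by eventually_elim (auto intro!: tendsto_intros LIMSEQ_ignore_initial_segment)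
    moreover have "Lp_int t M (\<lambda>x. f n x - f (r (k + K)) x) \<le> e" for k
      using that seq_suble[OF r, of "k + K"] by (force intro!: less_imp_le)
    ultimately show ?thesis
      using Lp_Fatou[where t = t and g = "\<lambda>x. f n x - g x" and M = M and f = "\<lambda>k x. f n x - f (r (k + K)) x" and c = e] Lp_fun_diff[OF t f f] t
      by auto
  qed
  obtain K1 where K1: "\<forall>m\<ge>K1. \<forall>n\<ge>K1. Lp_int t M (\<lambda>x. f m x - f n x) < 1" using cauchy[of 1] by auto
  have "Lp_fun t M (\<lambda>x. f K1 x - (f K1 x - g x))"
    using key[OF _ K1, of K1] Lp_fun_diff[OF t f, of "\<lambda>x. f K1 x - g x" K1] by auto
  then have g: "Lp_fun t M g" by simp
  have "(\<lambda>n. Lp_int t M (\<lambda>x. f n x - g x)) \<longlonglongrightarrow> 0"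
  proof (rule LIMSEQ_I)
    fix e :: real assume "e > 0"
    then obtain K where K: "\<forall>m\<ge>K. \<forall>n\<ge>K. Lp_int t M (\<lambda>x. f m x - f n x) < e/2" using cauchy[of "e/2"] by auto
    then show "\<exists>no. \<forall>n\<ge>no. norm (Lp_int t M (\<lambda>x. f n x - g x) - 0) < e"
      using key[OF _ K] \<open>e > 0\<close> by (intro exI[of _ K]) force
  qed
  then have "Lp_conv t M f g" using Lp_fun_diff[OF t f g] by (auto simp: Lp_conv_def)
  with g show ?thesis by (rule that)
qed

lemma Holder_powr:
  fixes F G :: "'a \<Rightarrow> real"
  assumes y: "0 \<le> y" "y \<le> 1" and F: "integrable M F" "\<And>x. F x \<ge> 0" and G: "integrable M G" "\<And>x. G x \<ge> 0"
  shows "integrable M (\<lambda>x. F x powr y * G x powr (1 - y))"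
    and "(\<integral>x. F x powr y * G x powr (1 - y) \<partial>M) \<le> (\<integral>x. F x \<partial>M) powr y * (\<integral>x. G x \<partial>M) powr (1 - y)"
proof -
  have Y: "a powr y * b powr (1 - y) \<le> y * a + (1 - y) * b" if "a \<ge> 0" "b \<ge> 0" for a b :: real
  proof (cases "a = 0 \<or> b = 0")
    case True
    then show ?thesis using y that by auto
  next
    case False
    then show ?thesis using Youngs_inequality_0[of y "1 - y" a b] y that by auto
  qed
  have [measurable]: "F \<in> borel_measurable M" "G \<in> borel_measurable M" using F G by auto
  show i: "integrable M (\<lambda>x. F x powr y * G x powr (1 - y))"
    by (rule Bochner_Integration.integrable_bound[of M "\<lambda>x. y * F x + (1 - y) * G x"])
      (use F G y Y in \<open>auto intro!: AE_I2 Bochner_Integration.integrable_add intro: order_trans\<close>)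
  define X where "X = (\<integral>x. F x \<partial>M)"
  define Z where "Z = (\<integral>x. G x \<partial>M)"
  have XZ: "X \<ge> 0" "Z \<ge> 0" using F G by (auto simp: X_def Z_def)
  show "(\<integral>x. F x powr y * G x powr (1 - y) \<partial>M) \<le> (\<integral>x. F x \<partial>M) powr y * (\<integral>x. G x \<partial>M) powr (1 - y)"
  proof (cases "X = 0 \<or> Z = 0")
    case True
    then have "AE x in M. F x powr y * G x powr (1 - y) = 0"
      using integral_nonneg_eq_0_iff_AE[OF F(1)] integral_nonneg_eq_0_iff_AE[OF G(1)] F G
      unfolding X_def Z_def by (auto elim!: eventually_mono)
    then have "(\<integral>x. F x powr y * G x powr (1 - y) \<partial>M) = 0" by (rule integral_eq_zero_AE)
    then show ?thesis by simp
  next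
    case False
    then have XZ: "X > 0" "Z > 0" using XZ by auto
    have "(\<integral>x. F x powr y * G x powr (1 - y) \<partial>M)
        \<le> (\<integral>x. X powr y * Z powr (1 - y) * (y * (F x / X) + (1 - y) * (G x / Z)) \<partial>M)"
    proof (rule integral_mono[OF i])
      show "integrable M (\<lambda>x. X powr y * Z powr (1 - y) * (y * (F x / X) + (1 - y) * (G x / Z)))"
        using F G by auto
      fix x
      have "F x powr y * G x powr (1 - y)
          = X powr y * Z powr (1 - y) * ((F x / X) powr y * (G x / Z) powr (1 - y))"
        using XZ F(2)[of x] G(2)[of x] by (simp add: powr_divide)
      also have "\<dots> \<le> X powr y * Z powr (1 - y) * (y * (F x / X) + (1 - y) * (G x / Z))"
        using XZ F(2)[of x] G(2)[of x] by (intro mult_left_mono Y) auto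
      finally show "F x powr y * G x powr (1 - y)
          \<le> X powr y * Z powr (1 - y) * (y * (F x / X) + (1 - y) * (G x / Z))" .
    qed
    also have "\<dots> = X powr y * Z powr (1 - y) * (y * (X / X) + (1 - y) * (Z / Z))"
      using F G by (simp add: X_def Z_def)
    also have "\<dots> = X powr y * Z powr (1 - y)" using XZ by simp
    finally show ?thesis by (simp add: X_def Z_def)
  qed
qed

lemma powr_midpoint_strict:
  fixes u v p :: real
  assumes p: "p > 1" and uv: "0 \<le> u" "u < v"
  shows "((u + v) / 2) powr p < (u powr p + v powr p) / 2"
proof -
  define m where "m = (u + v) / 2"
  have m: "u < m" "m < v" using uv by (auto simp: m_def)
  have D: "((\<lambda>x. x powr p) has_real_derivative p * x powr (p - 1)) (at x)" if "x > 0" for x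
    using has_real_derivative_powr[OF that, of p] by simp
  have C: "continuous_on {a..b} (\<lambda>x. x powr p)" if "a \<ge> 0" for a b
    using that p by (intro continuous_on_powr' continuous_intros) auto
  have mvt: "\<exists>z>a. z < b \<and> b powr p - a powr p = (b - a) * (p * z powr (p - 1))" if "0 \<le> a" "a < b" for a b
    using MVT[OF that(2) C[OF that(1)]] D that
    by (smt (verit, best) DERIV_unique real_differentiable_def)
  obtain z1 where z1: "u < z1" "z1 < m" "m powr p - u powr p = (m - u) * (p * z1 powr (p - 1))"
    using mvt[of u m] uv m by auto
  obtain z2 where z2: "m < z2" "z2 < v" "v powr p - m powr p = (v - m) * (p * z2 powr (p - 1))"
    using mvt[of m v] uv m by auto
  have "z1 powr (p - 1) < z2 powr (p - 1)" using z1 z2 uv p by (intro powr_less_mono2) auto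
  moreover have "v - m = m - u" by (simp add: m_def field_simps)
  ultimately have "m powr p - u powr p < v powr p - m powr p"
    unfolding z1(3) z2(3) using m p by simp
  then show ?thesis by (simp add: m_def)
qed

lemma norm_powr_midpoint_strict:
  fixes a b :: "'b::real_inner"
  assumes p: "p > 1" and ab: "a \<noteq> b"
  shows "norm ((1/2) *\<^sub>R (a + b)) powr p < (norm a powr p + norm b powr p) / 2"
proof -
  have n: "norm ((1/2) *\<^sub>R (a + b)) = norm (a + b) / 2" by simp
  consider "norm a = norm b" | "norm a < norm b" | "norm b < norm a" by linarith
  then show ?thesis
  proof cases
    case 1
    have "norm (a + b) \<noteq> norm a + norm b"
    proof
      assume "norm (a + b) = norm a + norm b"
      then have "norm a *\<^sub>R b = norm b *\<^sub>R a" by (simp add: norm_triangle_eq)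
      then show False using 1 ab by (cases "norm a = 0") auto
    qed
    then have "norm (a + b) < norm a + norm b" using norm_triangle_ineq[of a b] by linarith
    then have "norm (a + b) / 2 < norm a" using 1 by simp
    then have "(norm (a + b) / 2) powr p < norm a powr p" using p by (intro powr_less_mono2) auto
    then show ?thesis using 1 n by simp
  next
    case 2
    have "(norm (a + b) / 2) powr p \<le> ((norm a + norm b) / 2) powr p"
      using p norm_triangle_ineq[of a b] by (intro powr_mono2) auto
    then show ?thesis using powr_midpoint_strict[OF p norm_ge_zero 2] n by simp
  next
    case 3
    have "(norm (a + b) / 2) powr p \<le> ((norm b + norm a) / 2) powr p"
      using p norm_triangle_ineq[of a b] by (intro powr_mono2) auto
    then show ?thesis using powr_midpoint_strict[OF p norm_ge_zero 3] n by (simp add: add.commute)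
  qed
qed

text \<open>A quantitative form of strict convexity. Both sides are homogeneous of degree \<open>p\<close>, so it is
  enough to look at the compact set of normalised pairs that are not close to each other, on which
  the continuous bracket is positive and hence bounded below.\<close>

lemma norm_powr_uniform_convex:
  fixes p \<epsilon> :: real
  assumes p: "p > 1" and \<epsilon>: "\<epsilon> > 0"
  obtains C where "C > 0" "\<And>a b :: 'b::euclidean_space. norm (a - b) powr p \<le> \<epsilon> * (norm a powr p + norm b powr p)
      + C * ((norm a powr p + norm b powr p) / 2 - norm ((1/2) *\<^sub>R (a + b)) powr p)"
proof -
  define S where "S z = norm (fst z) powr p + norm (snd z) powr p" for z :: "'b \<times> 'b"
  define h where "h z = S z / 2 - norm ((1/2) *\<^sub>R (fst z + snd z)) powr p" for z :: "'b \<times> 'b"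
  define K where "K = {z. S z = 1 \<and> \<epsilon> \<le> norm (fst z - snd z) powr p}"
  have contS: "continuous_on UNIV S" unfolding S_def
    using p by (intro continuous_intros continuous_on_powr') auto
  have conth: "continuous_on UNIV h" unfolding h_def
    using p contS by (intro continuous_intros continuous_on_powr') auto
  have h0: "h z \<ge> 0" for z
    using norm_powr_midpoint_strict[OF p, of "fst z" "snd z"]
    by (cases "fst z = snd z") (auto simp: h_def S_def simp flip: scaleR_2)
  have "closed K"
  proof -
    have "closed {z. S z = 1}" by (rule closed_Collect_eq[OF contS]) auto
    moreover have "closed {z :: 'b \<times> 'b. \<epsilon> \<le> norm (fst z - snd z) powr p}"
      using p by (intro closed_Collect_le continuous_intros continuous_on_powr') auto
    ultimately show ?thesis unfolding K_def by (simp add: Collect_conj_eq closed_Int)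
  qed
  moreover have "bounded K"
  proof (rule boundedI)
    fix z assume "z \<in> K"
    then have "norm (fst z) powr p \<le> 1" "norm (snd z) powr p \<le> 1"
      unfolding K_def S_def mem_Collect_eq
      by (smt (verit) powr_ge_zero)+
    then have "norm (fst z) \<le> 1" "norm (snd z) \<le> 1"
      using p gr_one_powr[of "norm (fst z)" p] gr_one_powr[of "norm (snd z)" p] by linarith+
    then show "norm z \<le> 2"
      using norm_Pair_le[of "fst z" "snd z"] by auto
  qed
  ultimately have cK: "compact K" by (simp add: compact_eq_bounded_closed)
  obtain \<delta> where \<delta>: "\<delta> > 0" "\<And>z. z \<in> K \<Longrightarrow> h z \<ge> \<delta>"
  proof (cases "K = {}")
    case True
    then show ?thesis using that[of 1] by auto
  next
    case False
    obtain z where z: "z \<in> K" "\<And>w. w \<in> K \<Longrightarrow> h z \<le> h w"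
      using continuous_attains_inf[OF cK False continuous_on_subset[OF conth]] by auto
    have "fst z \<noteq> snd z" using z(1) \<epsilon> by (auto simp: K_def)
    then have "h z > 0" using norm_powr_midpoint_strict[OF p] by (auto simp: h_def S_def)
    then show ?thesis using that[of "h z"] z by auto
  qed
  have bnd: "norm (a - b) powr p \<le> 2 powr (p - 1) * S (a, b)" for a b
  proof -
    have "(1/2::real) powr (1 - p) = 2 powr (p - 1)"
      by (simp add: powr_divide powr_minus_divide[symmetric])
    then show ?thesis
      using norm_add_powr_le[of p "1/2" a "-b"] p by (simp add: S_def distrib_left)
  qed
  define C where "C = 2 powr (p - 1) / \<delta>"
  have C: "C > 0" using \<delta> by (simp add: C_def)
  have "norm (a - b) powr p \<le> \<epsilon> * S (a, b) + C * h (a, b)" for a b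
  proof (cases "S (a, b) = 0")
    case True
    then show ?thesis using bnd[of a b] h0[of "(a,b)"] C by simp
  next
    case False
    then have S: "S (a, b) > 0" by (simp add: S_def less_le)
    define c where "c = S (a, b) powr (- 1 / p)"
    have c: "c > 0" using S by (simp add: c_def)
    have cp: "c powr p = 1 / S (a, b)"
      using S p unfolding c_def by (subst powr_powr) (simp add: powr_minus_divide)
    have hom: "S (c *\<^sub>R a, c *\<^sub>R b) = c powr p * S (a, b)"
      "norm (c *\<^sub>R a - c *\<^sub>R b) powr p = c powr p * norm (a - b) powr p"
      using c by (auto simp: S_def powr_mult distrib_left simp flip: scaleR_diff_right)
    have nm: "norm ((1/2) *\<^sub>R (c *\<^sub>R a + c *\<^sub>R b)) = c * norm ((1/2) *\<^sub>R (a + b))"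
      using c by (simp flip: scaleR_add_right)
    have homh: "h (c *\<^sub>R a, c *\<^sub>R b) = c powr p * h (a, b)"
      using c unfolding h_def hom fst_conv snd_conv nm by (simp add: powr_mult algebra_simps)
    have S1: "S (c *\<^sub>R a, c *\<^sub>R b) = 1" using hom(1) cp S by simp
    have "norm (c *\<^sub>R a - c *\<^sub>R b) powr p \<le> \<epsilon> + C * h (c *\<^sub>R a, c *\<^sub>R b)"
    proof (cases "(c *\<^sub>R a, c *\<^sub>R b) \<in> K")
      case True
      have "norm (c *\<^sub>R a - c *\<^sub>R b) powr p \<le> 2 powr (p - 1)" using bnd[of "c *\<^sub>R a" "c *\<^sub>R b"] S1 by simp
      also have "\<dots> = C * \<delta>" using \<delta> by (simp add: C_def)
      also have "\<dots> \<le> C * h (c *\<^sub>R a, c *\<^sub>R b)" using \<delta>(2)[OF True] C by simp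
      finally show ?thesis using \<epsilon> by simp
    next
      case False
      then have "norm (c *\<^sub>R a - c *\<^sub>R b) powr p \<le> \<epsilon>" using S1 by (auto simp: K_def)
      then show ?thesis using C h0[of "(c *\<^sub>R a, c *\<^sub>R b)"] by (smt (verit) mult_nonneg_nonneg)
    qed
    then have "c powr p * norm (a - b) powr p \<le> \<epsilon> + C * (c powr p * h (a, b))"
      by (simp only: hom homh)
    then show ?thesis using S by (simp add: cp field_simps)
  qed
  then show ?thesis using C by (intro that[of C]) (auto simp: S_def h_def)
qed

text \<open>The midpoint has an integral that is almost as large as the limit, so the bracket in the
  uniform convexity inequality has a small integral.\<close>

lemma Lp_minimizing_Cauchy:
  fixes F :: "nat \<Rightarrow> 'a \<Rightarrow> 'b::euclidean_space"
  assumes p: "p > 1" and F: "\<And>n. Lp_fun p M (F n)"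
    and lim: "(\<lambda>n. Lp_int p M (F n)) \<longlonglongrightarrow> L" and l: "l \<longlonglongrightarrow> L"
    and mid: "\<And>m n. l (min m n) \<le> Lp_int p M (\<lambda>x. (1/2) *\<^sub>R (F m x + F n x))"
    and e: "e > 0"
  shows "\<exists>N. \<forall>m\<ge>N. \<forall>n\<ge>N. Lp_int p M (\<lambda>x. F m x - F n x) < e"
proof -
  have L0: "L \<ge> 0" using lim by (rule LIMSEQ_le_const) auto
  define \<epsilon> where "\<epsilon> = e / (4 * (L + 1))"
  have \<epsilon>: "\<epsilon> > 0" using e L0 by (simp add: \<epsilon>_def)
  obtain C where C: "C > 0" and uc: "\<And>a b :: 'b. norm (a - b) powr p \<le> \<epsilon> * (norm a powr p + norm b powr p)
      + C * ((norm a powr p + norm b powr p) / 2 - norm ((1/2) *\<^sub>R (a + b)) powr p)"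
    using norm_powr_uniform_convex[OF p \<epsilon>] by blast
  have int: "Lp_int p M (\<lambda>x. F m x - F n x) \<le> \<epsilon> * (Lp_int p M (F m) + Lp_int p M (F n))
      + C * ((Lp_int p M (F m) + Lp_int p M (F n)) / 2 - Lp_int p M (\<lambda>x. (1/2) *\<^sub>R (F m x + F n x)))" for m n
  proof -
    have p1: "p \<ge> 1" using p by simp
    have a: "Lp_fun p M (\<lambda>x. (1/2) *\<^sub>R (F m x + F n x))"
      using Lp_fun_scaleR[OF Lp_fun_add[OF p1 F F]] by blast
    note ints = Lp_funD(2)[OF F] Lp_funD(2)[OF a] Lp_funD(2)[OF Lp_fun_diff[OF p1 F F]]
    have "Lp_int p M (\<lambda>x. F m x - F n x) \<le> (\<integral>x. \<epsilon> * (norm (F m x) powr p + norm (F n x) powr p)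
      + C * ((norm (F m x) powr p + norm (F n x) powr p) / 2 - norm ((1/2) *\<^sub>R (F m x + F n x)) powr p) \<partial>M)"
      unfolding Lp_int_def by (rule integral_mono) (use ints uc in auto)
    also have "\<dots> = \<epsilon> * (Lp_int p M (F m) + Lp_int p M (F n))
      + C * ((Lp_int p M (F m) + Lp_int p M (F n)) / 2 - Lp_int p M (\<lambda>x. (1/2) *\<^sub>R (F m x + F n x)))"
      unfolding Lp_int_def using ints
      by (subst Bochner_Integration.integral_add Bochner_Integration.integral_diff | simp)+
    finally show ?thesis .
  qed
  define \<eta> where "\<eta> = min 1 (e / (8 * C))"
  have \<eta>: "\<eta> > 0" using e C by (simp add: \<eta>_def)
  obtain N1 where N1: "\<And>n. n \<ge> N1 \<Longrightarrow> \<bar>Lp_int p M (F n) - L\<bar> < \<eta>"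
    using LIMSEQ_D[OF lim \<eta>] by auto
  obtain N2 where N2: "\<And>n. n \<ge> N2 \<Longrightarrow> \<bar>l n - L\<bar> < \<eta>"
    using LIMSEQ_D[OF l \<eta>] by auto
  have "Lp_int p M (\<lambda>x. F m x - F n x) < e" if mn: "m \<ge> max N1 N2" "n \<ge> max N1 N2" for m n
  proof -
    have s: "Lp_int p M (F m) + Lp_int p M (F n) \<le> 2 * (L + \<eta>)"
      using N1[of m] N1[of n] mn by auto
    have a: "Lp_int p M (\<lambda>x. (1/2) *\<^sub>R (F m x + F n x)) \<ge> L - \<eta>"
      using mid[of m n] N2[of "min m n"] mn by (auto simp: min_def split: if_splits)
    have "\<epsilon> * (Lp_int p M (F m) + Lp_int p M (F n)) \<le> \<epsilon> * (2 * (L + 1))"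
      using s \<epsilon> by (intro mult_left_mono) (auto simp: \<eta>_def)
    also have "\<dots> = e / 2" using L0 by (simp add: \<epsilon>_def field_simps)
    finally have 1: "\<epsilon> * (Lp_int p M (F m) + Lp_int p M (F n)) \<le> e / 2" .
    have "C * ((Lp_int p M (F m) + Lp_int p M (F n)) / 2 - Lp_int p M (\<lambda>x. (1/2) *\<^sub>R (F m x + F n x))) \<le> C * (2 * \<eta>)"
      using s a C by (intro mult_left_mono) (auto simp: field_simps)
    also have "\<dots> \<le> C * (2 * (e / (8 * C)))" using C by (intro mult_left_mono) (auto simp: \<eta>_def)
    also have "\<dots> = e / 4" using C by simp
    finally show ?thesis using int[of m n] 1 e by linarith
  qed
  then show ?thesis by blast
qed

section \<open>Test functions\<close>

lemma Ck_derivD: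
  assumes "Ck (Suc k) f"
  shows "(f has_derivative frechet_derivative f (at x)) (at x)"
  using assms by (simp add: differentiable_on_def frechet_derivative_works)

lemma CkI:
  assumes "\<And>x. (f has_derivative f' x) (at x)" "\<And>v. Ck k (\<lambda>x. f' x v)"
  shows "Ck (Suc k) f"
proof -
  have "frechet_derivative f (at x) = f' x" for x using frechet_derivative_at[OF assms(1)] by metis
  then show ?thesis using assms by (auto simp: differentiable_on_def differentiable_def)
qed

lemma Ck_Suc_imp: "Ck (Suc k) f \<Longrightarrow> Ck k f"
proof (induction k arbitrary: f)
  case 0
  then show ?case by (auto intro: differentiable_imp_continuous_on)
next
  case (Suc k)
  have "Ck k (\<lambda>x. frechet_derivative f (at x) v)" for v
    using Suc.prems Ck.simps(2)[of "Suc k" f] by (intro Suc.IH) blast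
  moreover have "f differentiable_on UNIV" using Suc.prems by simp
  ultimately show ?case by simp
qed

lemma Ck_const [simp]: "Ck k (\<lambda>x. c)"
proof (induction k arbitrary: c)
  case (Suc k)
  show ?case by (rule CkI[where f' = "\<lambda>x v. 0"]) (auto simp: Suc)
qed auto

lemma Ck_add: "Ck k f \<Longrightarrow> Ck k g \<Longrightarrow> Ck k (\<lambda>x. f x + g x)"
proof (induction k arbitrary: f g)
  case 0
  then show ?case by (auto intro: continuous_intros)
next
  case (Suc k)
  have "Ck k (\<lambda>x. frechet_derivative f (at x) v + frechet_derivative g (at x) v)" for v
    using Suc by auto
  then show ?case
    using has_derivative_add[OF Ck_derivD[OF Suc.prems(1)] Ck_derivD[OF Suc.prems(2)]] by (intro CkI)
qed

lemma Ck_mult: "Ck k f \<Longrightarrow> Ck k g \<Longrightarrow> Ck k (\<lambda>x. f x * g x)"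
proof (induction k arbitrary: f g)
  case 0
  then show ?case by (auto intro: continuous_intros)
next
  case (Suc k)
  have "Ck k (\<lambda>x. f x * frechet_derivative g (at x) v + frechet_derivative f (at x) v * g x)" for v
    using Suc.prems by (intro Ck_add Suc.IH) (auto intro: Ck_Suc_imp simp del: Ck.simps(2), auto)
  then show ?case
    using has_derivative_mult[OF Ck_derivD[OF Suc.prems(1)] Ck_derivD[OF Suc.prems(2)]] by (intro CkI)
qed

lemma Ck_linear: "bounded_linear f \<Longrightarrow> Ck k f"
  by (cases k) (auto intro: linear_continuous_on simp del: Ck.simps(2)
      intro!: CkI[where f' = "\<lambda>x. f"] bounded_linear_imp_has_derivative)

lemma Ck_scaled_arg: "Ck k f \<Longrightarrow> Ck k (\<lambda>x. f (c *\<^sub>R x))"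
proof (induction k arbitrary: f)
  case 0
  then show ?case 
    by (auto intro!: continuous_on_compose2[of UNIV f UNIV "\<lambda>x. c *\<^sub>R x"] continuous_intros)
next
  case (Suc k)
  have lin: "frechet_derivative f (at y) (c *\<^sub>R v) = c * frechet_derivative f (at y) v" for y v
    using linear_frechet_derivative[of f "at y"] Suc.prems
    by (simp add: differentiable_on_def linear_scale)
  have "Ck k (\<lambda>x. c * frechet_derivative f (at (c *\<^sub>R x)) v)" for v
    by (intro Ck_mult Ck_const Suc.IH) (use Suc.prems in auto)
  moreover have "((\<lambda>x. f (c *\<^sub>R x)) has_derivative (\<lambda>v. c * frechet_derivative f (at (c *\<^sub>R x)) v)) (at x)" for x
  proof -
    have "((\<lambda>x. f (c *\<^sub>R x)) has_derivative (\<lambda>v. frechet_derivative f (at (c *\<^sub>R x)) (c *\<^sub>R v))) (at x)"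
      by (rule has_derivative_compose[of "\<lambda>x. c *\<^sub>R x", OF _ Ck_derivD[OF Suc.prems]])
        (auto intro!: derivative_eq_intros)
    then show ?thesis by (simp add: lin)
  qed
  ultimately show ?case by (rule CkI[rotated])
qed

text \<open>A smooth function of one variable enters through the sequence of its derivatives.\<close>

lemma Ck_comp:
  assumes g: "\<And>n t. (g n has_real_derivative g (Suc n) t) (at t)"
  shows "Ck k f \<Longrightarrow> Ck k (\<lambda>x. g n (f x))"
proof (induction k arbitrary: f n)
  case 0
  have "continuous_on UNIV (g n)" using g by (intro DERIV_continuous_on) (auto intro: DERIV_subset)
  then show ?case using 0 continuous_on_compose2[of UNIV "g n" UNIV f] by auto
next
  case (Suc k)
  have "Ck k (\<lambda>x. frechet_derivative f (at x) v * g (Suc n) (f x))" for v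
    using Suc.prems by (intro Ck_mult Suc.IH) (auto intro: Ck_Suc_imp simp del: Ck.simps(2), auto)
  moreover have "((\<lambda>x. g n (f x)) has_derivative (\<lambda>v. frechet_derivative f (at x) v * g (Suc n) (f x))) (at x)" for x
    using has_derivative_compose[OF Ck_derivD[OF Suc.prems], of "g n" "(*) (g (Suc n) (f x))" x] g[of n "f x"]
    by (simp add: has_field_derivative_def mult.commute)
  ultimately show ?case by (rule CkI[rotated])
qed

subsection \<open>Bump functions\<close>

text \<open>These functions form a family that is closed under differentiation and contains the
  standard example of a smooth function that vanishes on a half-line.\<close>

definition poly_exp :: "real poly \<Rightarrow> real \<Rightarrow> real" where
  "poly_exp P t = (if t > 0 then poly P (inverse t) * exp (- inverse t) else 0)"

lemma poly_times_exp_tendsto_0: "((\<lambda>s. poly P s * exp (- s)) \<longlongrightarrow> (0::real)) at_top"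
proof (induction P)
  case 0
  then show ?case by simp
next
  case (pCons c P)
  have "((\<lambda>s. \<Sum>i\<le>degree (pCons c P). coeff (pCons c P) i * (s ^ i / exp s)) \<longlongrightarrow> (\<Sum>i\<le>degree (pCons c P). coeff (pCons c P) i * 0)) at_top"
    by (intro tendsto_intros tendsto_power_div_exp_0)
  then show ?case
    unfolding poly_altdef sum_distrib_right by (simp add: exp_minus divide_inverse mult.assoc)
qed

lemma poly_exp_deriv:
  "(poly_exp P has_real_derivative poly_exp ([:0, 0, 1:] * (P - pderiv P)) t) (at t)"
proof -
  consider "t > 0" | "t < 0" | "t = 0" by linarith
  then show ?thesis
  proof cases
    case 1
    have d: "((\<lambda>t. poly P (inverse t) * exp (- inverse t)) has_real_derivative
        poly_exp ([:0, 0, 1:] * (P - pderiv P)) t) (at t)"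
      using 1 by (auto intro!: derivative_eq_intros poly_DERIV[THEN DERIV_chain2]
          simp: poly_exp_def algebra_simps power2_eq_square)
    have "\<forall>\<^sub>F x in nhds t. x > 0" using 1 by (rule eventually_nhds_in_open[of "{0<..}", simplified, rotated]) auto
    then show ?thesis
      by (intro DERIV_cong_ev[THEN iffD2, OF refl _ refl d]) (auto elim!: eventually_mono simp: poly_exp_def)
  next
    case 2
    have "\<forall>\<^sub>F x in nhds t. x < 0" using 2 by (rule eventually_nhds_in_open[of "{..<0}", simplified, rotated]) auto
    then have "(poly_exp P has_real_derivative 0) (at t)"
      by (intro DERIV_cong_ev[THEN iffD2, OF refl _ refl DERIV_const[of 0]]) (auto elim!: eventually_mono simp: poly_exp_def)
    then show ?thesis using 2 by (simp add: poly_exp_def)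
  next
    case 3
    have "((\<lambda>h. poly_exp P h / h) \<longlongrightarrow> 0) (at_right 0)"
    proof -
      have "((\<lambda>h. poly (pCons 0 P) (inverse h) * exp (- inverse h)) \<longlongrightarrow> 0) (at_right (0::real))"
        by (rule filterlim_compose[OF poly_times_exp_tendsto_0 filterlim_inverse_at_top_right])
      then show ?thesis
        by (rule Lim_transform_eventually)
          (auto simp: poly_exp_def eventually_at_filter divide_inverse)
    qed
    moreover have "((\<lambda>h. poly_exp P h / h) \<longlongrightarrow> 0) (at_left 0)"
      by (rule Lim_transform_eventually[OF tendsto_const]) (auto simp: poly_exp_def eventually_at_filter)
    ultimately have "((\<lambda>h. poly_exp P h / h) \<longlongrightarrow> 0) (at 0)" by (rule filterlim_split_at[rotated])
    then show ?thesis using 3 by (simp add: DERIV_def poly_exp_def)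
  qed
qed

definition bump :: "'a::euclidean_space \<Rightarrow> real \<Rightarrow> 'a \<Rightarrow> real" where
  "bump c \<rho> x = poly_exp 1 (\<rho>\<^sup>2 - (norm (x - c))\<^sup>2)"

lemma Ck_bump: "Ck k (bump c \<rho>)"
proof -
  define g where "g n = ((\<lambda>P. [:0, 0, 1:] * (P - pderiv P)) ^^ n) (1 :: real poly)" for n
  have "(poly_exp (g n) has_real_derivative poly_exp (g (Suc n)) t) (at t)" for n t
    using poly_exp_deriv[of "g n" t] by (simp add: g_def)
  moreover have "Ck k (\<lambda>x. \<rho>\<^sup>2 - (norm (x - c))\<^sup>2)"
  proof (cases k)
    case 0
    then show ?thesis by (auto intro!: continuous_intros)
  next
    case (Suc j)
    have eq: "\<rho>\<^sup>2 - (norm (x - c))\<^sup>2 = \<rho>\<^sup>2 - (x - c) \<bullet> (x - c)" for x by (simp add: power2_norm_eq_inner)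
    have "((\<lambda>x. \<rho>\<^sup>2 - (norm (x - c))\<^sup>2) has_derivative (\<lambda>v. - 2 * (x \<bullet> v) + 2 * (c \<bullet> v))) (at x)" for x
      unfolding eq by (auto intro!: derivative_eq_intros simp: inner_diff_left inner_diff_right inner_commute)
    moreover have "Ck j (\<lambda>x. - 2 * (x \<bullet> v) + 2 * (c \<bullet> v))" for v
      by (intro Ck_add Ck_mult Ck_const Ck_linear bounded_linear_inner_left)
    ultimately show ?thesis unfolding Suc by (rule CkI)
  qed
  ultimately have "Ck k (\<lambda>x. poly_exp (g 0) (\<rho>\<^sup>2 - (norm (x - c))\<^sup>2))" by (rule Ck_comp)
  then show ?thesis by (simp add: bump_def[abs_def] g_def)
qed

lemma bump_bounds: "0 \<le> bump c \<rho> x" "bump c \<rho> x \<le> 1"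
  by (auto simp: bump_def poly_exp_def)

lemma bump_pos_iff: "\<rho> > 0 \<Longrightarrow> bump c \<rho> x > 0 \<longleftrightarrow> x \<in> ball c \<rho>"
  by (auto simp: bump_def poly_exp_def dist_norm norm_minus_commute power2_less_imp_less
      intro!: power_strict_mono)

subsection \<open>The space of test functions\<close>

lemma C0_inftyI:
  assumes "\<And>k. Ck k f" "compact K" "K \<subseteq> \<Omega>" "\<And>x. x \<notin> K \<Longrightarrow> f x = 0"
  shows "f \<in> C0_infty \<Omega>"
proof -
  have sub: "{x. f x \<noteq> 0} \<subseteq> K" using assms(4) by auto
  then have "closure {x. f x \<noteq> 0} \<subseteq> K" using assms(2) by (simp add: closure_minimal compact_imp_closed)
  moreover have "compact (closure {x. f x \<noteq> 0})"
    using assms(2) sub by (meson bounded_subset compact_closure compact_imp_bounded)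
  ultimately show ?thesis using assms by (auto simp: C0_infty_def)
qed

lemma C0_inftyE:
  assumes "f \<in> C0_infty \<Omega>"
  obtains K where "compact K" "K \<subseteq> \<Omega>" "\<And>x. x \<notin> K \<Longrightarrow> f x = 0"
proof (rule that[of "closure {x. f x \<noteq> 0}"])
  show "f x = 0" if "x \<notin> closure {x. f x \<noteq> 0}" for x
    using that closure_subset[of "{x. f x \<noteq> 0}"] by auto
qed (use assms in \<open>auto simp: C0_infty_def\<close>)

lemma C0_infty_Ck: "f \<in> C0_infty \<Omega> \<Longrightarrow> Ck k f"
  by (auto simp: C0_infty_def)

lemma C0_infty_mono: "f \<in> C0_infty \<Omega> \<Longrightarrow> \<Omega> \<subseteq> \<Omega>' \<Longrightarrow> f \<in> C0_infty \<Omega>'"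
  by (auto simp: C0_infty_def)

lemma C0_infty_0: "(\<lambda>x. 0) \<in> C0_infty \<Omega>"
  by (rule C0_inftyI[of _ "{}"]) auto

lemma C0_infty_add:
  assumes "f \<in> C0_infty \<Omega>" "g \<in> C0_infty \<Omega>"
  shows "(\<lambda>x. f x + g x) \<in> C0_infty \<Omega>"
proof -
  obtain K L where "compact K" "K \<subseteq> \<Omega>" "\<And>x. x \<notin> K \<Longrightarrow> f x = 0" "compact L" "L \<subseteq> \<Omega>" "\<And>x. x \<notin> L \<Longrightarrow> g x = 0"
    using C0_inftyE[OF assms(1)] C0_inftyE[OF assms(2)] by metis
  then show ?thesis
    by (intro C0_inftyI[of _ "K \<union> L"]) (auto intro!: Ck_add C0_infty_Ck[OF assms(1)] C0_infty_Ck[OF assms(2)])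
qed

lemma C0_infty_mult:
  assumes "f \<in> C0_infty \<Omega>" "\<And>k. Ck k g"
  shows "(\<lambda>x. f x * g x) \<in> C0_infty \<Omega>"
proof -
  obtain K where "compact K" "K \<subseteq> \<Omega>" "\<And>x. x \<notin> K \<Longrightarrow> f x = 0"
    using C0_inftyE[OF assms(1)] by metis
  then show ?thesis
    by (intro C0_inftyI[of _ K]) (auto intro!: Ck_mult C0_infty_Ck[OF assms(1)] assms(2))
qed

lemma C0_infty_cmult: "f \<in> C0_infty \<Omega> \<Longrightarrow> (\<lambda>x. c * f x) \<in> C0_infty \<Omega>"
  using C0_infty_mult[of f \<Omega> "\<lambda>x. c"] by (simp add: mult.commute)

lemma C0_infty_diff:
  assumes "f \<in> C0_infty \<Omega>" "g \<in> C0_infty \<Omega>"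
  shows "(\<lambda>x. f x - g x) \<in> C0_infty \<Omega>"
  using C0_infty_add[OF assms(1) C0_infty_cmult[OF assms(2), of "-1"]] by simp

lemma C0_infty_scaled_arg:
  assumes f: "f \<in> C0_infty \<Omega>" and c: "c > 0" and cone: "\<And>x c. x \<in> \<Omega> \<Longrightarrow> c > 0 \<Longrightarrow> c *\<^sub>R x \<in> \<Omega>"
  shows "(\<lambda>x. f (c *\<^sub>R x)) \<in> C0_infty \<Omega>"
proof -
  obtain K where K: "compact K" "K \<subseteq> \<Omega>" "\<And>x. x \<notin> K \<Longrightarrow> f x = 0"
    using C0_inftyE[OF f] by metis
  show ?thesis
  proof (rule C0_inftyI[of _ "(*\<^sub>R) (inverse c) ` K"])
    show "compact ((*\<^sub>R) (inverse c) ` K)" using K by (intro compact_scaling)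
    show "(*\<^sub>R) (inverse c) ` K \<subseteq> \<Omega>" using K c cone[of _ "inverse c"] by auto
    fix x assume "x \<notin> (*\<^sub>R) (inverse c) ` K"
    then have "c *\<^sub>R x \<notin> K" using c by (auto simp: image_iff)
    then show "f (c *\<^sub>R x) = 0" using K by auto
  qed (intro Ck_scaled_arg C0_infty_Ck[OF f])
qed

subsection \<open>Gradients of test functions\<close>

lemma grad_eqI:
  assumes "(f has_derivative (\<lambda>h. h \<bullet> D)) (at x)"
  shows "grad f x = D"
  unfolding grad_def
proof (rule the_equality)
  show "GDERIV f x :> D" using assms by (simp add: gderiv_def inner_commute)
  fix E assume "GDERIV f x :> E"
  then have "(\<lambda>h. h \<bullet> E) = (\<lambda>h. h \<bullet> D)"
    using has_derivative_unique[OF _ assms] by (simp add: gderiv_def inner_commute)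
  then show "E = D" by (metis inner_commute vector_eq_rdot)
qed

lemma has_derivative_grad:
  fixes f :: "'a::euclidean_space \<Rightarrow> real"
  assumes "f differentiable (at x)"
  shows "(f has_derivative (\<lambda>h. h \<bullet> grad f x)) (at x)"
proof -
  define D where "D = (\<Sum>b\<in>Basis. frechet_derivative f (at x) b *\<^sub>R b)"
  have d: "(f has_derivative frechet_derivative f (at x)) (at x)" using assms by (simp add: frechet_derivative_works)
  interpret bounded_linear "frechet_derivative f (at x)" using d by (rule has_derivative_bounded_linear)
  have "frechet_derivative f (at x) h = h \<bullet> D" for h
  proof -
    have "frechet_derivative f (at x) h = frechet_derivative f (at x) (\<Sum>b\<in>Basis. (h \<bullet> b) *\<^sub>R b)"
      by (simp add: euclidean_representation)
    also have "\<dots> = h \<bullet> D" by (simp add: D_def sum scaleR inner_sum_right mult.commute)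
    finally show ?thesis .
  qed
  then have "frechet_derivative f (at x) = (\<lambda>h. h \<bullet> D)" by auto
  with d have "(f has_derivative (\<lambda>h. h \<bullet> D)) (at x)" by simp
  with grad_eqI[OF this] show ?thesis by simp
qed

lemma Ck_grad:
  fixes f :: "'a::euclidean_space \<Rightarrow> real"
  assumes "Ck (Suc k) f"
  shows "(f has_derivative (\<lambda>h. h \<bullet> grad f x)) (at x)" "Ck k (\<lambda>x. v \<bullet> grad f x)"
proof -
  show d: "(f has_derivative (\<lambda>h. h \<bullet> grad f x)) (at x)" for x
    using assms by (intro has_derivative_grad) (auto simp: differentiable_on_def)
  have "frechet_derivative f (at x) v = v \<bullet> grad f x" for x
    using frechet_derivative_at[OF d[of x]] by metis
  moreover have "Ck k (\<lambda>x. frechet_derivative f (at x) v)" using assms by simp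
  ultimately show "Ck k (\<lambda>x. v \<bullet> grad f x)" by (simp only:)
qed

lemma C0_infty_has_derivative: "f \<in> C0_infty \<Omega> \<Longrightarrow> (f has_derivative (\<lambda>h. h \<bullet> grad f x)) (at x)"
  using Ck_grad(1)[OF C0_infty_Ck] .

lemma C0_infty_continuous: "f \<in> C0_infty \<Omega> \<Longrightarrow> continuous_on UNIV f"
  using C0_infty_Ck[of f \<Omega> 0] by simp

lemma continuous_on_grad:
  fixes f :: "'a::euclidean_space \<Rightarrow> real"
  assumes "f \<in> C0_infty \<Omega>"
  shows "continuous_on UNIV (grad f)"
proof -
  have "continuous_on UNIV (\<lambda>x. \<Sum>b\<in>Basis. (b \<bullet> grad f x) *\<^sub>R b)"
    using Ck_grad(2)[OF C0_infty_Ck[OF assms], of 0] by (intro continuous_on_sum continuous_on_scaleR continuous_on_const) simp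
  moreover have "(\<lambda>x. \<Sum>b\<in>Basis. (b \<bullet> grad f x) *\<^sub>R b) = grad f"
    by (simp add: inner_commute[of _ "grad f _"] euclidean_representation)
  ultimately show ?thesis by (simp only:)
qed

lemma grad_add:
  assumes "f \<in> C0_infty \<Omega>" "g \<in> C0_infty \<Omega>"
  shows "grad (\<lambda>x. f x + g x) x = grad f x + grad g x"
  using has_derivative_add[OF C0_infty_has_derivative[OF assms(1)] C0_infty_has_derivative[OF assms(2)]]
  by (intro grad_eqI) (simp add: inner_add_right)

lemma grad_cmult:
  assumes "f \<in> C0_infty \<Omega>"
  shows "grad (\<lambda>x. c * f x) x = c *\<^sub>R grad f x"
  using has_derivative_mult_right[OF C0_infty_has_derivative[OF assms], of c]
  by (intro grad_eqI) simp

lemma grad_diff: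
  assumes "f \<in> C0_infty \<Omega>" "g \<in> C0_infty \<Omega>"
  shows "grad (\<lambda>x. f x - g x) x = grad f x - grad g x"
  using has_derivative_diff[OF C0_infty_has_derivative[OF assms(1)] C0_infty_has_derivative[OF assms(2)]]
  by (intro grad_eqI) (simp add: inner_diff_right)

lemma grad_mult:
  assumes "f \<in> C0_infty \<Omega>" "g \<in> C0_infty \<Omega>'"
  shows "grad (\<lambda>x. f x * g x) x = f x *\<^sub>R grad g x + g x *\<^sub>R grad f x"
  using has_derivative_mult[OF C0_infty_has_derivative[OF assms(1)] C0_infty_has_derivative[OF assms(2)]]
  by (intro grad_eqI) (simp add: inner_add_right mult.commute)

lemma grad_scaled_arg:
  assumes "f \<in> C0_infty \<Omega>"
  shows "grad (\<lambda>x. f (c *\<^sub>R x)) x = c *\<^sub>R grad f (c *\<^sub>R x)"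
proof (rule grad_eqI)
  have "((\<lambda>x. f (c *\<^sub>R x)) has_derivative (\<lambda>v. (c *\<^sub>R v) \<bullet> grad f (c *\<^sub>R x))) (at x)"
    by (rule has_derivative_compose[of "\<lambda>x. c *\<^sub>R x", OF _ C0_infty_has_derivative[OF assms]])
      (auto intro!: derivative_eq_intros)
  then show "((\<lambda>x. f (c *\<^sub>R x)) has_derivative (\<lambda>v. v \<bullet> (c *\<^sub>R grad f (c *\<^sub>R x)))) (at x)" by simp
qed

lemma C0_inftyE_grad:
  fixes f :: "'a::euclidean_space \<Rightarrow> real"
  assumes "f \<in> C0_infty \<Omega>"
  obtains K where "compact K" "K \<subseteq> \<Omega>" "\<And>x. x \<notin> K \<Longrightarrow> f x = 0" "\<And>x. x \<notin> K \<Longrightarrow> grad f x = 0"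
proof -
  obtain K where K: "compact K" "K \<subseteq> \<Omega>" "\<And>x. x \<notin> K \<Longrightarrow> f x = 0"
    using C0_inftyE[OF assms] by metis
  have "grad f x = 0" if "x \<notin> K" for x
  proof (rule grad_eqI)
    have "open (- K)" using K by (simp add: compact_imp_closed open_Compl)
    then show "(f has_derivative (\<lambda>h. h \<bullet> 0)) (at x)"
      using has_derivative_transform_within_open[of "\<lambda>x. 0" "\<lambda>h. 0" x UNIV "- K" f] K that
      by (simp add: has_derivative_const)
  qed
  with K show ?thesis by (rule that)
qed

lemma C0_infty_bounded:
  fixes f :: "'a::euclidean_space \<Rightarrow> real"
  assumes "f \<in> C0_infty \<Omega>"
  obtains B where "B > 0" "\<And>x. \<bar>f x\<bar> \<le> B" "\<And>x. norm (grad f x) \<le> B"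
proof -
  obtain K where K: "compact K" "\<And>x. x \<notin> K \<Longrightarrow> f x = 0" "\<And>x. x \<notin> K \<Longrightarrow> grad f x = 0"
    using C0_inftyE_grad[OF assms] by metis
  have "bounded (f ` K)" "bounded (grad f ` K)"
    using K(1) continuous_on_grad[OF assms] C0_infty_continuous[OF assms]
    by (auto intro!: compact_imp_bounded compact_continuous_image intro: continuous_on_subset)
  then obtain B1 B2 where B: "\<And>x. x \<in> K \<Longrightarrow> \<bar>f x\<bar> \<le> B1" "\<And>x. x \<in> K \<Longrightarrow> norm (grad f x) \<le> B2"
    unfolding bounded_iff by (metis imageI real_norm_def)
  show ?thesis
  proof (rule that[of "max 1 (max B1 B2)"])
    fix x show "\<bar>f x\<bar> \<le> max 1 (max B1 B2)" "norm (grad f x) \<le> max 1 (max B1 B2)"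
      using K(2,3)[of x] B[of x] by (cases "x \<in> K"; simp; linarith)+
  qed simp
qed

text \<open>Test functions increasing to the indicator of \<open>\<Omega>\<close>: if the balls of a countable
  family cover \<open>\<Omega>\<close>, then the product of the \<open>k\<close>-th powers of \<open>1 - bump\<close> over the first \<open>k\<close> of
  them tends to \<open>0\<close> on \<open>\<Omega>\<close>, because one of its factors is less than \<open>1\<close>.\<close>

lemma C0_infty_exhaustion:
  fixes \<Omega> :: "'a::euclidean_space set"
  assumes "open \<Omega>"
  obtains \<xi> where "\<And>k. \<xi> k \<in> C0_infty \<Omega>" "\<And>k x. 0 \<le> \<xi> k x" "\<And>k x. \<xi> k x \<le> 1"
    "\<And>x. x \<in> \<Omega> \<Longrightarrow> (\<lambda>k. \<xi> k x) \<longlonglongrightarrow> 1"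
proof (cases "\<Omega> = {}")
  case True
  then show ?thesis by (intro that[of "\<lambda>k x. 0"] C0_infty_0) auto
next
  case False
  define F where "F = {ball c \<rho> | c \<rho>. \<rho> > 0 \<and> cball c \<rho> \<subseteq> \<Omega>}"
  obtain F' where F': "F' \<subseteq> F" "countable F'" "\<Union>F' = \<Union>F"
    by (rule Lindelof[of F]) (auto simp: F_def)
  have UF: "\<Union>F = \<Omega>"
  proof
    show "\<Union>F \<subseteq> \<Omega>" unfolding F_def using ball_subset_cball by blast
    show "\<Omega> \<subseteq> \<Union>F"
    proof
      fix x assume "x \<in> \<Omega>"
      then obtain e where "e > 0" "cball x e \<subseteq> \<Omega>" using assms open_contains_cball by blast
      then show "x \<in> \<Union>F" by (auto simp: F_def intro!: exI[of _ "ball x e"] exI[of _ x] exI[of _ e])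
    qed
  qed
  then have ne: "F' \<noteq> {}" using F' False by auto
  have "\<forall>i. \<exists>c \<rho>. from_nat_into F' i = ball c \<rho> \<and> \<rho> > 0 \<and> cball c \<rho> \<subseteq> \<Omega>"
    using from_nat_into[OF ne] F'(1) by (auto simp: F_def)
  then obtain c \<rho> where c\<rho>: "\<And>i. from_nat_into F' i = ball (c i) (\<rho> i)" "\<And>i. \<rho> i > 0" "\<And>i. cball (c i) (\<rho> i) \<subseteq> \<Omega>"
    by metis
  define \<psi> where "\<psi> i = bump (c i) (\<rho> i)" for i
  define \<xi> where "\<xi> k x = 1 - (\<Prod>i<k. (1 - \<psi> i x) ^ k)" for k x
  have \<psi>: "0 \<le> \<psi> i x" "\<psi> i x \<le> 1" for i x by (auto simp: \<psi>_def bump_bounds)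
  have prod01: "0 \<le> (\<Prod>i<k. (1 - \<psi> i x) ^ m)" "(\<Prod>i<k. (1 - \<psi> i x) ^ m) \<le> 1" for k m x
    using \<psi> by (auto intro!: prod_nonneg prod_le_1 power_le_one)
  have Ckpow: "Ck j f \<Longrightarrow> Ck j (\<lambda>x. f x ^ m)" for j m and f :: "'a \<Rightarrow> real"
    by (induction m) (auto intro: Ck_mult)
  have Ckprod: "Ck j (\<lambda>x. \<Prod>i<k. (1 - \<psi> i x) ^ m)" for j k m
  proof (induction k)
    case (Suc k)
    have "Ck j (\<lambda>x. 1 + (-1) * \<psi> k x)" unfolding \<psi>_def by (intro Ck_add Ck_mult Ck_const Ck_bump)
    then show ?case using Suc by (auto intro!: Ck_mult Ckpow)
  qed auto
  show ?thesis
  proof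
    fix k
    show "\<xi> k \<in> C0_infty \<Omega>"
    proof (rule C0_inftyI[of _ "\<Union>i<k. cball (c i) (\<rho> i)"])
      fix j
      have "Ck j (\<lambda>x. 1 + (-1) * (\<Prod>i<k. (1 - \<psi> i x) ^ k))" by (intro Ck_add Ck_mult Ck_const Ckprod)
      then show "Ck j (\<xi> k)" by (simp add: \<xi>_def[abs_def])
    next
      fix x assume "x \<notin> (\<Union>i<k. cball (c i) (\<rho> i))"
      then have "x \<notin> ball (c i) (\<rho> i)" if "i < k" for i using that ball_subset_cball by blast
      then have "\<psi> i x = 0" if "i < k" for i
        using bump_pos_iff[OF c\<rho>(2), of "c i" i x] \<psi>(1)[of i x] that by (auto simp: \<psi>_def)
      then show "\<xi> k x = 0" by (simp add: \<xi>_def)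
    qed (use c\<rho>(3) in auto)
    fix x show "0 \<le> \<xi> k x" "\<xi> k x \<le> 1" using prod01 by (auto simp: \<xi>_def)
  next
    fix x assume "x \<in> \<Omega>"
    then obtain U where U: "U \<in> F'" "x \<in> U" using UF F'(3) by auto
    then obtain i where i: "from_nat_into F' i = U" using from_nat_into_surj[OF F'(2)] by blast
    then have "\<psi> i x > 0" using bump_pos_iff[OF c\<rho>(2)[of i], of "c i" x] U(2) c\<rho>(1)[of i] by (auto simp: \<psi>_def)
    then have lim: "(\<lambda>k. (1 - \<psi> i x) ^ k) \<longlonglongrightarrow> 0" using \<psi>[of i x] by (intro LIMSEQ_realpow_zero) auto
    have "(\<lambda>k. \<Prod>j<k. (1 - \<psi> j x) ^ k) \<longlonglongrightarrow> 0"
    proof (rule tendsto_sandwich[OF _ _ tendsto_const lim])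
      show "\<forall>\<^sub>F k in sequentially. (\<Prod>j<k. (1 - \<psi> j x) ^ k) \<le> (1 - \<psi> i x) ^ k"
      proof (rule eventually_sequentiallyI[of "Suc i"])
        fix k assume "Suc i \<le> k"
        then have "(\<Prod>j<k. (1 - \<psi> j x) ^ k) = (1 - \<psi> i x) ^ k * (\<Prod>j\<in>{..<k} - {i}. (1 - \<psi> j x) ^ k)"
          by (intro prod.remove) auto
        also have "\<dots> \<le> (1 - \<psi> i x) ^ k * 1"
          using \<psi> by (intro mult_left_mono prod_le_1) (auto intro!: power_le_one)
        finally show "(\<Prod>j<k. (1 - \<psi> j x) ^ k) \<le> (1 - \<psi> i x) ^ k" by simp
      qed
    qed (simp add: prod01)
    then have "(\<lambda>k. 1 - (\<Prod>j<k. (1 - \<psi> j x) ^ k)) \<longlonglongrightarrow> 1 - 0" by (intro tendsto_intros)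
    then show "(\<lambda>k. \<xi> k x) \<longlonglongrightarrow> 1" by (simp add: \<xi>_def)
  qed
qed

text \<open>A measurable function is an almost everywhere limit of continuous ones, and on the
  compact support of \<open>\<xi>\<close> these are uniform limits of polynomials, which are smooth.\<close>

lemma C0_infty_approx_bounded:
  fixes \<xi> g :: "'a::euclidean_space \<Rightarrow> real"
  assumes \<xi>: "\<xi> \<in> C0_infty \<Omega>" and g: "g \<in> borel_measurable lebesgue" "\<And>x. \<bar>g x\<bar> \<le> 1"
  obtains \<psi> where "\<And>j. \<psi> j \<in> C0_infty \<Omega>" "\<And>j x. \<bar>\<psi> j x\<bar> \<le> 2 * \<bar>\<xi> x\<bar>"
    "AE x in lebesgue. (\<lambda>j. \<psi> j x) \<longlonglongrightarrow> \<xi> x * g x"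
proof -
  obtain K where K: "compact K" "K \<subseteq> \<Omega>" "\<And>x. x \<notin> K \<Longrightarrow> \<xi> x = 0"
    using C0_inftyE[OF \<xi>] by metis
  have "g \<in> borel_measurable (lebesgue_on UNIV)" using g by simp
  then have "g measurable_on UNIV" by (simp add: measurable_on_iff_borel_measurable)
  then obtain Z f where Z: "negligible Z" and fc: "\<And>n. continuous_on UNIV (f n)"
      and flim: "\<And>x. x \<notin> Z \<Longrightarrow> (\<lambda>n. f n x) \<longlonglongrightarrow> g x"
    by (auto simp: measurable_on_def)
  define h where "h n x = max (-1) (min 1 (f n x))" for n x
  have hc: "continuous_on UNIV (h n)" for n unfolding h_def using fc by (intro continuous_intros)
  have hb: "\<bar>h n x\<bar> \<le> 1" for n x by (auto simp: h_def)
  have hlim: "(\<lambda>n. h n x) \<longlonglongrightarrow> g x" if "x \<notin> Z" for x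
  proof -
    have "(\<lambda>n. h n x) \<longlonglongrightarrow> max (-1) (min 1 (g x))" unfolding h_def using flim[OF that] by (intro tendsto_intros)
    then show ?thesis using g(2)[of x] by (simp add: max_def min_def abs_le_iff split: if_splits)
  qed
  have "\<exists>P. real_polynomial_function P \<and> (\<forall>x\<in>K. \<bar>h n x - P x\<bar> < 1 / Suc n)" for n
  proof -
    have "continuous_on K (h n)" using hc continuous_on_subset by blast
    moreover have "0 < 1 / real (Suc n)" by simp
    ultimately show ?thesis
      using Stone_Weierstrass_real_polynomial_function[OF K(1)] by metis
  qed
  then obtain P where P: "\<And>n. real_polynomial_function (P n)" "\<And>n x. x \<in> K \<Longrightarrow> \<bar>h n x - P n x\<bar> < 1 / Suc n"
    by metis
  have CkP: "Ck k Q" if "real_polynomial_function Q" for k and Q :: "'a \<Rightarrow> real"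
    using that by induction (auto intro: Ck_linear Ck_add Ck_mult)
  show ?thesis
  proof
    fix j show "(\<lambda>x. \<xi> x * P j x) \<in> C0_infty \<Omega>" by (intro C0_infty_mult \<xi> CkP P)
    fix x
    show "\<bar>\<xi> x * P j x\<bar> \<le> 2 * \<bar>\<xi> x\<bar>"
    proof (cases "x \<in> K")
      case True
      have "1 / real (Suc j) \<le> 1" by simp
      then have "\<bar>P j x\<bar> \<le> 2" using P(2)[OF True, of j] hb[of j x] by linarith
      then show ?thesis by (simp add: abs_mult mult_left_mono mult.commute[of 2])
    qed (simp add: K)
  next
    have "AE x in lebesgue. x \<notin> Z" using Z by (simp add: negligible_iff_null_sets AE_not_in)
    then show "AE x in lebesgue. (\<lambda>j. \<xi> x * P j x) \<longlonglongrightarrow> \<xi> x * g x"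
    proof eventually_elim
      case (elim x)
      show ?case
      proof (cases "x \<in> K")
        case True
        have "(\<lambda>n. h n x - P n x) \<longlonglongrightarrow> 0"
          by (rule Lim_null_comparison[OF _ LIMSEQ_inverse_real_of_nat])
            (use P(2)[OF True] in \<open>auto intro!: always_eventually less_imp_le simp: inverse_eq_divide\<close>)
        then have "(\<lambda>n. h n x - (h n x - P n x)) \<longlonglongrightarrow> g x - 0" by (intro tendsto_diff hlim elim)
        then show ?thesis by (intro tendsto_mult tendsto_const) simp
      qed (simp add: K)
    qed
  qed
qed

section \<open>Weighted Lebesgue spaces\<close>

definition wmeas :: "'a::euclidean_space set \<Rightarrow> real \<Rightarrow> 'a measure" where
  "wmeas S m = density (lebesgue_on S) (\<lambda>x. ennreal (1 / norm x powr m))"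

lemma borel_measurable_wmeas [simp]:
  "f \<in> borel_measurable (wmeas S m) \<longleftrightarrow> f \<in> borel_measurable (lebesgue_on S)"
  by (simp add: wmeas_def)

lemma weight_measurable_on: "(\<lambda>x::'a::euclidean_space. 1 / norm x powr m) \<in> borel_measurable (lebesgue_on S)"
  by (intro measurable_restrict_space1 measurable_completion) simp

lemma lebesgue_on_measurable_subset:
  "f \<in> borel_measurable (lebesgue_on S) \<Longrightarrow> T \<subseteq> S \<Longrightarrow> f \<in> borel_measurable (lebesgue_on T)"
  using measurable_restrict_mono by blast

lemma AE_wmeas:
  fixes S :: "'a::euclidean_space set"
  assumes "S \<in> sets lebesgue"
  shows "(AE x in wmeas S m. P x) \<longleftrightarrow> (AE x in lebesgue. x \<in> S \<longrightarrow> P x)"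
proof -
  have ne: "AE x in lebesgue. x \<noteq> (0::'a)"
    by (rule AE_not_in[where N = "{0}", simplified]) (simp add: null_sets_completionI)
  have "(AE x in wmeas S m. P x) \<longleftrightarrow> (AE x in lebesgue_on S. 0 < ennreal (1 / norm x powr m) \<longrightarrow> P x)"
    unfolding wmeas_def using weight_measurable_on by (subst AE_density) auto
  also have "\<dots> \<longleftrightarrow> (AE x in lebesgue. x \<in> S \<longrightarrow> 0 < ennreal (1 / norm x powr m) \<longrightarrow> P x)"
    using assms by (subst AE_restrict_space_iff) auto
  also have "\<dots> \<longleftrightarrow> (AE x in lebesgue. x \<in> S \<longrightarrow> P x)"
  proof (rule iffI; elim AE_mp)
    show "AE x in lebesgue. (x \<in> S \<longrightarrow> 0 < ennreal (1 / norm x powr m) \<longrightarrow> P x) \<longrightarrow> x \<in> S \<longrightarrow> P x"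
      using ne by eventually_elim (auto simp: ennreal_zero_less_divide)
  qed auto
  finally show ?thesis .
qed

lemma Lp_fun_wmeas:
  assumes "S \<in> sets lebesgue"
  shows "Lp_fun t (wmeas S m) f \<longleftrightarrow> f \<in> borel_measurable (lebesgue_on S) \<and>
    integrable lebesgue (\<lambda>x. indicator S x * (norm (f x) powr t / norm x powr m))"
proof (cases "f \<in> borel_measurable (lebesgue_on S)")
  case True
  have "integrable (wmeas S m) (\<lambda>x. norm (f x) powr t) \<longleftrightarrow>
      integrable (lebesgue_on S) (\<lambda>x. (1 / norm x powr m) *\<^sub>R norm (f x) powr t)"
    unfolding wmeas_def using weight_measurable_on True by (intro integrable_density) auto
  also have "\<dots> \<longleftrightarrow> integrable lebesgue (\<lambda>x. indicator S x *\<^sub>R ((1 / norm x powr m) *\<^sub>R norm (f x) powr t))"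
    using assms by (subst integrable_restrict_space) auto
  finally show ?thesis using True by (simp add: Lp_fun_def)
qed (auto simp: Lp_fun_def)

lemma Lp_int_wmeas:
  assumes "S \<in> sets lebesgue" "f \<in> borel_measurable (lebesgue_on S)"
  shows "Lp_int t (wmeas S m) f = (\<integral>x. indicator S x * (norm (f x) powr t / norm x powr m) \<partial>lebesgue)"
proof -
  have "Lp_int t (wmeas S m) f = (\<integral>x. (1 / norm x powr m) *\<^sub>R norm (f x) powr t \<partial>lebesgue_on S)"
    unfolding wmeas_def Lp_int_def using weight_measurable_on assms by (intro integral_density) auto
  also have "\<dots> = (\<integral>x. indicator S x *\<^sub>R ((1 / norm x powr m) *\<^sub>R norm (f x) powr t) \<partial>lebesgue)"
    using assms by (subst integral_restrict_space) auto
  finally show ?thesis by simp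
qed

lemma weighted_Lp_iff: "S \<in> sets lebesgue \<Longrightarrow> weighted_Lp S t m f \<longleftrightarrow> Lp_fun t (wmeas S m) f"
  by (simp add: Lp_fun_wmeas weighted_Lp_def set_integrable_def)

lemma weighted_int_eq:
  "S \<in> sets lebesgue \<Longrightarrow> f \<in> borel_measurable (lebesgue_on S) \<Longrightarrow> weighted_int S t m f = Lp_int t (wmeas S m) f"
  by (simp add: Lp_int_wmeas weighted_int_def set_lebesgue_integral_def)

lemma weighted_Lp_converges_iff:
  assumes "S \<in> sets lebesgue"
  shows "weighted_Lp_converges S t m f g \<longleftrightarrow> Lp_conv t (wmeas S m) f g"
proof (cases "\<forall>n. weighted_Lp S t m (\<lambda>x. f n x - g x)")
  case True
  then have m: "(\<lambda>x. f n x - g x) \<in> borel_measurable (lebesgue_on S)" for n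
    by (auto simp: weighted_Lp_def)
  have "weighted_int S t m (\<lambda>x. f n x - g x) = Lp_int t (wmeas S m) (\<lambda>x. f n x - g x)" for n
    by (rule weighted_int_eq[OF assms m])
  then show ?thesis using True assms
    by (simp add: weighted_Lp_converges_def Lp_conv_def weighted_Lp_iff)
qed (use assms in \<open>auto simp: weighted_Lp_converges_def Lp_conv_def weighted_Lp_iff\<close>)

lemma weighted_powr_measurable:
  assumes "S \<in> sets lebesgue" "f \<in> borel_measurable (lebesgue_on S)"
  shows "(\<lambda>x. indicator S x * (norm (f x) powr t / norm x powr m)) \<in> borel_measurable lebesgue"
proof -
  have "(\<lambda>x. norm (f x) powr t * (1 / norm x powr m)) \<in> borel_measurable (lebesgue_on S)"
    using assms(2) weight_measurable_on by measurable
  then have "(\<lambda>x. indicator S x *\<^sub>R (norm (f x) powr t * (1 / norm x powr m))) \<in> borel_measurable lebesgue"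
    using assms(1) by (subst (asm) borel_measurable_restrict_space_iff) auto
  then show ?thesis by simp
qed

lemma Lp_wmeas_mono:
  assumes S: "S \<in> sets lebesgue" "S' \<in> sets lebesgue" "S \<subseteq> S'"
    and w: "\<And>x. x \<in> S \<Longrightarrow> 1 / norm x powr m \<le> c * (1 / norm x powr m')"
    and f: "Lp_fun t (wmeas S' m') f"
  shows "Lp_fun t (wmeas S m) f" "c \<ge> 0 \<Longrightarrow> Lp_int t (wmeas S m) f \<le> c * Lp_int t (wmeas S' m') f"
proof -
  have fm': "f \<in> borel_measurable (lebesgue_on S')"
    and i': "integrable lebesgue (\<lambda>x. indicator S' x * (norm (f x) powr t / norm x powr m'))"
    using f S by (auto simp: Lp_fun_wmeas)
  have fm: "f \<in> borel_measurable (lebesgue_on S)" using lebesgue_on_measurable_subset[OF fm' S(3)] .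
  have le: "indicator S x * (norm (f x) powr t / norm x powr m) \<le>
      \<bar>c\<bar> * (indicator S' x * (norm (f x) powr t / norm x powr m'))" for x
  proof (cases "x \<in> S")
    case True
    have "norm (f x) powr t * (1 / norm x powr m) \<le> norm (f x) powr t * (\<bar>c\<bar> * (1 / norm x powr m'))"
      using w[OF True] mult_right_mono[OF abs_ge_self[of c], of "1 / norm x powr m'"]
      by (intro mult_left_mono) auto
    then show ?thesis using True S by (auto simp: mult.commute mult.left_commute)
  qed auto
  note m = weighted_powr_measurable[OF S(1) fm, of t m]
  have i: "integrable lebesgue (\<lambda>x. indicator S x * (norm (f x) powr t / norm x powr m))"
    by (rule Bochner_Integration.integrable_bound[OF integrable_mult_right[OF i', of "\<bar>c\<bar>"] m])
      (use le in \<open>auto intro!: AE_I2 simp: abs_mult\<close>)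
  then show "Lp_fun t (wmeas S m) f" using fm S by (simp add: Lp_fun_wmeas)
  assume "c \<ge> 0"
  then have "(\<integral>x. indicator S x * (norm (f x) powr t / norm x powr m) \<partial>lebesgue)
      \<le> (\<integral>x. c * (indicator S' x * (norm (f x) powr t / norm x powr m')) \<partial>lebesgue)"
    using le \<open>c \<ge> 0\<close> by (intro integral_mono[OF i integrable_mult_right[OF i']]) (simp only: abs_of_nonneg)
  then show "Lp_int t (wmeas S m) f \<le> c * Lp_int t (wmeas S' m') f"
    unfolding Lp_int_wmeas[OF S(1) fm] Lp_int_wmeas[OF S(2) fm'] integral_mult_right_zero .
qed

lemma Lp_wmeas_subset:
  assumes "S \<in> sets lebesgue" "S' \<in> sets lebesgue" "S \<subseteq> S'" "Lp_fun t (wmeas S' m) f"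
  shows "Lp_fun t (wmeas S m) f" "Lp_int t (wmeas S m) f \<le> Lp_int t (wmeas S' m) f"
  using Lp_wmeas_mono[OF assms(1-3), of m 1 m] assms(4) by auto

lemma Lp_cong_AE:
  assumes S: "S \<in> sets lebesgue" and f: "f \<in> borel_measurable (lebesgue_on S)"
    and g: "g \<in> borel_measurable (lebesgue_on S)" and ae: "AE x in lebesgue. x \<in> S \<longrightarrow> f x = g x"
  shows "Lp_int t (wmeas S m) f = Lp_int t (wmeas S m) g" "Lp_fun t (wmeas S m) f \<longleftrightarrow> Lp_fun t (wmeas S m) g"
proof -
  have ae': "AE x in wmeas S m. f x = g x" using ae S by (simp add: AE_wmeas)
  have m: "f \<in> borel_measurable (wmeas S m)" "g \<in> borel_measurable (wmeas S m)" using f g by auto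
  show "Lp_int t (wmeas S m) f = Lp_int t (wmeas S m) g"
    unfolding Lp_int_def using ae' m by (intro integral_cong_AE) auto
  have "integrable (wmeas S m) (\<lambda>x. norm (f x) powr t) \<longleftrightarrow> integrable (wmeas S m) (\<lambda>x. norm (g x) powr t)"
    using ae' m by (intro integrable_cong_AE) auto
  then show "Lp_fun t (wmeas S m) f \<longleftrightarrow> Lp_fun t (wmeas S m) g" using f g by (simp add: Lp_fun_def)
qed

text \<open>On the shell \<open>R / 2 ^ (k + 1) < norm x \<le> R / 2 ^ k\<close> the weight is at most a multiple of
  \<open>2 powr (m * k)\<close>, and the ball containing the shell has volume proportional to \<open>2 powr (- N * k)\<close>.\<close>

lemma weight_integrable_ball:
  assumes m: "m < real DIM('a::euclidean_space)" and R: "R > 0"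
  shows "integrable lborel (\<lambda>x::'a. indicator (cball 0 R) x * (1 / norm x powr m))"
proof (cases "m \<le> 0")
  case True
  have "integrable lborel (\<lambda>x::'a. R powr (-m) * indicator (cball 0 R) x)"
    using R by (intro integrable_mult_right integrable_real_indicator) (use emeasure_lborel_cball_finite in auto)
  then show ?thesis
  proof (rule Bochner_Integration.integrable_bound, goal_cases)
    case 1
    show ?case by (intro borel_measurable_times borel_measurable_indicator) auto
  next
    case 2
    have "norm x powr (-m) \<le> R powr (-m)" if "x \<in> cball 0 R" for x :: 'a
      using that True by (intro powr_mono2) auto
    then show ?case by (auto simp: indicator_def powr_minus_divide)
  qed
next
  case False
  define h where "h k x = (2 ^ Suc k / R) powr m * indicator (cball 0 (R / 2 ^ k)) x" for k and x :: 'a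
  have hm: "h k \<in> borel_measurable lborel" for k
    unfolding h_def[abs_def] by (intro borel_measurable_times borel_measurable_const borel_measurable_indicator) simp
  define V where "V = measure lborel (cball (0::'a) 1)"
  define q where "q = 2 powr (m - DIM('a))"
  have q: "0 < q" "q < 1" using m by (auto simp: q_def powr_less_one)
  have int: "(\<integral>\<^sup>+x. ennreal (h k x) \<partial>lborel) = ennreal ((2 / R) powr m * R ^ DIM('a) * V * q ^ k)" for k
  proof -
    have "(\<integral>\<^sup>+x. ennreal (h k x) \<partial>lborel) = (\<integral>\<^sup>+x. ennreal ((2 ^ Suc k / R) powr m) * indicator (cball (0::'a) (R / 2 ^ k)) x \<partial>lborel)"
      by (intro nn_integral_cong) (auto simp: h_def indicator_def)
    also have "\<dots> = ennreal ((2 ^ Suc k / R) powr m) * emeasure lborel (cball (0::'a) (R / 2 ^ k))"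
      by (rule nn_integral_cmult_indicator) simp
    also have "emeasure lborel (cball (0::'a) (R / 2 ^ k)) = ennreal (unit_ball_vol DIM('a) * (R / 2 ^ k) ^ DIM('a))"
      using R by (intro emeasure_cball) simp
    also have "unit_ball_vol DIM('a) = V" using content_cball[of 1 "0::'a"] by (simp add: V_def)
    also have "ennreal ((2 ^ Suc k / R) powr m) * ennreal (V * (R / 2 ^ k) ^ DIM('a))
        = ennreal ((2 ^ Suc k / R) powr m * (V * (R / 2 ^ k) ^ DIM('a)))"
      by (subst ennreal_mult) (auto simp: V_def R less_imp_le)
    also have "(2 ^ Suc k / R) powr m = (2 / R) powr m * (2 powr m) ^ k"
    proof -
      have "(2 ^ Suc k / R) powr m = ((2 / R) * 2 powr (real k)) powr m" by (simp add: powr_realpow)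
      also have "\<dots> = (2 / R) powr m * (2 powr m) powr (real k)"
        using R by (subst powr_mult) (simp_all add: powr_powr mult.commute)
      finally show ?thesis by (simp add: powr_realpow)
    qed
    also have "(R / 2 ^ k) ^ DIM('a) = R ^ DIM('a) * (2 powr (- DIM('a))) ^ k"
    proof -
      have "(2 powr (- real DIM('a))) ^ k = (1 / 2 ^ DIM('a)) ^ k"
        by (simp add: powr_minus_divide powr_realpow)
      also have "\<dots> = 1 / (2 ^ k) ^ DIM('a)" by (simp add: power_divide power_mult[symmetric] mult.commute)
      finally show ?thesis by (simp add: power_divide)
    qed
    finally have "(\<integral>\<^sup>+x. ennreal (h k x) \<partial>lborel)
      = ennreal ((2 / R) powr m * R ^ DIM('a) * V * ((2 powr m) ^ k * (2 powr (- DIM('a))) ^ k))"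
      by (simp add: mult_ac)
    also have "(2 powr m) ^ k * (2 powr (- DIM('a))) ^ k = q ^ k"
      by (simp add: q_def power_mult_distrib[symmetric] powr_add[symmetric])
    finally show ?thesis .
  qed
  have le: "indicator (cball 0 R) x * ennreal (1 / norm x powr m) \<le> (\<Sum>k. ennreal (h k x))" for x :: 'a
  proof (cases "x = 0 \<or> x \<notin> cball 0 R")
    case True
    then show ?thesis by auto
  next
    case nz: False
    have "norm x > 0" using nz by simp
    then obtain n where n: "R < 2 ^ n * norm x"
      using real_arch_pow[of 2 "R / norm x"] by (auto simp: field_simps)
    define k where "k = (LEAST k. R < 2 ^ Suc k * norm x)"
    have ex: "R < 2 ^ Suc n * norm x" using n by (rule order_less_trans) (use \<open>norm x > 0\<close> in simp)
    have k1: "R < 2 ^ Suc k * norm x" unfolding k_def using ex by (rule LeastI)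
    have k2: "norm x \<le> R / 2 ^ k"
    proof (cases k)
      case 0
      then show ?thesis using nz by simp
    next
      case (Suc j)
      then have "\<not> R < 2 ^ Suc j * norm x" unfolding k_def using not_less_Least[of j] by (metis lessI)
      then show ?thesis using Suc by (simp add: field_simps)
    qed
    have "1 / norm x powr m = (1 / norm x) powr m" using \<open>norm x > 0\<close> by (simp add: powr_divide)
    also have "\<dots> \<le> (2 ^ Suc k / R) powr m"
      using k1 R False \<open>norm x > 0\<close> by (intro powr_mono2) (auto simp: field_simps)
    also have "\<dots> = h k x" using k2 by (simp add: h_def)
    finally have "ennreal (1 / norm x powr m) \<le> ennreal (h k x)" by (rule ennreal_leI)
    also have "\<dots> = (\<Sum>j\<in>{k}. ennreal (h j x))" by simp
    also have "\<dots> \<le> (\<Sum>k. ennreal (h k x))" by (intro sum_le_suminf) auto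
    finally show ?thesis using nz by simp
  qed
  have "(\<integral>\<^sup>+x. indicator (cball (0::'a) R) x * ennreal (1 / norm x powr m) \<partial>lborel) \<le> (\<integral>\<^sup>+x. (\<Sum>k. ennreal (h k x)) \<partial>lborel)"
    by (intro nn_integral_mono le)
  also have "\<dots> = (\<Sum>k. \<integral>\<^sup>+x. ennreal (h k x) \<partial>lborel)"
    using hm by (intro nn_integral_suminf measurable_compose[OF hm measurable_ennreal])
  also have "\<dots> = (\<Sum>k. ennreal ((2 / R) powr m * R ^ DIM('a) * V * q ^ k))" by (simp add: int)
  also have "\<dots> = ennreal (\<Sum>k. (2 / R) powr m * R ^ DIM('a) * V * q ^ k)"
    using q R by (intro suminf_ennreal2 summable_mult summable_geometric) (auto simp: V_def)
  finally have "(\<integral>\<^sup>+x. indicator (cball (0::'a) R) x * ennreal (1 / norm x powr m) \<partial>lborel) < \<infinity>"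
    by (rule le_less_trans) simp
  also have "(\<integral>\<^sup>+x. indicator (cball (0::'a) R) x * ennreal (1 / norm x powr m) \<partial>lborel)
     = (\<integral>\<^sup>+x. ennreal (norm (indicator (cball (0::'a) R) x * (1 / norm x powr m))) \<partial>lborel)"
    by (intro nn_integral_cong) (auto simp: indicator_def)
  finally show ?thesis
    by (intro integrableI_bounded borel_measurable_times borel_measurable_indicator) auto
qed

lemma weight_integrable_compact:
  assumes m: "m < real DIM('a::euclidean_space)" and K: "compact K"
  shows "integrable lebesgue (\<lambda>x::'a. indicator K x * (1 / norm x powr m))"
proof -
  obtain R where R: "R > 0" "K \<subseteq> cball 0 R"
    using compact_imp_bounded[OF K] by (meson bounded_subset_cball order.trans ball_subset_cball bounded_subset_ballD)
  have "integrable lborel (\<lambda>x::'a. indicator K x * (1 / norm x powr m))"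
  proof (rule Bochner_Integration.integrable_bound[OF weight_integrable_ball[OF m R(1)]])
    show "(\<lambda>x. indicator K x * (1 / norm x powr m)) \<in> borel_measurable lborel"
      using K by (intro borel_measurable_times borel_measurable_indicator) (auto intro: borel_compact)
    show "AE x in lborel. norm (indicator K x * (1 / norm x powr m)) \<le> norm (indicator (cball 0 R) x * (1 / norm x powr m))"
      using R(2) by (intro AE_I2) (auto simp: indicator_def)
  qed
  then show ?thesis by (simp add: integrable_completion)
qed

lemma Lp_fun_continuous_compact_support:
  fixes f :: "'a::euclidean_space \<Rightarrow> 'b::euclidean_space"
  assumes m: "m < real DIM('a)" and t: "t > 0" and f: "continuous_on UNIV f"
    and K: "compact K" "\<And>x. x \<notin> K \<Longrightarrow> f x = 0" and S: "S \<in> sets lebesgue"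
  shows "Lp_fun t (wmeas S m) f"
proof -
  have fm: "f \<in> borel_measurable borel" using f by (simp add: borel_measurable_continuous_onI)
  then have fS: "f \<in> borel_measurable (lebesgue_on S)" by (intro measurable_restrict_space1 measurable_completion) simp
  have "bounded (f ` K)" using K f by (intro compact_imp_bounded compact_continuous_image) (auto intro: continuous_on_subset)
  then obtain B where B: "\<And>x. x \<in> K \<Longrightarrow> norm (f x) \<le> B" by (auto simp: bounded_iff)
  have i: "integrable lebesgue (\<lambda>x::'a. B powr t * (indicator K x * (1 / norm x powr m)))"
    by (rule integrable_mult_right[OF weight_integrable_compact[OF m K(1)]])
  have "(\<lambda>x. norm (f x) powr t / norm x powr m) \<in> borel_measurable borel" using fm by measurable
  then have "(\<lambda>x. norm (f x) powr t / norm x powr m) \<in> borel_measurable lebesgue" by (simp add: measurable_completion)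
  then have m: "(\<lambda>x. indicator S x * (norm (f x) powr t / norm x powr m)) \<in> borel_measurable lebesgue"
    using S by (intro borel_measurable_times borel_measurable_indicator)
  have "integrable lebesgue (\<lambda>x. indicator S x * (norm (f x) powr t / norm x powr m))"
  proof (rule Bochner_Integration.integrable_bound[OF i m], intro AE_I2)
    fix x
    show "norm (indicator S x * (norm (f x) powr t / norm x powr m)) \<le> norm (B powr t * (indicator K x * (1 / norm x powr m)))"
    proof (cases "x \<in> K")
      case True
      have "norm (f x) powr t \<le> B powr t" using B[OF True] t by (intro powr_mono2) auto
      then show ?thesis using True by (auto simp: indicator_def divide_right_mono)
    qed (use K t in auto)
  qed
  then show ?thesis using fS S by (simp add: Lp_fun_wmeas)
qed

lemma Lp_fun_C0_infty:
  fixes f :: "'a::euclidean_space \<Rightarrow> real"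
  assumes f: "f \<in> C0_infty \<Omega>" and m: "m < real DIM('a)" and t: "t > 0" and S: "S \<in> sets lebesgue"
  shows "Lp_fun t (wmeas S m) f" "Lp_fun t (wmeas S m) (grad f)"
proof -
  obtain K where K: "compact K" "\<And>x. x \<notin> K \<Longrightarrow> f x = 0" "\<And>x. x \<notin> K \<Longrightarrow> grad f x = 0"
    using C0_inftyE_grad[OF f] by metis
  show "Lp_fun t (wmeas S m) f" "Lp_fun t (wmeas S m) (grad f)"
    by (rule Lp_fun_continuous_compact_support[OF m t _ K(1) _ S], use K f in \<open>auto intro: C0_infty_continuous continuous_on_grad\<close>)+
qed

lemma Lp_int_C0_infty:
  fixes f :: "'a::euclidean_space \<Rightarrow> real"
  assumes f: "f \<in> C0_infty \<Omega>" and S: "S \<in> sets lebesgue" "\<Omega> \<subseteq> S" and t: "t > 0"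
  shows "Lp_int t (wmeas S m) f = Lp_int t (wmeas UNIV m) f"
    "Lp_int t (wmeas S m) (grad f) = Lp_int t (wmeas UNIV m) (grad f)"
proof -
  obtain K where K: "K \<subseteq> \<Omega>" "\<And>x. x \<notin> K \<Longrightarrow> f x = 0" "\<And>x. x \<notin> K \<Longrightarrow> grad f x = 0"
    using C0_inftyE_grad[OF f] by metis
  have "f \<in> borel_measurable borel" "grad f \<in> borel_measurable borel"
    using C0_infty_continuous[OF f] continuous_on_grad[OF f] by (auto simp: borel_measurable_continuous_onI)
  then have m: "f \<in> borel_measurable (lebesgue_on S)" "grad f \<in> borel_measurable (lebesgue_on S)" for S
    by (auto intro!: measurable_restrict_space1 measurable_completion)
  show "Lp_int t (wmeas S m) f = Lp_int t (wmeas UNIV m) f"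
    "Lp_int t (wmeas S m) (grad f) = Lp_int t (wmeas UNIV m) (grad f)"
    by (simp_all add: Lp_int_wmeas S m, (intro Bochner_Integration.integral_cong refl, use K S t in \<open>auto simp: indicator_def\<close>)+)
qed

lemma norm_le_powr_split:
  assumes "p \<ge> 1" "\<epsilon> > 0"
  shows "norm a \<le> \<epsilon> + \<epsilon> powr (1 - p) * norm a powr p"
proof (cases "norm a \<le> \<epsilon>")
  case True
  then show ?thesis by (simp add: add_increasing2)
next
  case False
  then have "norm a = norm a powr (1 - p) * norm a powr p"
    using assms by (simp add: powr_add[symmetric])
  also have "\<dots> \<le> \<epsilon> powr (1 - p) * norm a powr p"
    using False assms by (intro mult_right_mono powr_mono2') auto
  finally show ?thesis using assms by simp
qed

text \<open>On the bounded set \<open>K\<close> the \<open>L\<^sup>1\<close> norm is at most a small multiple of the volume plus a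
  multiple of the integral of the \<open>p\<close>-th power.\<close>

lemma Lp_conv_imp_L1_conv:
  fixes f :: "nat \<Rightarrow> 'a::euclidean_space \<Rightarrow> 'b::euclidean_space"
  assumes S: "S \<in> sets lebesgue" and p: "p \<ge> 1" and conv: "Lp_conv p (wmeas S m) f g"
    and K: "compact K" "K \<subseteq> S" and c: "c > 0" "\<And>x. x \<in> K \<Longrightarrow> x \<noteq> 0 \<Longrightarrow> 1 / norm x powr m \<ge> c"
  shows "set_integrable lebesgue K (\<lambda>x. f n x - g x)"
    "(\<lambda>n. LINT x:K|lebesgue. norm (f n x - g x)) \<longlonglongrightarrow> 0"
proof -
  have KL [measurable]: "K \<in> sets lebesgue" using K by (simp add: borel_compact)
  have Kfin: "emeasure lebesgue K < \<infinity>"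
    using emeasure_bounded_finite[OF compact_imp_bounded[OF K(1)]] K(1) by (simp add: emeasure_completion borel_compact)
  define d where "d n x = f n x - g x" for n x
  have dL: "Lp_fun p (wmeas S m) (d n)" and dlim: "(\<lambda>n. Lp_int p (wmeas S m) (d n)) \<longlonglongrightarrow> 0" for n
    using conv by (auto simp: Lp_conv_def d_def[abs_def])
  have dm: "d n \<in> borel_measurable (lebesgue_on S)"
    and i: "integrable lebesgue (\<lambda>x. indicator S x * (norm (d n x) powr p / norm x powr m))" for n
    using dL S by (auto simp: Lp_fun_wmeas)
  have dmK: "(\<lambda>x. indicator K x *\<^sub>R d n x) \<in> borel_measurable lebesgue" for n
    using lebesgue_on_measurable_subset[OF dm K(2)] KL by (subst (asm) borel_measurable_restrict_space_iff) auto
  have ne: "AE x in lebesgue. x \<noteq> (0::'a)"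
    by (rule AE_not_in[where N = "{0}", simplified]) (simp add: null_sets_completionI)
  have bd: "AE x in lebesgue. norm (indicator K x *\<^sub>R d n x) \<le>
      \<epsilon> * indicator K x + \<epsilon> powr (1 - p) / c * (indicator S x * (norm (d n x) powr p / norm x powr m))" if "\<epsilon> > 0" for \<epsilon> n
    using ne
  proof eventually_elim
    case (elim x)
    show ?case
    proof (cases "x \<in> K")
      case True
      have "c * norm (d n x) powr p \<le> norm (d n x) powr p / norm x powr m"
        using mult_right_mono[OF c(2)[OF True elim], of "norm (d n x) powr p"] by simp
      then have "norm (d n x) powr p \<le> (norm (d n x) powr p / norm x powr m) / c"
        unfolding pos_le_divide_eq[OF c(1)] by (simp only: mult.commute)
      then have "\<epsilon> powr (1 - p) * norm (d n x) powr p \<le> \<epsilon> powr (1 - p) * ((norm (d n x) powr p / norm x powr m) / c)"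
        by (intro mult_left_mono) auto
      moreover have "x \<in> S" using True K by auto
      ultimately show ?thesis using norm_le_powr_split[OF p that, of "d n x"] True by (simp add: mult_ac)
    qed (use that c in auto)
  qed
  have ib: "integrable lebesgue (\<lambda>x. \<epsilon> * indicator K x + \<epsilon> powr (1 - p) / c * (indicator S x * (norm (d n x) powr p / norm x powr m)))" for \<epsilon> n
    using i[of n] Kfin KL by (intro Bochner_Integration.integrable_add integrable_mult_right) auto
  have int: "integrable lebesgue (\<lambda>x. indicator K x *\<^sub>R d n x)" for n
  proof (rule Bochner_Integration.integrable_bound[OF ib[of 1 n] dmK])
    show "AE x in lebesgue. norm (indicator K x *\<^sub>R d n x) \<le> norm (1 * indicator K x + 1 powr (1 - p) / c * (indicator S x * (norm (d n x) powr p / norm x powr m)))"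
      using bd[OF zero_less_one, of n] by eventually_elim (use c in auto)
  qed
  then show "set_integrable lebesgue K (\<lambda>x. f n x - g x)" for n
    by (simp add: set_integrable_def d_def)
  have le: "(\<integral>x. norm (indicator K x *\<^sub>R d n x) \<partial>lebesgue) \<le> \<epsilon> * measure lebesgue K + \<epsilon> powr (1 - p) / c * Lp_int p (wmeas S m) (d n)"
    if "\<epsilon> > 0" for \<epsilon> n
  proof -
    have "(\<integral>x. norm (indicator K x *\<^sub>R d n x) \<partial>lebesgue) \<le>
      (\<integral>x. \<epsilon> * indicator K x + \<epsilon> powr (1 - p) / c * (indicator S x * (norm (d n x) powr p / norm x powr m)) \<partial>lebesgue)"
      by (rule integral_mono_AE[OF integrable_norm[OF int] ib bd[OF that]])
    also have "\<dots> = \<epsilon> * (\<integral>x. indicator K x \<partial>lebesgue) + \<epsilon> powr (1 - p) / c * Lp_int p (wmeas S m) (d n)"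
      unfolding Lp_int_wmeas[OF S dm] using Kfin KL
      by (subst Bochner_Integration.integral_add[OF _ integrable_mult_right[OF i]])
        (auto simp only: integral_mult_right_zero
          intro!: integrable_mult_right integrable_real_indicator)
    finally show ?thesis by simp
  qed
  have "(\<lambda>n. \<integral>x. norm (indicator K x *\<^sub>R d n x) \<partial>lebesgue) \<longlonglongrightarrow> 0"
  proof (rule LIMSEQ_I)
    fix e :: real assume e: "e > 0"
    define \<epsilon> where "\<epsilon> = e / (2 * (measure lebesgue K + 1))"
    have \<epsilon>: "\<epsilon> > 0" using e by (simp add: \<epsilon>_def add_nonneg_pos)
    have "\<epsilon> * measure lebesgue K \<le> \<epsilon> * (measure lebesgue K + 1)" using \<epsilon> by (intro mult_left_mono) auto
    also have "\<dots> = e / 2"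
    proof -
      have "e / (2 * M) * M = e / 2" if "M > 0" for M using that by simp
      then show ?thesis by (simp only: \<epsilon>_def add_nonneg_pos measure_nonneg zero_less_one)
    qed
    finally have 1: "\<epsilon> * measure lebesgue K \<le> e / 2" .
    have "(\<lambda>n. \<epsilon> powr (1 - p) / c * Lp_int p (wmeas S m) (d n)) \<longlonglongrightarrow> \<epsilon> powr (1 - p) / c * 0"
      by (intro tendsto_intros dlim)
    then have "\<forall>\<^sub>F n in sequentially. \<epsilon> powr (1 - p) / c * Lp_int p (wmeas S m) (d n) < e / 2"
      using e by (intro order_tendstoD(2)) auto
    then obtain N where N: "\<And>n. n \<ge> N \<Longrightarrow> \<epsilon> powr (1 - p) / c * Lp_int p (wmeas S m) (d n) < e / 2"
      by (auto simp: eventually_sequentially)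
    show "\<exists>no. \<forall>n\<ge>no. norm ((\<integral>x. norm (indicator K x *\<^sub>R d n x) \<partial>lebesgue) - 0) < e"
    proof (intro exI[of _ N] allI impI)
      fix n assume "n \<ge> N"
      have "(\<integral>x. norm (indicator K x *\<^sub>R d n x) \<partial>lebesgue) \<ge> 0" by simp
      then show "norm ((\<integral>x. norm (indicator K x *\<^sub>R d n x) \<partial>lebesgue) - 0) < e"
        using le[OF \<epsilon>, of n] N[OF \<open>n \<ge> N\<close>] 1 unfolding real_norm_def by linarith
    qed
  qed
  moreover have "(LINT x:K|lebesgue. norm (f n x - g x)) = (\<integral>x. norm (indicator K x *\<^sub>R d n x) \<partial>lebesgue)" for n
    by (simp add: set_lebesgue_integral_def d_def)
  ultimately show "(\<lambda>n. LINT x:K|lebesgue. norm (f n x - g x)) \<longlonglongrightarrow> 0" by simp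
qed

lemma Lp_dominated:
  fixes f :: "nat \<Rightarrow> 'a \<Rightarrow> 'b::euclidean_space"
  assumes t: "t > 0" and m: "\<And>n. f n \<in> borel_measurable M" "g \<in> borel_measurable M"
    and lim: "AE x in M. (\<lambda>n. f n x) \<longlonglongrightarrow> g x"
    and h: "Lp_fun t M (h :: 'a \<Rightarrow> real)" and bd: "\<And>n. AE x in M. norm (f n x - g x) \<le> h x"
  shows "Lp_conv t M f g"
proof -
  have i: "integrable M (\<lambda>x. norm (h x) powr t)" using h by auto
  have bd': "AE x in M. norm (norm (f n x - g x) powr t) \<le> norm (h x) powr t" for n
    using bd[of n]
  proof eventually_elim
    case (elim x)
    have "norm (f n x - g x) powr t \<le> norm (h x) powr t" using elim t by (intro powr_mono2) auto
    then show ?case by simp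
  qed
  have mm: "(\<lambda>x. norm (f n x - g x) powr t) \<in> borel_measurable M" for n using m by measurable
  have "integrable M (\<lambda>x. norm (f n x - g x) powr t)" for n
    by (rule Bochner_Integration.integrable_bound[OF i mm]) (use bd'[of n] in auto)
  then have 1: "Lp_fun t M (\<lambda>x. f n x - g x)" for n using m by (auto simp: Lp_fun_def)
  have "(\<lambda>n. \<integral>x. norm (f n x - g x) powr t \<partial>M) \<longlonglongrightarrow> (\<integral>x. 0 \<partial>M)"
  proof (rule integral_dominated_convergence[OF _ mm i _ bd'])
    show "AE x in M. (\<lambda>n. norm (f n x - g x) powr t) \<longlonglongrightarrow> 0"
      using lim
    proof eventually_elim
      case (elim x)
      have "(\<lambda>n. norm (f n x - g x) powr t) \<longlonglongrightarrow> norm (g x - g x) powr t"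
        using t by (intro tendsto_powr' tendsto_norm tendsto_diff elim tendsto_const disjI2) auto
      then show ?case by simp
    qed
  qed simp
  with 1 show ?thesis by (simp add: Lp_conv_def Lp_int_def)
qed

lemma borel_measurable_C0_infty:
  fixes f :: "'a::euclidean_space \<Rightarrow> real"
  assumes "f \<in> C0_infty \<Omega>"
  shows "f \<in> borel_measurable borel" "grad f \<in> borel_measurable borel"
    "f \<in> borel_measurable (lebesgue_on S)" "grad f \<in> borel_measurable (lebesgue_on S)"
proof -
  show 1: "f \<in> borel_measurable borel" "grad f \<in> borel_measurable borel"
    using C0_infty_continuous[OF assms] continuous_on_grad[OF assms] by (auto simp: borel_measurable_continuous_onI)
  then show "f \<in> borel_measurable (lebesgue_on S)" "grad f \<in> borel_measurable (lebesgue_on S)"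
    by (auto intro!: measurable_restrict_space1 measurable_completion)
qed

text \<open>Truncating \<open>u\<close> in size and multiplying it by test functions that increase to \<open>1\<close> on \<open>\<Omega>\<close>
  gives bounded functions close to \<open>u\<close>, which test functions approximate boundedly.\<close>

lemma Lq_space_iff:
  fixes \<Omega> :: "'a::euclidean_space set" and u :: "'a \<Rightarrow> real"
  assumes \<Omega>: "open \<Omega>" and q: "q \<ge> 1" and \<sigma>: "\<sigma> < real DIM('a)"
  shows "u \<in> Lq_space \<Omega> q \<sigma> \<longleftrightarrow> Lp_fun q (wmeas \<Omega> \<sigma>) u"
proof
  have \<Omega>L: "\<Omega> \<in> sets lebesgue" using \<Omega> by (simp add: borel_open)
  {
    assume "u \<in> Lq_space \<Omega> q \<sigma>"
    then obtain \<phi> where \<phi>: "\<And>n. \<phi> n \<in> C0_infty \<Omega>" "Lp_conv q (wmeas \<Omega> \<sigma>) \<phi> u"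
      by (auto simp: Lq_space_def weighted_Lp_converges_iff \<Omega>L)
    then show "Lp_fun q (wmeas \<Omega> \<sigma>) u"
      using Lp_conv_fun[OF q \<phi>(2), of 0] Lp_fun_C0_infty(1)[OF \<phi>(1) \<sigma> _ \<Omega>L, of q] q by simp
  }
  assume u: "Lp_fun q (wmeas \<Omega> \<sigma>) u"
  then have um: "u \<in> borel_measurable (lebesgue_on \<Omega>)" by auto
  obtain \<xi> where \<xi>: "\<And>k. \<xi> k \<in> C0_infty \<Omega>" "\<And>k x. 0 \<le> \<xi> k x" "\<And>k x. \<xi> k x \<le> (1::real)"
    "\<And>x. x \<in> \<Omega> \<Longrightarrow> (\<lambda>k. \<xi> k x) \<longlonglongrightarrow> 1"
    using C0_infty_exhaustion[OF \<Omega>] by metis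
  define N where "N k = real (Suc k)" for k
  define c where "c k x = max (- N k) (min (N k) (u x))" for k x
  define g where "g k x = (if x \<in> \<Omega> then c k x / N k else 0)" for k x
  have cm: "c k \<in> borel_measurable (lebesgue_on \<Omega>)" for k unfolding c_def using um by measurable
  have gm: "g k \<in> borel_measurable lebesgue" for k
  proof -
    have "(\<lambda>x. c k x / N k) \<in> borel_measurable (lebesgue_on \<Omega>)" using cm[of k] by measurable
    then have "(\<lambda>x. indicator \<Omega> x *\<^sub>R (c k x / N k)) \<in> borel_measurable lebesgue"
      using \<Omega>L by (subst (asm) borel_measurable_restrict_space_iff) auto
    moreover have "(\<lambda>x. indicator \<Omega> x *\<^sub>R (c k x / N k)) = g k" by (auto simp: g_def indicator_def)
    ultimately show ?thesis by simp
  qed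
  have gb: "\<bar>g k x\<bar> \<le> 1" for k x by (auto simp: g_def c_def N_def abs_le_iff field_simps)
  define f where "f k x = \<xi> k x * c k x" for k x
  have fm: "f k \<in> borel_measurable (lebesgue_on \<Omega>)" for k
    unfolding f_def[abs_def] using cm[of k] borel_measurable_C0_infty(3)[OF \<xi>(1)] by measurable
  have "\<exists>\<phi>. \<phi> \<in> C0_infty \<Omega> \<and> Lp_fun q (wmeas \<Omega> \<sigma>) (\<lambda>x. \<phi> x - f k x) \<and> Lp_int q (wmeas \<Omega> \<sigma>) (\<lambda>x. \<phi> x - f k x) < 1 / N k" for k
  proof -
    obtain \<psi> where \<psi>: "\<And>j. \<psi> j \<in> C0_infty \<Omega>" "\<And>j x. \<bar>\<psi> j x\<bar> \<le> 2 * \<bar>\<xi> k x\<bar>"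
      "AE x in lebesgue. (\<lambda>j. \<psi> j x) \<longlonglongrightarrow> \<xi> k x * g k x"
      by (rule C0_infty_approx_bounded[OF \<xi>(1)[of k] gm[of k] gb]) blast
    have "Lp_conv q (wmeas \<Omega> \<sigma>) (\<lambda>j x. N k * \<psi> j x) (f k)"
    proof (rule Lp_dominated)
      show "Lp_fun q (wmeas \<Omega> \<sigma>) (\<lambda>x. (3 * N k) *\<^sub>R \<xi> k x)"
        using q by (intro Lp_fun_scaleR Lp_fun_C0_infty(1)[OF \<xi>(1) \<sigma> _ \<Omega>L]) auto
      show "AE x in wmeas \<Omega> \<sigma>. (\<lambda>j. N k * \<psi> j x) \<longlonglongrightarrow> f k x"
        unfolding AE_wmeas[OF \<Omega>L] using \<psi>(3)
      proof eventually_elim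
        case (elim x)
        show ?case
        proof
          assume "x \<in> \<Omega>"
          then have "f k x = N k * (\<xi> k x * g k x)" by (simp add: f_def g_def N_def)
          then show "(\<lambda>j. N k * \<psi> j x) \<longlonglongrightarrow> f k x" using tendsto_mult_left[OF elim] by simp
        qed
      qed
      fix j
      show "AE x in wmeas \<Omega> \<sigma>. norm (N k * \<psi> j x - f k x) \<le> (3 * N k) *\<^sub>R \<xi> k x"
      proof (rule AE_I2)
        fix x
        have "\<bar>N k * \<psi> j x\<bar> \<le> N k * (2 * \<xi> k x)"
          using \<psi>(2)[of j x] \<xi>(2)[of k x] by (simp add: abs_mult N_def mult_left_mono del: of_nat_Suc)
        moreover have "\<bar>f k x\<bar> \<le> \<xi> k x * N k"
          using \<xi>(2)[of k x] by (auto simp: f_def abs_mult c_def N_def intro!: mult_left_mono)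
        ultimately show "norm (N k * \<psi> j x - f k x) \<le> (3 * N k) *\<^sub>R \<xi> k x"
          using abs_triangle_ineq4[of "N k * \<psi> j x" "f k x"] by (simp add: algebra_simps)
      qed
    qed (use q fm borel_measurable_C0_infty(3)[OF \<psi>(1)] in \<open>auto intro!: borel_measurable_times\<close>)
    then have l: "\<And>j. Lp_fun q (wmeas \<Omega> \<sigma>) (\<lambda>x. N k * \<psi> j x - f k x)"
      "(\<lambda>j. Lp_int q (wmeas \<Omega> \<sigma>) (\<lambda>x. N k * \<psi> j x - f k x)) \<longlonglongrightarrow> 0"
      by (auto simp: Lp_conv_def)
    then have "\<forall>\<^sub>F j in sequentially. Lp_int q (wmeas \<Omega> \<sigma>) (\<lambda>x. N k * \<psi> j x - f k x) < 1 / N k"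
      by (intro order_tendstoD(2)) (auto simp: N_def)
    then obtain j where "Lp_int q (wmeas \<Omega> \<sigma>) (\<lambda>x. N k * \<psi> j x - f k x) < 1 / N k"
      by (auto simp: eventually_sequentially)
    then show ?thesis using l(1)[of j] C0_infty_cmult[OF \<psi>(1)[of j], of "N k"] by blast
  qed
  then obtain \<phi> where \<phi>: "\<And>k. \<phi> k \<in> C0_infty \<Omega>" "\<And>k. Lp_fun q (wmeas \<Omega> \<sigma>) (\<lambda>x. \<phi> k x - f k x)"
    "\<And>k. Lp_int q (wmeas \<Omega> \<sigma>) (\<lambda>x. \<phi> k x - f k x) < 1 / N k"
    by metis
  have fu: "Lp_conv q (wmeas \<Omega> \<sigma>) f u"
  proof (rule Lp_dominated)
    show "Lp_fun q (wmeas \<Omega> \<sigma>) (\<lambda>x. \<bar>u x\<bar>)" using u um by (auto simp: Lp_fun_def)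
    show "AE x in wmeas \<Omega> \<sigma>. (\<lambda>k. f k x) \<longlonglongrightarrow> u x"
      unfolding AE_wmeas[OF \<Omega>L]
    proof (intro AE_I2 impI)
      fix x assume x: "x \<in> \<Omega>"
      obtain n where n: "\<bar>u x\<bar> < real n" using reals_Archimedean2 by blast
      have "\<forall>\<^sub>F k in sequentially. \<xi> k x * u x = f k x"
        by (rule eventually_sequentiallyI[of n]) (use n in \<open>auto simp: f_def c_def N_def\<close>)
      then show "(\<lambda>k. f k x) \<longlonglongrightarrow> u x"
        using tendsto_mult_right[OF \<xi>(4)[OF x], of "u x"] by (simp add: Lim_transform_eventually)
    qed
    fix k
    show "AE x in wmeas \<Omega> \<sigma>. norm (f k x - u x) \<le> \<bar>u x\<bar>"
    proof (rule AE_I2)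
      fix x
      consider "u x \<ge> 0" | "u x < 0" by linarith
      then show "norm (f k x - u x) \<le> \<bar>u x\<bar>"
      proof cases
        case 1
        then have "0 \<le> c k x" "c k x \<le> u x" by (auto simp: c_def N_def)
        then have "0 \<le> f k x" "f k x \<le> u x"
          using \<xi>(2,3)[of k x] mult_mono[of "\<xi> k x" 1 "c k x" "u x"] by (auto simp: f_def)
        then show ?thesis by simp
      next
        case 2
        then have "c k x \<le> 0" "u x \<le> c k x" by (auto simp: c_def N_def)
        then have "f k x \<le> 0" "u x \<le> f k x"
          using \<xi>(2,3)[of k x] mult_mono[of "\<xi> k x" 1 "- c k x" "- u x"] by (auto simp: f_def mult_nonneg_nonpos)
        then show ?thesis by simp
      qed
    qed
  qed (use q fm um in auto)
  have e: "(\<lambda>x. \<phi> k x - u x) = (\<lambda>x. (\<phi> k x - f k x) + (f k x - u x))" for k by auto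
  have fu': "Lp_fun q (wmeas \<Omega> \<sigma>) (\<lambda>x. f k x - u x)" for k using fu by (auto simp: Lp_conv_def)
  have "Lp_conv q (wmeas \<Omega> \<sigma>) \<phi> u"
    unfolding Lp_conv_def
  proof (intro conjI allI)
    show "Lp_fun q (wmeas \<Omega> \<sigma>) (\<lambda>x. \<phi> k x - u x)" for k
      unfolding e by (rule Lp_fun_add[OF q \<phi>(2) fu'])
    show "(\<lambda>k. Lp_int q (wmeas \<Omega> \<sigma>) (\<lambda>x. \<phi> k x - u x)) \<longlonglongrightarrow> 0"
    proof (rule tendsto_sandwich[OF _ _ tendsto_const])
      have "(\<lambda>k. 1 / N k) \<longlonglongrightarrow> 0"
        using LIMSEQ_inverse_real_of_nat by (simp add: N_def inverse_eq_divide)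
      then have "(\<lambda>k. 2 powr (q - 1) * (1 / N k + Lp_int q (wmeas \<Omega> \<sigma>) (\<lambda>x. f k x - u x))) \<longlonglongrightarrow> 2 powr (q - 1) * (0 + 0)"
        using fu by (intro tendsto_intros) (auto simp: Lp_conv_def)
      then show "(\<lambda>k. 2 powr (q - 1) * (1 / N k + Lp_int q (wmeas \<Omega> \<sigma>) (\<lambda>x. f k x - u x))) \<longlonglongrightarrow> 0" by simp
      show "\<forall>\<^sub>F k in sequentially. Lp_int q (wmeas \<Omega> \<sigma>) (\<lambda>x. \<phi> k x - u x)
          \<le> 2 powr (q - 1) * (1 / N k + Lp_int q (wmeas \<Omega> \<sigma>) (\<lambda>x. f k x - u x))"
      proof (rule always_eventually, rule allI)
        fix k
        have "Lp_int q (wmeas \<Omega> \<sigma>) (\<lambda>x. \<phi> k x - u x)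
           \<le> 2 powr (q - 1) * (Lp_int q (wmeas \<Omega> \<sigma>) (\<lambda>x. \<phi> k x - f k x) + Lp_int q (wmeas \<Omega> \<sigma>) (\<lambda>x. f k x - u x))"
          unfolding e by (rule Lp_int_add_le_half[OF q \<phi>(2) fu'])
        also have "\<dots> \<le> 2 powr (q - 1) * (1 / N k + Lp_int q (wmeas \<Omega> \<sigma>) (\<lambda>x. f k x - u x))"
          using \<phi>(3)[of k] by (intro mult_left_mono add_right_mono) auto
        finally show "Lp_int q (wmeas \<Omega> \<sigma>) (\<lambda>x. \<phi> k x - u x)
          \<le> 2 powr (q - 1) * (1 / N k + Lp_int q (wmeas \<Omega> \<sigma>) (\<lambda>x. f k x - u x))" .
      qed
    qed auto
  qed
  then show "u \<in> Lq_space \<Omega> q \<sigma>"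
    using \<phi>(1) by (auto simp: Lq_space_def weighted_Lp_converges_iff \<Omega>L)
qed

section \<open>Uniqueness of the gradient\<close>

lemma integrable_continuous_compact_support:
  fixes f :: "'a::euclidean_space \<Rightarrow> 'b::euclidean_space"
  assumes f: "continuous_on UNIV f" and K: "compact K" "\<And>x. x \<notin> K \<Longrightarrow> f x = 0"
  shows "integrable lborel f"
proof -
  have "integrable lborel (\<lambda>x. indicator K x *\<^sub>R f x)"
    using K(1) continuous_on_subset[OF f] by (intro borel_integrable_compact) auto
  moreover have "(\<lambda>x. indicator K x *\<^sub>R f x) = f" using K(2) by (auto simp: indicator_def)
  ultimately show ?thesis by simp
qed

lemma integral_lborel_translate:
  fixes f :: "'a::euclidean_space \<Rightarrow> real"
  assumes "f \<in> borel_measurable borel"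
  shows "(\<integral>x. f (x + c) \<partial>lborel) = (\<integral>x. f x \<partial>lborel)"
proof -
  have "(\<integral>x. f x \<partial>lborel) = (\<integral>x. f x \<partial>(distr lborel borel ((+) c)))" by (simp add: lborel_distr_plus)
  also have "\<dots> = (\<integral>x. f (c + x) \<partial>lborel)" using assms by (intro integral_distr) auto
  finally show ?thesis by (simp add: add.commute)
qed

lemma C0_infty_Lipschitz:
  fixes f :: "'a::euclidean_space \<Rightarrow> real"
  assumes f: "f \<in> C0_infty \<Omega>" and B: "\<And>x. norm (grad f x) \<le> B"
  shows "\<bar>f y - f x\<bar> \<le> B * norm (y - x)"
proof -
  have "norm (f y - f x) \<le> B * norm (y - x)"
  proof (rule differentiable_bound[of UNIV f "\<lambda>x h. h \<bullet> grad f x"])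
    show "(f has_derivative (\<lambda>h. h \<bullet> grad f x)) (at x within UNIV)" for x using C0_infty_has_derivative[OF f] by simp
    show "onorm (\<lambda>h. h \<bullet> grad f x) \<le> B" for x
    proof (rule onorm_le)
      fix h
      have "norm (h \<bullet> grad f x) \<le> norm h * norm (grad f x)" using Cauchy_Schwarz_ineq2 by simp
      also have "\<dots> \<le> norm h * B" by (intro mult_left_mono B) simp
      finally show "norm (h \<bullet> grad f x) \<le> B * norm h" by (simp add: mult.commute)
    qed
  qed auto
  then show ?thesis by simp
qed

text \<open>Difference quotients have integral zero by translation invariance, and they converge
  dominatedly to the directional derivative.\<close>

lemma integral_grad_eq_0:
  fixes F :: "'a::euclidean_space \<Rightarrow> real"
  assumes F: "F \<in> C0_infty \<Omega>"
  shows "(\<integral>x. v \<bullet> grad F x \<partial>lborel) = 0"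
proof -
  obtain K where K: "compact K" "\<And>x. x \<notin> K \<Longrightarrow> F x = 0"
    using C0_inftyE[OF F] by metis
  obtain R where R: "K \<subseteq> cball 0 R"
    using compact_imp_bounded[OF K(1)] by (meson bounded_subset_cball order.trans ball_subset_cball bounded_subset_ballD)
  obtain B where B: "B > 0" "\<And>x. norm (grad F x) \<le> B" using C0_infty_bounded[OF F] by metis
  have Fm: "F \<in> borel_measurable borel" using borel_measurable_C0_infty(1)[OF F] .
  have Fi: "integrable lborel F" by (rule integrable_continuous_compact_support[OF C0_infty_continuous[OF F] K])
  define D where "D k x = real (Suc k) * (F (x + inverse (real (Suc k)) *\<^sub>R v) - F x)" for k x
  have Fti: "integrable lborel (\<lambda>x. F (x + c))" for c
  proof -
    have "integrable (distr lborel borel ((+) c)) F" using Fi by (simp add: lborel_distr_plus)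
    then show ?thesis using Fm by (subst (asm) integrable_distr_eq) (auto simp: add.commute)
  qed
  have D0: "(\<integral>x. D k x \<partial>lborel) = 0" for k
    using Fi Fti integral_lborel_translate[OF Fm] by (simp add: D_def)
  have Dm: "D k \<in> borel_measurable lborel" for k
    unfolding D_def[abs_def] using Fm by measurable
  have lim: "(\<lambda>k. D k x) \<longlonglongrightarrow> v \<bullet> grad F x" for x
  proof -
    have "((\<lambda>t. F (x + t *\<^sub>R v)) has_derivative (\<lambda>t. (t *\<^sub>R v) \<bullet> grad F (x + 0 *\<^sub>R v))) (at 0)"
      by (rule has_derivative_compose[of "\<lambda>t. x + t *\<^sub>R v", OF _ C0_infty_has_derivative[OF F]])
        (auto intro!: derivative_eq_intros)
    then have "((\<lambda>t. F (x + t *\<^sub>R v)) has_real_derivative (v \<bullet> grad F x)) (at 0)"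
      by (simp add: has_field_derivative_def mult.commute[of _ "v \<bullet> grad F x"])
    then have "((\<lambda>h. (F (x + h *\<^sub>R v) - F x) / h) \<longlongrightarrow> v \<bullet> grad F x) (at 0)"
      by (simp add: DERIV_def)
    moreover have "filterlim (\<lambda>k. inverse (real (Suc k))) (at 0) sequentially"
      unfolding filterlim_at using LIMSEQ_inverse_real_of_nat by auto
    ultimately have "(\<lambda>k. (F (x + inverse (real (Suc k)) *\<^sub>R v) - F x) / inverse (real (Suc k))) \<longlonglongrightarrow> v \<bullet> grad F x"
      by (rule filterlim_compose)
    then show ?thesis by (simp add: D_def field_simps)
  qed
  have "(\<lambda>k. \<integral>x. D k x \<partial>lborel) \<longlonglongrightarrow> (\<integral>x. v \<bullet> grad F x \<partial>lborel)"
  proof (rule integral_dominated_convergence[where w = "\<lambda>x. B * norm v * indicator (cball 0 (R + norm v)) x"])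
    show "(\<lambda>x. v \<bullet> grad F x) \<in> borel_measurable lborel" using borel_measurable_C0_infty(2)[OF F] by measurable
    show "integrable lborel (\<lambda>x. B * norm v * indicator (cball 0 (R + norm v)) x)"
      using emeasure_lborel_cball_finite by (intro integrable_mult_right integrable_real_indicator) auto
    fix k
    show "AE x in lborel. norm (D k x) \<le> B * norm v * indicator (cball 0 (R + norm v)) x"
    proof (rule AE_I2)
      fix x
      have 1: "\<bar>F (x + inverse (real (Suc k)) *\<^sub>R v) - F x\<bar> \<le> B * (inverse (real (Suc k)) * norm v)"
        using C0_infty_Lipschitz[OF F B(2), of "x + inverse (real (Suc k)) *\<^sub>R v" x] by simp
      have "norm (D k x) \<le> real (Suc k) * (B * (inverse (real (Suc k)) * norm v))"
        unfolding D_def real_norm_def abs_mult using 1 by (intro mult_mono) auto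
      also have "\<dots> = B * norm v" by simp
      finally have 2: "norm (D k x) \<le> B * norm v" .
      have "D k x = 0" if "x \<notin> cball 0 (R + norm v)"
      proof -
        have le: "norm (inverse (real (Suc k)) *\<^sub>R v) \<le> norm v"
          by (simp add: divide_le_eq_1 inverse_le_1_iff mult_left_le_one_le)
        have gt: "norm x > R + norm v" using that by simp
        then have "norm x \<le> norm (x + inverse (real (Suc k)) *\<^sub>R v) + norm v"
          using norm_triangle_ineq4[of "x + inverse (real (Suc k)) *\<^sub>R v" "inverse (real (Suc k)) *\<^sub>R v"] le by simp
        then have "x + inverse (real (Suc k)) *\<^sub>R v \<notin> cball 0 R" "x \<notin> cball 0 R"
          unfolding mem_cball dist_0_norm using gt norm_ge_zero[of v] by linarith+
        then have "x + inverse (real (Suc k)) *\<^sub>R v \<notin> K" "x \<notin> K" using R by blast+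
        then show ?thesis using K(2) by (simp add: D_def)
      qed
      then show "norm (D k x) \<le> B * norm v * indicator (cball 0 (R + norm v)) x" using 2 by (auto simp: indicator_def)
    qed
  qed (use Dm lim in auto)
  then show ?thesis by (simp add: D0 LIMSEQ_const_iff)
qed

text \<open>Testing against a test function \<open>\<xi>\<close> and integrating by parts moves the derivative onto
  \<open>\<xi>\<close>, so that both sides of the identity have limits; and a function orthogonal to all test
  functions vanishes, because its sign is a bounded limit of test functions.\<close>

lemma weak_gradient_of_0:
  fixes \<phi> :: "nat \<Rightarrow> 'a::euclidean_space \<Rightarrow> real" and G :: "'a \<Rightarrow> 'a"
  assumes U: "open U" and \<phi>: "\<And>n. \<phi> n \<in> C0_infty \<Omega>" and Gm: "G \<in> borel_measurable (lebesgue_on U)"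
    and l0: "\<And>K. compact K \<Longrightarrow> K \<subseteq> U \<Longrightarrow> (\<lambda>n. LINT x:K|lebesgue. norm (\<phi> n x)) \<longlonglongrightarrow> 0"
    and li: "\<And>K n. compact K \<Longrightarrow> K \<subseteq> U \<Longrightarrow> set_integrable lebesgue K (\<lambda>x. grad (\<phi> n) x - G x)"
    and l1: "\<And>K. compact K \<Longrightarrow> K \<subseteq> U \<Longrightarrow> (\<lambda>n. LINT x:K|lebesgue. norm (grad (\<phi> n) x - G x)) \<longlonglongrightarrow> 0"
  shows "AE x in lebesgue. x \<in> U \<longrightarrow> G x = 0"
proof -
  have UL: "U \<in> sets lebesgue" using U by (simp add: borel_open)
  define G0 where "G0 x = indicator U x *\<^sub>R G x" for x
  have G0m: "G0 \<in> borel_measurable lebesgue"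
    using Gm UL unfolding G0_def[abs_def] by (subst (asm) borel_measurable_restrict_space_iff) auto
  have GK: "integrable lebesgue (\<lambda>x. indicator K x *\<^sub>R G x)" if K: "compact K" "K \<subseteq> U" for K
  proof -
    have "integrable lebesgue (\<lambda>x. indicator K x *\<^sub>R (grad (\<phi> 0) x - G x))" using li[OF K, of 0] by (simp add: set_integrable_def)
    moreover have "integrable lborel (\<lambda>x. indicator K x *\<^sub>R grad (\<phi> 0) x)"
      using K(1) continuous_on_subset[OF continuous_on_grad[OF \<phi>]] by (intro borel_integrable_compact) auto
    then have "integrable lebesgue (\<lambda>x. indicator K x *\<^sub>R grad (\<phi> 0) x)" by (simp add: integrable_completion)
    ultimately have "integrable lebesgue (\<lambda>x. indicator K x *\<^sub>R grad (\<phi> 0) x - indicator K x *\<^sub>R (grad (\<phi> 0) x - G x))"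
      by (intro Bochner_Integration.integrable_diff)
    then show ?thesis by (simp add: scaleR_diff_right)
  qed
  have G\<xi>: "integrable lebesgue (\<lambda>x. (v \<bullet> G0 x) * \<xi> x)" if \<xi>: "\<xi> \<in> C0_infty U" for \<xi> v
  proof -
    obtain K where K: "compact K" "K \<subseteq> U" "\<And>x. x \<notin> K \<Longrightarrow> \<xi> x = 0" using C0_inftyE[OF \<xi>] by metis
    obtain B where B: "B > 0" "\<And>x. \<bar>\<xi> x\<bar> \<le> B" using C0_infty_bounded[OF \<xi>] by metis
    have "\<xi> \<in> borel_measurable lebesgue" using borel_measurable_C0_infty(3)[OF \<xi>, of UNIV] by simp
    then have m: "(\<lambda>x. (v \<bullet> G0 x) * \<xi> x) \<in> borel_measurable lebesgue" using G0m by measurable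
    show ?thesis
    proof (rule Bochner_Integration.integrable_bound[OF integrable_scaleR_right[OF GK[OF K(1,2)], of "B * norm v"] m], rule AE_I2)
      fix x
      show "norm ((v \<bullet> G0 x) * \<xi> x) \<le> norm ((B * norm v) *\<^sub>R indicator K x *\<^sub>R G x)"
      proof (cases "x \<in> K")
        case True
        have "\<bar>v \<bullet> G x\<bar> * \<bar>\<xi> x\<bar> \<le> (norm v * norm (G x)) * B"
          using B Cauchy_Schwarz_ineq2[of v "G x"] by (intro mult_mono) auto
        then show ?thesis using True K(2) B(1) by (auto simp: G0_def abs_mult mult_ac)
      qed (simp add: K(3))
    qed
  qed
  have zero: "(\<integral>x. (v \<bullet> G0 x) * \<xi> x \<partial>lebesgue) = 0" if \<xi>: "\<xi> \<in> C0_infty U" for \<xi> v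
  proof -
    obtain K where K: "compact K" "K \<subseteq> U" "\<And>x. x \<notin> K \<Longrightarrow> \<xi> x = 0" "\<And>x. x \<notin> K \<Longrightarrow> grad \<xi> x = 0"
      using C0_inftyE_grad[OF \<xi>] by metis
    obtain B where B: "B > 0" "\<And>x. \<bar>\<xi> x\<bar> \<le> B" "\<And>x. norm (grad \<xi> x) \<le> B" using C0_infty_bounded[OF \<xi>] by metis
    have KL: "K \<in> sets lebesgue" using K(1) by (simp add: borel_compact)
    have mm: "\<xi> \<in> borel_measurable lebesgue" "grad \<xi> \<in> borel_measurable lebesgue"
      "\<phi> n \<in> borel_measurable lebesgue" "grad (\<phi> n) \<in> borel_measurable lebesgue" for n
      using borel_measurable_C0_infty(3,4)[OF \<xi>, of UNIV] borel_measurable_C0_infty(3,4)[OF \<phi>, of n UNIV] by auto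
    have ip: "integrable lebesgue (\<lambda>x. \<phi> n x * (v \<bullet> grad \<xi> x))" "integrable lebesgue (\<lambda>x. \<xi> x * (v \<bullet> grad (\<phi> n) x))"
      and ibp: "(\<integral>x. \<xi> x * (v \<bullet> grad (\<phi> n) x) \<partial>lebesgue) = - (\<integral>x. \<phi> n x * (v \<bullet> grad \<xi> x) \<partial>lebesgue)" for n
    proof -
      have c: "continuous_on UNIV (\<lambda>x. \<phi> n x * (v \<bullet> grad \<xi> x))" "continuous_on UNIV (\<lambda>x. \<xi> x * (v \<bullet> grad (\<phi> n) x))"
        using C0_infty_continuous[OF \<xi>] C0_infty_continuous[OF \<phi>] continuous_on_grad[OF \<xi>] continuous_on_grad[OF \<phi>]
        by (intro continuous_intros; simp)+
      have i: "integrable lborel (\<lambda>x. \<phi> n x * (v \<bullet> grad \<xi> x))" "integrable lborel (\<lambda>x. \<xi> x * (v \<bullet> grad (\<phi> n) x))"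
        using integrable_continuous_compact_support[OF c(1) K(1)] integrable_continuous_compact_support[OF c(2) K(1)] K(3,4) by auto
      then show "integrable lebesgue (\<lambda>x. \<phi> n x * (v \<bullet> grad \<xi> x))" "integrable lebesgue (\<lambda>x. \<xi> x * (v \<bullet> grad (\<phi> n) x))"
        by (simp_all add: integrable_completion)
      have "(\<lambda>x. \<phi> n x * \<xi> x) \<in> C0_infty \<Omega>" by (intro C0_infty_mult \<phi> C0_infty_Ck[OF \<xi>])
      from integral_grad_eq_0[OF this, of v]
      have "(\<integral>x. \<phi> n x * (v \<bullet> grad \<xi> x) + \<xi> x * (v \<bullet> grad (\<phi> n) x) \<partial>lborel) = 0"
        by (simp add: grad_mult[OF \<phi> \<xi>] inner_add_right)
      then have "(\<integral>x. \<xi> x * (v \<bullet> grad (\<phi> n) x) \<partial>lborel) = - (\<integral>x. \<phi> n x * (v \<bullet> grad \<xi> x) \<partial>lborel)"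
        using i by simp
      then show "(\<integral>x. \<xi> x * (v \<bullet> grad (\<phi> n) x) \<partial>lebesgue) = - (\<integral>x. \<phi> n x * (v \<bullet> grad \<xi> x) \<partial>lebesgue)"
        using i by (simp add: integral_completion borel_measurable_integrable)
    qed
    have ni: "integrable lebesgue (\<lambda>x. indicator K x * norm (\<phi> n x))" for n
    proof -
      have "integrable lborel (\<lambda>x. indicator K x *\<^sub>R norm (\<phi> n x))"
        using K(1) continuous_on_subset[OF C0_infty_continuous[OF \<phi>]]
        by (intro borel_integrable_compact continuous_on_norm) auto
      then show ?thesis by (simp add: integrable_completion)
    qed
    have gi: "integrable lebesgue (\<lambda>x. indicator K x * norm (grad (\<phi> n) x - G x))" for n
      using integrable_norm[OF li[OF K(1,2), of n, unfolded set_integrable_def]] by simp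
    have bound: "\<bar>\<integral>x. (v \<bullet> G0 x) * \<xi> x \<partial>lebesgue\<bar> \<le> B * norm v * (LINT x:K|lebesgue. norm (\<phi> n x))
        + B * norm v * (LINT x:K|lebesgue. norm (grad (\<phi> n) x - G x))" for n
    proof -
      have eq: "(\<integral>x. (v \<bullet> G0 x) * \<xi> x \<partial>lebesgue)
          = (\<integral>x. ((v \<bullet> G0 x) * \<xi> x - \<xi> x * (v \<bullet> grad (\<phi> n) x)) - \<phi> n x * (v \<bullet> grad \<xi> x) \<partial>lebesgue)"
        using ip[of n] G\<xi>[OF \<xi>, of v] ibp[of n] by simp
      have "\<bar>\<integral>x. (v \<bullet> G0 x) * \<xi> x \<partial>lebesgue\<bar> \<le> (\<integral>x. B * norm v * (indicator K x * norm (\<phi> n x)) + B * norm v * (indicator K x * norm (grad (\<phi> n) x - G x)) \<partial>lebesgue)"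
        unfolding eq
      proof (rule order_trans[OF integral_abs_bound], rule integral_mono)
        show "integrable lebesgue (\<lambda>x. \<bar>((v \<bullet> G0 x) * \<xi> x - \<xi> x * (v \<bullet> grad (\<phi> n) x)) - \<phi> n x * (v \<bullet> grad \<xi> x)\<bar>)"
          using ip[of n] G\<xi>[OF \<xi>, of v] by (intro integrable_abs Bochner_Integration.integrable_diff)
        show "integrable lebesgue (\<lambda>x. B * norm v * (indicator K x * norm (\<phi> n x)) + B * norm v * (indicator K x * norm (grad (\<phi> n) x - G x)))"
          by (intro Bochner_Integration.integrable_add integrable_mult_right ni gi)
        fix x
        show "\<bar>((v \<bullet> G0 x) * \<xi> x - \<xi> x * (v \<bullet> grad (\<phi> n) x)) - \<phi> n x * (v \<bullet> grad \<xi> x)\<bar>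
            \<le> B * norm v * (indicator K x * norm (\<phi> n x)) + B * norm v * (indicator K x * norm (grad (\<phi> n) x - G x))"
        proof (cases "x \<in> K")
          case True
          then have "G0 x = G x" using K(2) by (auto simp: G0_def)
          then have "((v \<bullet> G0 x) * \<xi> x - \<xi> x * (v \<bullet> grad (\<phi> n) x)) = - (\<xi> x * (v \<bullet> (grad (\<phi> n) x - G x)))"
            by (simp add: inner_diff_right algebra_simps)
          moreover have "\<bar>\<xi> x * (v \<bullet> (grad (\<phi> n) x - G x))\<bar> \<le> B * (norm v * norm (grad (\<phi> n) x - G x))"
            unfolding abs_mult using B Cauchy_Schwarz_ineq2[of v] by (intro mult_mono) auto
          moreover have "\<bar>\<phi> n x * (v \<bullet> grad \<xi> x)\<bar> \<le> \<bar>\<phi> n x\<bar> * (norm v * B)"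
            unfolding abs_mult using B(3)[of x] Cauchy_Schwarz_ineq2[of v "grad \<xi> x"]
            by (intro mult_left_mono order_trans[OF Cauchy_Schwarz_ineq2] mult_mono) auto
          ultimately show ?thesis using True by (simp add: mult_ac)
        qed (use K in simp)
      qed
      also have "\<dots> = B * norm v * (LINT x:K|lebesgue. norm (\<phi> n x)) + B * norm v * (LINT x:K|lebesgue. norm (grad (\<phi> n) x - G x))"
        unfolding set_lebesgue_integral_def real_scaleR_def
        by (subst Bochner_Integration.integral_add[OF integrable_mult_right[OF ni] integrable_mult_right[OF gi]])
          (simp only: integral_mult_right_zero)
      finally show ?thesis .
    qed
    have "(\<lambda>n. B * norm v * (LINT x:K|lebesgue. norm (\<phi> n x)) + B * norm v * (LINT x:K|lebesgue. norm (grad (\<phi> n) x - G x)))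
        \<longlonglongrightarrow> B * norm v * 0 + B * norm v * 0"
      by (intro tendsto_intros l0[OF K(1,2)] l1[OF K(1,2)])
    from LIMSEQ_le_const[OF this] bound
    have "\<bar>\<integral>x. (v \<bullet> G0 x) * \<xi> x \<partial>lebesgue\<bar> \<le> B * norm v * 0 + B * norm v * 0" by blast
    then show ?thesis by simp
  qed
  obtain \<xi> where \<xi>: "\<And>k. \<xi> k \<in> C0_infty U" "\<And>k x. 0 \<le> \<xi> k x" "\<And>x. x \<in> U \<Longrightarrow> (\<lambda>k. \<xi> k x) \<longlonglongrightarrow> (1::real)"
    using C0_infty_exhaustion[OF U] by metis
  have ae: "AE x in lebesgue. \<xi> k x * \<bar>v \<bullet> G0 x\<bar> = 0" for k v
  proof -
    define g where "g x = sgn (v \<bullet> G0 x)" for x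
    have gm: "g \<in> borel_measurable lebesgue" unfolding g_def[abs_def] using G0m by measurable
    have gb: "\<bar>g x\<bar> \<le> 1" for x by (simp add: g_def abs_sgn_eq)
    obtain \<psi> where \<psi>: "\<And>j. \<psi> j \<in> C0_infty U" "\<And>j x. \<bar>\<psi> j x\<bar> \<le> 2 * \<bar>\<xi> k x\<bar>"
      "AE x in lebesgue. (\<lambda>j. \<psi> j x) \<longlonglongrightarrow> \<xi> k x * g x"
      by (rule C0_infty_approx_bounded[OF \<xi>(1)[of k] gm gb]) blast
    have \<xi>m: "\<xi> k \<in> borel_measurable lebesgue" "\<psi> j \<in> borel_measurable lebesgue" for j
      using borel_measurable_C0_infty(3)[OF \<xi>(1), of k UNIV] borel_measurable_C0_infty(3)[OF \<psi>(1), of j UNIV] by auto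
    have "(\<lambda>j. \<integral>x. (v \<bullet> G0 x) * \<psi> j x \<partial>lebesgue) \<longlonglongrightarrow> (\<integral>x. (v \<bullet> G0 x) * (\<xi> k x * g x) \<partial>lebesgue)"
    proof (rule integral_dominated_convergence[where w = "\<lambda>x. 2 * \<bar>(v \<bullet> G0 x) * \<xi> k x\<bar>"])
      show "integrable lebesgue (\<lambda>x. 2 * \<bar>(v \<bullet> G0 x) * \<xi> k x\<bar>)" using G\<xi>[OF \<xi>(1)] by (intro integrable_mult_right integrable_abs)
      show "AE x in lebesgue. (\<lambda>j. (v \<bullet> G0 x) * \<psi> j x) \<longlonglongrightarrow> (v \<bullet> G0 x) * (\<xi> k x * g x)"
        using \<psi>(3) by eventually_elim (rule tendsto_mult_left)
      show "AE x in lebesgue. norm ((v \<bullet> G0 x) * \<psi> j x) \<le> 2 * \<bar>(v \<bullet> G0 x) * \<xi> k x\<bar>" for j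
        using mult_left_mono[OF \<psi>(2), of "\<bar>v \<bullet> G0 _\<bar>" j] by (intro AE_I2) (simp add: abs_mult mult_ac)
    qed (use G0m \<xi>m gm in measurable)
    then have "(\<integral>x. (v \<bullet> G0 x) * (\<xi> k x * g x) \<partial>lebesgue) = 0" by (simp add: zero[OF \<psi>(1)] LIMSEQ_const_iff)
    moreover have "(v \<bullet> G0 x) * (\<xi> k x * g x) = \<bar>(v \<bullet> G0 x) * \<xi> k x\<bar>" for x
      using \<xi>(2)[of k x] by (simp add: g_def abs_mult sgn_if)
    ultimately have "(\<integral>x. \<bar>(v \<bullet> G0 x) * \<xi> k x\<bar> \<partial>lebesgue) = 0" by simp
    then have "AE x in lebesgue. \<bar>(v \<bullet> G0 x) * \<xi> k x\<bar> = 0"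
      using integral_nonneg_eq_0_iff_AE[OF integrable_abs[OF G\<xi>[OF \<xi>(1)]]] by simp
    then show ?thesis by eventually_elim (auto simp: abs_mult)
  qed
  have "AE x in lebesgue. \<forall>k. \<forall>v\<in>Basis. \<xi> k x * \<bar>v \<bullet> G0 x\<bar> = 0"
    unfolding AE_all_countable by (intro allI AE_finite_allI ae finite_Basis)
  then show ?thesis
  proof eventually_elim
    case (elim x)
    show ?case
    proof
      assume x: "x \<in> U"
      have "\<forall>\<^sub>F k in sequentially. \<xi> k x > 1/2" using \<xi>(3)[OF x] by (rule order_tendstoD(1)) simp
      then obtain k where "\<xi> k x > 1/2" by (auto simp: eventually_sequentially)
      then have "\<forall>v\<in>Basis. v \<bullet> G0 x = 0" using elim by force
      then have "G0 x = 0" by (metis euclidean_all_zero_iff inner_commute)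
      then show "G x = 0" using x by (simp add: G0_def)
    qed
  qed
qed

section \<open>Dilations\<close>

lemma lebesgue_scale:
  fixes c :: real
  assumes "c > 0"
  shows "lebesgue = density (distr lebesgue lebesgue (\<lambda>x::'a::euclidean_space. c *\<^sub>R x)) (\<lambda>_. ennreal (c ^ DIM('a)))"
    and "(\<lambda>x::'a. c *\<^sub>R x) \<in> lebesgue \<rightarrow>\<^sub>M lebesgue"
proof -
  have eq: "(\<Sum>j\<in>Basis. (c * (x \<bullet> j)) *\<^sub>R j) = c *\<^sub>R x" for x :: 'a
    unfolding scaleR_scaleR[symmetric] scaleR_sum_right[symmetric] euclidean_representation ..
  show "lebesgue = density (distr lebesgue lebesgue (\<lambda>x::'a. c *\<^sub>R x)) (\<lambda>_. ennreal (c ^ DIM('a)))"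
    using lebesgue_affine_euclidean[of "\<lambda>_::'a. c" 0] assms by (simp add: eq)
  show "(\<lambda>x::'a. c *\<^sub>R x) \<in> lebesgue \<rightarrow>\<^sub>M lebesgue"
    using lebesgue_affine_measurable[of "\<lambda>_::'a. c" 0] assms by (simp add: eq)
qed

lemma nn_integral_scale:
  fixes F :: "'a::euclidean_space \<Rightarrow> ennreal"
  assumes c: "c > 0" and F: "F \<in> borel_measurable lebesgue"
  shows "(\<integral>\<^sup>+x. F x \<partial>lebesgue) = ennreal (c ^ DIM('a)) * (\<integral>\<^sup>+x. F (c *\<^sub>R x) \<partial>lebesgue)"
proof -
  have Fc: "(\<lambda>x. F (c *\<^sub>R x)) \<in> borel_measurable lebesgue"
    using measurable_compose[OF lebesgue_scale(2)[OF c] F] .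
  have "(\<integral>\<^sup>+x. F x \<partial>lebesgue) = (\<integral>\<^sup>+x. F x \<partial>density (distr lebesgue lebesgue (\<lambda>x. c *\<^sub>R x)) (\<lambda>_. ennreal (c ^ DIM('a))))"
    using lebesgue_scale(1)[OF c, where 'a = 'a] by simp
  also have "\<dots> = (\<integral>\<^sup>+x. ennreal (c ^ DIM('a)) * F x \<partial>distr lebesgue lebesgue (\<lambda>x. c *\<^sub>R x))"
    using F by (intro nn_integral_density) auto
  also have "\<dots> = (\<integral>\<^sup>+x. ennreal (c ^ DIM('a)) * F (c *\<^sub>R x) \<partial>lebesgue)"
    using F lebesgue_scale(2)[OF c] by (intro nn_integral_distr) auto
  also have "\<dots> = ennreal (c ^ DIM('a)) * (\<integral>\<^sup>+x. F (c *\<^sub>R x) \<partial>lebesgue)"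
    by (rule nn_integral_cmult[OF Fc])
  finally show ?thesis .
qed

lemma Lp_scale:
  fixes f :: "'a::euclidean_space \<Rightarrow> 'b::euclidean_space"
  assumes c: "c > 0" and S: "S \<in> sets lebesgue" "S' \<in> sets lebesgue" "\<And>x. x \<in> S \<longleftrightarrow> c *\<^sub>R x \<in> S'"
    and f: "Lp_fun t (wmeas S' m) f"
  shows "Lp_fun t (wmeas S m) (\<lambda>x. f (c *\<^sub>R x))"
    "Lp_int t (wmeas S m) (\<lambda>x. f (c *\<^sub>R x)) = c powr (m - DIM('a)) * Lp_int t (wmeas S' m) f"
proof -
  define F where "F x = indicator S' x * (norm (f x) powr t / norm x powr m)" for x
  have fm: "f \<in> borel_measurable (lebesgue_on S')" and Fi: "integrable lebesgue F"
    using f S by (auto simp: Lp_fun_wmeas F_def[abs_def])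
  have "(\<lambda>x. indicator S' x *\<^sub>R f x) \<in> borel_measurable lebesgue"
    using fm S by (subst (asm) borel_measurable_restrict_space_iff) auto
  then have "(\<lambda>x. indicator S' (c *\<^sub>R x) *\<^sub>R f (c *\<^sub>R x)) \<in> borel_measurable lebesgue"
    by (rule measurable_compose[OF lebesgue_scale(2)[OF c]])
  moreover have "indicator S' (c *\<^sub>R x) = (indicator S x :: real)" for x using S(3) by (simp add: indicator_def)
  ultimately have fcm: "(\<lambda>x. f (c *\<^sub>R x)) \<in> borel_measurable (lebesgue_on S)"
    using S by (subst borel_measurable_restrict_space_iff) auto
  have F0: "F x \<ge> 0" for x by (simp add: F_def)
  have eq: "indicator S x * (norm (f (c *\<^sub>R x)) powr t / norm x powr m) = c powr m * F (c *\<^sub>R x)" for x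
    using c S(3)[of x] by (simp add: F_def indicator_def powr_mult)
  have Fm: "F \<in> borel_measurable lebesgue" using Fi by simp
  have nn: "(\<integral>\<^sup>+x. ennreal (F (c *\<^sub>R x)) \<partial>lebesgue) = ennreal (c powr (- DIM('a)) * (\<integral>x. F x \<partial>lebesgue))"
  proof -
    have cc: "c powr (- real DIM('a)) * c ^ DIM('a) = 1"
      using c by (simp add: powr_realpow[symmetric] powr_add[symmetric])
    have "ennreal (\<integral>x. F x \<partial>lebesgue) = (\<integral>\<^sup>+x. ennreal (F x) \<partial>lebesgue)"
      using Fi F0 by (simp add: nn_integral_eq_integral)
    also have "\<dots> = ennreal (c ^ DIM('a)) * (\<integral>\<^sup>+x. ennreal (F (c *\<^sub>R x)) \<partial>lebesgue)"
      using Fm by (intro nn_integral_scale[OF c]) simp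
    finally have "ennreal (c powr (- DIM('a))) * ennreal (\<integral>x. F x \<partial>lebesgue)
        = (ennreal (c powr (- DIM('a))) * ennreal (c ^ DIM('a))) * (\<integral>\<^sup>+x. ennreal (F (c *\<^sub>R x)) \<partial>lebesgue)"
      by (simp add: mult.assoc)
    also have "ennreal (c powr (- DIM('a))) * ennreal (c ^ DIM('a)) = 1"
      using cc c by (subst ennreal_mult[symmetric]) auto
    finally show ?thesis by (simp add: ennreal_mult')
  qed
  have i: "integrable lebesgue (\<lambda>x. F (c *\<^sub>R x))"
    using nn F0 measurable_compose[OF lebesgue_scale(2)[OF c] Fm] by (intro integrableI_bounded) auto
  have int: "(\<integral>x. F (c *\<^sub>R x) \<partial>lebesgue) = c powr (- DIM('a)) * (\<integral>x. F x \<partial>lebesgue)"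
  proof -
    have "ennreal (\<integral>x. F (c *\<^sub>R x) \<partial>lebesgue) = ennreal (c powr (- DIM('a)) * (\<integral>x. F x \<partial>lebesgue))"
      using nn_integral_eq_integral[OF i] F0 nn by simp
    then show ?thesis using F0 by (subst (asm) ennreal_inj) (auto intro!: integral_nonneg_AE mult_nonneg_nonneg)
  qed
  show "Lp_fun t (wmeas S m) (\<lambda>x. f (c *\<^sub>R x))"
    unfolding Lp_fun_wmeas[OF S(1)] eq by (intro conjI fcm integrable_mult_right i)
  show "Lp_int t (wmeas S m) (\<lambda>x. f (c *\<^sub>R x)) = c powr (m - DIM('a)) * Lp_int t (wmeas S' m) f"
    unfolding Lp_int_wmeas[OF S(1) fcm] Lp_int_wmeas[OF S(2) fm] eq F_def[symmetric]
    using int by (simp add: powr_diff powr_minus_divide)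
qed

section \<open>The Hardy inequality\<close>

lemma Jensen_powr:
  fixes h :: "'a \<Rightarrow> real"
  assumes M: "emeasure M (space M) = 1" and p: "p \<ge> 1" and h: "h \<in> borel_measurable M" "\<And>x. h x \<ge> 0"
    and i: "integrable M (\<lambda>x. h x powr p)"
  shows "(\<integral>x. h x \<partial>M) powr p \<le> (\<integral>x. h x powr p \<partial>M)"
proof -
  have fin: "integrable M (\<lambda>x. 1::real)" using M by (auto simp: integrable_iff_bounded)
  have one: "measure M (space M) = 1" using M by (simp add: measure_def)
  have eq: "h x = (h x powr p) powr (1/p) * 1 powr (1 - 1/p)" for x
    using p h(2)[of x] by (simp add: powr_powr)
  have "(\<integral>x. h x \<partial>M) \<le> (\<integral>x. h x powr p \<partial>M) powr (1/p) * (\<integral>x. 1 \<partial>M) powr (1 - 1/p)"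
    using Holder_powr(2)[of "1/p" M "\<lambda>x. h x powr p" "\<lambda>x. 1"] p i fin unfolding eq[symmetric] by simp
  then have "(\<integral>x. h x \<partial>M) \<le> (\<integral>x. h x powr p \<partial>M) powr (1/p)" by (simp add: one)
  then have "(\<integral>x. h x \<partial>M) powr p \<le> ((\<integral>x. h x powr p \<partial>M) powr (1/p)) powr p"
    using p h by (intro powr_mono2) auto
  also have "\<dots> = (\<integral>x. h x powr p \<partial>M)" using p by (simp add: powr_powr)
  finally show ?thesis .
qed

text \<open>The segment from \<open>x\<close> to \<open>x + v\<close> is run through at speed \<open>k * s ^ (k - 1)\<close>.
  A large \<open>k\<close> makes room for a factor that is singular at \<open>s = 0\<close>.\<close>

lemma C0_infty_segment:
  fixes \<phi> :: "'a::euclidean_space \<Rightarrow> real" and k :: nat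
  assumes \<phi>: "\<phi> \<in> C0_infty \<Omega>" and k: "k \<ge> 1" and t: "t \<ge> 1"
  shows "ennreal (\<bar>\<phi> (x + v) - \<phi> x\<bar> powr t)
    \<le> (\<integral>\<^sup>+s. indicator {0..1} s * ennreal ((real k * s ^ (k - 1) * norm v * norm (grad \<phi> (x + s ^ k *\<^sub>R v))) powr t) \<partial>lborel)"
proof -
  define h where "h s = real k * s ^ (k - 1) * norm v * norm (grad \<phi> (x + s ^ k *\<^sub>R v))" for s :: real
  define d where "d s = real k * s ^ (k - 1) * (v \<bullet> grad \<phi> (x + s ^ k *\<^sub>R v))" for s :: real
  have cg: "continuous_on UNIV (\<lambda>s::real. grad \<phi> (x + s ^ k *\<^sub>R v))"
    by (rule continuous_on_compose2[OF continuous_on_grad[OF \<phi>]]) (auto intro!: continuous_intros)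
  have ch: "continuous_on UNIV h" and cd: "continuous_on UNIV d"
    unfolding h_def d_def by (intro continuous_intros cg)+
  have h0: "h s \<ge> 0" if "s \<ge> 0" for s using that by (simp add: h_def)
  have dh: "\<bar>d s\<bar> \<le> h s" if "s \<ge> 0" for s
    unfolding d_def h_def abs_mult using that Cauchy_Schwarz_ineq2[of v "grad \<phi> (x + s ^ k *\<^sub>R v)"]
    by (simp add: mult.assoc mult_left_mono)
  have deriv: "((\<lambda>s. \<phi> (x + s ^ k *\<^sub>R v)) has_real_derivative d s) (at s)" for s
  proof -
    have "((\<lambda>s. \<phi> (x + s ^ k *\<^sub>R v)) has_derivative (\<lambda>r. ((real k * s ^ (k - 1) * r) *\<^sub>R v) \<bullet> grad \<phi> (x + s ^ k *\<^sub>R v))) (at s)"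
      by (rule has_derivative_compose[of "\<lambda>s. x + s ^ k *\<^sub>R v", OF _ C0_infty_has_derivative[OF \<phi>]])
        (auto intro!: derivative_eq_intros simp: mult_ac)
    then show ?thesis unfolding has_field_derivative_def by (rule has_derivative_eq_rhs) (auto simp: d_def mult_ac)
  qed
  have id: "integrable lborel (\<lambda>s. indicator {0..1} s *\<^sub>R d s)" and ih: "integrable lborel (\<lambda>s. indicator {0..1} s *\<^sub>R h s)"
    by (intro borel_integrable_compact compact_Icc continuous_on_subset[OF cd] continuous_on_subset[OF ch] subset_UNIV)+
  have iht: "integrable lborel (\<lambda>s. indicator {0..1} s *\<^sub>R (h s powr t))"
    using continuous_on_subset[OF ch] h0 t by (intro borel_integrable_compact continuous_on_powr' continuous_on_const) auto
  have "(\<integral>s. d s * indicator {0..1} s \<partial>lborel) = \<phi> (x + 1 ^ k *\<^sub>R v) - \<phi> (x + 0 ^ k *\<^sub>R v)"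
    by (rule integral_FTC_Icc_real) (use deriv cd in \<open>auto simp: continuous_on_eq_continuous_at\<close>)
  then have ftc: "\<phi> (x + v) - \<phi> x = (\<integral>s. indicator {0..1} s *\<^sub>R d s \<partial>lborel)"
    using k by (simp add: mult.commute power_0_left)
  let ?U = "restrict_space lborel {0..1::real}"
  have U1: "emeasure ?U (space ?U) = 1" by (simp add: emeasure_restrict_space space_restrict_space)
  have U: "(\<integral>s. f s \<partial>?U) = (\<integral>s. indicator {0..1} s *\<^sub>R f s \<partial>lborel)" for f :: "real \<Rightarrow> real"
    by (rule integral_restrict_space) simp
  have h0U: "max 0 (h s) = h s" if "s \<in> {0..1}" for s using h0 that by simp
  have iU: "integrable ?U (\<lambda>s. max 0 (h s) powr t)"
    apply (subst integrable_restrict_space)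
     apply simp
    by (rule Bochner_Integration.integrable_cong[THEN iffD1, OF refl _ iht]) (auto simp: indicator_def h0U)
  have hm: "h \<in> borel_measurable borel" using ch by (simp add: borel_measurable_continuous_onI)
  have "\<bar>\<phi> (x + v) - \<phi> x\<bar> \<le> (\<integral>s. indicator {0..1} s *\<^sub>R h s \<partial>lborel)"
    unfolding ftc by (rule order_trans[OF integral_abs_bound], rule integral_mono)
      (use id ih dh in \<open>auto simp: indicator_def\<close>)
  also have "\<dots> = (\<integral>s. max 0 (h s) \<partial>?U)"
    unfolding U by (intro Bochner_Integration.integral_cong) (auto simp: indicator_def h0U)
  finally have "\<bar>\<phi> (x + v) - \<phi> x\<bar> powr t \<le> (\<integral>s. max 0 (h s) \<partial>?U) powr t"
    using t by (intro powr_mono2) auto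
  also have "\<dots> \<le> (\<integral>s. max 0 (h s) powr t \<partial>?U)"
    using hm by (intro Jensen_powr U1 t iU measurable_restrict_space1) auto
  finally have "ennreal (\<bar>\<phi> (x + v) - \<phi> x\<bar> powr t) \<le> ennreal (\<integral>s. max 0 (h s) powr t \<partial>?U)" by (rule ennreal_leI)
  also have "\<dots> = ennreal (\<integral>s. indicator {0..1} s *\<^sub>R (h s powr t) \<partial>lborel)"
    unfolding U by (intro arg_cong[where f = ennreal] Bochner_Integration.integral_cong) (auto simp: indicator_def h0U)
  also have "\<dots> = (\<integral>\<^sup>+s. ennreal (indicator {0..1} s *\<^sub>R (h s powr t)) \<partial>lborel)"
    by (rule nn_integral_eq_integral[symmetric, OF iht]) auto
  also have "\<dots> = (\<integral>\<^sup>+s. indicator {0..1} s * ennreal (h s powr t) \<partial>lborel)"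
    by (intro nn_integral_cong) (auto simp: indicator_def)
  finally show ?thesis by (simp add: h_def)
qed

lemma nn_integral_wmeas:
  fixes f :: "'a::euclidean_space \<Rightarrow> 'b::euclidean_space"
  assumes "S \<in> sets lebesgue" "Lp_fun t (wmeas S m) f"
  shows "(\<integral>\<^sup>+x. ennreal (indicator S x * (norm (f x) powr t / norm x powr m)) \<partial>lebesgue) = ennreal (Lp_int t (wmeas S m) f)"
  using assms by (subst Lp_int_wmeas) (auto simp: Lp_fun_wmeas intro!: nn_integral_eq_integral)

text \<open>Comparing \<open>\<phi>\<close> with its dilation \<open>\<phi> (2 *\<^sub>R x)\<close>: the dilation has a norm smaller by the factor
  \<open>2 powr (- \<alpha>)\<close>, \<open>\<alpha> = N - \<mu> - p > 0\<close>, and the difference is controlled by the gradient along rays.\<close>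

lemma Hardy:
  fixes p \<mu> :: real
  assumes p: "p > 1" and \<mu>: "\<mu> + p < real DIM('a::euclidean_space)"
  obtains K where "K > 0" "\<And>\<phi> :: 'a \<Rightarrow> real. \<And>\<Omega>. \<phi> \<in> C0_infty \<Omega> \<Longrightarrow>
    Lp_int p (wmeas UNIV (\<mu> + p)) \<phi> \<le> K * Lp_int p (wmeas UNIV \<mu>) (grad \<phi>)"
proof -
  define \<alpha> where "\<alpha> = real DIM('a) - \<mu> - p"
  have \<alpha>: "\<alpha> > 0" using \<mu> by (simp add: \<alpha>_def)
  define s where "s = 1 - 2 powr (- (\<alpha> / (2 * (p - 1))))"
  have "2 powr (- (\<alpha> / (2 * (p - 1)))) < 1" using \<alpha> p by (simp add: powr_less_one)
  then have s: "0 < s" "s < 1" by (auto simp: s_def)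
  have s1: "(1 - s) powr (1 - p) = 2 powr (\<alpha> / 2)"
  proof -
    have "- (\<alpha> / (2 * (p - 1))) * (1 - p) = \<alpha> / 2" using p by (simp add: field_simps)
    moreover have "1 - s = 2 powr (- (\<alpha> / (2 * (p - 1))))" by (simp add: s_def)
    ultimately show ?thesis by (simp only: powr_powr)
  qed
  define \<theta> where "\<theta> = (2::real) powr (- (\<alpha> / 2))"
  have \<theta>: "\<theta> < 1" using \<alpha> by (simp add: \<theta>_def powr_less_one)
  define K where "K = s powr (1 - p) / (1 - \<theta>)"
  have K: "K > 0" using \<theta> s by (simp add: K_def)
  have p1: "p \<ge> 1" using p by simp
  have "Lp_int p (wmeas UNIV (\<mu> + p)) \<phi> \<le> K * Lp_int p (wmeas UNIV \<mu>) (grad \<phi>)"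
    if \<phi>: "\<phi> \<in> C0_infty \<Omega>" for \<phi> :: "'a \<Rightarrow> real" and \<Omega>
  proof -
    define X where "X = Lp_int p (wmeas UNIV (\<mu> + p)) \<phi>"
    define A where "A = Lp_int p (wmeas UNIV \<mu>) (grad \<phi>)"
    have L: "Lp_fun p (wmeas UNIV (\<mu> + p)) \<phi>" "Lp_fun p (wmeas UNIV \<mu>) (grad \<phi>)"
      using Lp_fun_C0_infty[OF \<phi>, of _ p UNIV] p \<mu> by auto
    have L2: "Lp_fun p (wmeas UNIV (\<mu> + p)) (\<lambda>x. \<phi> (2 *\<^sub>R x))"
      "Lp_int p (wmeas UNIV (\<mu> + p)) (\<lambda>x. \<phi> (2 *\<^sub>R x)) = 2 powr (- \<alpha>) * X"
    proof -
      have e: "\<mu> + p - real DIM('a) = - \<alpha>" by (simp add: \<alpha>_def)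
      show "Lp_fun p (wmeas UNIV (\<mu> + p)) (\<lambda>x. \<phi> (2 *\<^sub>R x))"
        "Lp_int p (wmeas UNIV (\<mu> + p)) (\<lambda>x. \<phi> (2 *\<^sub>R x)) = 2 powr (- \<alpha>) * X"
        using Lp_scale[OF _ _ _ _ L(1), of 2 UNIV] unfolding e X_def by auto
    qed
    have Ld: "Lp_fun p (wmeas UNIV (\<mu> + p)) (\<lambda>x. \<phi> x - \<phi> (2 *\<^sub>R x))"
      by (rule Lp_fun_diff[OF p1 L(1) L2(1)])
    define Y where "Y = Lp_int p (wmeas UNIV (\<mu> + p)) (\<lambda>x. \<phi> x - \<phi> (2 *\<^sub>R x))"
    have gm [measurable]: "grad \<phi> \<in> borel_measurable borel" by (rule borel_measurable_C0_infty(2)[OF \<phi>])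
    have "ennreal Y = (\<integral>\<^sup>+x. ennreal (indicator UNIV x * (norm (\<phi> x - \<phi> (2 *\<^sub>R x)) powr p / norm x powr (\<mu> + p))) \<partial>lebesgue)"
      unfolding Y_def by (rule nn_integral_wmeas[symmetric, OF _ Ld]) simp
    also have "\<dots> \<le> (\<integral>\<^sup>+x. (\<integral>\<^sup>+\<tau>. indicator {0..1} \<tau> * ennreal (norm (grad \<phi> ((1 + \<tau>) *\<^sub>R x)) powr p / norm x powr \<mu>) \<partial>lborel) \<partial>lebesgue)"
    proof (rule nn_integral_mono)
      fix x :: 'a
      show "ennreal (indicator UNIV x * (norm (\<phi> x - \<phi> (2 *\<^sub>R x)) powr p / norm x powr (\<mu> + p)))
        \<le> (\<integral>\<^sup>+\<tau>. indicator {0..1} \<tau> * ennreal (norm (grad \<phi> ((1 + \<tau>) *\<^sub>R x)) powr p / norm x powr \<mu>) \<partial>lborel)"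
      proof (cases "x = 0")
        case False
        have e: "norm x powr p / norm x powr (\<mu> + p) = 1 / norm x powr \<mu>"
          using False by (simp add: powr_add)
        have "ennreal (indicator UNIV x * (norm (\<phi> x - \<phi> (2 *\<^sub>R x)) powr p / norm x powr (\<mu> + p)))
          = ennreal (1 / norm x powr (\<mu> + p)) * ennreal (\<bar>\<phi> (x + x) - \<phi> x\<bar> powr p)"
          by (subst ennreal_mult[symmetric]) (auto simp: scaleR_2 abs_minus_commute)
        also have "\<dots> \<le> ennreal (1 / norm x powr (\<mu> + p)) *
          (\<integral>\<^sup>+\<tau>. indicator {0..1} \<tau> * ennreal ((real 1 * \<tau> ^ (1 - 1) * norm x * norm (grad \<phi> (x + \<tau> ^ 1 *\<^sub>R x))) powr p) \<partial>lborel)"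
          by (intro mult_left_mono C0_infty_segment[OF \<phi> _ p1]) auto
        also have "\<dots> = (\<integral>\<^sup>+\<tau>. ennreal (1 / norm x powr (\<mu> + p)) *
          (indicator {0..1} \<tau> * ennreal ((real 1 * \<tau> ^ (1 - 1) * norm x * norm (grad \<phi> (x + \<tau> ^ 1 *\<^sub>R x))) powr p)) \<partial>lborel)"
          by (rule nn_integral_cmult[symmetric]) measurable
        also have "\<dots> = (\<integral>\<^sup>+\<tau>. indicator {0..1} \<tau> * ennreal (norm (grad \<phi> ((1 + \<tau>) *\<^sub>R x)) powr p / norm x powr \<mu>) \<partial>lborel)"
        proof (rule nn_integral_cong)
          fix \<tau> :: real
          have "ennreal (1 / norm x powr (\<mu> + p)) * ennreal ((norm x * norm (grad \<phi> (x + \<tau> *\<^sub>R x))) powr p)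
            = ennreal (norm (grad \<phi> ((1 + \<tau>) *\<^sub>R x)) powr p * (norm x powr p / norm x powr (\<mu> + p)))"
            by (subst ennreal_mult[symmetric]) (auto simp: powr_mult algebra_simps)
          then show "ennreal (1 / norm x powr (\<mu> + p)) *
            (indicator {0..1} \<tau> * ennreal ((real 1 * \<tau> ^ (1 - 1) * norm x * norm (grad \<phi> (x + \<tau> ^ 1 *\<^sub>R x))) powr p))
            = indicator {0..1} \<tau> * ennreal (norm (grad \<phi> ((1 + \<tau>) *\<^sub>R x)) powr p / norm x powr \<mu>)"
            unfolding e by (auto simp: indicator_def)
        qed
        finally show ?thesis .
      qed simp
    qed
    also have "\<dots> = (\<integral>\<^sup>+x. (\<integral>\<^sup>+\<tau>. indicator {0..1} \<tau> * ennreal (norm (grad \<phi> ((1 + \<tau>) *\<^sub>R x)) powr p / norm x powr \<mu>) \<partial>lborel) \<partial>lborel)"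
      by (rule nn_integral_completion)
    also have "\<dots> = (\<integral>\<^sup>+\<tau>. (\<integral>\<^sup>+x. indicator {0..1} \<tau> * ennreal (norm (grad \<phi> ((1 + \<tau>) *\<^sub>R x)) powr p / norm x powr \<mu>) \<partial>lborel) \<partial>lborel)"
      by (rule lborel_pair.Fubini') measurable
    also have "\<dots> \<le> (\<integral>\<^sup>+\<tau>. indicator {0..1::real} \<tau> * ennreal A \<partial>lborel)"
    proof (rule nn_integral_mono)
      fix \<tau> :: real
      show "(\<integral>\<^sup>+x. indicator {0..1} \<tau> * ennreal (norm (grad \<phi> ((1 + \<tau>) *\<^sub>R x)) powr p / norm x powr \<mu>) \<partial>lborel)
        \<le> indicator {0..1} \<tau> * ennreal A"
      proof (cases "\<tau> \<in> {0..1}")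
        case True
        have \<tau>: "1 + \<tau> > 0" using True by simp
        have Ls: "Lp_fun p (wmeas UNIV \<mu>) (\<lambda>x. grad \<phi> ((1 + \<tau>) *\<^sub>R x))"
          "Lp_int p (wmeas UNIV \<mu>) (\<lambda>x. grad \<phi> ((1 + \<tau>) *\<^sub>R x)) = (1 + \<tau>) powr (\<mu> - DIM('a)) * A"
          using Lp_scale[OF \<tau> _ _ _ L(2), of UNIV] by (auto simp: A_def)
        have "(\<integral>\<^sup>+x. ennreal (norm (grad \<phi> ((1 + \<tau>) *\<^sub>R x)) powr p / norm x powr \<mu>) \<partial>lborel)
          = (\<integral>\<^sup>+x. ennreal (indicator UNIV x * (norm (grad \<phi> ((1 + \<tau>) *\<^sub>R x)) powr p / norm x powr \<mu>)) \<partial>lebesgue)"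
          by (simp add: nn_integral_completion)
        also have "\<dots> = ennreal ((1 + \<tau>) powr (\<mu> - DIM('a)) * A)"
          by (subst nn_integral_wmeas[OF _ Ls(1)]) (auto simp: Ls(2))
        also have "\<dots> \<le> ennreal (1 * A)"
          using True p \<mu> powr_mono[of "\<mu> - DIM('a)" 0 "1 + \<tau>"]
          by (intro ennreal_leI mult_right_mono) (auto simp: A_def)
        finally show ?thesis using True by simp
      qed simp
    qed
    also have "\<dots> = ennreal A * (\<integral>\<^sup>+\<tau>. indicator {0..1::real} \<tau> \<partial>lborel)"
      by (subst nn_integral_cmult[symmetric]) (auto simp: mult.commute)
    also have "\<dots> = ennreal A" by simp
    finally have "Y \<le> A" by (simp add: A_def)
    have "X = Lp_int p (wmeas UNIV (\<mu> + p)) (\<lambda>x. \<phi> (2 *\<^sub>R x) + (\<phi> x - \<phi> (2 *\<^sub>R x)))" by (simp add: X_def)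
    also have "\<dots> \<le> (1 - s) powr (1 - p) * (2 powr (- \<alpha>) * X) + s powr (1 - p) * Y"
      using Lp_int_add_le[OF p1 s L2(1) Ld] by (simp add: L2(2) Y_def)
    also have "(1 - s) powr (1 - p) * (2 powr (- \<alpha>) * X) = \<theta> * X"
      by (simp add: s1 \<theta>_def powr_add[symmetric] mult.assoc[symmetric])
    also have "s powr (1 - p) * Y \<le> s powr (1 - p) * A" using \<open>Y \<le> A\<close> by (intro mult_left_mono) auto
    finally have "(1 - \<theta>) * X \<le> s powr (1 - p) * A" by (simp add: algebra_simps)
    then have "X \<le> K * A" using \<theta> by (simp add: K_def field_simps)
    then show ?thesis by (simp add: X_def A_def)
  qed
  then show ?thesis using K by (intro that[of K]) auto
qed

section \<open>The energy space\<close>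

lemma Lp_int_indicator:
  fixes f :: "'a::euclidean_space \<Rightarrow> 'b::euclidean_space"
  assumes S: "S \<in> sets lebesgue" "K \<in> sets lebesgue" "K \<subseteq> S" and t: "t > 0"
    and f: "Lp_fun t (wmeas K m) f"
  shows "Lp_fun t (wmeas S m) (\<lambda>x. indicator K x *\<^sub>R f x)"
    "Lp_int t (wmeas S m) (\<lambda>x. indicator K x *\<^sub>R f x) = Lp_int t (wmeas K m) f"
proof -
  have fm: "f \<in> borel_measurable (lebesgue_on K)"
    and i: "integrable lebesgue (\<lambda>x. indicator K x * (norm (f x) powr t / norm x powr m))"
    using f S by (auto simp: Lp_fun_wmeas)
  have "(\<lambda>x. indicator K x *\<^sub>R f x) \<in> borel_measurable lebesgue"
    using fm S by (subst (asm) borel_measurable_restrict_space_iff) auto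
  then have m: "(\<lambda>x. indicator K x *\<^sub>R f x) \<in> borel_measurable (lebesgue_on S)"
    by (rule measurable_restrict_space1)
  have eq: "indicator S x * (norm (indicator K x *\<^sub>R f x) powr t / norm x powr m)
      = indicator K x * (norm (f x) powr t / norm x powr m)" for x
    using S(3) t by (auto simp: indicator_def)
  show "Lp_fun t (wmeas S m) (\<lambda>x. indicator K x *\<^sub>R f x)"
    unfolding Lp_fun_wmeas[OF S(1)] eq using m i by blast
  show "Lp_int t (wmeas S m) (\<lambda>x. indicator K x *\<^sub>R f x) = Lp_int t (wmeas K m) f"
    unfolding Lp_int_wmeas[OF S(1) m] Lp_int_wmeas[OF S(2) fm] eq ..
qed

lemma Lp_conv_Cauchy:
  assumes t: "t \<ge> 1" and conv: "Lp_conv t M f g" and e: "e > 0"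
  shows "\<exists>N. \<forall>m\<ge>N. \<forall>n\<ge>N. Lp_int t M (\<lambda>x. f m x - f n x) < e"
proof -
  have d: "Lp_fun t M (\<lambda>x. f n x - g x)" "(\<lambda>n. Lp_int t M (\<lambda>x. f n x - g x)) \<longlonglongrightarrow> 0" for n
    using conv by (auto simp: Lp_conv_def)
  have "2 powr (t - 1) > (0::real)" by simp
  define \<delta> where "\<delta> = e / (2 * 2 powr (t - 1))"
  have \<delta>: "\<delta> > 0" using e by (simp add: \<delta>_def)
  obtain N where N: "\<And>n. n \<ge> N \<Longrightarrow> Lp_int t M (\<lambda>x. f n x - g x) < \<delta>"
    using order_tendstoD(2)[OF d(2) \<delta>] by (auto simp: eventually_sequentially)
  have "Lp_int t M (\<lambda>x. f m x - f n x) < e" if "m \<ge> N" "n \<ge> N" for m n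
  proof -
    have eq: "(\<lambda>x. f m x - f n x) = (\<lambda>x. (f m x - g x) - (f n x - g x))" by auto
    have "Lp_int t M (\<lambda>x. f m x - f n x) \<le> 2 powr (t - 1) * (Lp_int t M (\<lambda>x. f m x - g x) + Lp_int t M (\<lambda>x. f n x - g x))"
      unfolding eq by (rule Lp_int_diff_le_half[OF t d(1) d(1)])
    also have "\<dots> < 2 powr (t - 1) * (\<delta> + \<delta>)"
      using N that by (intro mult_strict_left_mono add_strict_mono) auto
    also have "\<dots> = e" by (simp add: \<delta>_def)
    finally show ?thesis .
  qed
  then show ?thesis by blast
qed

lemma Lp_conv_diff:
  fixes f :: "nat \<Rightarrow> 'a \<Rightarrow> 'b::euclidean_space"
  assumes t: "t \<ge> 1" and f: "Lp_conv t M f g" and f': "Lp_conv t M f' g'"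
  shows "Lp_conv t M (\<lambda>n x. f n x - f' n x) (\<lambda>x. g x - g' x)"
proof -
  have d: "Lp_fun t M (\<lambda>x. f n x - g x)" "Lp_fun t M (\<lambda>x. f' n x - g' x)" for n
    using f f' by (auto simp: Lp_conv_def)
  have eq: "(\<lambda>x. f n x - f' n x - (g x - g' x)) = (\<lambda>x. (f n x - g x) - (f' n x - g' x))" for n by auto
  have "(\<lambda>n. Lp_int t M (\<lambda>x. f n x - f' n x - (g x - g' x))) \<longlonglongrightarrow> 0"
  proof (rule tendsto_sandwich[OF _ _ tendsto_const])
    have "(\<lambda>n. 2 powr (t - 1) * (Lp_int t M (\<lambda>x. f n x - g x) + Lp_int t M (\<lambda>x. f' n x - g' x))) \<longlonglongrightarrow> 2 powr (t - 1) * (0 + 0)"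
      using f f' by (intro tendsto_intros) (auto simp: Lp_conv_def)
    then show "(\<lambda>n. 2 powr (t - 1) * (Lp_int t M (\<lambda>x. f n x - g x) + Lp_int t M (\<lambda>x. f' n x - g' x))) \<longlonglongrightarrow> 0" by simp
    show "\<forall>\<^sub>F n in sequentially. Lp_int t M (\<lambda>x. f n x - f' n x - (g x - g' x))
       \<le> 2 powr (t - 1) * (Lp_int t M (\<lambda>x. f n x - g x) + Lp_int t M (\<lambda>x. f' n x - g' x))"
      unfolding eq using Lp_int_diff_le_half[OF t d] by simp
  qed simp
  then show ?thesis using Lp_fun_diff[OF t d] by (simp add: Lp_conv_def eq)
qed

text \<open>By the Hardy inequality a sequence of test functions that is Cauchy in the gradient norm is
  Cauchy in the weighted \<open>L\<^sup>p\<close> space with weight exponent \<open>\<mu> + p\<close>, so its \<open>L\<^sup>1_loc\<close> limit is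
  a limit there as well.\<close>

lemma is_W_grad_iff:
  fixes \<Omega> :: "'a::euclidean_space set" and u :: "'a \<Rightarrow> real"
  assumes \<Omega>: "open \<Omega>" and p: "p > 1" and \<mu>: "0 < \<mu> + p" "\<mu> + p < real DIM('a)"
  shows "is_W_grad \<Omega> p \<mu> u G \<longleftrightarrow> (\<exists>\<phi>. (\<forall>n. \<phi> n \<in> C0_infty \<Omega>) \<and>
    Lp_conv p (wmeas \<Omega> (\<mu> + p)) \<phi> u \<and> Lp_conv p (wmeas \<Omega> \<mu>) (\<lambda>n. grad (\<phi> n)) G)"
proof
  have \<Omega>L: "\<Omega> \<in> sets lebesgue" using \<Omega> by (simp add: borel_open)
  have p1: "p \<ge> 1" using p by simp
  {
    assume "is_W_grad \<Omega> p \<mu> u G"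
    then obtain \<phi> where \<phi>: "\<And>n. \<phi> n \<in> C0_infty \<Omega>" and loc: "L1_loc_converges \<Omega> \<phi> u"
      and gr: "Lp_conv p (wmeas \<Omega> \<mu>) (\<lambda>n. grad (\<phi> n)) G"
      by (auto simp: is_W_grad_def weighted_Lp_converges_iff[OF \<Omega>L])
    obtain H where H: "H > 0" "\<And>\<phi> :: 'a \<Rightarrow> real. \<And>\<Omega>. \<phi> \<in> C0_infty \<Omega> \<Longrightarrow>
      Lp_int p (wmeas UNIV (\<mu> + p)) \<phi> \<le> H * Lp_int p (wmeas UNIV \<mu>) (grad \<phi>)"
      using Hardy[OF p \<mu>(2)] by metis
    obtain C where C: "\<And>n. compact (C n)" "\<And>n. C n \<subseteq> \<Omega>" "\<And>n. C n \<subseteq> interior (C (Suc n))" "\<Union>(range C) = \<Omega>"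
      using open_Union_compact_subsets[OF \<Omega>] by metis
    have CL: "C j \<in> sets lebesgue" for j using C(1) by (simp add: borel_compact)
    have C_mono: "C i \<subseteq> C j" if "i \<le> j" for i j
      using that by (rule lift_Suc_mono_le[rotated]) (meson C(3) interior_subset order_trans)
    have evC: "\<forall>\<^sub>F j in sequentially. x \<in> C j" if x: "x \<in> \<Omega>" for x
    proof -
      obtain i where "x \<in> C i" using C(4) x by blast
      then show ?thesis using C_mono by (intro eventually_sequentiallyI[of i]) blast
    qed
    have limC: "(\<lambda>j. indicator (C j) x *\<^sub>R y) \<longlonglongrightarrow> y" if "x \<in> \<Omega>" for x and y :: real
      by (rule tendsto_eventually, rule eventually_mono[OF evC[OF that]]) simp
    have \<phi>m: "\<phi> n \<in> borel_measurable (lebesgue_on S)" for n S by (rule borel_measurable_C0_infty(3)[OF \<phi>])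
    have si: "integrable lebesgue (\<lambda>x. indicator (C j) x *\<^sub>R (\<phi> n x - u x))"
      and sl: "(\<lambda>n. \<integral>x. norm (indicator (C j) x *\<^sub>R (\<phi> n x - u x)) \<partial>lebesgue) \<longlonglongrightarrow> 0" for j n
      using loc C(1,2) unfolding L1_loc_converges_def set_integrable_def set_lebesgue_integral_def
      by (auto simp: abs_mult)
    have dmC: "(\<lambda>x. \<phi> n x - u x) \<in> borel_measurable (lebesgue_on (C j))" for n j
      using borel_measurable_integrable[OF si[of j n]] CL by (subst borel_measurable_restrict_space_iff) auto
    have dm: "(\<lambda>x. \<phi> n x - u x) \<in> borel_measurable (lebesgue_on \<Omega>)" for n
    proof (rule borel_measurable_LIMSEQ_real)
      fix x assume "x \<in> space (lebesgue_on \<Omega>)"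
      then have x: "x \<in> \<Omega>" by simp
      show "(\<lambda>j. indicator (C j) x *\<^sub>R (\<phi> n x - u x)) \<longlonglongrightarrow> \<phi> n x - u x"
        by (rule limC[OF x])
    qed (intro measurable_restrict_space1 borel_measurable_integrable[OF si])
    have key: "Lp_fun p (wmeas \<Omega> (\<mu> + p)) (\<lambda>x. \<phi> n x - u x) \<and> Lp_int p (wmeas \<Omega> (\<mu> + p)) (\<lambda>x. \<phi> n x - u x) \<le> H * e"
      if "e > 0" and N: "\<forall>m\<ge>N. \<forall>n\<ge>N. Lp_int p (wmeas \<Omega> \<mu>) (\<lambda>x. grad (\<phi> m) x - grad (\<phi> n) x) < e" and "n \<ge> N" for n N e
    proof -
      have dC: "Lp_fun p (wmeas (C j) (\<mu> + p)) (\<lambda>x. \<phi> n x - u x) \<and> Lp_int p (wmeas (C j) (\<mu> + p)) (\<lambda>x. \<phi> n x - u x) \<le> H * e" for j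
      proof -
        obtain r where r: "strict_mono r" and ae: "AE x in lebesgue. (\<lambda>k. indicator (C j) x *\<^sub>R (\<phi> (r k) x - u x)) \<longlonglongrightarrow> 0"
          using tendsto_L1_AE_subseq[OF si sl] by blast
        define f where "f k x = \<phi> n x - \<phi> (r (k + N)) x" for k x
        have fL: "Lp_fun p (wmeas (C j) (\<mu> + p)) (f k)" for k
          unfolding f_def[abs_def] using p by (intro Lp_fun_diff[OF p1] Lp_fun_C0_infty(1)[OF \<phi> \<mu>(2) _ CL]) auto
        have fI: "Lp_int p (wmeas (C j) (\<mu> + p)) (f k) \<le> H * e" for k
        proof -
          have t: "f k \<in> C0_infty \<Omega>" unfolding f_def[abs_def] by (intro C0_infty_diff \<phi>)
          have "Lp_int p (wmeas (C j) (\<mu> + p)) (f k) \<le> Lp_int p (wmeas UNIV (\<mu> + p)) (f k)"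
            using p by (intro Lp_wmeas_subset(2) CL Lp_fun_C0_infty(1)[OF t \<mu>(2)]) auto
          also have "\<dots> \<le> H * Lp_int p (wmeas UNIV \<mu>) (grad (f k))" by (rule H(2)[OF t])
          also have "Lp_int p (wmeas UNIV \<mu>) (grad (f k)) = Lp_int p (wmeas \<Omega> \<mu>) (grad (f k))"
            using Lp_int_C0_infty(2)[OF t \<Omega>L] p by simp
          also have "grad (f k) = (\<lambda>x. grad (\<phi> n) x - grad (\<phi> (r (k + N))) x)"
            unfolding f_def[abs_def] using grad_diff[OF \<phi> \<phi>] by auto
          also have "H * Lp_int p (wmeas \<Omega> \<mu>) (\<lambda>x. grad (\<phi> n) x - grad (\<phi> (r (k + N))) x) \<le> H * e"
            using H(1) that seq_suble[OF r, of "k + N"] by (intro mult_left_mono less_imp_le) auto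
          finally show ?thesis .
        qed
        have "AE x in wmeas (C j) (\<mu> + p). (\<lambda>k. f k x) \<longlonglongrightarrow> \<phi> n x - u x"
          unfolding AE_wmeas[OF CL] using ae
        proof eventually_elim
          case (elim x)
          show ?case
          proof
            assume "x \<in> C j"
            then have "(\<lambda>k. \<phi> (r k) x - u x) \<longlonglongrightarrow> 0" using elim by simp
            then have "(\<lambda>k. \<phi> (r (k + N)) x - u x) \<longlonglongrightarrow> 0" by (rule LIMSEQ_ignore_initial_segment)
            then have "(\<lambda>k. (\<phi> n x - u x) - (\<phi> (r (k + N)) x - u x)) \<longlonglongrightarrow> (\<phi> n x - u x) - 0"
              by (intro tendsto_intros)
            then show "(\<lambda>k. f k x) \<longlonglongrightarrow> \<phi> n x - u x" by (simp add: f_def)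
          qed
        qed
        then show ?thesis
          using Lp_Fatou[of p "\<lambda>x. \<phi> n x - u x" "wmeas (C j) (\<mu> + p)" f "H * e"] p dmC fL fI by simp
      qed
      have "AE x in wmeas \<Omega> (\<mu> + p). (\<lambda>j. indicator (C j) x *\<^sub>R (\<phi> n x - u x)) \<longlonglongrightarrow> \<phi> n x - u x"
        unfolding AE_wmeas[OF \<Omega>L]
        by (intro AE_I2 impI limC)
      then show ?thesis
        using Lp_Fatou[of p "\<lambda>x. \<phi> n x - u x" "wmeas \<Omega> (\<mu> + p)" "\<lambda>j x. indicator (C j) x *\<^sub>R (\<phi> n x - u x)" "H * e"]
          p dm Lp_int_indicator[OF \<Omega>L CL C(2) _ conjunct1[OF dC]] conjunct2[OF dC] by simp
    qed
    have u: "Lp_fun p (wmeas \<Omega> (\<mu> + p)) u"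
    proof -
      obtain N where N: "\<forall>m\<ge>N. \<forall>n\<ge>N. Lp_int p (wmeas \<Omega> \<mu>) (\<lambda>x. grad (\<phi> m) x - grad (\<phi> n) x) < 1"
        using Lp_conv_Cauchy[OF p1 gr, of 1] by auto
      have "Lp_fun p (wmeas \<Omega> (\<mu> + p)) (\<phi> N)" using p by (intro Lp_fun_C0_infty(1)[OF \<phi> \<mu>(2) _ \<Omega>L]) auto
      then show ?thesis using Lp_fun_diff[OF p1 _ conjunct1[OF key[OF zero_less_one N order_refl]], of "\<phi> N"] by simp
    qed
    have "Lp_conv p (wmeas \<Omega> (\<mu> + p)) \<phi> u"
      unfolding Lp_conv_def
    proof (intro conjI allI LIMSEQ_I)
      show "Lp_fun p (wmeas \<Omega> (\<mu> + p)) (\<lambda>x. \<phi> n x - u x)" for n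
        using p by (intro Lp_fun_diff[OF p1 _ u] Lp_fun_C0_infty(1)[OF \<phi> \<mu>(2) _ \<Omega>L]) auto
      fix e :: real assume e: "e > 0"
      then have e': "e / (2 * H) > 0" using H by simp
      obtain N where N: "\<forall>m\<ge>N. \<forall>n\<ge>N. Lp_int p (wmeas \<Omega> \<mu>) (\<lambda>x. grad (\<phi> m) x - grad (\<phi> n) x) < e / (2 * H)"
        using Lp_conv_Cauchy[OF p1 gr e'] by auto
      show "\<exists>no. \<forall>n\<ge>no. norm (Lp_int p (wmeas \<Omega> (\<mu> + p)) (\<lambda>x. \<phi> n x - u x) - 0) < e"
        using key[OF e' N] e H(1) by (intro exI[of _ N]) force
    qed
    then show "\<exists>\<phi>. (\<forall>n. \<phi> n \<in> C0_infty \<Omega>) \<and> Lp_conv p (wmeas \<Omega> (\<mu> + p)) \<phi> u \<and> Lp_conv p (wmeas \<Omega> \<mu>) (\<lambda>n. grad (\<phi> n)) G"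
      using \<phi> gr by blast
  }
  assume "\<exists>\<phi>. (\<forall>n. \<phi> n \<in> C0_infty \<Omega>) \<and> Lp_conv p (wmeas \<Omega> (\<mu> + p)) \<phi> u \<and> Lp_conv p (wmeas \<Omega> \<mu>) (\<lambda>n. grad (\<phi> n)) G"
  then obtain \<phi> where \<phi>: "\<And>n. \<phi> n \<in> C0_infty \<Omega>" and lp: "Lp_conv p (wmeas \<Omega> (\<mu> + p)) \<phi> u"
    and gr: "Lp_conv p (wmeas \<Omega> \<mu>) (\<lambda>n. grad (\<phi> n)) G" by blast
  have "L1_loc_converges \<Omega> \<phi> u"
    unfolding L1_loc_converges_def
  proof (intro allI impI, elim conjE)
    fix K assume K: "compact K" "K \<subseteq> \<Omega>"
    obtain R where R: "R > 0" "K \<subseteq> cball 0 R"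
      using compact_imp_bounded[OF K(1)] by (meson bounded_subset_cball order.trans ball_subset_cball bounded_subset_ballD)
    have c: "1 / norm x powr (\<mu> + p) \<ge> 1 / R powr (\<mu> + p)" if "x \<in> K" "x \<noteq> 0" for x
      using that R \<mu> by (intro divide_left_mono powr_mono2 mult_pos_pos) auto
    have "1 / R powr (\<mu> + p) > 0" using R by simp
    from Lp_conv_imp_L1_conv[OF \<Omega>L p1 lp K this c]
    show "(\<forall>n. set_integrable lebesgue K (\<lambda>x. \<phi> n x - u x)) \<and> (\<lambda>n. LINT x:K|lebesgue. \<bar>\<phi> n x - u x\<bar>) \<longlonglongrightarrow> 0"
      by simp
  qed
  then show "is_W_grad \<Omega> p \<mu> u G"
    using \<phi> gr by (auto simp: is_W_grad_def weighted_Lp_converges_iff[OF \<Omega>L])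
qed

lemma weight_bounded_below:
  fixes K :: "'a::euclidean_space set"
  assumes K: "compact K" "0 \<notin> K"
  obtains c where "c > 0" "\<And>x. x \<in> K \<Longrightarrow> 1 / norm x powr m \<ge> c"
proof (cases "K = {}")
  case True
  then show ?thesis using that[of 1] by auto
next
  case False
  have "continuous_on K (\<lambda>x. 1 / norm x powr m)"
    using K(2) by (intro continuous_intros continuous_on_powr) auto
  then obtain y where y: "y \<in> K" "\<And>x. x \<in> K \<Longrightarrow> 1 / norm y powr m \<le> 1 / norm x powr m"
    using continuous_attains_inf[OF K(1) False] by metis
  have "y \<noteq> 0" using y(1) K(2) by auto
  then show ?thesis using y by (intro that[of "1 / norm y powr m"]) auto
qed

text \<open>For negative \<open>\<mu>\<close> the weight of the gradient vanishes at the origin. So the limits in \<open>L\<^sup>1\<close> are taken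
  on compact sets that do not contain this point, which is a null set.\<close>

lemma is_W_grad_unique:
  fixes \<Omega> :: "'a::euclidean_space set" and u :: "'a \<Rightarrow> real"
  assumes \<Omega>: "open \<Omega>" and p: "p > 1" and \<mu>: "0 < \<mu> + p" "\<mu> + p < real DIM('a)"
    and G: "is_W_grad \<Omega> p \<mu> u G" "is_W_grad \<Omega> p \<mu> u G'"
  shows "AE x in lebesgue. x \<in> \<Omega> \<longrightarrow> G x = G' x"
proof -
  have \<Omega>L: "\<Omega> \<in> sets lebesgue" using \<Omega> by (simp add: borel_open)
  have p1: "p \<ge> 1" using p by simp
  have \<mu>N: "\<mu> < real DIM('a)" using \<mu> p by simp
  obtain \<phi> where \<phi>: "\<And>n. \<phi> n \<in> C0_infty \<Omega>" "Lp_conv p (wmeas \<Omega> (\<mu> + p)) \<phi> u" "Lp_conv p (wmeas \<Omega> \<mu>) (\<lambda>n. grad (\<phi> n)) G"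
    using G(1) unfolding is_W_grad_iff[OF \<Omega> p \<mu>] by blast
  obtain \<psi> where \<psi>: "\<And>n. \<psi> n \<in> C0_infty \<Omega>" "Lp_conv p (wmeas \<Omega> (\<mu> + p)) \<psi> u" "Lp_conv p (wmeas \<Omega> \<mu>) (\<lambda>n. grad (\<psi> n)) G'"
    using G(2) unfolding is_W_grad_iff[OF \<Omega> p \<mu>] by blast
  define d where "d n x = \<phi> n x - \<psi> n x" for n x
  have d: "d n \<in> C0_infty \<Omega>" for n unfolding d_def[abs_def] by (intro C0_infty_diff \<phi> \<psi>)
  have gd: "grad (d n) = (\<lambda>x. grad (\<phi> n) x - grad (\<psi> n) x)" for n
    unfolding d_def[abs_def] using grad_diff[OF \<phi>(1) \<psi>(1)] by auto
  have c0: "Lp_conv p (wmeas \<Omega> (\<mu> + p)) d (\<lambda>x. 0)"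
    using Lp_conv_diff[OF p1 \<phi>(2) \<psi>(2)] by (simp add: d_def[abs_def])
  have c1: "Lp_conv p (wmeas \<Omega> \<mu>) (\<lambda>n. grad (d n)) (\<lambda>x. G x - G' x)"
    using Lp_conv_diff[OF p1 \<phi>(3) \<psi>(3)] by (simp add: gd)
  have Gm: "(\<lambda>x. G x - G' x) \<in> borel_measurable (lebesgue_on \<Omega>)"
    using Lp_conv_fun[OF p1 c1, of 0] Lp_fun_C0_infty(2)[OF d \<mu>N _ \<Omega>L, of p 0] p by auto
  have "AE x in lebesgue. x \<in> \<Omega> - {0} \<longrightarrow> G x - G' x = 0"
  proof (rule weak_gradient_of_0[where \<phi> = d])
    show "open (\<Omega> - {0})" using \<Omega> by (simp add: open_delete)
    show "d n \<in> C0_infty \<Omega>" for n by (rule d)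
    show "(\<lambda>x. G x - G' x) \<in> borel_measurable (lebesgue_on (\<Omega> - {0}))" by (rule lebesgue_on_measurable_subset[OF Gm]) auto
    fix K assume K: "compact K" "K \<subseteq> \<Omega> - {0}"
    then have K0: "0 \<notin> K" "K \<subseteq> \<Omega>" by auto
    obtain b where b: "b > 0" "\<And>x. x \<in> K \<Longrightarrow> 1 / norm x powr (\<mu> + p) \<ge> b" using weight_bounded_below[OF K(1) K0(1)] by metis
    obtain c where c: "c > 0" "\<And>x. x \<in> K \<Longrightarrow> 1 / norm x powr \<mu> \<ge> c" using weight_bounded_below[OF K(1) K0(1)] by metis
    show "(\<lambda>n. LINT x:K|lebesgue. norm (d n x)) \<longlonglongrightarrow> 0"
      using Lp_conv_imp_L1_conv(2)[OF \<Omega>L p1 c0 K(1) K0(2) b] by simp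
    show "set_integrable lebesgue K (\<lambda>x. grad (d n) x - (G x - G' x))" for n
      using Lp_conv_imp_L1_conv(1)[OF \<Omega>L p1 c1 K(1) K0(2) c] .
    show "(\<lambda>n. LINT x:K|lebesgue. norm (grad (d n) x - (G x - G' x))) \<longlonglongrightarrow> 0"
      using Lp_conv_imp_L1_conv(2)[OF \<Omega>L p1 c1 K(1) K0(2) c] .
  qed
  moreover have "AE x in lebesgue. x \<noteq> (0::'a)"
    by (rule AE_not_in[where N = "{0}", simplified]) (simp add: null_sets_completionI)
  ultimately show ?thesis by eventually_elim auto
qed

lemma is_W_grad_Lp:
  fixes \<Omega> :: "'a::euclidean_space set" and u :: "'a \<Rightarrow> real"
  assumes \<Omega>: "open \<Omega>" and p: "p > 1" and \<mu>: "0 < \<mu> + p" "\<mu> + p < real DIM('a)"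
    and G: "is_W_grad \<Omega> p \<mu> u G"
  shows "Lp_fun p (wmeas \<Omega> \<mu>) G" "Lp_fun p (wmeas \<Omega> (\<mu> + p)) u"
    "grad_int \<Omega> p \<mu> u = Lp_int p (wmeas \<Omega> \<mu>) G"
proof -
  have \<Omega>L: "\<Omega> \<in> sets lebesgue" using \<Omega> by (simp add: borel_open)
  have p1: "p \<ge> 1" using p by simp
  have \<mu>N: "\<mu> < real DIM('a)" using \<mu> p by simp
  have L: "Lp_fun p (wmeas \<Omega> \<mu>) G' \<and> Lp_fun p (wmeas \<Omega> (\<mu> + p)) u" if G': "is_W_grad \<Omega> p \<mu> u G'" for G'
  proof -
    obtain \<phi> where \<phi>: "\<And>n. \<phi> n \<in> C0_infty \<Omega>" "Lp_conv p (wmeas \<Omega> (\<mu> + p)) \<phi> u" "Lp_conv p (wmeas \<Omega> \<mu>) (\<lambda>n. grad (\<phi> n)) G'"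
      using G' unfolding is_W_grad_iff[OF \<Omega> p \<mu>] by blast
    show ?thesis
      using Lp_conv_fun[OF p1 \<phi>(2), of 0] Lp_conv_fun[OF p1 \<phi>(3), of 0]
        Lp_fun_C0_infty(1)[OF \<phi>(1) \<mu>(2) _ \<Omega>L, of p 0] Lp_fun_C0_infty(2)[OF \<phi>(1) \<mu>N _ \<Omega>L, of p 0] p by simp
  qed
  show "Lp_fun p (wmeas \<Omega> \<mu>) G" "Lp_fun p (wmeas \<Omega> (\<mu> + p)) u" using L[OF G] by auto
  have W: "is_W_grad \<Omega> p \<mu> u (W_grad \<Omega> p \<mu> u)" unfolding W_grad_def using G by (rule someI[of "is_W_grad \<Omega> p \<mu> u"])
  have m: "G \<in> borel_measurable (lebesgue_on \<Omega>)" "W_grad \<Omega> p \<mu> u \<in> borel_measurable (lebesgue_on \<Omega>)"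
    using L[OF G] L[OF W] by auto
  have "grad_int \<Omega> p \<mu> u = Lp_int p (wmeas \<Omega> \<mu>) (W_grad \<Omega> p \<mu> u)"
    unfolding grad_int_def by (rule weighted_int_eq[OF \<Omega>L m(2)])
  also have "\<dots> = Lp_int p (wmeas \<Omega> \<mu>) G"
    by (rule Lp_cong_AE(1)[OF \<Omega>L m(2,1) is_W_grad_unique[OF \<Omega> p \<mu> W G]])
  finally show "grad_int \<Omega> p \<mu> u = Lp_int p (wmeas \<Omega> \<mu>) G" .
qed

section \<open>Sobolev inequality on shells\<close>

text \<open>Jensen's inequality for integrals that may be infinite.\<close>

lemma Jensen_powr_nn:
  fixes h :: "'a \<Rightarrow> real"
  assumes M: "emeasure M (space M) = 1" and t: "t \<ge> 1" and h: "h \<in> borel_measurable M" "\<And>x. h x \<ge> 0"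
    and a: "a \<ge> 0" "ennreal a \<le> (\<integral>\<^sup>+x. ennreal (h x) \<partial>M)"
  shows "ennreal (a powr t) \<le> (\<integral>\<^sup>+x. ennreal (h x powr t) \<partial>M)"
proof (cases "(\<integral>\<^sup>+x. ennreal (h x powr t) \<partial>M) = \<infinity>")
  case False
  have i: "integrable M (\<lambda>x. h x powr t)"
    using False h by (intro integrableI_bounded) (auto simp: top.not_eq_extremum)
  have one: "integrable M (\<lambda>x. 1::real)" using M by (auto simp: integrable_iff_bounded)
  have "integrable M (\<lambda>x. 1 + h x powr t)" using i one by (rule Bochner_Integration.integrable_add[rotated])
  then have ih: "integrable M h"
    by (rule Bochner_Integration.integrable_bound[OF _ h(1)])
      (use norm_le_powr_split[OF t zero_less_one, of "h _"] h(2) in \<open>auto intro!: AE_I2\<close>)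
  have "a \<le> (\<integral>x. h x \<partial>M)"
    using a h(2) nn_integral_eq_integral[OF ih] by (simp add: integral_nonneg_AE)
  then have "a powr t \<le> (\<integral>x. h x \<partial>M) powr t" using a t by (intro powr_mono2) auto
  also have "\<dots> \<le> (\<integral>x. h x powr t \<partial>M)" by (rule Jensen_powr[OF M t h i])
  finally show ?thesis using nn_integral_eq_integral[OF i] by (simp add: ennreal_leI)
qed simp

lemma nn_integral_lborel_affine:
  fixes F :: "'a::euclidean_space \<Rightarrow> ennreal"
  assumes "\<tau> > 0" and F: "F \<in> borel_measurable borel"
  shows "(\<integral>\<^sup>+y. F y \<partial>lborel) = ennreal (\<tau> ^ DIM('a)) * (\<integral>\<^sup>+z. F (x + \<tau> *\<^sub>R z) \<partial>lborel)"
  using assms by (subst lborel_affine[of \<tau> x])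
    (auto simp: nn_integral_density nn_integral_distr nn_integral_cmult)

lemma integral_lborel_affine:
  fixes F :: "'a::euclidean_space \<Rightarrow> real"
  assumes "\<tau> > 0" and F: "F \<in> borel_measurable borel"
  shows "(\<integral>y. F y \<partial>lborel) = \<tau> ^ DIM('a) * (\<integral>z. F (x + \<tau> *\<^sub>R z) \<partial>lborel)"
  using assms by (subst lborel_affine[of \<tau> x]) (auto simp: integral_density integral_distr)

definition bump_vol :: "'a::euclidean_space itself \<Rightarrow> real" where
  "bump_vol _ = (\<integral>z. bump 0 1 (z::'a) \<partial>lborel)"

text \<open>Average over the ball of radius \<open>\<tau>\<close>. The smooth kernel makes it a Lipschitz function of the centre.\<close>

definition avg :: "real \<Rightarrow> ('a::euclidean_space \<Rightarrow> real) \<Rightarrow> 'a \<Rightarrow> real" where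
  "avg \<tau> f x = (\<integral>z. bump 0 1 z * f (x + \<tau> *\<^sub>R z) \<partial>lborel) / bump_vol TYPE('a)"

lemma bump_C0_infty: "bump 0 1 \<in> C0_infty (UNIV :: 'a::euclidean_space set)"
proof (rule C0_inftyI[of _ "cball 0 1"])
  fix x :: 'a assume "x \<notin> cball 0 1"
  then have "\<not> bump 0 1 x > 0" by (simp add: bump_pos_iff)
  then show "bump 0 1 x = 0" using bump_bounds(1)[of 0 1 x] by linarith
qed (auto simp: Ck_bump)

lemma bump_eq_0: "x \<notin> ball 0 1 \<Longrightarrow> bump 0 1 x = 0"
  using bump_pos_iff[of 1 0 x] bump_bounds(1)[of 0 1 x] by auto

lemma bump_borel [measurable]: "bump 0 1 \<in> borel_measurable borel"
  by (rule borel_measurable_C0_infty(1)[OF bump_C0_infty])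

lemma integrable_bump: "integrable lborel (bump 0 1 :: 'a::euclidean_space \<Rightarrow> real)"
  by (rule integrable_continuous_compact_support[OF C0_infty_continuous[OF bump_C0_infty], of "cball 0 1"])
    (auto intro: bump_eq_0)

lemma bump_vol_pos: "bump_vol TYPE('a::euclidean_space) > 0"
proof -
  have ge: "bump_vol TYPE('a) \<ge> 0" unfolding bump_vol_def by (simp add: bump_bounds)
  have "bump_vol TYPE('a) \<noteq> 0"
  proof
    assume "bump_vol TYPE('a) = 0"
    then have ae: "AE z in lborel. bump 0 1 (z::'a) = 0"
      using integral_nonneg_eq_0_iff_AE[OF integrable_bump] by (auto simp: bump_vol_def bump_bounds)
    have "AE z in lborel. z \<notin> ball (0::'a) 1"
      using ae by eventually_elim (metis bump_pos_iff less_irrefl zero_less_one)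
    then have "emeasure lborel (ball (0::'a) 1) = 0" by (subst (asm) AE_iff_measurable[of "ball 0 1"]) auto
    then show False using content_ball_pos[of 1 "0::'a"] by (simp add: measure_def)
  qed
  with ge show ?thesis by simp
qed

lemma continuous_integrable_bump:
  fixes f :: "'a::euclidean_space \<Rightarrow> real"
  assumes f: "continuous_on UNIV f"
  shows "integrable lborel (\<lambda>z. bump 0 1 z * f (x + \<tau> *\<^sub>R z))"
proof (rule integrable_continuous_compact_support[of _ "cball 0 1"])
  show "continuous_on UNIV (\<lambda>z. bump 0 1 z * f (x + \<tau> *\<^sub>R z))"
    by (intro continuous_on_mult C0_infty_continuous[OF bump_C0_infty] continuous_on_compose2[OF f] continuous_intros) auto
qed (auto simp: bump_eq_0)

lemma avg_nn:
  fixes f :: "'a::euclidean_space \<Rightarrow> real"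
  assumes f: "continuous_on UNIV f" "\<And>y. f y \<ge> 0"
  shows "ennreal (avg \<tau> f x) = (\<integral>\<^sup>+z. ennreal (bump 0 1 z / bump_vol TYPE('a) * f (x + \<tau> *\<^sub>R z)) \<partial>lborel)" "avg \<tau> f x \<ge> 0"
proof -
  have i: "integrable lborel (\<lambda>z. bump 0 1 z / bump_vol TYPE('a) * f (x + \<tau> *\<^sub>R z))"
    using integrable_divide_zero[OF continuous_integrable_bump[OF f(1), of x \<tau>], of "bump_vol TYPE('a)"] by simp
  have "(\<integral>\<^sup>+z. ennreal (bump 0 1 z / bump_vol TYPE('a) * f (x + \<tau> *\<^sub>R z)) \<partial>lborel)
      = ennreal (\<integral>z. bump 0 1 z / bump_vol TYPE('a) * f (x + \<tau> *\<^sub>R z) \<partial>lborel)"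
    using f bump_bounds(1) bump_vol_pos[where 'a = 'a]
    by (intro nn_integral_eq_integral i AE_I2 mult_nonneg_nonneg divide_nonneg_pos) auto
  then show "ennreal (avg \<tau> f x) = (\<integral>\<^sup>+z. ennreal (bump 0 1 z / bump_vol TYPE('a) * f (x + \<tau> *\<^sub>R z)) \<partial>lborel)"
    by (simp add: avg_def)
  show "avg \<tau> f x \<ge> 0" unfolding avg_def
    using f bump_bounds(1) bump_vol_pos[where 'a = 'a] by (intro divide_nonneg_pos integral_nonneg_AE AE_I2 mult_nonneg_nonneg) auto
qed

lemma bump_prob: "emeasure (density lborel (\<lambda>z::'a::euclidean_space. ennreal (bump 0 1 z / bump_vol TYPE('a))))
    (space (density lborel (\<lambda>z::'a. ennreal (bump 0 1 z / bump_vol TYPE('a))))) = 1"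
proof -
  have "(\<integral>\<^sup>+z. ennreal (bump 0 1 (z::'a) / bump_vol TYPE('a)) \<partial>lborel) = ennreal (\<integral>z. bump 0 1 (z::'a) / bump_vol TYPE('a) \<partial>lborel)"
    using bump_bounds(1) bump_vol_pos[where 'a = 'a] integrable_bump
    by (intro nn_integral_eq_integral AE_I2 divide_nonneg_pos integrable_divide_zero) auto
  also have "(\<integral>z. bump 0 1 (z::'a) / bump_vol TYPE('a) \<partial>lborel) = 1"
    using bump_vol_pos[where 'a = 'a] by (simp add: bump_vol_def)
  finally show ?thesis by (subst emeasure_density) auto
qed

lemma avg_powr_le:
  fixes f :: "'a::euclidean_space \<Rightarrow> real"
  assumes p: "p \<ge> 1" and f: "continuous_on UNIV f" "\<And>y. f y \<ge> 0"
  shows "avg \<tau> f x powr p \<le> avg \<tau> (\<lambda>y. f y powr p) x"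
proof -
  let ?M = "density lborel (\<lambda>z::'a. ennreal (bump 0 1 z / bump_vol TYPE('a)))"
  have fp: "continuous_on UNIV (\<lambda>y. f y powr p)" using p f by (intro continuous_on_powr') auto
  have [measurable]: "f \<in> borel_measurable borel" using f by (simp add: borel_measurable_continuous_onI)
  have nn: "(\<integral>\<^sup>+z. ennreal (h (x + \<tau> *\<^sub>R z)) \<partial>?M) = ennreal (avg \<tau> h x)" if h: "continuous_on UNIV h" "\<And>y. h y \<ge> 0" for h
  proof -
    have [measurable]: "h \<in> borel_measurable borel" using h by (simp add: borel_measurable_continuous_onI)
    have "(\<integral>\<^sup>+z. ennreal (h (x + \<tau> *\<^sub>R z)) \<partial>?M) = (\<integral>\<^sup>+z. ennreal (bump 0 1 z / bump_vol TYPE('a)) * ennreal (h (x + \<tau> *\<^sub>R z)) \<partial>lborel)"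
      by (rule nn_integral_density) measurable
    also have "\<dots> = ennreal (avg \<tau> h x)"
      unfolding avg_nn(1)[OF h] using h bump_bounds(1) bump_vol_pos[where 'a = 'a]
      by (intro nn_integral_cong ennreal_mult[symmetric]) (auto intro!: divide_nonneg_pos)
    finally show ?thesis .
  qed
  have "ennreal (avg \<tau> f x powr p) \<le> (\<integral>\<^sup>+z. ennreal (f (x + \<tau> *\<^sub>R z) powr p) \<partial>?M)"
    using f by (intro Jensen_powr_nn[OF bump_prob p] avg_nn(2)[OF f]) (auto simp: nn[OF f])
  also have "\<dots> = ennreal (avg \<tau> (\<lambda>y. f y powr p) x)" by (rule nn[OF fp]) simp
  finally show ?thesis using avg_nn(2)[OF fp] by simp
qed

lemma avg_le:
  fixes f :: "'a::euclidean_space \<Rightarrow> real"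
  assumes \<tau>: "\<tau> > 0" and f: "continuous_on UNIV f" "\<And>y. f y \<ge> 0" and S: "S \<in> sets borel" "ball x \<tau> \<subseteq> S"
    and G: "(\<integral>\<^sup>+y. indicator S y * ennreal (f y) \<partial>lborel) \<le> ennreal G" "G \<ge> 0"
  shows "avg \<tau> f x \<le> G / (bump_vol TYPE('a) * \<tau> ^ DIM('a))"
proof -
  have V: "bump_vol TYPE('a) > 0" by (rule bump_vol_pos)
  have [measurable]: "f \<in> borel_measurable borel" using f by (simp add: borel_measurable_continuous_onI)
  note S(1)[measurable]
  have "ennreal (bump_vol TYPE('a) * \<tau> ^ DIM('a) * avg \<tau> f x) = ennreal (bump_vol TYPE('a) * \<tau> ^ DIM('a)) * ennreal (avg \<tau> f x)"
    using V \<tau> avg_nn(2)[OF f] by (intro ennreal_mult) auto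
  also have "\<dots> = (\<integral>\<^sup>+z. ennreal (bump_vol TYPE('a) * \<tau> ^ DIM('a)) * ennreal (bump 0 1 z / bump_vol TYPE('a) * f (x + \<tau> *\<^sub>R z)) \<partial>lborel)"
    unfolding avg_nn(1)[OF f] by (rule nn_integral_cmult[symmetric]) measurable
  also have "\<dots> \<le> (\<integral>\<^sup>+z. ennreal (\<tau> ^ DIM('a)) * (indicator S (x + \<tau> *\<^sub>R z) * ennreal (f (x + \<tau> *\<^sub>R z))) \<partial>lborel)"
  proof (rule nn_integral_mono)
    fix z :: 'a
    have "ennreal (bump_vol TYPE('a) * \<tau> ^ DIM('a)) * ennreal (bump 0 1 z / bump_vol TYPE('a) * f (x + \<tau> *\<^sub>R z))
      = ennreal (\<tau> ^ DIM('a) * (bump 0 1 z * f (x + \<tau> *\<^sub>R z)))"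
      using V \<tau> f(2) bump_bounds(1)[of 0 1 z] by (subst ennreal_mult[symmetric]) (auto intro!: mult_nonneg_nonneg divide_nonneg_pos)
    also have "\<dots> \<le> ennreal (\<tau> ^ DIM('a)) * (indicator S (x + \<tau> *\<^sub>R z) * ennreal (f (x + \<tau> *\<^sub>R z)))"
    proof (cases "z \<in> ball 0 1")
      case True
      then have "dist x (x + \<tau> *\<^sub>R z) < \<tau>" using \<tau> by (simp add: dist_norm)
      then have "x + \<tau> *\<^sub>R z \<in> S" using S(2) by auto
      moreover have "bump 0 1 z * f (x + \<tau> *\<^sub>R z) \<le> 1 * f (x + \<tau> *\<^sub>R z)"
        by (intro mult_right_mono bump_bounds f)
      ultimately show ?thesis using \<tau> f(2) by (simp add: ennreal_mult[symmetric] ennreal_leI)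
    qed (simp add: bump_eq_0)
    finally show "ennreal (bump_vol TYPE('a) * \<tau> ^ DIM('a)) * ennreal (bump 0 1 z / bump_vol TYPE('a) * f (x + \<tau> *\<^sub>R z))
        \<le> ennreal (\<tau> ^ DIM('a)) * (indicator S (x + \<tau> *\<^sub>R z) * ennreal (f (x + \<tau> *\<^sub>R z)))" .
  qed
  also have "\<dots> = ennreal (\<tau> ^ DIM('a)) * (\<integral>\<^sup>+z. indicator S (x + \<tau> *\<^sub>R z) * ennreal (f (x + \<tau> *\<^sub>R z)) \<partial>lborel)"
    by (rule nn_integral_cmult) measurable
  also have "\<dots> = (\<integral>\<^sup>+y. indicator S y * ennreal (f y) \<partial>lborel)"
    by (rule nn_integral_lborel_affine[symmetric, OF \<tau>]) measurable
  also have "\<dots> \<le> ennreal G" by (rule G)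
  finally have "bump_vol TYPE('a) * \<tau> ^ DIM('a) * avg \<tau> f x \<le> G" using G(2) by simp
  then show ?thesis using V \<tau> by (simp add: field_simps)
qed

text \<open>The difference \<open>\<phi> x - avg \<epsilon> \<phi> x\<close> is an integral over \<open>s\<close> of averages of \<open>norm (grad \<phi>)\<close> at
  scale \<open>\<epsilon> * s ^ k\<close>. Such an average at scale \<open>\<tau>\<close> is bounded in \<open>L\<^sup>p\<close>, and uniformly by
  \<open>\<tau> powr (- N / p)\<close>. The t-th power of an average is its p-th power times a factor controlled by
  the uniform bound; \<open>t\<close> is subcritical exactly when the resulting power of \<open>\<epsilon>\<close>
  is positive, and then for large \<open>k\<close> no negative power of \<open>s\<close> is left.\<close>

lemma avg_Poincare:
  fixes p t :: real
  defines "e \<equiv> t - DIM('a::euclidean_space) * (t - p) / p"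
  assumes p: "p \<ge> 1" and t: "p \<le> t" and e: "e > 0"
  obtains C where "C > 0" "\<And>(\<phi> :: 'a \<Rightarrow> real) \<Omega> S S' \<epsilon> G. \<phi> \<in> C0_infty \<Omega> \<Longrightarrow> \<epsilon> > 0 \<Longrightarrow>
      S \<in> sets borel \<Longrightarrow> S' \<in> sets borel \<Longrightarrow> (\<And>x y. x \<in> S \<Longrightarrow> dist x y < \<epsilon> \<Longrightarrow> y \<in> S') \<Longrightarrow> G \<ge> 0 \<Longrightarrow>
      (\<integral>\<^sup>+y. indicator S' y * ennreal (norm (grad \<phi> y) powr p) \<partial>lborel) \<le> ennreal G \<Longrightarrow>
      (\<integral>\<^sup>+x. indicator S x * ennreal (\<bar>\<phi> x - avg \<epsilon> \<phi> x\<bar> powr t) \<partial>lborel) \<le> ennreal (C * \<epsilon> powr e * G powr (t / p))"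
proof -
  define N where "N = real DIM('a)"
  define V where "V = bump_vol TYPE('a)"
  have V: "V > 0" unfolding V_def by (rule bump_vol_pos)
  obtain k0 :: nat where "t / e < real k0" using reals_Archimedean2 by blast
  then have k0: "t \<le> real k0 * e" using e by (simp add: field_simps)
  define k where "k = max 2 k0"
  have k: "k \<ge> 2" "t \<le> real k * e"
  proof -
    have "real k0 * e \<le> real k * e" using e by (intro mult_right_mono) (auto simp: k_def)
    then show "t \<le> real k * e" using k0 by linarith
  qed (simp add: k_def)
  have t1: "t \<ge> 1" using p t by simp
  define C where "C = real k powr t * (1 / V) powr ((t - p) / p)"
  have C: "C > 0" using k V by (simp add: C_def)
  have main: "(\<integral>\<^sup>+x. indicator S x * ennreal (\<bar>\<phi> x - avg \<epsilon> \<phi> x\<bar> powr t) \<partial>lborel) \<le> ennreal (C * \<epsilon> powr e * G powr (t / p))"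
    if \<phi>: "\<phi> \<in> C0_infty \<Omega>" and \<epsilon>: "\<epsilon> > 0" and S [measurable]: "S \<in> sets borel" and S' [measurable]: "S' \<in> sets borel"
      and SS: "\<And>x y. x \<in> S \<Longrightarrow> dist x y < \<epsilon> \<Longrightarrow> y \<in> S'" and G: "G \<ge> 0"
      "(\<integral>\<^sup>+y. indicator S' y * ennreal (norm (grad \<phi> y) powr p) \<partial>lborel) \<le> ennreal G"
    for \<phi> :: "'a \<Rightarrow> real" and \<Omega> S S' \<epsilon> G
  proof -
    define g where "g y = norm (grad \<phi> y)" for y
    have gc: "continuous_on UNIV g" unfolding g_def[abs_def] by (intro continuous_on_norm continuous_on_grad[OF \<phi>])
    have g0: "g y \<ge> 0" for y by (simp add: g_def)
    have gpc: "continuous_on UNIV (\<lambda>y. g y powr p)" using p by (intro continuous_on_powr' gc) (auto simp: g0)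
    have gm [measurable]: "g \<in> borel_measurable borel" using gc by (simp add: borel_measurable_continuous_onI)
    have \<phi>m [measurable]: "\<phi> \<in> borel_measurable borel" "grad \<phi> \<in> borel_measurable borel"
      by (rule borel_measurable_C0_infty[OF \<phi>])+
    have \<phi>c: "continuous_on UNIV \<phi>" by (rule C0_infty_continuous[OF \<phi>])
    let ?w = "\<lambda>z::'a. bump 0 1 z / V"
    have w0: "?w z \<ge> 0" for z using V bump_bounds(1)[of 0 1 z] by simp
    let ?U = "restrict_space lborel {0..1::real}"
    have U1: "emeasure ?U (space ?U) = 1" by (simp add: emeasure_restrict_space space_restrict_space)
    have pw: "ennreal (\<bar>\<phi> x - avg \<epsilon> \<phi> x\<bar> powr t)
      \<le> ennreal (C * \<epsilon> powr e * G powr ((t - p) / p)) *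
        (\<integral>\<^sup>+s. indicator {0..1} s * (\<integral>\<^sup>+z. ennreal (?w z * g (x + (s ^ k * \<epsilon>) *\<^sub>R z) powr p) \<partial>lborel) \<partial>lborel)"
      if x: "x \<in> S" for x
    proof -
      define m where "m s = avg (s ^ k * \<epsilon>) g x" for s
      have m0: "m s \<ge> 0" for s unfolding m_def by (rule avg_nn(2)[OF gc g0])
      have mm [measurable]: "m \<in> borel_measurable borel" unfolding m_def[abs_def] avg_def by measurable
      define h where "h s = real k * \<bar>s\<bar> ^ (k - 1) * \<epsilon> * m s" for s
      have h0: "h s \<ge> 0" for s using \<epsilon> m0 by (simp add: h_def)
      have hm [measurable]: "h \<in> borel_measurable borel" unfolding h_def[abs_def] by measurable
      \<comment> \<open>the difference as a double integral\<close>
      have d1: "\<bar>\<phi> x - avg \<epsilon> \<phi> x\<bar> \<le> avg \<epsilon> (\<lambda>y. \<bar>\<phi> y - \<phi> x\<bar>) x"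
      proof -
        have i1: "integrable lborel (\<lambda>z. bump 0 1 z * \<phi> (x + \<epsilon> *\<^sub>R z))" by (rule continuous_integrable_bump[OF \<phi>c])
        have i2: "integrable lborel (\<lambda>z::'a. bump 0 1 z * \<phi> x)"
          by (rule integrable_mult_left[OF integrable_bump])
        have c: "continuous_on UNIV (\<lambda>y. \<bar>\<phi> y - \<phi> x\<bar>)" by (intro continuous_intros \<phi>c)
        have i3: "integrable lborel (\<lambda>z. bump 0 1 z * \<bar>\<phi> (x + \<epsilon> *\<^sub>R z) - \<phi> x\<bar>)"
          using continuous_integrable_bump[OF c, of x \<epsilon>] by simp
        have "\<phi> x - avg \<epsilon> \<phi> x = (V * \<phi> x - (\<integral>z. bump 0 1 z * \<phi> (x + \<epsilon> *\<^sub>R z) \<partial>lborel)) / V"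
          using V by (simp add: avg_def V_def[symmetric] field_simps)
        also have "V * \<phi> x = (\<integral>z. bump 0 1 (z::'a) * \<phi> x \<partial>lborel)" by (simp add: V_def bump_vol_def)
        also have "(\<integral>z. bump 0 1 (z::'a) * \<phi> x \<partial>lborel) - (\<integral>z. bump 0 1 z * \<phi> (x + \<epsilon> *\<^sub>R z) \<partial>lborel)
           = (\<integral>z. bump 0 1 z * \<phi> x - bump 0 1 z * \<phi> (x + \<epsilon> *\<^sub>R z) \<partial>lborel)"
          by (rule Bochner_Integration.integral_diff[symmetric, OF i2 i1])
        finally have eq: "\<phi> x - avg \<epsilon> \<phi> x = (\<integral>z. bump 0 1 z * \<phi> x - bump 0 1 z * \<phi> (x + \<epsilon> *\<^sub>R z) \<partial>lborel) / V" .
        have "\<bar>\<integral>z. bump 0 1 z * \<phi> x - bump 0 1 z * \<phi> (x + \<epsilon> *\<^sub>R z) \<partial>lborel\<bar>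
            \<le> (\<integral>z. bump 0 1 z * \<bar>\<phi> (x + \<epsilon> *\<^sub>R z) - \<phi> x\<bar> \<partial>lborel)"
        proof (rule order_trans[OF integral_abs_bound], rule integral_mono)
          show "integrable lborel (\<lambda>z. \<bar>bump 0 1 z * \<phi> x - bump 0 1 z * \<phi> (x + \<epsilon> *\<^sub>R z)\<bar>)"
            by (intro integrable_abs Bochner_Integration.integrable_diff i1 i2)
          fix z :: 'a
          have "bump 0 1 z * \<phi> x - bump 0 1 z * \<phi> (x + \<epsilon> *\<^sub>R z) = bump 0 1 z * (\<phi> x - \<phi> (x + \<epsilon> *\<^sub>R z))"
            by (simp add: algebra_simps)
          then show "\<bar>bump 0 1 z * \<phi> x - bump 0 1 z * \<phi> (x + \<epsilon> *\<^sub>R z)\<bar> \<le> bump 0 1 z * \<bar>\<phi> (x + \<epsilon> *\<^sub>R z) - \<phi> x\<bar>"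
            using bump_bounds(1)[of 0 1 z] by (simp add: abs_mult abs_minus_commute)
        qed (rule i3)
        then show ?thesis unfolding eq unfolding avg_def V_def[symmetric] using V by (simp add: divide_right_mono)
      qed
      have c: "continuous_on UNIV (\<lambda>y. \<bar>\<phi> y - \<phi> x\<bar>)" by (intro continuous_intros \<phi>c)
      have "ennreal \<bar>\<phi> x - avg \<epsilon> \<phi> x\<bar> \<le> ennreal (avg \<epsilon> (\<lambda>y. \<bar>\<phi> y - \<phi> x\<bar>) x)"
        by (rule ennreal_leI[OF d1])
      also have "\<dots> = (\<integral>\<^sup>+z. ennreal (?w z * \<bar>\<phi> (x + \<epsilon> *\<^sub>R z) - \<phi> x\<bar>) \<partial>lborel)"
        by (subst avg_nn(1)[OF c]) (auto simp: V_def)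
      also have "\<dots> \<le> (\<integral>\<^sup>+z. (\<integral>\<^sup>+s. indicator {0..1} s * ennreal (real k * \<bar>s\<bar> ^ (k - 1) * \<epsilon> * (?w z * g (x + (s ^ k * \<epsilon>) *\<^sub>R z))) \<partial>lborel) \<partial>lborel)"
      proof (rule nn_integral_mono)
        fix z :: 'a
        show "ennreal (?w z * \<bar>\<phi> (x + \<epsilon> *\<^sub>R z) - \<phi> x\<bar>)
          \<le> (\<integral>\<^sup>+s. indicator {0..1} s * ennreal (real k * \<bar>s\<bar> ^ (k - 1) * \<epsilon> * (?w z * g (x + (s ^ k * \<epsilon>) *\<^sub>R z))) \<partial>lborel)"
        proof (cases "z \<in> ball 0 1")
          case False
          then show ?thesis by (simp add: bump_eq_0)
        next
          case True
          have "ennreal (?w z * \<bar>\<phi> (x + \<epsilon> *\<^sub>R z) - \<phi> x\<bar>) = ennreal (?w z) * ennreal (\<bar>\<phi> (x + \<epsilon> *\<^sub>R z) - \<phi> x\<bar> powr 1)"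
            using w0[of z] by (subst ennreal_mult[symmetric]) auto
          also have "\<dots> \<le> ennreal (?w z) * (\<integral>\<^sup>+s. indicator {0..1} s *
              ennreal ((real k * s ^ (k - 1) * norm (\<epsilon> *\<^sub>R z) * norm (grad \<phi> (x + s ^ k *\<^sub>R (\<epsilon> *\<^sub>R z)))) powr 1) \<partial>lborel)"
            using k by (intro mult_left_mono C0_infty_segment[OF \<phi>]) auto
          also have "\<dots> = (\<integral>\<^sup>+s. ennreal (?w z) * (indicator {0..1} s *
              ennreal ((real k * s ^ (k - 1) * norm (\<epsilon> *\<^sub>R z) * norm (grad \<phi> (x + s ^ k *\<^sub>R (\<epsilon> *\<^sub>R z)))) powr 1)) \<partial>lborel)"
            by (rule nn_integral_cmult[symmetric]) measurable
          also have "\<dots> \<le> (\<integral>\<^sup>+s. indicator {0..1} s * ennreal (real k * \<bar>s\<bar> ^ (k - 1) * \<epsilon> * (?w z * g (x + (s ^ k * \<epsilon>) *\<^sub>R z))) \<partial>lborel)"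
          proof (rule nn_integral_mono)
            fix s :: real
            have "?w z * (real k * s ^ (k - 1) * (\<epsilon> * norm z) * g (x + (s ^ k * \<epsilon>) *\<^sub>R z))
              \<le> ?w z * (real k * s ^ (k - 1) * (\<epsilon> * 1) * g (x + (s ^ k * \<epsilon>) *\<^sub>R z))" if "s \<ge> 0"
              using that True \<epsilon> w0[of z] by (intro mult_left_mono mult_right_mono) (auto simp: g0)
            then show "ennreal (?w z) * (indicator {0..1} s *
              ennreal ((real k * s ^ (k - 1) * norm (\<epsilon> *\<^sub>R z) * norm (grad \<phi> (x + s ^ k *\<^sub>R (\<epsilon> *\<^sub>R z)))) powr 1))
              \<le> indicator {0..1} s * ennreal (real k * \<bar>s\<bar> ^ (k - 1) * \<epsilon> * (?w z * g (x + (s ^ k * \<epsilon>) *\<^sub>R z)))"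
              using \<epsilon> w0[of z] by (cases "s \<in> {0..1}")
                (auto simp: ennreal_mult[symmetric] g_def mult_ac intro!: ennreal_leI)
          qed
          finally show ?thesis .
        qed
      qed
      also have "\<dots> = (\<integral>\<^sup>+s. (\<integral>\<^sup>+z. indicator {0..1} s * ennreal (real k * \<bar>s\<bar> ^ (k - 1) * \<epsilon> * (?w z * g (x + (s ^ k * \<epsilon>) *\<^sub>R z))) \<partial>lborel) \<partial>lborel)"
        by (rule lborel_pair.Fubini') measurable
      also have "\<dots> = (\<integral>\<^sup>+s. indicator {0..1} s * ennreal (h s) \<partial>lborel)"
      proof (rule nn_integral_cong)
        fix s :: real
        have "(\<integral>\<^sup>+z. indicator {0..1} s * ennreal (real k * \<bar>s\<bar> ^ (k - 1) * \<epsilon> * (?w z * g (x + (s ^ k * \<epsilon>) *\<^sub>R z))) \<partial>lborel)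
          = (\<integral>\<^sup>+z. (indicator {0..1} s * ennreal (real k * \<bar>s\<bar> ^ (k - 1) * \<epsilon>)) * ennreal (?w z * g (x + (s ^ k * \<epsilon>) *\<^sub>R z)) \<partial>lborel)"
        proof (rule nn_integral_cong)
          fix z :: 'a
          define A where "A = real k * \<bar>s\<bar> ^ (k - 1) * \<epsilon>"
          have "A \<ge> 0" using \<epsilon> by (simp add: A_def)
          then show "indicator {0..1} s * ennreal (real k * \<bar>s\<bar> ^ (k - 1) * \<epsilon> * (?w z * g (x + (s ^ k * \<epsilon>) *\<^sub>R z)))
            = (indicator {0..1} s * ennreal (real k * \<bar>s\<bar> ^ (k - 1) * \<epsilon>)) * ennreal (?w z * g (x + (s ^ k * \<epsilon>) *\<^sub>R z))"
            unfolding A_def[symmetric] by (simp only: ennreal_mult' mult.assoc)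
        qed
        also have "\<dots> = (indicator {0..1} s * ennreal (real k * \<bar>s\<bar> ^ (k - 1) * \<epsilon>)) * ennreal (m s)"
          unfolding m_def avg_nn(1)[OF gc g0] V_def by (rule nn_integral_cmult) measurable
        also have "\<dots> = indicator {0..1} s * ennreal (h s)"
          using \<epsilon> m0 by (simp add: h_def ennreal_mult mult.assoc)
        finally show "(\<integral>\<^sup>+z. indicator {0..1} s * ennreal (real k * \<bar>s\<bar> ^ (k - 1) * \<epsilon> * (?w z * g (x + (s ^ k * \<epsilon>) *\<^sub>R z))) \<partial>lborel)
          = indicator {0..1} s * ennreal (h s)" .
      qed
      also have "\<dots> = (\<integral>\<^sup>+s. ennreal (h s) \<partial>?U)"
        by (subst nn_integral_restrict_space) (auto simp: mult.commute)
      finally have "ennreal (\<bar>\<phi> x - avg \<epsilon> \<phi> x\<bar> powr t) \<le> (\<integral>\<^sup>+s. ennreal (h s powr t) \<partial>?U)"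
        by (intro Jensen_powr_nn[OF U1 t1] h0 measurable_restrict_space1) auto
      also have "\<dots> = (\<integral>\<^sup>+s. indicator {0..1} s * ennreal (h s powr t) \<partial>lborel)"
        by (subst nn_integral_restrict_space) (auto simp: mult.commute)
      also have "\<dots> \<le> (\<integral>\<^sup>+s. ennreal (C * \<epsilon> powr e * G powr ((t - p) / p)) *
          (indicator {0..1} s * (\<integral>\<^sup>+z. ennreal (?w z * g (x + (s ^ k * \<epsilon>) *\<^sub>R z) powr p) \<partial>lborel)) \<partial>lborel)"
      proof (rule nn_integral_mono)
        fix s :: real
        have av: "(\<integral>\<^sup>+z. ennreal (?w z * g (x + (s ^ k * \<epsilon>) *\<^sub>R z) powr p) \<partial>lborel) = ennreal (avg (s ^ k * \<epsilon>) (\<lambda>y. g y powr p) x)"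
          unfolding V_def by (rule avg_nn(1)[symmetric, OF gpc]) simp
        have "h s powr t \<le> C * \<epsilon> powr e * G powr ((t - p) / p) * avg (s ^ k * \<epsilon>) (\<lambda>y. g y powr p) x" if s01: "s \<in> {0..1}"
        proof (cases "s = 0")
          case True
          then have "h s = 0" using k by (simp add: h_def)
          then show ?thesis using C avg_nn(2)[OF gpc, of "s ^ k * \<epsilon>" x] by simp
        next
          case False
          then have s: "s > 0" "s \<le> 1" using s01 by auto
          define \<tau> where "\<tau> = s ^ k * \<epsilon>"
          define n where "n = avg \<tau> (\<lambda>y. g y powr p) x"
          have \<tau>: "\<tau> > 0" "\<tau> \<le> \<epsilon>" using s \<epsilon> by (auto simp: \<tau>_def power_le_one mult_left_le_one_le)
          have n0: "n \<ge> 0" unfolding n_def by (rule avg_nn(2)[OF gpc]) simp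
          have mn: "m s powr p \<le> n" unfolding m_def n_def \<tau>_def by (rule avg_powr_le[OF p gc g0])
          have "n \<le> G / (V * \<tau> ^ DIM('a))"
            unfolding n_def V_def using SS[OF x] \<tau> G by (intro avg_le gpc S') (auto simp: g_def)
          also have "\<dots> = (1 / V) * G * \<tau> powr (- N)" using \<tau> by (simp add: N_def powr_minus_divide powr_realpow)
          finally have nG: "n \<le> (1 / V) * G * \<tau> powr (- N)" .
          have "m s powr t = (m s powr p) powr (t / p)" using p by (simp add: powr_powr)
          also have "\<dots> \<le> n powr (t / p)" using mn p t by (intro powr_mono2) auto
          also have "\<dots> = n powr ((t - p) / p) * n"
          proof (cases "n = 0")
            case False
            then have "n powr ((t - p) / p) * n = n powr ((t - p) / p + 1)" using n0 by (simp add: powr_add)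
            then show ?thesis using p by (simp add: diff_divide_distrib)
          qed simp
          also have "\<dots> \<le> ((1 / V) * G * \<tau> powr (- N)) powr ((t - p) / p) * n"
            using nG n0 p t by (intro mult_right_mono powr_mono2) auto
          also have "((1 / V) * G * \<tau> powr (- N)) powr ((t - p) / p)
              = (1 / V) powr ((t - p) / p) * G powr ((t - p) / p) * \<tau> powr (- (N * (t - p) / p))"
          proof -
            have "(\<tau> powr (- N)) powr ((t - p) / p) = \<tau> powr (- (N * (t - p) / p))" by (simp add: powr_powr)
            then show ?thesis by (simp only: powr_mult)
          qed
          finally have mt: "m s powr t \<le> (1 / V) powr ((t - p) / p) * G powr ((t - p) / p) * \<tau> powr (- (N * (t - p) / p)) * n" .
          have "h s powr t = real k powr t * ((s ^ (k - 1)) powr t * \<epsilon> powr t) * m s powr t"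
            using s \<epsilon> m0 by (simp add: h_def powr_mult mult_ac)
          also have "\<dots> \<le> real k powr t * ((s ^ (k - 1)) powr t * \<epsilon> powr t) *
              ((1 / V) powr ((t - p) / p) * G powr ((t - p) / p) * \<tau> powr (- (N * (t - p) / p)) * n)"
            by (intro mult_left_mono mt) auto
          also have "\<dots> = C * G powr ((t - p) / p) * (((s ^ (k - 1)) powr t * \<epsilon> powr t) * \<tau> powr (- (N * (t - p) / p))) * n"
            by (simp add: C_def mult_ac)
          also have "((s ^ (k - 1)) powr t * \<epsilon> powr t) * \<tau> powr (- (N * (t - p) / p))
              = s powr (real (k - 1) * t + real k * (- (N * (t - p) / p))) * \<epsilon> powr (t + - (N * (t - p) / p))"
          proof -
            have "(s ^ (k - 1)) powr t = s powr (real (k - 1) * t)" using s by (simp add: powr_realpow[symmetric] powr_powr)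
            moreover have "\<tau> powr r = s powr (real k * r) * \<epsilon> powr r" for r
              using s \<epsilon> by (simp add: \<tau>_def powr_mult powr_realpow[symmetric] powr_powr)
            ultimately show ?thesis by (simp only: powr_add mult.assoc mult.commute mult.left_commute)
          qed
          also have "t + - (N * (t - p) / p) = e" by (simp add: e_def N_def)
          also have "C * G powr ((t - p) / p) * (s powr (real (k - 1) * t + real k * (- (N * (t - p) / p))) * \<epsilon> powr e) * n
              \<le> C * G powr ((t - p) / p) * (1 * \<epsilon> powr e) * n"
          proof -
            have "real (k - 1) * t + real k * (- (N * (t - p) / p)) = real k * e - t"
              using k by (simp add: e_def N_def of_nat_diff algebra_simps)
            then have "s powr (real (k - 1) * t + real k * (- (N * (t - p) / p))) \<le> s powr 0"
              using k s by (intro powr_mono') auto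
            then have "s powr (real (k - 1) * t + real k * (- (N * (t - p) / p))) \<le> 1" using s by simp
            then show ?thesis using C n0 by (intro mult_right_mono mult_left_mono) auto
          qed
          finally show ?thesis by (simp add: n_def \<tau>_def mult_ac)
        qed
        then show "indicator {0..1} s * ennreal (h s powr t) \<le> ennreal (C * \<epsilon> powr e * G powr ((t - p) / p)) *
          (indicator {0..1} s * (\<integral>\<^sup>+z. ennreal (?w z * g (x + (s ^ k * \<epsilon>) *\<^sub>R z) powr p) \<partial>lborel))"
          unfolding av using C avg_nn(2)[OF gpc, of "s ^ k * \<epsilon>" x]
          by (cases "s \<in> {0..1}") (auto simp: ennreal_mult[symmetric] intro!: ennreal_leI)
      qed
      also have "\<dots> = ennreal (C * \<epsilon> powr e * G powr ((t - p) / p)) *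
        (\<integral>\<^sup>+s. indicator {0..1} s * (\<integral>\<^sup>+z. ennreal (?w z * g (x + (s ^ k * \<epsilon>) *\<^sub>R z) powr p) \<partial>lborel) \<partial>lborel)"
        by (rule nn_integral_cmult) measurable
      finally show ?thesis .
    qed
    let ?c = "ennreal (C * \<epsilon> powr e * G powr ((t - p) / p))"
    have "(\<integral>\<^sup>+x. indicator S x * ennreal (\<bar>\<phi> x - avg \<epsilon> \<phi> x\<bar> powr t) \<partial>lborel)
       \<le> (\<integral>\<^sup>+x. ?c * (\<integral>\<^sup>+s. (\<integral>\<^sup>+z. indicator S x * indicator {0..1} s * ennreal (?w z * g (x + (s ^ k * \<epsilon>) *\<^sub>R z) powr p) \<partial>lborel) \<partial>lborel) \<partial>lborel)"
    proof (rule nn_integral_mono)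
      fix x :: 'a
      show "indicator S x * ennreal (\<bar>\<phi> x - avg \<epsilon> \<phi> x\<bar> powr t)
        \<le> ?c * (\<integral>\<^sup>+s. (\<integral>\<^sup>+z. indicator S x * indicator {0..1} s * ennreal (?w z * g (x + (s ^ k * \<epsilon>) *\<^sub>R z) powr p) \<partial>lborel) \<partial>lborel)"
      proof (cases "x \<in> S")
        case True
        have "(\<integral>\<^sup>+z. indicator S x * indicator {0..1} s * ennreal (?w z * g (x + (s ^ k * \<epsilon>) *\<^sub>R z) powr p) \<partial>lborel)
          = indicator {0..1} s * (\<integral>\<^sup>+z. ennreal (?w z * g (x + (s ^ k * \<epsilon>) *\<^sub>R z) powr p) \<partial>lborel)" for s
          using True by (subst nn_integral_cmult[symmetric]) auto
        then show ?thesis using pw[OF True] True by simp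
      qed simp
    qed
    also have "\<dots> = ?c * (\<integral>\<^sup>+x. (\<integral>\<^sup>+s. (\<integral>\<^sup>+z. indicator S x * indicator {0..1} s * ennreal (?w z * g (x + (s ^ k * \<epsilon>) *\<^sub>R z) powr p) \<partial>lborel) \<partial>lborel) \<partial>lborel)"
      by (rule nn_integral_cmult) measurable
    also have "(\<integral>\<^sup>+x. (\<integral>\<^sup>+s. (\<integral>\<^sup>+z. indicator S x * indicator {0..1} s * ennreal (?w z * g (x + (s ^ k * \<epsilon>) *\<^sub>R z) powr p) \<partial>lborel) \<partial>lborel) \<partial>lborel)
       = (\<integral>\<^sup>+s. (\<integral>\<^sup>+x. (\<integral>\<^sup>+z. indicator S x * indicator {0..1} s * ennreal (?w z * g (x + (s ^ k * \<epsilon>) *\<^sub>R z) powr p) \<partial>lborel) \<partial>lborel) \<partial>lborel)"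
      by (rule lborel_pair.Fubini') measurable
    also have "\<dots> = (\<integral>\<^sup>+s. (\<integral>\<^sup>+z. (\<integral>\<^sup>+x. indicator S x * indicator {0..1} s * ennreal (?w z * g (x + (s ^ k * \<epsilon>) *\<^sub>R z) powr p) \<partial>lborel) \<partial>lborel) \<partial>lborel)"
      by (intro nn_integral_cong lborel_pair.Fubini') measurable
    also have "\<dots> \<le> (\<integral>\<^sup>+s. indicator {0..1::real} s * ennreal G \<partial>lborel)"
    proof (rule nn_integral_mono)
      fix s :: real
      show "(\<integral>\<^sup>+z. (\<integral>\<^sup>+x. indicator S x * indicator {0..1} s * ennreal (?w z * g (x + (s ^ k * \<epsilon>) *\<^sub>R z) powr p) \<partial>lborel) \<partial>lborel)
        \<le> indicator {0..1::real} s * ennreal G"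
      proof (cases "s \<in> {0..1}")
        case True
        have "(\<integral>\<^sup>+z. (\<integral>\<^sup>+x. indicator S x * indicator {0..1} s * ennreal (?w z * g (x + (s ^ k * \<epsilon>) *\<^sub>R z) powr p) \<partial>lborel) \<partial>lborel)
          \<le> (\<integral>\<^sup>+z. ennreal G * ennreal (?w z) \<partial>lborel)"
        proof (rule nn_integral_mono)
          fix z :: 'a
          show "(\<integral>\<^sup>+x. indicator S x * indicator {0..1} s * ennreal (?w z * g (x + (s ^ k * \<epsilon>) *\<^sub>R z) powr p) \<partial>lborel) \<le> ennreal G * ennreal (?w z)"
          proof (cases "z \<in> ball 0 1")
            case False
            then show ?thesis by (simp add: bump_eq_0)
          next
            case z: True
            define v where "v = (s ^ k * \<epsilon>) *\<^sub>R z"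
            have sk: "\<bar>s ^ k\<bar> \<le> 1" using True by (auto simp: power_le_one)
            have "norm v = \<bar>s ^ k\<bar> * (\<epsilon> * norm z)" using \<epsilon> by (simp add: v_def abs_mult)
            also have "\<dots> \<le> 1 * (\<epsilon> * norm z)" using sk \<epsilon> by (intro mult_right_mono) auto
            also have "\<dots> < \<epsilon>" using z \<epsilon> by simp
            finally have v: "norm v < \<epsilon>" .
            have "(\<integral>\<^sup>+x. indicator S x * indicator {0..1} s * ennreal (?w z * g (x + (s ^ k * \<epsilon>) *\<^sub>R z) powr p) \<partial>lborel)
              \<le> (\<integral>\<^sup>+x. ennreal (?w z) * (indicator S' (v + 1 *\<^sub>R x) * ennreal (g (v + 1 *\<^sub>R x) powr p)) \<partial>lborel)"
            proof (rule nn_integral_mono)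
              fix x :: 'a
              have "x \<in> S \<Longrightarrow> v + x \<in> S'" using SS[of x "v + x"] v by (simp add: dist_norm norm_minus_commute)
              then show "indicator S x * indicator {0..1} s * ennreal (?w z * g (x + (s ^ k * \<epsilon>) *\<^sub>R z) powr p)
                \<le> ennreal (?w z) * (indicator S' (v + 1 *\<^sub>R x) * ennreal (g (v + 1 *\<^sub>R x) powr p))"
                using w0[of z] True ennreal_mult'[OF w0[of z], of "g (v + x) powr p"]
                by (cases "x \<in> S") (auto simp: v_def[symmetric] add.commute)
            qed
            also have "\<dots> = ennreal (?w z) * (\<integral>\<^sup>+x. indicator S' (v + 1 *\<^sub>R x) * ennreal (g (v + 1 *\<^sub>R x) powr p) \<partial>lborel)"
              by (rule nn_integral_cmult) measurable
            also have "(\<integral>\<^sup>+x. indicator S' (v + 1 *\<^sub>R x) * ennreal (g (v + 1 *\<^sub>R x) powr p) \<partial>lborel)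
               = (\<integral>\<^sup>+y. indicator S' y * ennreal (g y powr p) \<partial>lborel)"
              by (subst nn_integral_lborel_affine[OF zero_less_one, of "\<lambda>y. indicator S' y * ennreal (g y powr p)" v]) auto
            also have "ennreal (?w z) * \<dots> \<le> ennreal (?w z) * ennreal G"
              using G by (intro mult_left_mono) (auto simp: g_def)
            finally show ?thesis by (simp add: mult.commute)
          qed
        qed
        also have "\<dots> = ennreal G * (\<integral>\<^sup>+z. ennreal (?w z) \<partial>lborel)" by (rule nn_integral_cmult) measurable
        also have "(\<integral>\<^sup>+z. ennreal (?w z) \<partial>lborel) = 1"
          using bump_prob[where 'a = 'a] by (subst (asm) emeasure_density) (auto simp: V_def)
        finally show ?thesis using True by simp
      qed simp
    qed
    also have "\<dots> = ennreal G"
      by (subst nn_integral_multc) auto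
    finally have "(\<integral>\<^sup>+x. indicator S x * ennreal (\<bar>\<phi> x - avg \<epsilon> \<phi> x\<bar> powr t) \<partial>lborel) \<le> ?c * ennreal G"
      by (simp add: mult_left_mono)
    also have "\<dots> = ennreal (C * \<epsilon> powr e * (G powr ((t - p) / p) * G))"
      using C G by (simp add: ennreal_mult[symmetric] mult_ac)
    also have "G powr ((t - p) / p) * G = G powr (t / p)"
    proof (cases "G = 0")
      case False
      then have "G powr ((t - p) / p) * G = G powr ((t - p) / p + 1)" using G by (simp add: powr_add)
      then show ?thesis using p by (simp add: diff_divide_distrib)
    qed simp
    finally show ?thesis .
  qed
  show ?thesis by (rule that[OF C main])
qed

definition shell :: "real \<Rightarrow> 'a::euclidean_space set" where
  "shell l = {x. l \<le> norm x \<and> norm x < 2 * l}"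

text \<open>An open neighbourhood of the shell; the balls of radius \<open>l / 4\<close> around its points stay away from the origin.\<close>

definition fat_shell :: "real \<Rightarrow> 'a::euclidean_space set" where
  "fat_shell l = {x. l / 2 < norm x \<and> norm x < 3 * l}"

lemma shell_borel [measurable]: "shell l \<in> sets borel"
  unfolding shell_def by measurable

lemma fat_shell_borel [measurable]: "fat_shell l \<in> sets borel"
  unfolding fat_shell_def by measurable

lemma open_fat_shell: "open (fat_shell l :: 'a::euclidean_space set)"
  unfolding fat_shell_def by (intro open_Collect_conj open_Collect_less continuous_intros)

lemma shell_lebesgue [simp]: "shell l \<in> sets lebesgue" "fat_shell l \<in> sets lebesgue"
  by (auto intro: sets_completionI_sets)

lemma shell_subset_fat: "l > 0 \<Longrightarrow> shell l \<subseteq> fat_shell l"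
  by (auto simp: shell_def fat_shell_def)

lemma fat_shell_nbhd:
  assumes "x \<in> fat_shell l" "dist x y < \<epsilon>" "\<epsilon> \<le> l / 4"
  shows "y \<in> cball 0 (4 * l) - ball 0 (l / 4)"
  using assms norm_triangle_ineq2[of y x] norm_triangle_ineq2[of x y]
  by (auto simp: fat_shell_def dist_norm norm_minus_commute)

lemma closed_shell_weight:
  assumes "l > 0"
  obtains b where "b > 0" "\<And>y :: 'a::euclidean_space. y \<in> cball 0 (4 * l) - ball 0 (l / 4) \<Longrightarrow> 1 / norm y powr m \<ge> b"
proof -
  have "compact (cball 0 (4 * l) - ball (0::'a) (l / 4))" by (intro compact_diff) auto
  moreover have "0 \<notin> cball 0 (4 * l) - ball (0::'a) (l / 4)" using assms by simp
  ultimately obtain b where "b > 0" "\<And>y :: 'a. y \<in> cball 0 (4 * l) - ball 0 (l / 4) \<Longrightarrow> 1 / norm y powr m \<ge> b"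
    by (rule weight_bounded_below[of _ m]) blast
  then show ?thesis by (rule that)
qed

lemma nn_integral_le_wmeas:
  fixes f :: "'a::euclidean_space \<Rightarrow> 'b::euclidean_space"
  assumes f: "Lp_fun t (wmeas UNIV m) f" "f \<in> borel_measurable borel" and S: "S \<in> sets borel"
    and b: "b > 0" "\<And>y. y \<in> S \<Longrightarrow> 1 / norm y powr m \<ge> b"
  shows "(\<integral>\<^sup>+y. indicator S y * ennreal (norm (f y) powr t) \<partial>lborel) \<le> ennreal (Lp_int t (wmeas UNIV m) f / b)"
proof -
  note f(2)[measurable] S[measurable]
  have "ennreal b * (\<integral>\<^sup>+y. indicator S y * ennreal (norm (f y) powr t) \<partial>lborel)
      = (\<integral>\<^sup>+y. ennreal b * (indicator S y * ennreal (norm (f y) powr t)) \<partial>lborel)"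
    by (intro nn_integral_cmult[symmetric]) measurable
  also have "\<dots> \<le> (\<integral>\<^sup>+y. ennreal (indicator UNIV y * (norm (f y) powr t / norm y powr m)) \<partial>lborel)"
  proof (rule nn_integral_mono)
    fix y
    show "ennreal b * (indicator S y * ennreal (norm (f y) powr t)) \<le> ennreal (indicator UNIV y * (norm (f y) powr t / norm y powr m))"
    proof (cases "y \<in> S")
      case True
      have "b * norm (f y) powr t \<le> norm (f y) powr t / norm y powr m"
        using mult_right_mono[OF b(2)[OF True], of "norm (f y) powr t"] by simp
      then show ?thesis using True b(1) by (simp add: ennreal_mult[symmetric] ennreal_leI)
    qed simp
  qed
  also have "\<dots> = (\<integral>\<^sup>+y. ennreal (indicator UNIV y * (norm (f y) powr t / norm y powr m)) \<partial>lebesgue)"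
    by (simp add: nn_integral_completion)
  also have "\<dots> = ennreal (Lp_int t (wmeas UNIV m) f)" by (rule nn_integral_wmeas) (use f in auto)
  finally have le: "ennreal b * (\<integral>\<^sup>+y. indicator S y * ennreal (norm (f y) powr t) \<partial>lborel) \<le> ennreal (Lp_int t (wmeas UNIV m) f)" .
  have "(\<integral>\<^sup>+y. indicator S y * ennreal (norm (f y) powr t) \<partial>lborel)
      = ennreal (1 / b) * (ennreal b * (\<integral>\<^sup>+y. indicator S y * ennreal (norm (f y) powr t) \<partial>lborel))"
    using b(1) by (simp add: mult.assoc[symmetric] ennreal_mult[symmetric])
  also have "\<dots> \<le> ennreal (1 / b) * ennreal (Lp_int t (wmeas UNIV m) f)" by (rule mult_left_mono[OF le]) simp
  also have "\<dots> = ennreal (Lp_int t (wmeas UNIV m) f / b)" using b(1) by (simp add: ennreal_mult[symmetric])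
  finally show ?thesis .
qed

lemma Lp_wmeas_0_of_nn_integral:
  fixes f :: "'a::euclidean_space \<Rightarrow> real"
  assumes f: "f \<in> borel_measurable borel" and S: "S \<in> sets borel"
    and c: "(\<integral>\<^sup>+y. indicator S y * ennreal (\<bar>f y\<bar> powr t) \<partial>lborel) \<le> ennreal c" "c \<ge> 0"
  shows "Lp_fun t (wmeas S 0) f" "Lp_int t (wmeas S 0) f \<le> c"
proof -
  have SL: "S \<in> sets lebesgue" using S by (auto intro: sets_completionI_sets)
  have m: "f \<in> borel_measurable (lebesgue_on S)" using f by (auto intro!: measurable_restrict_space1 measurable_completion)
  have "(\<integral>\<^sup>+y. ennreal (indicator S y * (norm (f y) powr t / norm y powr 0)) \<partial>lebesgue)
      \<le> (\<integral>\<^sup>+y. indicator S y * ennreal (\<bar>f y\<bar> powr t) \<partial>lebesgue)"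
    by (intro nn_integral_mono) (auto simp: indicator_def)
  also have "\<dots> \<le> ennreal c" using c(1) by (simp add: nn_integral_completion)
  finally have le: "(\<integral>\<^sup>+y. ennreal (indicator S y * (norm (f y) powr t / norm y powr 0)) \<partial>lebesgue) \<le> ennreal c" .
  have mm: "(\<lambda>y. indicator S y * (norm (f y) powr t / norm y powr 0)) \<in> borel_measurable lebesgue"
    by (rule measurable_completion) (use f S in measurable)
  have i: "integrable lebesgue (\<lambda>y. indicator S y * (norm (f y) powr t / norm y powr 0))"
    using le mm by (intro integrableI_nonneg) (auto intro: le_less_trans)
  then show L: "Lp_fun t (wmeas S 0) f" using m SL by (simp add: Lp_fun_wmeas)
  show "Lp_int t (wmeas S 0) f \<le> c"
    using le c(2) unfolding nn_integral_wmeas[OF SL L] by simp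
qed

lemma Lp_wmeas_0_bounded:
  fixes f :: "'a::euclidean_space \<Rightarrow> real"
  assumes f: "f \<in> borel_measurable borel" and S: "S \<in> sets borel" "bounded S" and t: "t > 0"
    and c: "\<And>y. y \<in> S \<Longrightarrow> \<bar>f y\<bar> \<le> c" "c \<ge> 0"
  shows "Lp_fun t (wmeas S 0) f" "Lp_int t (wmeas S 0) f \<le> c powr t * measure lborel S"
proof -
  have "(\<integral>\<^sup>+y. indicator S y * ennreal (\<bar>f y\<bar> powr t) \<partial>lborel) \<le> (\<integral>\<^sup>+y. ennreal (c powr t) * indicator S y \<partial>lborel)"
    using c t by (intro nn_integral_mono) (auto simp: indicator_def intro!: ennreal_leI powr_mono2)
  also have "\<dots> = ennreal (c powr t) * emeasure lborel S" using S by (simp add: nn_integral_cmult_indicator)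
  also have "\<dots> = ennreal (c powr t * measure lborel S)"
    using emeasure_bounded_finite[OF S(2)] by (simp add: ennreal_mult emeasure_eq_ennreal_measure)
  finally show "Lp_fun t (wmeas S 0) f" "Lp_int t (wmeas S 0) f \<le> c powr t * measure lborel S"
    using Lp_wmeas_0_of_nn_integral[OF f S(1)] by auto
qed

lemma avg_measurable:
  fixes f :: "'a::euclidean_space \<Rightarrow> real"
  assumes [measurable]: "f \<in> borel_measurable borel"
  shows "avg \<tau> f \<in> borel_measurable borel"
  unfolding avg_def[abs_def] by measurable

lemma avg_abs_le:
  fixes f :: "'a::euclidean_space \<Rightarrow> real"
  assumes f: "continuous_on UNIV f"
  shows "\<bar>avg \<tau> f x\<bar> \<le> avg \<tau> (\<lambda>y. \<bar>f y\<bar>) x"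
proof -
  have c: "continuous_on UNIV (\<lambda>y. \<bar>f y\<bar>)" by (intro continuous_intros f)
  have "\<bar>\<integral>z. bump 0 1 z * f (x + \<tau> *\<^sub>R z) \<partial>lborel\<bar> \<le> (\<integral>z. bump 0 1 z * \<bar>f (x + \<tau> *\<^sub>R z)\<bar> \<partial>lborel)"
    by (rule order_trans[OF integral_abs_bound], rule integral_mono)
      (use continuous_integrable_bump[OF f, of x \<tau>] continuous_integrable_bump[OF c, of x \<tau>]
        in \<open>auto simp: abs_mult bump_bounds intro!: integrable_abs\<close>)
  then show ?thesis using bump_vol_pos[where 'a = 'a] by (simp add: avg_def divide_right_mono)
qed

lemma bounded_shell: "bounded (shell l :: 'a::euclidean_space set)"
  by (rule boundedI[of _ "2 * l"]) (auto simp: shell_def)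

text \<open>The last condition says that \<open>t\<close> is below the Sobolev exponent, which is \<open>N * p / (N - p)\<close>
  for \<open>p < N\<close> and infinite otherwise.\<close>

locale subcritical_exponents =
  fixes p \<mu> t :: real and dim_type :: "'a::euclidean_space itself"
  assumes p: "p > 1" and \<mu>: "0 < \<mu> + p" "\<mu> + p < real DIM('a)"
    and t: "p \<le> t" "real DIM('a) * (t - p) < p * t"
begin

lemma p_ge_1: "p \<ge> 1" and t_ge_1: "t \<ge> 1" and t_pos: "t > 0" and \<mu>N: "\<mu> < real DIM('a)"
  using p t \<mu> by auto

lemma subcritical: "t - real DIM('a) * (t - p) / p > 0"
  using t p by (simp add: field_simps)

lemma grad_Lp: "\<phi> \<in> C0_infty \<Omega> \<Longrightarrow> S \<in> sets lebesgue \<Longrightarrow> Lp_fun p (wmeas S \<mu>) (grad (\<phi> :: 'a \<Rightarrow> real))"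
  using Lp_fun_C0_infty(2)[of \<phi> \<Omega> \<mu> p S] p \<mu>N by simp

lemma test_Lp: "\<phi> \<in> C0_infty \<Omega> \<Longrightarrow> S \<in> sets lebesgue \<Longrightarrow> Lp_fun p (wmeas S (\<mu> + p)) (\<phi> :: 'a \<Rightarrow> real)"
  using Lp_fun_C0_infty(1)[of \<phi> \<Omega> "\<mu> + p" p S] p \<mu> by simp

lemma shell_Poincare:
  assumes l: "l > 0"
  obtains C where "C > 0" "\<And>(\<phi> :: 'a \<Rightarrow> real) \<Omega> \<epsilon>. \<phi> \<in> C0_infty \<Omega> \<Longrightarrow> 0 < \<epsilon> \<Longrightarrow> \<epsilon> \<le> l / 4 \<Longrightarrow>
    Lp_fun t (wmeas (shell l) 0) (\<lambda>x. \<phi> x - avg \<epsilon> \<phi> x) \<and>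
    Lp_int t (wmeas (shell l) 0) (\<lambda>x. \<phi> x - avg \<epsilon> \<phi> x)
      \<le> C * \<epsilon> powr (t - real DIM('a) * (t - p) / p) * Lp_int p (wmeas UNIV \<mu>) (grad \<phi>) powr (t / p)"
proof -
  obtain C0 where C0: "C0 > 0" "\<And>(\<phi> :: 'a \<Rightarrow> real) \<Omega> S S' \<epsilon> G. \<phi> \<in> C0_infty \<Omega> \<Longrightarrow> \<epsilon> > 0 \<Longrightarrow>
      S \<in> sets borel \<Longrightarrow> S' \<in> sets borel \<Longrightarrow> (\<And>x y. x \<in> S \<Longrightarrow> dist x y < \<epsilon> \<Longrightarrow> y \<in> S') \<Longrightarrow> G \<ge> 0 \<Longrightarrow>
      (\<integral>\<^sup>+y. indicator S' y * ennreal (norm (grad \<phi> y) powr p) \<partial>lborel) \<le> ennreal G \<Longrightarrow>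
      (\<integral>\<^sup>+x. indicator S x * ennreal (\<bar>\<phi> x - avg \<epsilon> \<phi> x\<bar> powr t) \<partial>lborel)
        \<le> ennreal (C0 * \<epsilon> powr (t - real DIM('a) * (t - p) / p) * G powr (t / p))"
    by (rule avg_Poincare[OF p_ge_1 t(1) subcritical]) blast
  obtain b where b: "b > 0" "\<And>y :: 'a. y \<in> cball 0 (4 * l) - ball 0 (l / 4) \<Longrightarrow> 1 / norm y powr \<mu> \<ge> b"
    by (rule closed_shell_weight[OF l]) blast
  define C where "C = C0 * (1 / b) powr (t / p)"
  have "Lp_fun t (wmeas (shell l) 0) (\<lambda>x. \<phi> x - avg \<epsilon> \<phi> x) \<and>
    Lp_int t (wmeas (shell l) 0) (\<lambda>x. \<phi> x - avg \<epsilon> \<phi> x)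
      \<le> C * \<epsilon> powr (t - real DIM('a) * (t - p) / p) * Lp_int p (wmeas UNIV \<mu>) (grad \<phi>) powr (t / p)"
    if \<phi>: "\<phi> \<in> C0_infty \<Omega>" and \<epsilon>: "0 < \<epsilon>" "\<epsilon> \<le> l / 4" for \<phi> :: "'a \<Rightarrow> real" and \<Omega> \<epsilon>
  proof -
    define A where "A = Lp_int p (wmeas UNIV \<mu>) (grad \<phi>)"
    have A0: "A \<ge> 0" by (simp add: A_def)
    have "(\<integral>\<^sup>+y. indicator (cball 0 (4 * l) - ball 0 (l / 4)) y * ennreal (norm (grad \<phi> y) powr p) \<partial>lborel) \<le> ennreal (A / b)"
      unfolding A_def by (intro nn_integral_le_wmeas b grad_Lp[OF \<phi>] borel_measurable_C0_infty(2)[OF \<phi>]) auto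
    then have "(\<integral>\<^sup>+x. indicator (shell l) x * ennreal (\<bar>\<phi> x - avg \<epsilon> \<phi> x\<bar> powr t) \<partial>lborel)
        \<le> ennreal (C0 * \<epsilon> powr (t - real DIM('a) * (t - p) / p) * (A / b) powr (t / p))"
      using A0 b(1) shell_subset_fat[OF l] fat_shell_nbhd[OF _ _ \<epsilon>(2)]
      by (intro C0(2)[OF \<phi> \<epsilon>(1)]) auto
    also have "C0 * \<epsilon> powr (t - real DIM('a) * (t - p) / p) * (A / b) powr (t / p)
        = C * \<epsilon> powr (t - real DIM('a) * (t - p) / p) * A powr (t / p)"
      using A0 b(1) by (simp add: C_def powr_divide)
    finally have "(\<integral>\<^sup>+x. indicator (shell l) x * ennreal (\<bar>\<phi> x - avg \<epsilon> \<phi> x\<bar> powr t) \<partial>lborel)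
        \<le> ennreal (C * \<epsilon> powr (t - real DIM('a) * (t - p) / p) * A powr (t / p))" .
    moreover have "(\<lambda>x. \<phi> x - avg \<epsilon> \<phi> x) \<in> borel_measurable borel"
      using borel_measurable_C0_infty(1)[OF \<phi>] avg_measurable[OF borel_measurable_C0_infty(1)[OF \<phi>]] by measurable
    ultimately show ?thesis
      using C0(1) unfolding A_def[symmetric] by (intro conjI Lp_wmeas_0_of_nn_integral) (auto simp: C_def)
  qed
  moreover have "C > 0" using C0(1) b(1) by (simp add: C_def)
  ultimately show ?thesis using that[of C] by blast
qed

lemma fat_shell_Lp:
  assumes l: "l > 0"
  obtains H where "H > 0" "\<And>(\<phi> :: 'a \<Rightarrow> real) \<Omega>. \<phi> \<in> C0_infty \<Omega> \<Longrightarrow>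
    (\<integral>\<^sup>+y. indicator (cball 0 (4 * l) - ball 0 (l / 4)) y * ennreal (\<bar>\<phi> y\<bar> powr p) \<partial>lborel)
      \<le> ennreal (H * Lp_int p (wmeas UNIV \<mu>) (grad \<phi>))"
proof -
  obtain K where K: "K > 0" "\<And>\<phi> :: 'a \<Rightarrow> real. \<And>\<Omega>. \<phi> \<in> C0_infty \<Omega> \<Longrightarrow>
    Lp_int p (wmeas UNIV (\<mu> + p)) \<phi> \<le> K * Lp_int p (wmeas UNIV \<mu>) (grad \<phi>)"
    by (rule Hardy[OF p \<mu>(2)]) blast
  obtain b where b: "b > 0" "\<And>y :: 'a. y \<in> cball 0 (4 * l) - ball 0 (l / 4) \<Longrightarrow> 1 / norm y powr (\<mu> + p) \<ge> b"
    by (rule closed_shell_weight[OF l]) blast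
  have "(\<integral>\<^sup>+y. indicator (cball 0 (4 * l) - ball 0 (l / 4)) y * ennreal (\<bar>\<phi> y\<bar> powr p) \<partial>lborel)
      \<le> ennreal (K / b * Lp_int p (wmeas UNIV \<mu>) (grad \<phi>))" if \<phi>: "\<phi> \<in> C0_infty \<Omega>" for \<phi> :: "'a \<Rightarrow> real" and \<Omega>
  proof -
    have "(\<integral>\<^sup>+y. indicator (cball 0 (4 * l) - ball 0 (l / 4)) y * ennreal (norm (\<phi> y) powr p) \<partial>lborel)
       \<le> ennreal (Lp_int p (wmeas UNIV (\<mu> + p)) \<phi> / b)"
      by (intro nn_integral_le_wmeas b test_Lp[OF \<phi>] borel_measurable_C0_infty(1)[OF \<phi>]) auto
    also have "\<dots> \<le> ennreal (K / b * Lp_int p (wmeas UNIV \<mu>) (grad \<phi>))"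
      using K(2)[OF \<phi>] b(1) by (intro ennreal_leI) (simp add: divide_right_mono)
    finally show ?thesis by simp
  qed
  then show ?thesis using K b by (intro that[of "K / b"]) auto
qed

lemma avg_bound:
  assumes l: "l > 0" and \<epsilon>: "0 < \<epsilon>" "\<epsilon> \<le> l / 4"
  obtains C where "C > 0" "\<And>(\<phi> :: 'a \<Rightarrow> real) \<Omega> x. \<phi> \<in> C0_infty \<Omega> \<Longrightarrow> x \<in> fat_shell l \<Longrightarrow>
    \<bar>avg \<epsilon> \<phi> x\<bar> \<le> C * Lp_int p (wmeas UNIV \<mu>) (grad \<phi>) powr (1 / p)"
proof -
  obtain H where H: "H > 0" "\<And>(\<phi> :: 'a \<Rightarrow> real) \<Omega>. \<phi> \<in> C0_infty \<Omega> \<Longrightarrow>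
    (\<integral>\<^sup>+y. indicator (cball 0 (4 * l) - ball 0 (l / 4)) y * ennreal (\<bar>\<phi> y\<bar> powr p) \<partial>lborel)
      \<le> ennreal (H * Lp_int p (wmeas UNIV \<mu>) (grad \<phi>))"
    by (rule fat_shell_Lp[OF l]) blast
  define V where "V = bump_vol TYPE('a) * \<epsilon> ^ DIM('a)"
  have V: "V > 0" using bump_vol_pos[where 'a = 'a] \<epsilon> by (simp add: V_def)
  have "\<bar>avg \<epsilon> \<phi> x\<bar> \<le> (H / V) powr (1 / p) * Lp_int p (wmeas UNIV \<mu>) (grad \<phi>) powr (1 / p)"
    if \<phi>: "\<phi> \<in> C0_infty \<Omega>" and x: "x \<in> fat_shell l" for \<phi> :: "'a \<Rightarrow> real" and \<Omega> x
  proof -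
    have c: "continuous_on UNIV \<phi>" by (rule C0_infty_continuous[OF \<phi>])
    have ca: "continuous_on UNIV (\<lambda>y. \<bar>\<phi> y\<bar>)" by (intro continuous_intros c)
    have cp: "continuous_on UNIV (\<lambda>y. \<bar>\<phi> y\<bar> powr p)" using p by (intro continuous_on_powr' ca) auto
    have sub: "ball x \<epsilon> \<subseteq> cball 0 (4 * l) - ball 0 (l / 4)"
    proof
      fix y assume "y \<in> ball x \<epsilon>"
      then show "y \<in> cball 0 (4 * l) - ball 0 (l / 4)" using fat_shell_nbhd[OF x _ \<epsilon>(2), of y] by simp
    qed
    have "\<bar>avg \<epsilon> \<phi> x\<bar> powr p \<le> avg \<epsilon> (\<lambda>y. \<bar>\<phi> y\<bar>) x powr p"
      using p avg_abs_le[OF c, of \<epsilon> x] by (intro powr_mono2) auto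
    also have "\<dots> \<le> avg \<epsilon> (\<lambda>y. \<bar>\<phi> y\<bar> powr p) x" by (rule avg_powr_le[OF p_ge_1 ca]) simp
    also have "\<dots> \<le> H * Lp_int p (wmeas UNIV \<mu>) (grad \<phi>) / V"
      unfolding V_def using H by (intro avg_le[OF \<epsilon>(1) cp _ _ sub H(2)[OF \<phi>]]) auto
    finally have "(\<bar>avg \<epsilon> \<phi> x\<bar> powr p) powr (1 / p) \<le> (H * Lp_int p (wmeas UNIV \<mu>) (grad \<phi>) / V) powr (1 / p)"
      using p by (intro powr_mono2) auto
    also have "H * Lp_int p (wmeas UNIV \<mu>) (grad \<phi>) / V = (H / V) * Lp_int p (wmeas UNIV \<mu>) (grad \<phi>)" by simp
    finally show ?thesis using p by (simp add: powr_powr powr_mult del: times_divide_eq_left)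
  qed
  then show ?thesis using H V by (intro that[of "(H / V) powr (1 / p)"]) auto
qed

text \<open>The difference falls on the kernel, which is smooth.\<close>

lemma avg_Lipschitz:
  assumes l: "l > 0" and \<epsilon>: "0 < \<epsilon>" "\<epsilon> \<le> l / 4"
  obtains L where "L > 0" "\<And>(\<phi> :: 'a \<Rightarrow> real) \<Omega> x x'. \<phi> \<in> C0_infty \<Omega> \<Longrightarrow> x \<in> fat_shell l \<Longrightarrow> x' \<in> fat_shell l \<Longrightarrow>
    \<bar>avg \<epsilon> \<phi> x - avg \<epsilon> \<phi> x'\<bar> \<le> L * (1 + Lp_int p (wmeas UNIV \<mu>) (grad \<phi>)) * norm (x - x')"
proof -
  obtain H where H: "H > 0" "\<And>(\<phi> :: 'a \<Rightarrow> real) \<Omega>. \<phi> \<in> C0_infty \<Omega> \<Longrightarrow>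
    (\<integral>\<^sup>+y. indicator (cball 0 (4 * l) - ball 0 (l / 4)) y * ennreal (\<bar>\<phi> y\<bar> powr p) \<partial>lborel)
      \<le> ennreal (H * Lp_int p (wmeas UNIV \<mu>) (grad \<phi>))"
    by (rule fat_shell_Lp[OF l]) blast
  define S where "S = cball 0 (4 * l) - ball (0::'a) (l / 4)"
  have Sb: "S \<in> sets borel" by (simp add: S_def)
  define vS where "vS = measure lborel S"
  have vS: "emeasure lborel S = ennreal vS"
    unfolding vS_def by (intro emeasure_eq_ennreal_measure) (use emeasure_bounded_finite[of S] in \<open>auto simp: S_def bounded_diff\<close>)
  obtain B where B: "B > 0" "\<And>x :: 'a. norm (grad (bump 0 1) x) \<le> B"
    by (rule C0_infty_bounded[OF bump_C0_infty]) blast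
  define V where "V = bump_vol TYPE('a) * \<epsilon> ^ DIM('a)"
  have V: "V > 0" using bump_vol_pos[where 'a = 'a] \<epsilon> by (simp add: V_def)
  define L where "L = B / \<epsilon> / V * (vS + H + 1)"
  have vS0: "vS \<ge> 0" by (simp add: vS_def)
  have L: "L > 0" using B \<epsilon> V H vS0 by (simp add: L_def add_nonneg_pos)
  have "\<bar>avg \<epsilon> \<phi> x - avg \<epsilon> \<phi> x'\<bar> \<le> L * (1 + Lp_int p (wmeas UNIV \<mu>) (grad \<phi>)) * norm (x - x')"
    if \<phi>: "\<phi> \<in> C0_infty \<Omega>" and x: "x \<in> fat_shell l" "x' \<in> fat_shell l" for \<phi> :: "'a \<Rightarrow> real" and \<Omega> x x'
  proof -
    define A where "A = Lp_int p (wmeas UNIV \<mu>) (grad \<phi>)"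
    have A0: "A \<ge> 0" by (simp add: A_def)
    have [measurable]: "\<phi> \<in> borel_measurable borel" by (rule borel_measurable_C0_infty(1)[OF \<phi>])
    note Sb[measurable]
    have c: "continuous_on UNIV \<phi>" by (rule C0_infty_continuous[OF \<phi>])
    define \<eta> where "\<eta> x y = bump 0 1 ((1 / \<epsilon>) *\<^sub>R (y - x))" for x y :: 'a
    have \<eta>m [measurable]: "\<eta> x \<in> borel_measurable borel" for x unfolding \<eta>_def[abs_def] by measurable
    have av: "avg \<epsilon> \<phi> z = (\<integral>y. \<eta> z y * \<phi> y \<partial>lborel) / V" for z
    proof -
      have "(\<integral>y. \<eta> z y * \<phi> y \<partial>lborel) = \<epsilon> ^ DIM('a) * (\<integral>w. \<eta> z (z + \<epsilon> *\<^sub>R w) * \<phi> (z + \<epsilon> *\<^sub>R w) \<partial>lborel)"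
        by (rule integral_lborel_affine[OF \<epsilon>(1)]) measurable
      moreover have "\<eta> z (z + \<epsilon> *\<^sub>R w) = bump 0 1 w" for w using \<epsilon> by (simp add: \<eta>_def)
      ultimately show ?thesis using \<epsilon> by (simp add: avg_def V_def)
    qed
    have i\<eta>: "integrable lborel (\<lambda>y. \<eta> z y * \<phi> y)" for z
    proof (rule integrable_continuous_compact_support[of _ "cball z \<epsilon>"])
      show "continuous_on UNIV (\<lambda>y. \<eta> z y * \<phi> y)"
        unfolding \<eta>_def by (intro continuous_on_mult c continuous_on_compose2[OF C0_infty_continuous[OF bump_C0_infty]] continuous_intros) auto
      fix y assume "y \<notin> cball z \<epsilon>"
      then have "(1 / \<epsilon>) *\<^sub>R (y - z) \<notin> ball 0 1" using \<epsilon> by (simp add: dist_norm norm_minus_commute)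
      then show "\<eta> z y * \<phi> y = 0" by (simp add: \<eta>_def bump_eq_0)
    qed simp
    have supp: "\<eta> z y = 0" if "z \<in> fat_shell l" "y \<notin> S" for z y
    proof -
      have "\<not> dist z y < \<epsilon>" using fat_shell_nbhd[OF that(1) _ \<epsilon>(2), of y] that(2) by (auto simp: S_def)
      then have "(1 / \<epsilon>) *\<^sub>R (y - z) \<notin> ball 0 1" using \<epsilon> by (simp add: dist_norm norm_minus_commute)
      then show ?thesis by (simp add: \<eta>_def bump_eq_0)
    qed
    have lip: "\<bar>\<eta> x y - \<eta> x' y\<bar> \<le> B / \<epsilon> * norm (x - x')" for y
    proof -
      have "\<bar>\<eta> x y - \<eta> x' y\<bar> \<le> B * norm ((1 / \<epsilon>) *\<^sub>R (y - x) - (1 / \<epsilon>) *\<^sub>R (y - x'))"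
        unfolding \<eta>_def by (rule C0_infty_Lipschitz[OF bump_C0_infty B(2)])
      also have "(1 / \<epsilon>) *\<^sub>R (y - x) - (1 / \<epsilon>) *\<^sub>R (y - x') = (1 / \<epsilon>) *\<^sub>R (x' - x)"
        by (simp add: scaleR_diff_right[symmetric])
      finally show ?thesis using \<epsilon> by (simp add: norm_minus_commute)
    qed
    have "(\<integral>\<^sup>+y. ennreal \<bar>\<eta> x y * \<phi> y - \<eta> x' y * \<phi> y\<bar> \<partial>lborel)
      \<le> (\<integral>\<^sup>+y. ennreal (B / \<epsilon> * norm (x - x')) * (indicator S y + indicator S y * ennreal (\<bar>\<phi> y\<bar> powr p)) \<partial>lborel)"
    proof (rule nn_integral_mono)
      fix y
      show "ennreal \<bar>\<eta> x y * \<phi> y - \<eta> x' y * \<phi> y\<bar>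
        \<le> ennreal (B / \<epsilon> * norm (x - x')) * (indicator S y + indicator S y * ennreal (\<bar>\<phi> y\<bar> powr p))"
      proof (cases "y \<in> S")
        case True
        have "\<bar>\<eta> x y * \<phi> y - \<eta> x' y * \<phi> y\<bar> = \<bar>\<eta> x y - \<eta> x' y\<bar> * \<bar>\<phi> y\<bar>"
          by (simp add: abs_mult[symmetric] algebra_simps)
        also have "\<dots> \<le> (B / \<epsilon> * norm (x - x')) * (1 + \<bar>\<phi> y\<bar> powr p)"
          using norm_le_powr_split[OF p_ge_1 zero_less_one, of "\<phi> y"] B \<epsilon> by (intro mult_mono lip) auto
        finally have "ennreal \<bar>\<eta> x y * \<phi> y - \<eta> x' y * \<phi> y\<bar> \<le> ennreal ((B / \<epsilon> * norm (x - x')) * (1 + \<bar>\<phi> y\<bar> powr p))"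
          by (rule ennreal_leI)
        also have "\<dots> = ennreal (B / \<epsilon> * norm (x - x')) * ennreal (1 + \<bar>\<phi> y\<bar> powr p)"
          using B \<epsilon> by (intro ennreal_mult) auto
        also have "ennreal (1 + \<bar>\<phi> y\<bar> powr p) = 1 + ennreal (\<bar>\<phi> y\<bar> powr p)" by (subst ennreal_plus) auto
        finally show ?thesis using True by simp
      qed (simp add: supp x)
    qed
    also have "\<dots> = ennreal (B / \<epsilon> * norm (x - x')) * (\<integral>\<^sup>+y. (indicator S y + indicator S y * ennreal (\<bar>\<phi> y\<bar> powr p)) \<partial>lborel)"
      by (rule nn_integral_cmult) measurable
    also have "(\<integral>\<^sup>+y. (indicator S y + indicator S y * ennreal (\<bar>\<phi> y\<bar> powr p)) \<partial>lborel)
        = ennreal vS + (\<integral>\<^sup>+y. indicator S y * ennreal (\<bar>\<phi> y\<bar> powr p) \<partial>lborel)"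
      unfolding vS[symmetric] by (subst nn_integral_add) (use Sb in auto)
    also have "ennreal (B / \<epsilon> * norm (x - x')) * \<dots> \<le> ennreal (B / \<epsilon> * norm (x - x')) * (ennreal vS + ennreal (H * A))"
      using H(2)[OF \<phi>] unfolding S_def[symmetric] A_def[symmetric] by (intro mult_left_mono add_left_mono) auto
    also have "\<dots> = ennreal (B / \<epsilon> * norm (x - x') * (vS + H * A))"
    proof -
      have "ennreal vS + ennreal (H * A) = ennreal (vS + H * A)" using H vS0 A0 by (intro ennreal_plus[symmetric]) auto
      moreover have "B / \<epsilon> * norm (x - x') \<ge> 0" using B \<epsilon> by simp
      ultimately show ?thesis by (simp only: ennreal_mult')
    qed
    finally have nn: "(\<integral>\<^sup>+y. ennreal \<bar>\<eta> x y * \<phi> y - \<eta> x' y * \<phi> y\<bar> \<partial>lborel) \<le> ennreal (B / \<epsilon> * norm (x - x') * (vS + H * A))" .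
    have id: "integrable lborel (\<lambda>y. \<bar>\<eta> x y * \<phi> y - \<eta> x' y * \<phi> y\<bar>)"
      by (intro integrable_abs Bochner_Integration.integrable_diff i\<eta>)
    have "avg \<epsilon> \<phi> x - avg \<epsilon> \<phi> x' = (\<integral>y. \<eta> x y * \<phi> y - \<eta> x' y * \<phi> y \<partial>lborel) / V"
      unfolding av Bochner_Integration.integral_diff[OF i\<eta> i\<eta>] by (simp add: diff_divide_distrib)
    then have "\<bar>avg \<epsilon> \<phi> x - avg \<epsilon> \<phi> x'\<bar> \<le> (\<integral>y. \<bar>\<eta> x y * \<phi> y - \<eta> x' y * \<phi> y\<bar> \<partial>lborel) / V"
      using V integral_abs_bound[of lborel "\<lambda>y. \<eta> x y * \<phi> y - \<eta> x' y * \<phi> y"] by (simp add: divide_right_mono)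
    also have "(\<integral>y. \<bar>\<eta> x y * \<phi> y - \<eta> x' y * \<phi> y\<bar> \<partial>lborel) \<le> B / \<epsilon> * norm (x - x') * (vS + H * A)"
      using nn nn_integral_eq_integral[OF id] B \<epsilon> H vS0 A0 by simp
    also have "B / \<epsilon> * norm (x - x') * (vS + H * A) \<le> B / \<epsilon> * norm (x - x') * ((vS + H + 1) * (1 + A))"
      using B \<epsilon> H vS0 A0 by (intro mult_left_mono) (auto simp: algebra_simps)
    also have "B / \<epsilon> * norm (x - x') * ((vS + H + 1) * (1 + A)) / V = L * (1 + A) * norm (x - x')"
      by (simp add: L_def)
    finally show ?thesis using V unfolding A_def by (simp add: divide_right_mono)
  qed
  then show ?thesis using that[OF L] by blast
qed

text \<open>On a shell of fixed size no small scale is needed: \<open>\<phi>\<close> is its average at scale \<open>1 / 4\<close>, which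
  is bounded, plus a difference that is bounded in \<open>L\<^sup>t\<close>.\<close>

lemma unit_shell_Sobolev:
  obtains C where "C > 0" "\<And>(\<phi> :: 'a \<Rightarrow> real) \<Omega>. \<phi> \<in> C0_infty \<Omega> \<Longrightarrow>
    Lp_int t (wmeas (shell 1) 0) \<phi> \<le> C * Lp_int p (wmeas UNIV \<mu>) (grad \<phi>) powr (t / p)"
proof -
  obtain C1 where C1: "C1 > 0" "\<And>(\<phi> :: 'a \<Rightarrow> real) \<Omega> \<epsilon>. \<phi> \<in> C0_infty \<Omega> \<Longrightarrow> 0 < \<epsilon> \<Longrightarrow> \<epsilon> \<le> 1 / 4 \<Longrightarrow>
    Lp_fun t (wmeas (shell 1) 0) (\<lambda>x. \<phi> x - avg \<epsilon> \<phi> x) \<and>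
    Lp_int t (wmeas (shell 1) 0) (\<lambda>x. \<phi> x - avg \<epsilon> \<phi> x)
      \<le> C1 * \<epsilon> powr (t - real DIM('a) * (t - p) / p) * Lp_int p (wmeas UNIV \<mu>) (grad \<phi>) powr (t / p)"
    by (rule shell_Poincare[of 1]) (simp, blast)
  obtain C2 where C2: "C2 > 0" "\<And>(\<phi> :: 'a \<Rightarrow> real) \<Omega> x. \<phi> \<in> C0_infty \<Omega> \<Longrightarrow> x \<in> fat_shell 1 \<Longrightarrow>
    \<bar>avg (1/4) \<phi> x\<bar> \<le> C2 * Lp_int p (wmeas UNIV \<mu>) (grad \<phi>) powr (1 / p)"
    by (rule avg_bound[of 1 "1/4"]) (simp, simp, simp, blast)
  define e where "e = t - real DIM('a) * (t - p) / p"
  define v where "v = measure lborel (shell 1 :: 'a set)"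
  define C where "C = 2 powr (t - 1) * (C1 * (1/4) powr e + C2 powr t * v)"
  have v: "v \<ge> 0" by (simp add: v_def)
  have C: "C > 0" using C1 C2 v by (simp add: C_def add_pos_nonneg)
  have "Lp_int t (wmeas (shell 1) 0) \<phi> \<le> C * Lp_int p (wmeas UNIV \<mu>) (grad \<phi>) powr (t / p)"
    if \<phi>: "\<phi> \<in> C0_infty \<Omega>" for \<phi> :: "'a \<Rightarrow> real" and \<Omega>
  proof -
    define A where "A = Lp_int p (wmeas UNIV \<mu>) (grad \<phi>)"
    have A0: "A \<ge> 0" by (simp add: A_def)
    have d: "Lp_fun t (wmeas (shell 1) 0) (\<lambda>x. \<phi> x - avg (1/4) \<phi> x)"
      "Lp_int t (wmeas (shell 1) 0) (\<lambda>x. \<phi> x - avg (1/4) \<phi> x) \<le> C1 * (1/4) powr e * A powr (t / p)"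
      using C1(2)[OF \<phi>, of "1/4"] by (auto simp: A_def e_def)
    have m: "avg (1/4) \<phi> \<in> borel_measurable borel" by (rule avg_measurable[OF borel_measurable_C0_infty(1)[OF \<phi>]])
    have le: "\<bar>avg (1/4) \<phi> x\<bar> \<le> C2 * A powr (1 / p)" if "x \<in> shell 1" for x
      using C2(2)[OF \<phi>] shell_subset_fat[of 1] that by (auto simp: A_def)
    have a: "Lp_fun t (wmeas (shell 1) 0) (avg (1/4) \<phi>)"
      "Lp_int t (wmeas (shell 1) 0) (avg (1/4) \<phi>) \<le> (C2 * A powr (1 / p)) powr t * v"
      unfolding v_def using C2(1) by (auto intro!: Lp_wmeas_0_bounded[OF m shell_borel bounded_shell t_pos le])
    have "(C2 * A powr (1 / p)) powr t = C2 powr t * A powr (t / p)"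
      using C2 by (simp add: powr_mult powr_powr)
    then have a2: "Lp_int t (wmeas (shell 1) 0) (avg (1/4) \<phi>) \<le> C2 powr t * v * A powr (t / p)"
      using a(2) by (simp add: mult_ac)
    have "Lp_int t (wmeas (shell 1) 0) (\<lambda>x. (\<phi> x - avg (1/4) \<phi> x) + avg (1/4) \<phi> x)
      \<le> 2 powr (t - 1) * (Lp_int t (wmeas (shell 1) 0) (\<lambda>x. \<phi> x - avg (1/4) \<phi> x) + Lp_int t (wmeas (shell 1) 0) (avg (1/4) \<phi>))"
      by (rule Lp_int_add_le_half[OF t_ge_1 d(1) a(1)])
    also have "\<dots> \<le> 2 powr (t - 1) * (C1 * (1/4) powr e * A powr (t / p) + C2 powr t * v * A powr (t / p))"
      using d(2) a2 by (intro mult_left_mono add_mono) auto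
    also have "\<dots> = C * A powr (t / p)" by (simp add: C_def algebra_simps)
    finally show ?thesis by (simp add: A_def)
  qed
  then show ?thesis using that[OF C] by blast
qed

text \<open>The power of \<open>l\<close> comes from dilating the unit shell to the shell of size \<open>l\<close>.\<close>

lemma shell_Sobolev_test:
  obtains C where "C > 0" "\<And>(\<phi> :: 'a \<Rightarrow> real) \<Omega> l. \<phi> \<in> C0_infty \<Omega> \<Longrightarrow> l > 0 \<Longrightarrow>
    Lp_fun t (wmeas (shell l) 0) \<phi> \<and>
    Lp_int t (wmeas (shell l) 0) \<phi>
      \<le> C * l powr (real DIM('a) - (real DIM('a) - \<mu> - p) * t / p) * Lp_int p (wmeas UNIV \<mu>) (grad \<phi>) powr (t / p)"
proof -
  obtain C where C: "C > 0" "\<And>(\<phi> :: 'a \<Rightarrow> real) \<Omega>. \<phi> \<in> C0_infty \<Omega> \<Longrightarrow>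
    Lp_int t (wmeas (shell 1) 0) \<phi> \<le> C * Lp_int p (wmeas UNIV \<mu>) (grad \<phi>) powr (t / p)"
    by (rule unit_shell_Sobolev) blast
  have "Lp_fun t (wmeas (shell l) 0) \<phi> \<and> Lp_int t (wmeas (shell l) 0) \<phi>
      \<le> C * l powr (real DIM('a) - (real DIM('a) - \<mu> - p) * t / p) * Lp_int p (wmeas UNIV \<mu>) (grad \<phi>) powr (t / p)"
    if \<phi>: "\<phi> \<in> C0_infty \<Omega>" and l: "l > 0" for \<phi> :: "'a \<Rightarrow> real" and \<Omega> l
  proof -
    have \<phi>U: "\<phi> \<in> C0_infty UNIV" by (rule C0_infty_mono[OF \<phi>]) simp
    define A where "A = Lp_int p (wmeas UNIV \<mu>) (grad \<phi>)"
    define D where "D = Lp_int t (wmeas (shell l) 0) \<phi>"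
    have A0: "A \<ge> 0" by (simp add: A_def)
    have L: "Lp_fun t (wmeas (shell l) 0) \<phi>"
      using Lp_fun_C0_infty(1)[OF \<phi>, of 0 t "shell l"] t_pos by simp
    have s: "(\<lambda>x. \<phi> (l *\<^sub>R x)) \<in> C0_infty UNIV" by (rule C0_infty_scaled_arg[OF \<phi>U l]) simp
    have sh: "x \<in> shell 1 \<longleftrightarrow> l *\<^sub>R x \<in> shell l" for x :: 'a using l by (simp add: shell_def)
    have D: "Lp_int t (wmeas (shell 1) 0) (\<lambda>x. \<phi> (l *\<^sub>R x)) = l powr (0 - real DIM('a)) * D"
      unfolding D_def by (rule Lp_scale(2)[OF l _ _ sh L]) auto
    have g: "grad (\<lambda>x. \<phi> (l *\<^sub>R x)) = (\<lambda>x. l *\<^sub>R grad \<phi> (l *\<^sub>R x))" using grad_scaled_arg[OF \<phi>] by auto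
    have "Lp_int p (wmeas UNIV \<mu>) (grad (\<lambda>x. \<phi> (l *\<^sub>R x))) = l powr p * (l powr (\<mu> - real DIM('a)) * A)"
      unfolding g Lp_int_scaleR A_def using l by (subst Lp_scale(2)[OF l _ _ _ grad_Lp[OF \<phi>], of UNIV UNIV]) auto
    then have gA: "Lp_int p (wmeas UNIV \<mu>) (grad (\<lambda>x. \<phi> (l *\<^sub>R x))) = l powr (- (real DIM('a) - \<mu> - p)) * A"
      by (simp add: powr_add[symmetric] mult.assoc[symmetric]) (simp add: algebra_simps)
    have "l powr (- real DIM('a)) * D \<le> C * (l powr (- (real DIM('a) - \<mu> - p)) * A) powr (t / p)"
      using C(2)[OF s] unfolding D gA by simp
    also have "(l powr (- (real DIM('a) - \<mu> - p)) * A) powr (t / p) = l powr (- (real DIM('a) - \<mu> - p) * t / p) * A powr (t / p)"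
      unfolding powr_mult powr_powr by simp
    finally have "l powr real DIM('a) * (l powr (- real DIM('a)) * D)
        \<le> l powr real DIM('a) * (C * (l powr (- (real DIM('a) - \<mu> - p) * t / p) * A powr (t / p)))"
      by (intro mult_left_mono) auto
    also have "l powr real DIM('a) * (l powr (- real DIM('a)) * D) = D"
      using l by (simp add: mult.assoc[symmetric] powr_add[symmetric])
    also have "l powr real DIM('a) * (C * (l powr (- (real DIM('a) - \<mu> - p) * t / p) * A powr (t / p)))
      = C * (l powr real DIM('a) * l powr (- (real DIM('a) - \<mu> - p) * t / p)) * A powr (t / p)"
      by (simp only: mult.assoc mult.commute mult.left_commute)
    also have "l powr real DIM('a) * l powr (- (real DIM('a) - \<mu> - p) * t / p)
       = l powr (real DIM('a) - (real DIM('a) - \<mu> - p) * t / p)"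
      unfolding powr_add[symmetric] by (simp only: mult_minus_left minus_divide_left[symmetric] diff_conv_add_uminus)
    finally show ?thesis using L by (simp add: D_def A_def)
  qed
  then show ?thesis using that[OF C(1)] by blast
qed

lemma shell_Sobolev:
  obtains C where "C > 0" "\<And>(u :: 'a \<Rightarrow> real) G \<Omega> l. open \<Omega> \<Longrightarrow> is_W_grad \<Omega> p \<mu> u G \<Longrightarrow> l > 0 \<Longrightarrow>
    Lp_fun t (wmeas (\<Omega> \<inter> shell l) 0) u \<and>
    Lp_int t (wmeas (\<Omega> \<inter> shell l) 0) u
      \<le> C * l powr (real DIM('a) - (real DIM('a) - \<mu> - p) * t / p) * Lp_int p (wmeas \<Omega> \<mu>) G powr (t / p)"
proof -
  obtain C where C: "C > 0" "\<And>(\<phi> :: 'a \<Rightarrow> real) \<Omega> l. \<phi> \<in> C0_infty \<Omega> \<Longrightarrow> l > 0 \<Longrightarrow>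
    Lp_fun t (wmeas (shell l) 0) \<phi> \<and>
    Lp_int t (wmeas (shell l) 0) \<phi>
      \<le> C * l powr (real DIM('a) - (real DIM('a) - \<mu> - p) * t / p) * Lp_int p (wmeas UNIV \<mu>) (grad \<phi>) powr (t / p)"
    by (rule shell_Sobolev_test) blast
  have "Lp_fun t (wmeas (\<Omega> \<inter> shell l) 0) u \<and> Lp_int t (wmeas (\<Omega> \<inter> shell l) 0) u
      \<le> C * l powr (real DIM('a) - (real DIM('a) - \<mu> - p) * t / p) * Lp_int p (wmeas \<Omega> \<mu>) G powr (t / p)"
    if \<Omega>: "open \<Omega>" and G: "is_W_grad \<Omega> p \<mu> u G" and l: "l > 0" for u :: "'a \<Rightarrow> real" and G \<Omega> l
  proof -
    have \<Omega>L: "\<Omega> \<in> sets lebesgue" using \<Omega> by (simp add: borel_open)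
    have SL: "\<Omega> \<inter> shell l \<in> sets lebesgue" using \<Omega>L by (intro sets.Int) auto
    obtain \<phi> where \<phi>: "\<And>n. \<phi> n \<in> C0_infty \<Omega>" and lp: "Lp_conv p (wmeas \<Omega> (\<mu> + p)) \<phi> u"
      and gr: "Lp_conv p (wmeas \<Omega> \<mu>) (\<lambda>n. grad (\<phi> n)) G"
      using G unfolding is_W_grad_iff[OF \<Omega> p \<mu>] by blast
    have p0: "p > 0" using p by simp
    obtain r where r: "strict_mono r" and ae: "AE x in wmeas \<Omega> (\<mu> + p). (\<lambda>n. \<phi> (r n) x) \<longlonglongrightarrow> u x"
      by (rule Lp_conv_AE_subseq[OF p0 lp]) blast
    have um: "u \<in> borel_measurable (lebesgue_on \<Omega>)" using is_W_grad_Lp(2)[OF \<Omega> p \<mu> G] by auto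
    let ?s = "real DIM('a) - (real DIM('a) - \<mu> - p) * t / p"
    let ?c = "\<lambda>n. C * l powr ?s * Lp_int p (wmeas \<Omega> \<mu>) (grad (\<phi> (r n))) powr (t / p)"
    have AG: "(\<lambda>n. Lp_int p (wmeas \<Omega> \<mu>) (grad (\<phi> (r n)))) \<longlonglongrightarrow> Lp_int p (wmeas \<Omega> \<mu>) G"
      using LIMSEQ_subseq_LIMSEQ[OF Lp_conv_int[OF p_ge_1 gr is_W_grad_Lp(1)[OF \<Omega> p \<mu> G]] r] by (simp add: o_def)
    have clim: "?c \<longlonglongrightarrow> C * l powr ?s * Lp_int p (wmeas \<Omega> \<mu>) G powr (t / p)"
      using t_pos p by (intro tendsto_intros tendsto_powr' AG) auto
    have L: "Lp_fun t (wmeas (\<Omega> \<inter> shell l) 0) (\<phi> (r n))" "Lp_int t (wmeas (\<Omega> \<inter> shell l) 0) (\<phi> (r n)) \<le> ?c n" for n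
    proof -
      note * = C(2)[OF \<phi>[of "r n"] l]
      show "Lp_fun t (wmeas (\<Omega> \<inter> shell l) 0) (\<phi> (r n))"
        by (rule Lp_wmeas_subset(1)[OF SL _ _ conjunct1[OF *]]) auto
      have "Lp_int t (wmeas (\<Omega> \<inter> shell l) 0) (\<phi> (r n)) \<le> Lp_int t (wmeas (shell l) 0) (\<phi> (r n))"
        by (rule Lp_wmeas_subset(2)[OF SL _ _ conjunct1[OF *]]) auto
      also have "\<dots> \<le> C * l powr ?s * Lp_int p (wmeas UNIV \<mu>) (grad (\<phi> (r n))) powr (t / p)" using * by blast
      also have "Lp_int p (wmeas UNIV \<mu>) (grad (\<phi> (r n))) = Lp_int p (wmeas \<Omega> \<mu>) (grad (\<phi> (r n)))"
        using Lp_int_C0_infty(2)[OF \<phi> \<Omega>L order_refl, of p \<mu>] p by simp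
      finally show "Lp_int t (wmeas (\<Omega> \<inter> shell l) 0) (\<phi> (r n)) \<le> ?c n" .
    qed
    have ae': "AE x in wmeas (\<Omega> \<inter> shell l) 0. (\<lambda>n. \<phi> (r n) x) \<longlonglongrightarrow> u x"
      using ae unfolding AE_wmeas[OF \<Omega>L] AE_wmeas[OF SL] by eventually_elim auto
    have um': "u \<in> borel_measurable (wmeas (\<Omega> \<inter> shell l) 0)"
      using lebesgue_on_measurable_subset[OF um, of "\<Omega> \<inter> shell l"] by simp
    show ?thesis
      using Lp_Fatou_lim[OF t_pos um' ae' L clim] by blast
  qed
  then show ?thesis using that[OF C(1)] by blast
qed

text \<open>Averages at scale \<open>1 / (j + 1)\<close> over a countable dense set of centres converge along
  a diagonal subsequence; the averages are Lipschitz uniformly along the sequence, so they converge at every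
  centre, hence boundedly, hence in \<open>L\<^sup>t\<close>; and they are uniformly \<open>L\<^sup>t\<close>-close to the functions.\<close>

lemma shell_compactness:
  fixes \<phi> :: "nat \<Rightarrow> 'a \<Rightarrow> real"
  assumes \<phi>: "\<And>n. \<phi> n \<in> C0_infty \<Omega>" and A: "\<And>n. Lp_int p (wmeas UNIV \<mu>) (grad (\<phi> n)) \<le> A"
  obtains r where "strict_mono (r :: nat \<Rightarrow> nat)"
    "\<And>l e. l > 0 \<Longrightarrow> e > 0 \<Longrightarrow> \<exists>K. \<forall>m\<ge>K. \<forall>n\<ge>K. Lp_int t (wmeas (shell l) 0) (\<lambda>x. \<phi> (r m) x - \<phi> (r n) x) < e"
proof -
  have A0: "A \<ge> 0" using A[of 0] order_trans[OF Lp_int_nonneg] by blast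
  obtain D :: "'a set" where D: "countable D" "\<And>X. open X \<Longrightarrow> X \<noteq> {} \<Longrightarrow> \<exists>d\<in>D. d \<in> X"
    by (rule countable_dense_setE) blast
  define \<epsilon> where "\<epsilon> j = 1 / real (Suc j)" for j
  have \<epsilon>: "\<epsilon> j > 0" for j by (simp add: \<epsilon>_def)
  have \<epsilon>lim: "\<epsilon> \<longlonglongrightarrow> 0" using LIMSEQ_inverse_real_of_nat by (simp add: \<epsilon>_def[abs_def] inverse_eq_divide)
  define I where "I = {(j, x). x \<in> D \<and> (\<exists>l>0. x \<in> fat_shell l \<and> \<epsilon> j \<le> l / 4)}"
  have cI: "countable I"
    by (rule countable_subset[OF _ countable_SIGMA[of UNIV "\<lambda>_. D"]]) (auto simp: I_def D(1))
  have bnd: "\<exists>C>0. \<forall>n. \<forall>x\<in>fat_shell l. \<bar>avg (\<epsilon> j) (\<phi> n) x\<bar> \<le> C" if l: "l > 0" "\<epsilon> j \<le> l / 4" for l j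
  proof -
    obtain C where C: "C > 0" "\<And>(\<phi> :: 'a \<Rightarrow> real) \<Omega> x. \<phi> \<in> C0_infty \<Omega> \<Longrightarrow> x \<in> fat_shell l \<Longrightarrow>
      \<bar>avg (\<epsilon> j) \<phi> x\<bar> \<le> C * Lp_int p (wmeas UNIV \<mu>) (grad \<phi>) powr (1 / p)"
      by (rule avg_bound[OF l(1) \<epsilon> l(2)]) blast
    have "\<bar>avg (\<epsilon> j) (\<phi> n) x\<bar> \<le> C * A powr (1 / p) + 1" if "x \<in> fat_shell l" for n x
    proof -
      have "\<bar>avg (\<epsilon> j) (\<phi> n) x\<bar> \<le> C * Lp_int p (wmeas UNIV \<mu>) (grad (\<phi> n)) powr (1 / p)" by (rule C(2)[OF \<phi> that])
      also have "\<dots> \<le> C * A powr (1 / p)" using C(1) A p by (intro mult_left_mono powr_mono2) auto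
      finally show ?thesis by simp
    qed
    moreover have "C * A powr (1 / p) + 1 > 0" using C(1) by (simp add: add_nonneg_pos)
    ultimately show ?thesis by blast
  qed
  have "\<exists>M>0. \<forall>n. \<bar>avg (\<epsilon> (fst i)) (\<phi> n) (snd i)\<bar> \<le> M" if "i \<in> I" for i
    using that bnd by (fastforce simp: I_def)
  then obtain M where M: "\<And>i. i \<in> I \<Longrightarrow> M i > 0" "\<And>i n. i \<in> I \<Longrightarrow> \<bar>avg (\<epsilon> (fst i)) (\<phi> n) (snd i)\<bar> \<le> M i"
    by metis
  define F where "F n i = avg (\<epsilon> (fst i)) (\<phi> n) (snd i) / M i" for n i
  have F1: "norm (F n i) \<le> 1" if "i \<in> I" for n i
    using M[OF that] by (simp add: F_def)
  obtain r where r: "strict_mono r" and rl: "\<And>i. i \<in> I \<Longrightarrow> \<exists>L. (\<lambda>n. F (r n) i) \<longlonglongrightarrow> L"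
    by (rule function_convergent_subsequence[OF cI, of F 1]) (use F1 in blast)+
  have conv: "convergent (\<lambda>n. avg (\<epsilon> j) (\<phi> (r n)) x)" if l: "l > 0" "\<epsilon> j \<le> l / 4" and x: "x \<in> fat_shell l" for l j x
  proof -
    obtain L where L: "L > 0" "\<And>(\<phi> :: 'a \<Rightarrow> real) \<Omega> x x'. \<phi> \<in> C0_infty \<Omega> \<Longrightarrow> x \<in> fat_shell l \<Longrightarrow> x' \<in> fat_shell l \<Longrightarrow>
      \<bar>avg (\<epsilon> j) \<phi> x - avg (\<epsilon> j) \<phi> x'\<bar> \<le> L * (1 + Lp_int p (wmeas UNIV \<mu>) (grad \<phi>)) * norm (x - x')"
      by (rule avg_Lipschitz[OF l(1) \<epsilon> l(2)]) blast
    have "Cauchy (\<lambda>n. avg (\<epsilon> j) (\<phi> (r n)) x)"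
    proof (rule CauchyI)
      fix e :: real assume e: "e > 0"
      define \<delta> where "\<delta> = e / (4 * (L * (1 + A)))"
      have LA: "L * (1 + A) > 0" using L A0 by simp
      have \<delta>: "\<delta> > 0" using e LA by (simp add: \<delta>_def)
      have "x \<in> fat_shell l \<inter> ball x \<delta>" using x \<delta> by simp
      then obtain d where d: "d \<in> D" "d \<in> fat_shell l" "d \<in> ball x \<delta>"
        using D(2)[of "fat_shell l \<inter> ball x \<delta>"] open_fat_shell by (metis IntE empty_iff open_Int open_ball)
      have near: "\<bar>avg (\<epsilon> j) (\<phi> n) x - avg (\<epsilon> j) (\<phi> n) d\<bar> \<le> e / 4" for n
      proof -
        have "\<bar>avg (\<epsilon> j) (\<phi> n) x - avg (\<epsilon> j) (\<phi> n) d\<bar> \<le> L * (1 + Lp_int p (wmeas UNIV \<mu>) (grad (\<phi> n))) * norm (x - d)"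
          by (rule L(2)[OF \<phi> x d(2)])
        also have "\<dots> \<le> L * (1 + A) * \<delta>"
          using A L(1) d(3) A0 by (intro mult_mono mult_left_mono) (auto simp: dist_norm)
        also have "\<dots> = e / 4"
        proof -
          have "Z * (e / (4 * Z)) = e / 4" if "Z > 0" for Z using that by simp
          from this[OF LA] show ?thesis by (simp only: \<delta>_def)
        qed
        finally show ?thesis .
      qed
      have i: "(j, d) \<in> I" using d l by (auto simp: I_def)
      then obtain L' where "(\<lambda>n. F (r n) (j, d)) \<longlonglongrightarrow> L'" using rl by blast
      then have "(\<lambda>n. F (r n) (j, d) * M (j, d)) \<longlonglongrightarrow> L' * M (j, d)" by (intro tendsto_intros)
      then have "(\<lambda>n. avg (\<epsilon> j) (\<phi> (r n)) d) \<longlonglongrightarrow> L' * M (j, d)" using M(1)[OF i] by (simp add: F_def)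
      then have "Cauchy (\<lambda>n. avg (\<epsilon> j) (\<phi> (r n)) d)" by (rule LIMSEQ_imp_Cauchy)
      then obtain K where K: "\<And>m n. m \<ge> K \<Longrightarrow> n \<ge> K \<Longrightarrow> norm (avg (\<epsilon> j) (\<phi> (r m)) d - avg (\<epsilon> j) (\<phi> (r n)) d) < e / 4"
        using CauchyD[of _ "e / 4"] e by (meson divide_pos_pos zero_less_numeral)
      show "\<exists>K. \<forall>m\<ge>K. \<forall>n\<ge>K. norm (avg (\<epsilon> j) (\<phi> (r m)) x - avg (\<epsilon> j) (\<phi> (r n)) x) < e"
      proof (intro exI[of _ K] allI impI)
        fix m n assume mn: "m \<ge> K" "n \<ge> K"
        show "norm (avg (\<epsilon> j) (\<phi> (r m)) x - avg (\<epsilon> j) (\<phi> (r n)) x) < e"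
          using K[OF mn] near[of "r m"] near[of "r n"] e unfolding real_norm_def by linarith
      qed
    qed
    then show ?thesis by (simp add: Cauchy_convergent_iff)
  qed
  have "\<exists>K. \<forall>m\<ge>K. \<forall>n\<ge>K. Lp_int t (wmeas (shell l) 0) (\<lambda>x. \<phi> (r m) x - \<phi> (r n) x) < e" if l: "l > 0" and e: "e > 0" for l e
  proof -
    let ?M = "wmeas (shell l :: 'a set) 0"
    define s where "s = t - real DIM('a) * (t - p) / p"
    have s: "s > 0" unfolding s_def by (rule subcritical)
    obtain C where C: "C > 0" "\<And>(\<phi> :: 'a \<Rightarrow> real) \<Omega> \<epsilon>. \<phi> \<in> C0_infty \<Omega> \<Longrightarrow> 0 < \<epsilon> \<Longrightarrow> \<epsilon> \<le> l / 4 \<Longrightarrow>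
      Lp_fun t ?M (\<lambda>x. \<phi> x - avg \<epsilon> \<phi> x) \<and>
      Lp_int t ?M (\<lambda>x. \<phi> x - avg \<epsilon> \<phi> x) \<le> C * \<epsilon> powr s * Lp_int p (wmeas UNIV \<mu>) (grad \<phi>) powr (t / p)"
      unfolding s_def by (rule shell_Poincare[OF l]) blast
    define Q where "Q = (2::real) powr (t - 1)"
    have Q: "Q > 0" by (simp add: Q_def)
    define \<gamma> where "\<gamma> = e / (4 * Q * Q)"
    have \<gamma>: "\<gamma> > 0" using e Q by (simp add: \<gamma>_def)
    have "(\<lambda>j. C * \<epsilon> j powr s * A powr (t / p)) \<longlonglongrightarrow> C * 0 powr s * A powr (t / p)"
      using s by (intro tendsto_intros tendsto_powr' \<epsilon>lim) (auto simp: \<epsilon> less_imp_le)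
    then have "\<forall>\<^sub>F j in sequentially. C * \<epsilon> j powr s * A powr (t / p) < \<gamma>"
      using \<gamma> by (intro order_tendstoD(2)) auto
    moreover have "\<forall>\<^sub>F j in sequentially. \<epsilon> j < l / 4" using l by (intro order_tendstoD(2)[OF \<epsilon>lim]) simp
    ultimately have "\<forall>\<^sub>F j in sequentially. C * \<epsilon> j powr s * A powr (t / p) < \<gamma> \<and> \<epsilon> j < l / 4"
      by (rule eventually_conj)
    then obtain j where j: "C * \<epsilon> j powr s * A powr (t / p) < \<gamma>" "\<epsilon> j \<le> l / 4"
      by (auto simp: eventually_sequentially intro: less_imp_le)
    have d: "Lp_fun t ?M (\<lambda>x. \<phi> n x - avg (\<epsilon> j) (\<phi> n) x)" "Lp_int t ?M (\<lambda>x. \<phi> n x - avg (\<epsilon> j) (\<phi> n) x) < \<gamma>" for n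
    proof -
      have "Lp_int t ?M (\<lambda>x. \<phi> n x - avg (\<epsilon> j) (\<phi> n) x) \<le> C * \<epsilon> j powr s * Lp_int p (wmeas UNIV \<mu>) (grad (\<phi> n)) powr (t / p)"
        using C(2)[OF \<phi> \<epsilon> j(2)] by blast
      also have "\<dots> \<le> C * \<epsilon> j powr s * A powr (t / p)" using C(1) A t_pos p by (intro mult_left_mono powr_mono2) auto
      finally show "Lp_int t ?M (\<lambda>x. \<phi> n x - avg (\<epsilon> j) (\<phi> n) x) < \<gamma>" using j(1) by linarith
      show "Lp_fun t ?M (\<lambda>x. \<phi> n x - avg (\<epsilon> j) (\<phi> n) x)" using C(2)[OF \<phi> \<epsilon> j(2)] by blast
    qed
    obtain B where B: "B > 0" "\<And>n x. x \<in> fat_shell l \<Longrightarrow> \<bar>avg (\<epsilon> j) (\<phi> n) x\<bar> \<le> B"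
      using bnd[OF l j(2)] by blast
    define g where "g x = lim (\<lambda>n. avg (\<epsilon> j) (\<phi> (r n)) x)" for x
    have am: "avg (\<epsilon> j) (\<phi> n) \<in> borel_measurable borel" for n by (rule avg_measurable[OF borel_measurable_C0_infty(1)[OF \<phi>]])
    have gm: "g \<in> borel_measurable borel" unfolding g_def using am by (intro borel_measurable_lim_metric) auto
    have gl: "(\<lambda>n. avg (\<epsilon> j) (\<phi> (r n)) x) \<longlonglongrightarrow> g x" if "x \<in> fat_shell l" for x
      using conv[OF l j(2) that] by (simp add: g_def convergent_LIMSEQ_iff)
    have am': "avg (\<epsilon> j) (\<phi> n) \<in> borel_measurable ?M" "g \<in> borel_measurable ?M" for n
      using am gm by (auto intro!: measurable_restrict_space1 measurable_completion)
    have "Lp_conv t ?M (\<lambda>n. avg (\<epsilon> j) (\<phi> (r n))) g"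
    proof (rule Lp_dominated[OF t_pos am'])
      show "Lp_fun t ?M (\<lambda>x. 2 * B)"
        using B(1) by (intro Lp_wmeas_0_bounded(1)[where c = "2 * B", OF _ shell_borel bounded_shell t_pos]) auto
      show "AE x in ?M. (\<lambda>n. avg (\<epsilon> j) (\<phi> (r n)) x) \<longlonglongrightarrow> g x"
        unfolding AE_wmeas[OF shell_lebesgue(1)] using gl shell_subset_fat[OF l] by (intro AE_I2) auto
      show "AE x in ?M. norm (avg (\<epsilon> j) (\<phi> (r n)) x - g x) \<le> 2 * B" for n
        unfolding AE_wmeas[OF shell_lebesgue(1)]
      proof (intro AE_I2 impI)
        fix x assume "x \<in> (shell l :: 'a set)"
        then have x: "x \<in> fat_shell l" using shell_subset_fat[OF l] by auto
        have "(\<lambda>n. \<bar>avg (\<epsilon> j) (\<phi> (r n)) x\<bar>) \<longlonglongrightarrow> \<bar>g x\<bar>" by (intro tendsto_intros gl x)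
        then have "\<bar>g x\<bar> \<le> B" by (rule LIMSEQ_le_const2) (use B(2)[OF x] in auto)
        then show "norm (avg (\<epsilon> j) (\<phi> (r n)) x - g x) \<le> 2 * B" using B(2)[OF x, of "r n"] by simp
      qed
    qed
    moreover have "e / (4 * Q) > 0" using e Q by simp
    ultimately obtain K where K: "\<forall>m\<ge>K. \<forall>n\<ge>K. Lp_int t ?M (\<lambda>x. avg (\<epsilon> j) (\<phi> (r m)) x - avg (\<epsilon> j) (\<phi> (r n)) x) < e / (4 * Q)"
      using Lp_conv_Cauchy[OF t_ge_1] by blast
    have aL: "Lp_fun t ?M (avg (\<epsilon> j) (\<phi> n))" for n
      using B shell_subset_fat[OF l] by (intro Lp_wmeas_0_bounded(1)[where c = B, OF am shell_borel bounded_shell t_pos]) auto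
    show ?thesis
    proof (intro exI[of _ K] allI impI)
      fix m n assume mn: "m \<ge> K" "n \<ge> K"
      let ?f = "\<lambda>k x. \<phi> (r k) x - avg (\<epsilon> j) (\<phi> (r k)) x"
      let ?g = "\<lambda>x. avg (\<epsilon> j) (\<phi> (r m)) x - avg (\<epsilon> j) (\<phi> (r n)) x"
      have eq: "(\<lambda>x. \<phi> (r m) x - \<phi> (r n) x) = (\<lambda>x. (?f m x - ?f n x) + ?g x)" by auto
      have "Lp_int t ?M (\<lambda>x. \<phi> (r m) x - \<phi> (r n) x) \<le> Q * (Lp_int t ?M (\<lambda>x. ?f m x - ?f n x) + Lp_int t ?M ?g)"
        unfolding eq Q_def by (intro Lp_int_add_le_half t_ge_1 Lp_fun_diff d(1) aL)
      also have "\<dots> \<le> Q * (Q * (Lp_int t ?M (?f m) + Lp_int t ?M (?f n)) + Lp_int t ?M ?g)"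
        using Q unfolding Q_def by (intro mult_left_mono add_right_mono Lp_int_diff_le_half t_ge_1 d(1)) auto
      also have "\<dots> < Q * (Q * (\<gamma> + \<gamma>) + e / (4 * Q))"
        using Q d(2) K mn by (intro mult_strict_left_mono add_strict_mono) auto
      also have "\<dots> = e / 2 + e / 4" using Q by (simp add: \<gamma>_def field_simps)
      also have "\<dots> < e" using e by simp
      finally show "Lp_int t ?M (\<lambda>x. \<phi> (r m) x - \<phi> (r n) x) < e" .
    qed
  qed
  with r show ?thesis by (rule that)
qed

end

section \<open>Weak limits in the energy space\<close>

lemma is_W_grad_test:
  fixes \<phi> :: "'a::euclidean_space \<Rightarrow> real"
  assumes \<Omega>: "open \<Omega>" and p: "p > 1" and \<mu>: "0 < \<mu> + p" "\<mu> + p < real DIM('a)" and \<phi>: "\<phi> \<in> C0_infty \<Omega>"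
  shows "is_W_grad \<Omega> p \<mu> \<phi> (grad \<phi>)"
  unfolding is_W_grad_iff[OF \<Omega> p \<mu>]
  by (rule exI[of _ "\<lambda>n. \<phi>"]) (use \<phi> in \<open>auto simp: Lp_conv_def Lp_fun_def Lp_int_def\<close>)

lemma is_W_grad_diff:
  fixes \<Omega> :: "'a::euclidean_space set"
  assumes \<Omega>: "open \<Omega>" and p: "p > 1" and \<mu>: "0 < \<mu> + p" "\<mu> + p < real DIM('a)"
    and u: "is_W_grad \<Omega> p \<mu> u G" "is_W_grad \<Omega> p \<mu> u' G'"
  shows "is_W_grad \<Omega> p \<mu> (\<lambda>x. u x - u' x) (\<lambda>x. G x - G' x)"
proof -
  have p1: "p \<ge> 1" using p by simp
  obtain \<phi> where \<phi>: "\<And>n. \<phi> n \<in> C0_infty \<Omega>" "Lp_conv p (wmeas \<Omega> (\<mu> + p)) \<phi> u" "Lp_conv p (wmeas \<Omega> \<mu>) (\<lambda>n. grad (\<phi> n)) G"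
    using u(1) unfolding is_W_grad_iff[OF \<Omega> p \<mu>] by blast
  obtain \<psi> where \<psi>: "\<And>n. \<psi> n \<in> C0_infty \<Omega>" "Lp_conv p (wmeas \<Omega> (\<mu> + p)) \<psi> u'" "Lp_conv p (wmeas \<Omega> \<mu>) (\<lambda>n. grad (\<psi> n)) G'"
    using u(2) unfolding is_W_grad_iff[OF \<Omega> p \<mu>] by blast
  have "grad (\<lambda>x. \<phi> n x - \<psi> n x) = (\<lambda>x. grad (\<phi> n) x - grad (\<psi> n) x)" for n
    using grad_diff[OF \<phi>(1) \<psi>(1)] by auto
  then show ?thesis
    unfolding is_W_grad_iff[OF \<Omega> p \<mu>]
    using C0_infty_diff[OF \<phi>(1) \<psi>(1)] Lp_conv_diff[OF p1 \<phi>(2) \<psi>(2)] Lp_conv_diff[OF p1 \<phi>(3) \<psi>(3)]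
    by (intro exI[of _ "\<lambda>n x. \<phi> n x - \<psi> n x"]) auto
qed

text \<open>The convex hull of a tail of the sequence, as far as it is reached by taking midpoints.\<close>

inductive_set midpoint_hull :: "(nat \<Rightarrow> 'a \<Rightarrow> real) \<Rightarrow> nat \<Rightarrow> ('a \<Rightarrow> real) set" for \<phi> n where
  base: "n \<le> k \<Longrightarrow> \<phi> k \<in> midpoint_hull \<phi> n"
| mid: "f \<in> midpoint_hull \<phi> n \<Longrightarrow> g \<in> midpoint_hull \<phi> n \<Longrightarrow> (\<lambda>x. (1/2) * (f x + g x)) \<in> midpoint_hull \<phi> n"

lemma midpoint_hull_mono:
  assumes "n \<le> m" "f \<in> midpoint_hull \<phi> m"
  shows "f \<in> midpoint_hull \<phi> n"
  using assms(2,1)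
proof induction
  case (base k)
  then show ?case by (intro midpoint_hull.base) simp
next
  case (mid f g)
  then show ?case by (intro midpoint_hull.mid) auto
qed

text \<open>Weak lower semicontinuity without duality. In the hull of a tail of the sequence choose
  functions of almost minimal energy. Their midpoints lie in the hull and so have no smaller energy; by uniform
  convexity the gradients converge strongly. The pointwise limit is not affected.\<close>

lemma is_W_grad_limit:
  fixes \<Omega> :: "'a::euclidean_space set" and \<phi> :: "nat \<Rightarrow> 'a \<Rightarrow> real"
  assumes \<Omega>: "open \<Omega>" and p: "p > 1" and \<mu>: "0 < \<mu> + p" "\<mu> + p < real DIM('a)"
    and \<phi>: "\<And>n. \<phi> n \<in> C0_infty \<Omega>" and c: "\<And>n. Lp_int p (wmeas \<Omega> \<mu>) (grad (\<phi> n)) \<le> c n" "c \<longlonglongrightarrow> c0"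
    and u: "u \<in> borel_measurable (lebesgue_on \<Omega>)" and ae: "AE x in lebesgue. x \<in> \<Omega> \<longrightarrow> (\<lambda>n. \<phi> n x) \<longlonglongrightarrow> u x"
  obtains G where "is_W_grad \<Omega> p \<mu> u G" "Lp_int p (wmeas \<Omega> \<mu>) G \<le> c0"
proof -
  have \<Omega>L: "\<Omega> \<in> sets lebesgue" using \<Omega> by (simp add: borel_open)
  have p1: "p \<ge> 1" and \<mu>N: "\<mu> < real DIM('a)" using p \<mu> by auto
  let ?A = "\<lambda>f. Lp_int p (wmeas \<Omega> \<mu>) (grad f)"
  let ?H = "midpoint_hull \<phi>"
  have HC: "f \<in> C0_infty \<Omega>" if "f \<in> ?H n" for f n
    using that
  proof induction
    case (mid f g)
    show ?case by (intro C0_infty_cmult C0_infty_add mid.IH)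
  qed (rule \<phi>)
  have gL: "Lp_fun p (wmeas \<Omega> \<mu>) (grad f)" if "f \<in> C0_infty \<Omega>" for f
    using Lp_fun_C0_infty(2)[OF that \<mu>N _ \<Omega>L, of p] p by simp
  have gmid: "grad (\<lambda>x. (1/2) * (f x + g x)) = (\<lambda>x. (1/2) *\<^sub>R (grad f x + grad g x))"
    if "f \<in> C0_infty \<Omega>" "g \<in> C0_infty \<Omega>" for f g :: "'a \<Rightarrow> real"
    using grad_cmult[OF C0_infty_add[OF that], of "1/2"] grad_add[OF that] by auto
  have Hlim: "\<bar>f x - y\<bar> \<le> e" if "f \<in> ?H n" and k: "\<And>k. n \<le> k \<Longrightarrow> \<bar>\<phi> k x - y\<bar> \<le> e" for f n x y e
    using that(1)
  proof induction
    case (mid f g)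
    then show ?case by (auto simp: abs_le_iff field_simps)
  qed (rule k)
  define m where "m n = (INF f\<in>?H n. ?A f)" for n
  have bdd: "bdd_below (?A ` ?H n)" for n by (intro bdd_belowI[of _ 0]) auto
  have ne: "?H n \<noteq> {}" for n using midpoint_hull.base[of n n \<phi>] by auto
  have m_le: "m n \<le> ?A f" if "f \<in> ?H n" for f n unfolding m_def by (rule cINF_lower[OF bdd that])
  have m_mono: "incseq m"
    unfolding incseq_def m_def
    by (intro allI impI cINF_superset_mono ne bdd) (auto intro: midpoint_hull_mono)
  have m_c: "m n \<le> c0" for n
    by (rule LIMSEQ_le_const[OF c(2)]) (use m_le[OF midpoint_hull.base] c(1) in \<open>blast intro: order_trans\<close>)
  obtain L where L: "m \<longlonglongrightarrow> L" using m_mono incseq_convergent[of m c0] m_c by blast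
  have Lc: "L \<le> c0" by (rule LIMSEQ_le_const2[OF L]) (use m_c in auto)
  have "\<exists>f\<in>?H n. ?A f < m n + 1 / real (Suc n)" for n
    using cINF_less_iff[OF ne bdd, of n "m n + 1 / real (Suc n)"] by (simp add: m_def)
  then obtain v where v: "\<And>n. v n \<in> ?H n" "\<And>n. ?A (v n) < m n + 1 / real (Suc n)" by metis
  have vC: "v n \<in> C0_infty \<Omega>" for n by (rule HC[OF v(1)])
  have vL: "(\<lambda>n. ?A (v n)) \<longlonglongrightarrow> L"
  proof (rule tendsto_sandwich[OF _ _ L])
    have "(\<lambda>n. m n + inverse (real (Suc n))) \<longlonglongrightarrow> L + 0" by (intro tendsto_intros L LIMSEQ_inverse_real_of_nat)
    then show "(\<lambda>n. m n + inverse (real (Suc n))) \<longlonglongrightarrow> L" by simp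
  qed (use m_le[OF v(1)] v(2) in \<open>auto intro!: always_eventually less_imp_le simp: inverse_eq_divide\<close>)
  have cauchy: "\<exists>K. \<forall>i\<ge>K. \<forall>j\<ge>K. Lp_int p (wmeas \<Omega> \<mu>) (\<lambda>x. grad (v i) x - grad (v j) x) < e" if "e > 0" for e
  proof (rule Lp_minimizing_Cauchy[OF p gL[OF vC] vL L _ that])
    fix i j
    have "(\<lambda>x. (1/2) * (v i x + v j x)) \<in> ?H (min i j)"
      using midpoint_hull_mono[OF min.cobounded1 v(1)] midpoint_hull_mono[OF min.cobounded2 v(1)]
      by (intro midpoint_hull.mid)
    then show "m (min i j) \<le> Lp_int p (wmeas \<Omega> \<mu>) (\<lambda>x. (1/2) *\<^sub>R (grad (v i) x + grad (v j) x))"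
      using m_le gmid[OF vC vC] by metis
  qed
  obtain G where G: "Lp_fun p (wmeas \<Omega> \<mu>) G" "Lp_conv p (wmeas \<Omega> \<mu>) (\<lambda>n. grad (v n)) G"
    by (rule Lp_complete[of p _ "\<lambda>n. grad (v n)", OF p1 gL[OF vC] cauchy]) blast+
  have AG: "Lp_int p (wmeas \<Omega> \<mu>) G \<le> c0"
    using LIMSEQ_unique[OF Lp_conv_int[OF p1 G(2,1)] vL] Lc by simp
  obtain H where H: "H > 0" "\<And>\<phi> :: 'a \<Rightarrow> real. \<And>\<Omega>. \<phi> \<in> C0_infty \<Omega> \<Longrightarrow>
    Lp_int p (wmeas UNIV (\<mu> + p)) \<phi> \<le> H * Lp_int p (wmeas UNIV \<mu>) (grad \<phi>)"
    by (rule Hardy[OF p \<mu>(2)]) blast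
  have vLp: "Lp_fun p (wmeas \<Omega> (\<mu> + p)) (v n)" for n
    using Lp_fun_C0_infty(1)[OF vC \<mu>(2) _ \<Omega>L, of p] p by simp
  have vcauchy: "\<exists>K. \<forall>i\<ge>K. \<forall>j\<ge>K. Lp_int p (wmeas \<Omega> (\<mu> + p)) (\<lambda>x. v i x - v j x) < e" if e: "e > 0" for e
  proof -
    have "e / H > 0" using e H by simp
    then obtain K where K: "\<forall>i\<ge>K. \<forall>j\<ge>K. Lp_int p (wmeas \<Omega> \<mu>) (\<lambda>x. grad (v i) x - grad (v j) x) < e / H" using cauchy by blast
    have "Lp_int p (wmeas \<Omega> (\<mu> + p)) (\<lambda>x. v i x - v j x) < e" if "i \<ge> K" "j \<ge> K" for i j
    proof -
      have t: "(\<lambda>x. v i x - v j x) \<in> C0_infty \<Omega>" by (intro C0_infty_diff vC)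
      have g: "grad (\<lambda>x. v i x - v j x) = (\<lambda>x. grad (v i) x - grad (v j) x)" using grad_diff[OF vC vC] by auto
      have "Lp_int p (wmeas \<Omega> (\<mu> + p)) (\<lambda>x. v i x - v j x) \<le> H * Lp_int p (wmeas \<Omega> \<mu>) (\<lambda>x. grad (v i) x - grad (v j) x)"
        using H(2)[OF t] Lp_int_C0_infty[OF t \<Omega>L order_refl, of p] p by (simp add: g)
      also have "\<dots> < H * (e / H)" using K that H(1) by (intro mult_strict_left_mono) auto
      finally show ?thesis using H(1) by simp
    qed
    then show ?thesis by blast
  qed
  obtain w where w: "Lp_fun p (wmeas \<Omega> (\<mu> + p)) w" "Lp_conv p (wmeas \<Omega> (\<mu> + p)) v w"
    by (rule Lp_complete[of p _ v, OF p1 vLp vcauchy]) blast+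
  have p0: "p > 0" using p by simp
  obtain r where r: "strict_mono r" and wae: "AE x in wmeas \<Omega> (\<mu> + p). (\<lambda>n. v (r n) x) \<longlonglongrightarrow> w x"
    by (rule Lp_conv_AE_subseq[OF p0 w(2)]) blast
  have vu: "(\<lambda>n. v n x) \<longlonglongrightarrow> u x" if lim: "(\<lambda>n. \<phi> n x) \<longlonglongrightarrow> u x" for x
  proof (rule LIMSEQ_I)
    fix e :: real assume e: "e > 0"
    then obtain n0 where n0: "\<And>k. k \<ge> n0 \<Longrightarrow> norm (\<phi> k x - u x) < e / 2" using LIMSEQ_D[OF lim, of "e / 2"] by auto
    have "\<bar>v n x - u x\<bar> \<le> e / 2" if "n \<ge> n0" for n
      by (rule Hlim[OF v(1)]) (use n0 that in \<open>force intro!: less_imp_le\<close>)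
    then show "\<exists>no. \<forall>n\<ge>no. norm (v n x - u x) < e" using e by (intro exI[of _ n0]) force
  qed
  have uw: "AE x in lebesgue. x \<in> \<Omega> \<longrightarrow> u x = w x"
    using ae wae[unfolded AE_wmeas[OF \<Omega>L]]
  proof eventually_elim
    case (elim x)
    show ?case
    proof
      assume x: "x \<in> \<Omega>"
      have "(\<lambda>n. v (r n) x) \<longlonglongrightarrow> u x" using LIMSEQ_subseq_LIMSEQ[OF vu r] elim x by (simp add: o_def)
      then show "u x = w x" using elim x LIMSEQ_unique by blast
    qed
  qed
  have wm: "w \<in> borel_measurable (lebesgue_on \<Omega>)" using w(1) by auto
  have vm: "v n \<in> borel_measurable (lebesgue_on \<Omega>)" for n by (rule borel_measurable_C0_infty(3)[OF vC])
  have "Lp_conv p (wmeas \<Omega> (\<mu> + p)) v u"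
  proof -
    have m: "(\<lambda>x. v n x - u x) \<in> borel_measurable (lebesgue_on \<Omega>)" "(\<lambda>x. v n x - w x) \<in> borel_measurable (lebesgue_on \<Omega>)" for n
      using vm u wm by measurable
    have ae2: "AE x in lebesgue. x \<in> \<Omega> \<longrightarrow> v n x - u x = v n x - w x" for n using uw by eventually_elim auto
    show ?thesis
      using w(2) Lp_cong_AE[OF \<Omega>L m ae2] by (simp add: Lp_conv_def)
  qed
  then have "is_W_grad \<Omega> p \<mu> u G"
    unfolding is_W_grad_iff[OF \<Omega> p \<mu>] using vC G(2) by blast
  then show ?thesis using AG by (rule that)
qed

section \<open>Compactness of the embedding\<close>

lemma Lp_countable_union:
  fixes f :: "'a::euclidean_space \<Rightarrow> real"
  assumes S: "S \<in> sets lebesgue" "\<And>i. W i \<in> sets lebesgue" "S - {0} \<subseteq> (\<Union>i. W i)" and fm: "f \<in> borel_measurable (lebesgue_on S)"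
    and f: "\<And>i. Lp_fun t (wmeas (W i) m) f" "\<And>i. Lp_int t (wmeas (W i) m) f \<le> c i" and c: "summable c"
  shows "Lp_fun t (wmeas S m) f" "Lp_int t (wmeas S m) f \<le> suminf c"
proof -
  have c0: "c i \<ge> 0" for i using f(2)[of i] order_trans[OF Lp_int_nonneg] by blast
  let ?g = "\<lambda>i x. indicator (W i) x * (norm (f x) powr t / norm x powr m)"
  have gm: "?g i \<in> borel_measurable lebesgue" for i
    using f(1)[of i] S by (auto simp: Lp_fun_wmeas)
  have "(\<integral>\<^sup>+x. ennreal (indicator S x * (norm (f x) powr t / norm x powr m)) \<partial>lebesgue)
      \<le> (\<integral>\<^sup>+x. (\<Sum>i. ennreal (?g i x)) \<partial>lebesgue)"
  proof (rule nn_integral_mono)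
    fix x :: 'a
    show "ennreal (indicator S x * (norm (f x) powr t / norm x powr m)) \<le> (\<Sum>i. ennreal (?g i x))"
    proof (cases "x \<in> S - {0}")
      case True
      then obtain i where i: "x \<in> W i" using S(3) by blast
      have "ennreal (indicator S x * (norm (f x) powr t / norm x powr m)) = (\<Sum>i\<in>{i}. ennreal (?g i x))" using True i by simp
      also have "\<dots> \<le> (\<Sum>i. ennreal (?g i x))" by (intro sum_le_suminf) auto
      finally show ?thesis .
    qed auto
  qed
  also have "\<dots> = (\<Sum>i. \<integral>\<^sup>+x. ennreal (?g i x) \<partial>lebesgue)"
    using gm by (intro nn_integral_suminf) auto
  also have "\<dots> = (\<Sum>i. ennreal (Lp_int t (wmeas (W i) m) f))"
    by (intro suminf_cong nn_integral_wmeas S f)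
  also have "\<dots> \<le> (\<Sum>i. ennreal (c i))" by (intro suminf_le ennreal_leI f) auto
  also have "\<dots> = ennreal (suminf c)" by (rule suminf_ennreal2[OF c0 c])
  finally have le: "(\<integral>\<^sup>+x. ennreal (indicator S x * (norm (f x) powr t / norm x powr m)) \<partial>lebesgue) \<le> ennreal (suminf c)" .
  note mm = weighted_powr_measurable[OF S(1) fm, of t m]
  have i: "integrable lebesgue (\<lambda>x. indicator S x * (norm (f x) powr t / norm x powr m))"
    using le mm by (intro integrableI_nonneg) (auto intro: le_less_trans)
  then show L: "Lp_fun t (wmeas S m) f" using fm S by (simp add: Lp_fun_wmeas)
  show "Lp_int t (wmeas S m) f \<le> suminf c"
    using le suminf_nonneg[OF c c0] unfolding nn_integral_wmeas[OF S(1) L] by simp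
qed

text \<open>On a shell a power of \<open>norm x\<close> is the same power of \<open>l\<close> up to a factor, so the three weights do
  not have to match.\<close>

lemma shell_Holder:
  fixes u :: "'a::euclidean_space \<Rightarrow> real"
  assumes l: "l > 0" and S: "S \<in> sets lebesgue" "S \<subseteq> shell l" and y: "0 < y" "y < 1"
    and e: "r = q * y + t * (1 - y)"
    and q: "Lp_fun q (wmeas S \<sigma>) u" and t: "Lp_fun t (wmeas S 0) u"
  shows "Lp_fun r (wmeas S s) u"
    "Lp_int r (wmeas S s) u \<le> 2 powr \<bar>\<sigma> * y - s\<bar> * l powr (\<sigma> * y - s) * (Lp_int q (wmeas S \<sigma>) u powr y * Lp_int t (wmeas S 0) u powr (1 - y))"
proof -
  have um: "u \<in> borel_measurable (lebesgue_on S)" using q by auto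
  let ?F = "\<lambda>x. indicator S x * (norm (u x) powr q / norm x powr \<sigma>)"
  let ?G = "\<lambda>x. indicator S x * (norm (u x) powr t / norm x powr 0)"
  let ?D = "\<lambda>x. indicator S x * (norm (u x) powr r / norm x powr s)"
  define c where "c = 2 powr \<bar>\<sigma> * y - s\<bar> * l powr (\<sigma> * y - s)"
  have c: "c > 0" using l by (simp add: c_def)
  have iF: "integrable lebesgue ?F" and iG: "integrable lebesgue ?G" using q t S by (auto simp: Lp_fun_wmeas)
  have F0: "?F x \<ge> 0" and G0: "?G x \<ge> 0" for x by auto
  note H = Holder_powr[OF less_imp_le[OF y(1)] less_imp_le[OF y(2)] iF F0 iG G0]
  have pt: "?D x \<le> c * (?F x powr y * ?G x powr (1 - y))" for x
  proof (cases "x \<in> S")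
    case True
    then have x: "l \<le> norm x" "norm x < 2 * l" using S(2) by (auto simp: shell_def)
    then have x0: "norm x > 0" using l by linarith
    have w: "norm x powr (\<sigma> * y - s) \<le> c"
    proof -
      have "norm x powr (\<sigma> * y - s) = l powr (\<sigma> * y - s) * (norm x / l) powr (\<sigma> * y - s)"
        using x0 l by (simp add: powr_divide)
      also have "(norm x / l) powr (\<sigma> * y - s) \<le> (norm x / l) powr \<bar>\<sigma> * y - s\<bar>"
        using x l by (intro powr_mono) (auto simp: field_simps)
      also have "\<dots> \<le> 2 powr \<bar>\<sigma> * y - s\<bar>" using x l by (intro powr_mono2) (auto simp: field_simps)
      finally show ?thesis using l by (simp add: c_def mult.commute)
    qed
    have "?D x = norm (u x) powr r * (norm x powr (\<sigma> * y - s) * norm x powr (- (\<sigma> * y)))"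
      using True by (simp add: powr_add[symmetric]) (simp add: powr_minus_divide)
    also have "\<dots> \<le> norm (u x) powr r * (c * norm x powr (- (\<sigma> * y)))"
      using w by (intro mult_left_mono mult_right_mono) auto
    also have "\<dots> = c * (norm (u x) powr r * norm x powr (- (\<sigma> * y)))" by simp
    also have "norm (u x) powr r * norm x powr (- (\<sigma> * y)) = ?F x powr y * ?G x powr (1 - y)"
      using True x0 by (simp add: powr_divide powr_powr e powr_add powr_minus_divide)
    finally show ?thesis .
  qed simp
  note mm = weighted_powr_measurable[OF S(1) um, of r s]
  have iD: "integrable lebesgue ?D"
    by (rule Bochner_Integration.integrable_bound[OF integrable_mult_right[OF H(1), of c] mm])
      (use pt c in \<open>auto intro!: AE_I2 simp: abs_mult simp del: indicator_simps\<close>)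
  then show "Lp_fun r (wmeas S s) u" using um S by (simp add: Lp_fun_wmeas)
  have "Lp_int r (wmeas S s) u = (\<integral>x. ?D x \<partial>lebesgue)" by (rule Lp_int_wmeas[OF S(1) um])
  also have "\<dots> \<le> (\<integral>x. c * (?F x powr y * ?G x powr (1 - y)) \<partial>lebesgue)"
    by (rule integral_mono[OF iD integrable_mult_right[OF H(1)] pt])
  also have "\<dots> = c * (\<integral>x. ?F x powr y * ?G x powr (1 - y) \<partial>lebesgue)" by (rule integral_mult_right_zero)
  also have "\<dots> \<le> c * ((\<integral>x. ?F x \<partial>lebesgue) powr y * (\<integral>x. ?G x \<partial>lebesgue) powr (1 - y))"
    using c by (intro mult_left_mono H(2)) simp
  finally show "Lp_int r (wmeas S s) u \<le> 2 powr \<bar>\<sigma> * y - s\<bar> * l powr (\<sigma> * y - s) * (Lp_int q (wmeas S \<sigma>) u powr y * Lp_int t (wmeas S 0) u powr (1 - y))"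
    unfolding Lp_int_wmeas[OF S(1) um] c_def .
qed

text \<open>The equations \<open>amplitude\<close> and \<open>dilation\<close> say that both sides of
  \<open>D \<le> K * A powr \<theta>1 * B powr \<theta>2\<close> are multiplied by the same factor if \<open>u\<close> is multiplied by a constant or
  dilated, and \<open>det\<close> says that these two operations change the pair of \<open>A\<close> and \<open>B\<close> independently.
  The last two assumptions say that \<open>t = p * \<theta>1 / (1 - \<theta>2)\<close> satisfies \<open>p < t\<close> and
  \<open>N * (t - p) < p * t\<close>.\<close>

locale ckn =
  fixes \<Omega> :: "'a::euclidean_space set" and p q r \<mu> \<sigma> s \<alpha> \<beta> \<gamma> \<theta>1 \<theta>2 :: real
  assumes open_\<Omega>: "open \<Omega>" and p: "p > 1" and q: "q \<ge> 1" and r: "r \<ge> 1"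
    and \<alpha>_eq: "\<alpha> = real DIM('a) - \<mu> - p" and \<beta>_eq: "\<beta> = real DIM('a) - \<sigma>" and \<gamma>_eq: "\<gamma> = real DIM('a) - s"
    and \<mu>p: "0 < \<mu> + p" and \<alpha>0: "0 < \<alpha>" and \<beta>0: "0 < \<beta>"
    and det: "\<alpha> * q < \<beta> * p"
    and amplitude: "p * \<theta>1 + q * \<theta>2 = r" and dilation: "\<alpha> * \<theta>1 + \<beta> * \<theta>2 = \<gamma>"
    and \<theta>1: "0 < \<theta>1" and \<theta>2: "0 < \<theta>2" "\<theta>2 < 1"
    and \<theta>_gt: "1 < \<theta>1 + \<theta>2" and conc: "real DIM('a) * (\<theta>1 + \<theta>2 - 1) < p * \<theta>1"
begin

lemma \<Omega>L: "\<Omega> \<in> sets lebesgue"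
  using open_\<Omega> by (simp add: borel_open)

lemma \<mu>pN: "\<mu> + p < real DIM('a)"
  using \<alpha>0 \<alpha>_eq by simp

lemma p_ge_1: "p \<ge> 1" using p by simp

definition E :: "('a \<Rightarrow> real) \<Rightarrow> ('a \<Rightarrow> 'a) \<Rightarrow> bool" where
  "E u G \<longleftrightarrow> is_W_grad \<Omega> p \<mu> u G \<and> Lp_fun q (wmeas \<Omega> \<sigma>) u"

abbreviation "intA G \<equiv> Lp_int p (wmeas \<Omega> \<mu>) G"
abbreviation "intB u \<equiv> Lp_int q (wmeas \<Omega> \<sigma>) u"
abbreviation "intD u \<equiv> Lp_int r (wmeas \<Omega> s) u"

lemma E_diff: "E u G \<Longrightarrow> E v H \<Longrightarrow> E (\<lambda>x. u x - v x) (\<lambda>x. G x - H x)"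
  unfolding E_def using is_W_grad_diff[OF open_\<Omega> p \<mu>p \<mu>pN] Lp_fun_diff[OF q] by blast

lemma E_Lp:
  assumes "E u G"
  shows "Lp_fun p (wmeas \<Omega> \<mu>) G" "Lp_fun p (wmeas \<Omega> (\<mu> + p)) u" "Lp_fun q (wmeas \<Omega> \<sigma>) u"
    "u \<in> borel_measurable (lebesgue_on \<Omega>)"
  using assms is_W_grad_Lp[OF open_\<Omega> p \<mu>p \<mu>pN, of u G] by (auto simp: E_def)

lemma E_space_iff: "u \<in> E_space \<Omega> p q \<mu> \<sigma> \<longleftrightarrow> (\<exists>G. E u G)"
proof -
  have "\<sigma> < real DIM('a)" using \<beta>0 \<beta>_eq by simp
  then show ?thesis
    by (auto simp: E_space_def W_space_def E_def Lq_space_iff[OF open_\<Omega> q])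
qed

lemma grad_int_eq: "E u G \<Longrightarrow> grad_int \<Omega> p \<mu> u = intA G"
  using is_W_grad_Lp(3)[OF open_\<Omega> p \<mu>p \<mu>pN] by (simp add: E_def)

text \<open>Exponents \<open>x\<close> of \<open>intA\<close> and \<open>y\<close> of \<open>intB\<close> with which the inequality holds on a single shell.
  The amplitudes still match; only the factor for dilations depends on the size of the shell.\<close>

definition local_exponents :: "real \<Rightarrow> real \<Rightarrow> bool" where
  "local_exponents x y \<longleftrightarrow> 0 < x \<and> 0 < y \<and> y < 1 \<and> 1 \<le> x + y \<and> real DIM('a) * (x + y - 1) < p * x \<and> p * x + q * y = r"

lemma local_exponents_subcritical:
  assumes "local_exponents x y"
  defines "t \<equiv> p * x / (1 - y)"
  shows "subcritical_exponents TYPE('a) p \<mu> t" "r = q * y + t * (1 - y)" "t > 0"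
proof -
  note xy = assms(1)[unfolded local_exponents_def]
  have t: "t * (1 - y) = p * x" using xy by (simp add: t_def)
  have "p * (1 - y) \<le> t * (1 - y)" unfolding t using xy p by (intro mult_left_mono) auto
  then have pt: "p \<le> t" using xy by simp
  have "(real DIM('a) * (t - p)) * (1 - y) = real DIM('a) * (t * (1 - y)) - real DIM('a) * p * (1 - y)"
    by (simp add: algebra_simps)
  also have "\<dots> = p * (real DIM('a) * (x + y - 1))" unfolding t by (simp add: algebra_simps)
  also have "\<dots> < p * (p * x)" using xy p by (intro mult_strict_left_mono) auto
  also have "\<dots> = (p * t) * (1 - y)" using t by simp
  finally have "real DIM('a) * (t - p) < p * t" using xy by simp
  then show "subcritical_exponents TYPE('a) p \<mu> t"
    using p \<mu>p \<mu>pN pt by unfold_locales auto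
  show "r = q * y + t * (1 - y)" using t xy by simp
  show "t > 0" using pt p by simp
qed

lemma shell_bound_2:
  assumes xy: "local_exponents x y" and l: "l > 0" and u: "E u G"
  defines "t \<equiv> p * x / (1 - y)"
  shows "Lp_fun r (wmeas (\<Omega> \<inter> shell l) s) u"
    "Lp_int r (wmeas (\<Omega> \<inter> shell l) s) u \<le> 2 powr \<bar>\<sigma> * y - s\<bar> * l powr (\<sigma> * y - s) *
       (intB u powr y * Lp_int t (wmeas (\<Omega> \<inter> shell l) 0) u powr (1 - y))"
proof -
  interpret S: subcritical_exponents p \<mu> t "TYPE('a)"
    unfolding t_def by (rule local_exponents_subcritical(1)[OF xy])
  have y: "0 < y" "y < 1" using xy by (auto simp: local_exponents_def)
  have SL: "\<Omega> \<inter> shell l \<in> sets lebesgue" using \<Omega>L by (intro sets.Int) auto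
  obtain C where "\<And>(u :: 'a \<Rightarrow> real) G \<Omega> l. open \<Omega> \<Longrightarrow> is_W_grad \<Omega> p \<mu> u G \<Longrightarrow> l > 0 \<Longrightarrow> Lp_fun t (wmeas (\<Omega> \<inter> shell l) 0) u"
    by (rule S.shell_Sobolev) blast
  then have ut: "Lp_fun t (wmeas (\<Omega> \<inter> shell l) 0) u" using open_\<Omega> u l by (auto simp: E_def)
  note uq = Lp_wmeas_subset[OF SL \<Omega>L Int_lower1 E_Lp(3)[OF u]]
  note H = shell_Holder[OF l SL Int_lower2 y local_exponents_subcritical(2)[OF xy] uq(1) ut[unfolded t_def], of s]
  show "Lp_fun r (wmeas (\<Omega> \<inter> shell l) s) u" by (rule H(1))
  note H(2)
  also have "2 powr \<bar>\<sigma> * y - s\<bar> * l powr (\<sigma> * y - s) * (Lp_int q (wmeas (\<Omega> \<inter> shell l) \<sigma>) u powr y * Lp_int (p * x / (1 - y)) (wmeas (\<Omega> \<inter> shell l) 0) u powr (1 - y))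
    \<le> 2 powr \<bar>\<sigma> * y - s\<bar> * l powr (\<sigma> * y - s) * (intB u powr y * Lp_int t (wmeas (\<Omega> \<inter> shell l) 0) u powr (1 - y))"
    unfolding t_def using uq(2) y by (intro mult_left_mono mult_right_mono powr_mono2) auto
  finally show "Lp_int r (wmeas (\<Omega> \<inter> shell l) s) u \<le> 2 powr \<bar>\<sigma> * y - s\<bar> * l powr (\<sigma> * y - s) *
       (intB u powr y * Lp_int t (wmeas (\<Omega> \<inter> shell l) 0) u powr (1 - y))" .
qed

lemma shell_bound:
  assumes xy: "local_exponents x y"
  obtains C where "C > 0" "\<And>u G l. E u G \<Longrightarrow> l > 0 \<Longrightarrow>
    Lp_int r (wmeas (\<Omega> \<inter> shell l) s) u \<le> C * l powr (\<gamma> - \<alpha> * x - \<beta> * y) * (intA G powr x * intB u powr y)"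
proof -
  define t where "t = p * x / (1 - y)"
  interpret S: subcritical_exponents p \<mu> t "TYPE('a)"
    unfolding t_def by (rule local_exponents_subcritical(1)[OF xy])
  have y: "0 < y" "y < 1" using xy by (auto simp: local_exponents_def)
  have ty: "t * (1 - y) = p * x" using y by (simp add: t_def)
  obtain C where C: "C > 0" "\<And>(u :: 'a \<Rightarrow> real) G \<Omega> l. open \<Omega> \<Longrightarrow> is_W_grad \<Omega> p \<mu> u G \<Longrightarrow> l > 0 \<Longrightarrow>
    Lp_fun t (wmeas (\<Omega> \<inter> shell l) 0) u \<and>
    Lp_int t (wmeas (\<Omega> \<inter> shell l) 0) u
      \<le> C * l powr (real DIM('a) - (real DIM('a) - \<mu> - p) * t / p) * Lp_int p (wmeas \<Omega> \<mu>) G powr (t / p)"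
    by (rule S.shell_Sobolev) blast
  define C' where "C' = 2 powr \<bar>\<sigma> * y - s\<bar> * C powr (1 - y)"
  have "Lp_int r (wmeas (\<Omega> \<inter> shell l) s) u \<le> C' * l powr (\<gamma> - \<alpha> * x - \<beta> * y) * (intA G powr x * intB u powr y)"
    if u: "E u G" and l: "l > 0" for u G l
  proof -
    let ?T = "Lp_int t (wmeas (\<Omega> \<inter> shell l) 0) u"
    have "?T powr (1 - y) \<le> (C * l powr (real DIM('a) - \<alpha> * t / p) * intA G powr (t / p)) powr (1 - y)"
      using C(2)[OF open_\<Omega> _ l, of u G] u y by (intro powr_mono2) (auto simp: E_def \<alpha>_eq)
    also have "\<dots> = C powr (1 - y) * l powr ((real DIM('a) - \<alpha> * t / p) * (1 - y)) * intA G powr ((t / p) * (1 - y))"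
      by (simp only: powr_mult powr_powr)
    also have "(t / p) * (1 - y) = x" using ty p by (simp add: field_simps)
    finally have T: "?T powr (1 - y) \<le> C powr (1 - y) * l powr ((real DIM('a) - \<alpha> * t / p) * (1 - y)) * intA G powr x" .
    have ex: "(real DIM('a) - \<alpha> * t / p) * (1 - y) = \<gamma> - \<alpha> * x - \<beta> * y - (\<sigma> * y - s)"
    proof -
      have "(\<alpha> * t / p) * (1 - y) = \<alpha> * (t * (1 - y)) / p" by simp
      also have "\<dots> = \<alpha> * x" unfolding ty using p by simp
      finally show ?thesis by (simp add: left_diff_distrib \<beta>_eq \<gamma>_eq algebra_simps)
    qed
    have "Lp_int r (wmeas (\<Omega> \<inter> shell l) s) u \<le> 2 powr \<bar>\<sigma> * y - s\<bar> * l powr (\<sigma> * y - s) * (intB u powr y * ?T powr (1 - y))"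
      unfolding t_def by (rule shell_bound_2(2)[OF xy l u])
    also have "\<dots> \<le> 2 powr \<bar>\<sigma> * y - s\<bar> * l powr (\<sigma> * y - s) *
        (intB u powr y * (C powr (1 - y) * l powr (\<gamma> - \<alpha> * x - \<beta> * y - (\<sigma> * y - s)) * intA G powr x))"
      using T unfolding ex by (intro mult_left_mono) auto
    also have "\<dots> = C' * (l powr (\<sigma> * y - s) * l powr (\<gamma> - \<alpha> * x - \<beta> * y - (\<sigma> * y - s))) * (intA G powr x * intB u powr y)"
      unfolding C'_def by (simp only: mult.assoc mult.commute mult.left_commute)
    also have "l powr (\<sigma> * y - s) * l powr (\<gamma> - \<alpha> * x - \<beta> * y - (\<sigma> * y - s)) = l powr (\<gamma> - \<alpha> * x - \<beta> * y)"
      unfolding powr_add[symmetric] by (rule arg_cong[where f = "\<lambda>z. l powr z"]) simp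
    finally show ?thesis .
  qed
  moreover have "C' > 0" using C(1) by (simp add: C'_def)
  ultimately show ?thesis using that[of C'] by blast
qed

lemma local_exponents_main: "local_exponents \<theta>1 \<theta>2"
  using \<theta>1 \<theta>2 \<theta>_gt conc amplitude by (simp add: local_exponents_def)

text \<open>The conditions are strict, so the exponents can be moved in either direction along the line
  that keeps amplitudes invariant. Dilations are then no longer neutral: on the shell of radius \<open>l\<close> a factor
  \<open>l powr \<kappa>\<close>, respectively \<open>l powr (- \<kappa>)\<close>, is gained.\<close>

lemma local_exponents_perturb:
  obtains \<delta> where "\<delta> > 0" "local_exponents (\<theta>1 + q * \<delta>) (\<theta>2 - p * \<delta>)" "local_exponents (\<theta>1 - q * \<delta>) (\<theta>2 + p * \<delta>)"
proof -
  have lin: "\<forall>\<^sub>F \<delta> in at_right 0. 0 < c + d * \<delta>" if "0 < c" for c d :: real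
  proof -
    have "((\<lambda>\<delta>. c + d * \<delta>) \<longlongrightarrow> c + d * 0) (at_right 0)" by (intro tendsto_intros)
    then show ?thesis using that by (intro order_tendstoD(1)) auto
  qed
  let ?N = "real DIM('a)"
  have "\<forall>\<^sub>F \<delta> in at_right 0. 0 < \<delta> \<and> 0 < \<theta>2 + (- p) * \<delta> \<and> 0 < \<theta>1 + (- q) * \<delta> \<and> 0 < (1 - \<theta>2) + (- p) * \<delta>
      \<and> 0 < (\<theta>1 + \<theta>2 - 1) + (q - p) * \<delta> \<and> 0 < (\<theta>1 + \<theta>2 - 1) + (p - q) * \<delta>
      \<and> 0 < (p * \<theta>1 - ?N * (\<theta>1 + \<theta>2 - 1)) + (p * q - ?N * (q - p)) * \<delta>
      \<and> 0 < (p * \<theta>1 - ?N * (\<theta>1 + \<theta>2 - 1)) + (- (p * q) + ?N * (q - p)) * \<delta>"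
    using \<theta>1 \<theta>2 \<theta>_gt conc by (intro eventually_conj lin eventually_at_right_less) auto
  then obtain \<delta> where \<delta>: "0 < \<delta>" "0 < \<theta>2 + (- p) * \<delta>" "0 < \<theta>1 + (- q) * \<delta>" "0 < (1 - \<theta>2) + (- p) * \<delta>"
      "0 < (\<theta>1 + \<theta>2 - 1) + (q - p) * \<delta>" "0 < (\<theta>1 + \<theta>2 - 1) + (p - q) * \<delta>"
      "0 < (p * \<theta>1 - ?N * (\<theta>1 + \<theta>2 - 1)) + (p * q - ?N * (q - p)) * \<delta>"
      "0 < (p * \<theta>1 - ?N * (\<theta>1 + \<theta>2 - 1)) + (- (p * q) + ?N * (q - p)) * \<delta>"
    using eventually_happens[of _ "at_right (0::real)"] by force
  have pq: "0 < q * \<delta>" "0 < p * \<delta>" using \<delta>(1) p q by auto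
  show ?thesis
  proof (rule that[OF \<delta>(1)])
    have "?N * ((\<theta>1 + q * \<delta>) + (\<theta>2 - p * \<delta>) - 1) < p * (\<theta>1 + q * \<delta>)" using \<delta>(7) by (simp add: algebra_simps)
    moreover have "p * (\<theta>1 + q * \<delta>) + q * (\<theta>2 - p * \<delta>) = r" using amplitude by (simp add: algebra_simps)
    ultimately show "local_exponents (\<theta>1 + q * \<delta>) (\<theta>2 - p * \<delta>)"
      using \<delta> pq \<theta>1 \<theta>2 by (simp add: local_exponents_def algebra_simps)
    have "?N * ((\<theta>1 - q * \<delta>) + (\<theta>2 + p * \<delta>) - 1) < p * (\<theta>1 - q * \<delta>)" using \<delta>(8) by (simp add: algebra_simps)
    moreover have "p * (\<theta>1 - q * \<delta>) + q * (\<theta>2 + p * \<delta>) = r" using amplitude by (simp add: algebra_simps)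
    ultimately show "local_exponents (\<theta>1 - q * \<delta>) (\<theta>2 + p * \<delta>)"
      using \<delta> pq \<theta>1 \<theta>2 by (simp add: local_exponents_def algebra_simps)
  qed
qed

text \<open>Radii of dyadic shells, going outwards along the even and inwards along the odd indices.\<close>

definition radius :: "nat \<Rightarrow> real" where
  "radius i = (if even i then 2 powr real (i div 2) else 2 powr (- real (i div 2 + 1)))"

lemma radius_pos: "radius i > 0"
  by (simp add: radius_def)

lemma radius_cover: "\<Omega> - {0} \<subseteq> (\<Union>i. \<Omega> \<inter> shell (radius i))"
proof
  fix x assume x: "x \<in> \<Omega> - {0}"
  define k where "k = \<lfloor>log 2 (norm x)\<rfloor>"
  have n0: "norm x > 0" using x by simp
  have k: "2 powr real_of_int k \<le> norm x" "norm x < 2 * 2 powr real_of_int k"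
  proof -
    have "real_of_int k \<le> log 2 (norm x)" "log 2 (norm x) < real_of_int k + 1" by (auto simp: k_def)
    then have "2 powr real_of_int k \<le> norm x" "norm x < 2 powr (real_of_int k + 1)"
      using n0 by (simp_all add: le_log_iff log_less_iff)
    then show "2 powr real_of_int k \<le> norm x" "norm x < 2 * 2 powr real_of_int k"
      by (simp_all add: powr_add mult.commute)
  qed
  define i where "i = (if k \<ge> 0 then 2 * nat k else 2 * nat (- k - 1) + 1)"
  have "radius i = 2 powr real_of_int k"
    by (auto simp: radius_def i_def)
  then have "x \<in> shell (radius i)" using k by (simp add: shell_def)
  then show "x \<in> (\<Union>i. \<Omega> \<inter> shell (radius i))" using x by blast
qed

text \<open>The exponents with the positive power of the radius serve the shells near the origin, those
  with the negative power the shells far out.\<close>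

lemma shells_decay:
  obtains \<rho> where "0 < \<rho>" "\<rho> < 1" "\<And>M. \<exists>C>0. \<forall>u G i. E u G \<longrightarrow> intA G \<le> M \<longrightarrow> intB u \<le> M \<longrightarrow>
    Lp_int r (wmeas (\<Omega> \<inter> shell (radius i)) s) u \<le> C * \<rho> ^ i"
proof -
  obtain \<delta> where \<delta>: "\<delta> > 0" "local_exponents (\<theta>1 + q * \<delta>) (\<theta>2 - p * \<delta>)" "local_exponents (\<theta>1 - q * \<delta>) (\<theta>2 + p * \<delta>)"
    by (rule local_exponents_perturb)
  define \<kappa> where "\<kappa> = \<delta> * (\<beta> * p - \<alpha> * q)"
  have \<kappa>: "\<kappa> > 0" using \<delta>(1) det by (simp add: \<kappa>_def)
  have in_exp: "\<gamma> - \<alpha> * (\<theta>1 + q * \<delta>) - \<beta> * (\<theta>2 - p * \<delta>) = \<kappa>"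
    and out_exp: "\<gamma> - \<alpha> * (\<theta>1 - q * \<delta>) - \<beta> * (\<theta>2 + p * \<delta>) = - \<kappa>"
    unfolding dilation[symmetric] \<kappa>_def by (simp_all add: algebra_simps)
  obtain C1 where C1: "C1 > 0" "\<And>u G l. E u G \<Longrightarrow> l > 0 \<Longrightarrow>
    Lp_int r (wmeas (\<Omega> \<inter> shell l) s) u \<le> C1 * l powr \<kappa> * (intA G powr (\<theta>1 + q * \<delta>) * intB u powr (\<theta>2 - p * \<delta>))"
    by (rule shell_bound[OF \<delta>(2), unfolded in_exp]) blast
  obtain C2 where C2: "C2 > 0" "\<And>u G l. E u G \<Longrightarrow> l > 0 \<Longrightarrow>
    Lp_int r (wmeas (\<Omega> \<inter> shell l) s) u \<le> C2 * l powr (- \<kappa>) * (intA G powr (\<theta>1 - q * \<delta>) * intB u powr (\<theta>2 + p * \<delta>))"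
    by (rule shell_bound[OF \<delta>(3), unfolded out_exp]) blast
  define \<rho> where "\<rho> = 2 powr (- \<kappa> / 2)"
  have \<rho>: "0 < \<rho>" "\<rho> < 1" using \<kappa> by (auto simp: \<rho>_def powr_less_one)
  have "\<exists>C>0. \<forall>u G i. E u G \<longrightarrow> intA G \<le> M \<longrightarrow> intB u \<le> M \<longrightarrow>
    Lp_int r (wmeas (\<Omega> \<inter> shell (radius i)) s) u \<le> C * \<rho> ^ i" for M
  proof -
    define M1 where "M1 = max M 1"
    define C where "C = (C1 + C2) * (M1 powr (\<theta>1 + q * \<delta>) * M1 powr (\<theta>2 - p * \<delta>) + M1 powr (\<theta>1 - q * \<delta>) * M1 powr (\<theta>2 + p * \<delta>))"
    have M1: "M1 > 0" by (simp add: M1_def)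
    have C: "C > 0" using C1(1) C2(1) M1 by (simp add: C_def add_pos_pos)
    have "Lp_int r (wmeas (\<Omega> \<inter> shell (radius i)) s) u \<le> C * \<rho> ^ i"
      if u: "E u G" and A: "intA G \<le> M" and B: "intB u \<le> M" for u G i
    proof -
      have mono: "intA G powr x * intB u powr y \<le> M1 powr x * M1 powr y" if "local_exponents x y" for x y
        using that A B M1 by (intro mult_mono powr_mono2) (auto simp: local_exponents_def M1_def)
      show ?thesis
      proof (cases "even i")
        case True
        then obtain j where j: "i = 2 * j" by blast
        have "radius i powr (- \<kappa>) = \<rho> ^ i"
          unfolding j by (simp add: radius_def \<rho>_def powr_powr powr_realpow[symmetric]) (simp add: mult.commute)
        then have "Lp_int r (wmeas (\<Omega> \<inter> shell (radius i)) s) u \<le> C2 * \<rho> ^ i * (intA G powr (\<theta>1 - q * \<delta>) * intB u powr (\<theta>2 + p * \<delta>))"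
          using C2(2)[OF u radius_pos[of i]] by simp
        also have "\<dots> \<le> C2 * \<rho> ^ i * (M1 powr (\<theta>1 - q * \<delta>) * M1 powr (\<theta>2 + p * \<delta>))"
          using mono[OF \<delta>(3)] C2(1) \<rho> by (intro mult_left_mono) auto
        also have "\<dots> = C2 * (M1 powr (\<theta>1 - q * \<delta>) * M1 powr (\<theta>2 + p * \<delta>)) * \<rho> ^ i" by simp
        also have "\<dots> \<le> C * \<rho> ^ i"
          unfolding C_def using C1(1) C2(1) \<rho> M1 by (intro mult_right_mono mult_mono) auto
        finally show ?thesis .
      next
        case False
        then obtain j where j: "i = 2 * j + 1" by (meson oddE)
        have "radius i powr \<kappa> = 2 powr (- (real (j + 1) * \<kappa>))"
          unfolding j by (simp add: radius_def powr_powr) (simp add: algebra_simps)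
        also have "\<dots> \<le> 2 powr (- (real i * (\<kappa> / 2)))"
          using \<kappa> by (intro powr_mono) (auto simp: j algebra_simps)
        also have "\<dots> = \<rho> ^ i" by (simp add: \<rho>_def powr_realpow[symmetric] powr_powr mult.commute)
        finally have ri: "radius i powr \<kappa> \<le> \<rho> ^ i" .
        have "Lp_int r (wmeas (\<Omega> \<inter> shell (radius i)) s) u \<le> C1 * radius i powr \<kappa> * (intA G powr (\<theta>1 + q * \<delta>) * intB u powr (\<theta>2 - p * \<delta>))"
          by (rule C1(2)[OF u radius_pos])
        also have "\<dots> \<le> C1 * \<rho> ^ i * (M1 powr (\<theta>1 + q * \<delta>) * M1 powr (\<theta>2 - p * \<delta>))"
          using C1(1) \<rho> ri by (intro mult_mono[OF _ mono[OF \<delta>(2)]] mult_left_mono) auto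
        also have "\<dots> = C1 * (M1 powr (\<theta>1 + q * \<delta>) * M1 powr (\<theta>2 - p * \<delta>)) * \<rho> ^ i" by simp
        also have "\<dots> \<le> C * \<rho> ^ i"
          unfolding C_def using C1(1) C2(1) \<rho> M1 by (intro mult_right_mono mult_mono) auto
        finally show ?thesis .
      qed
    qed
    then show ?thesis using C by blast
  qed
  with \<rho> show ?thesis by (rule that)
qed

lemma E_Lr:
  obtains C where "\<And>u G. E u G \<Longrightarrow> Lp_fun r (wmeas \<Omega> s) u" "\<And>u G. E u G \<Longrightarrow> intA G \<le> 1 \<Longrightarrow> intB u \<le> 1 \<Longrightarrow> intD u \<le> C"
proof -
  obtain \<rho> where \<rho>: "0 < \<rho>" "\<rho> < 1" and dec: "\<And>M. \<exists>C>0. \<forall>u G i. E u G \<longrightarrow> intA G \<le> M \<longrightarrow> intB u \<le> M \<longrightarrow>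
    Lp_int r (wmeas (\<Omega> \<inter> shell (radius i)) s) u \<le> C * \<rho> ^ i"
    by (rule shells_decay) blast
  have SL: "\<Omega> \<inter> shell l \<in> sets lebesgue" for l using \<Omega>L by (intro sets.Int) auto
  have sm: "summable (\<lambda>i. C * \<rho> ^ i)" for C using \<rho> by (intro summable_mult summable_geometric) auto
  have *: "Lp_fun r (wmeas \<Omega> s) u \<and> intD u \<le> (\<Sum>i. C * \<rho> ^ i)"
    if C: "\<forall>u G i. E u G \<longrightarrow> intA G \<le> M \<longrightarrow> intB u \<le> M \<longrightarrow> Lp_int r (wmeas (\<Omega> \<inter> shell (radius i)) s) u \<le> C * \<rho> ^ i"
      and u: "E u G" "intA G \<le> M" "intB u \<le> M" for u G M C
  proof -
    have le: "Lp_int r (wmeas (\<Omega> \<inter> shell (radius i)) s) u \<le> C * \<rho> ^ i" for i using C u by blast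
    show ?thesis
      using Lp_countable_union[OF \<Omega>L SL radius_cover E_Lp(4)[OF u(1)] shell_bound_2(1)[OF local_exponents_main radius_pos u(1)] le sm]
      by (rule conjI)
  qed
  obtain C1 where C1: "\<forall>u G i. E u G \<longrightarrow> intA G \<le> 1 \<longrightarrow> intB u \<le> 1 \<longrightarrow> Lp_int r (wmeas (\<Omega> \<inter> shell (radius i)) s) u \<le> C1 * \<rho> ^ i"
    using dec by blast
  show ?thesis
  proof
    fix u G assume u: "E u G"
    obtain C where "\<forall>v G' i. E v G' \<longrightarrow> intA G' \<le> max (intA G) (intB u) \<longrightarrow> intB v \<le> max (intA G) (intB u) \<longrightarrow>
       Lp_int r (wmeas (\<Omega> \<inter> shell (radius i)) s) v \<le> C * \<rho> ^ i" using dec by blast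
    from *[OF this u] show "Lp_fun r (wmeas \<Omega> s) u" by simp
  next
    fix u G assume "E u G" "intA G \<le> 1" "intB u \<le> 1"
    from *[OF C1 this] show "intD u \<le> (\<Sum>i. C1 * \<rho> ^ i)" by simp
  qed
qed

lemma E_Lp_r: "E u G \<Longrightarrow> Lp_fun r (wmeas \<Omega> s) u"
  by (rule E_Lr) blast

text \<open>On each shell the functions converge in \<open>L\<^sup>t\<close> along a subsequence, hence in \<open>L\<^sup>r\<close> by
  interpolation with the bounded integrals \<open>intB\<close>; the sum over the remaining shells is uniformly small.\<close>

lemma embedding_Cauchy:
  fixes u :: "nat \<Rightarrow> 'a \<Rightarrow> real" and G :: "nat \<Rightarrow> 'a \<Rightarrow> 'a"
  assumes E: "\<And>n. E (u n) (G n)" and A: "\<And>n. intA (G n) \<le> 1" and B: "\<And>n. intB (u n) \<le> 1"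
    and loc: "\<And>l e. l > 0 \<Longrightarrow> e > 0 \<Longrightarrow> \<exists>K. \<forall>m\<ge>K. \<forall>n\<ge>K.
      Lp_int (p * \<theta>1 / (1 - \<theta>2)) (wmeas (\<Omega> \<inter> shell l) 0) (\<lambda>x. u m x - u n x) < e"
    and e: "e > 0"
  shows "\<exists>K. \<forall>m\<ge>K. \<forall>n\<ge>K. intD (\<lambda>x. u m x - u n x) < e"
proof -
  have SL: "\<Omega> \<inter> shell l \<in> sets lebesgue" for l using \<Omega>L by (intro sets.Int) auto
  obtain \<rho> where \<rho>: "0 < \<rho>" "\<rho> < 1" and dec: "\<And>M. \<exists>C>0. \<forall>u G i. E u G \<longrightarrow> intA G \<le> M \<longrightarrow> intB u \<le> M \<longrightarrow>
    Lp_int r (wmeas (\<Omega> \<inter> shell (radius i)) s) u \<le> C * \<rho> ^ i"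
    by (rule shells_decay) blast
  define M where "M = max (2 powr p) (2 powr q)"
  have EE: "E (\<lambda>x. u m x - u n x) (\<lambda>x. G m x - G n x)" for m n by (rule E_diff[OF E E])
  have AA: "intA (\<lambda>x. G m x - G n x) \<le> M" for m n
  proof -
    have "intA (\<lambda>x. G m x - G n x) \<le> 2 powr (p - 1) * (intA (G m) + intA (G n))"
      by (rule Lp_int_diff_le_half[OF p_ge_1 E_Lp(1)[OF E] E_Lp(1)[OF E]])
    also have "\<dots> \<le> 2 powr (p - 1) * 2" using A[of m] A[of n] by (intro mult_left_mono) auto
    also have "\<dots> = 2 powr p" by (simp add: powr_diff)
    finally show ?thesis by (simp add: M_def)
  qed
  have BB: "intB (\<lambda>x. u m x - u n x) \<le> 2 powr q" for m n
  proof -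
    have "intB (\<lambda>x. u m x - u n x) \<le> 2 powr (q - 1) * (intB (u m) + intB (u n))"
      by (rule Lp_int_diff_le_half[OF q E_Lp(3)[OF E] E_Lp(3)[OF E]])
    also have "\<dots> \<le> 2 powr (q - 1) * 2" using B[of m] B[of n] by (intro mult_left_mono) auto
    also have "\<dots> = 2 powr q" by (simp add: powr_diff)
    finally show ?thesis .
  qed
  obtain C where C: "C > 0" "\<And>u G i. E u G \<Longrightarrow> intA G \<le> M \<Longrightarrow> intB u \<le> M \<Longrightarrow>
    Lp_int r (wmeas (\<Omega> \<inter> shell (radius i)) s) u \<le> C * \<rho> ^ i" using dec[of M] by blast
  have sm: "summable (\<lambda>i. C * \<rho> ^ i)" using \<rho> by (intro summable_mult summable_geometric) auto
  obtain I where I: "(\<Sum>i. C * \<rho> ^ (i + I)) < e / 2"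
  proof -
    have "(\<lambda>n. \<Sum>i. C * \<rho> ^ (i + n)) \<longlonglongrightarrow> 0" using suminf_exist_split2[OF sm] .
    then have "\<forall>\<^sub>F n in sequentially. (\<Sum>i. C * \<rho> ^ (i + n)) < e / 2" using e by (intro order_tendstoD(2)) auto
    then show ?thesis using that by (auto simp: eventually_sequentially)
  qed
  define \<eta> where "\<eta> = e / (4 * real (Suc I))"
  have \<eta>: "\<eta> > 0" using e by (simp add: \<eta>_def)
  have shell_small: "\<exists>K. \<forall>m\<ge>K. \<forall>n\<ge>K. Lp_int r (wmeas (\<Omega> \<inter> shell l) s) (\<lambda>x. u m x - u n x) \<le> \<eta>" if l: "l > 0" for l
  proof -
    define c where "c = 2 powr \<bar>\<sigma> * \<theta>2 - s\<bar> * l powr (\<sigma> * \<theta>2 - s) * (2 powr q) powr \<theta>2"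
    have c: "c > 0" using l by (simp add: c_def)
    have "(\<eta> / c) powr (1 / (1 - \<theta>2)) > 0" using \<eta> c by simp
    from loc[OF l this] obtain K where K: "\<And>m n. m \<ge> K \<Longrightarrow> n \<ge> K \<Longrightarrow>
      Lp_int (p * \<theta>1 / (1 - \<theta>2)) (wmeas (\<Omega> \<inter> shell l) 0) (\<lambda>x. u m x - u n x) < (\<eta> / c) powr (1 / (1 - \<theta>2))" by blast
    have "Lp_int r (wmeas (\<Omega> \<inter> shell l) s) (\<lambda>x. u m x - u n x) \<le> \<eta>" if mn: "m \<ge> K" "n \<ge> K" for m n
    proof -
      let ?T = "Lp_int (p * \<theta>1 / (1 - \<theta>2)) (wmeas (\<Omega> \<inter> shell l) 0) (\<lambda>x. u m x - u n x)"
      have "?T powr (1 - \<theta>2) \<le> ((\<eta> / c) powr (1 / (1 - \<theta>2))) powr (1 - \<theta>2)"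
        using K[OF mn] \<theta>2 by (intro powr_mono2) auto
      also have "\<dots> = \<eta> / c" using \<theta>2 \<eta> c by (simp add: powr_powr)
      finally have T: "?T powr (1 - \<theta>2) \<le> \<eta> / c" .
      have "Lp_int r (wmeas (\<Omega> \<inter> shell l) s) (\<lambda>x. u m x - u n x)
        \<le> 2 powr \<bar>\<sigma> * \<theta>2 - s\<bar> * l powr (\<sigma> * \<theta>2 - s) * (intB (\<lambda>x. u m x - u n x) powr \<theta>2 * ?T powr (1 - \<theta>2))"
        by (rule shell_bound_2(2)[OF local_exponents_main l EE])
      also have "\<dots> \<le> 2 powr \<bar>\<sigma> * \<theta>2 - s\<bar> * l powr (\<sigma> * \<theta>2 - s) * ((2 powr q) powr \<theta>2 * (\<eta> / c))"
        using BB[of m n] T \<theta>2 by (intro mult_left_mono mult_mono powr_mono2) auto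
      also have "\<dots> = c * (\<eta> / c)" by (simp add: c_def)
      also have "\<dots> = \<eta>" using c by simp
      finally show ?thesis .
    qed
    then show ?thesis by blast
  qed
  then obtain K where K: "\<And>l m n. l > 0 \<Longrightarrow> m \<ge> K l \<Longrightarrow> n \<ge> K l \<Longrightarrow> Lp_int r (wmeas (\<Omega> \<inter> shell l) s) (\<lambda>x. u m x - u n x) \<le> \<eta>"
    by metis
  define K0 where "K0 = (\<Sum>i<I. K (radius i))"
  have "intD (\<lambda>x. u m x - u n x) < e" if mn: "m \<ge> K0" "n \<ge> K0" for m n
  proof -
    define c where "c i = (if i < I then \<eta> else C * \<rho> ^ i)" for i
    have le: "Lp_int r (wmeas (\<Omega> \<inter> shell (radius i)) s) (\<lambda>x. u m x - u n x) \<le> c i" for i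
    proof (cases "i < I")
      case True
      then have "K (radius i) \<le> K0" unfolding K0_def by (intro member_le_sum) auto
      then show ?thesis using K[OF radius_pos, of i m n] mn True by (simp add: c_def)
    next
      case False
      have "intB (\<lambda>x. u m x - u n x) \<le> M" using BB[of m n] by (simp add: M_def)
      then show ?thesis using C(2)[OF EE AA] False by (simp add: c_def)
    qed
    have cI: "(\<lambda>i. c (i + I)) = (\<lambda>i. C * \<rho> ^ (i + I))" by (auto simp: c_def)
    have smc: "summable c"
      using summable_iff_shift[of c I] summable_iff_shift[of "\<lambda>i. C * \<rho> ^ i" I] sm unfolding cI by simp
    have "intD (\<lambda>x. u m x - u n x) \<le> suminf c"
      by (rule Lp_countable_union(2)[OF \<Omega>L SL radius_cover E_Lp(4)[OF EE] shell_bound_2(1)[OF local_exponents_main radius_pos EE] le smc])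
    also have "suminf c = (\<Sum>i. c (i + I)) + (\<Sum>i<I. c i)" by (rule suminf_split_initial_segment[OF smc])
    also have "(\<Sum>i<I. c i) = real I * \<eta>" by (simp add: c_def)
    also have "real I * \<eta> \<le> e / 4"
    proof -
      have "real I * \<eta> \<le> real (Suc I) * \<eta>" using \<eta> by (intro mult_right_mono) auto
      also have "\<dots> = e / 4" by (simp add: \<eta>_def del: of_nat_Suc)
      finally show ?thesis .
    qed
    finally show ?thesis using I e unfolding cI by linarith
  qed
  then show ?thesis by blast
qed

lemma E_approx:
  assumes u: "E u G" and e: "e > 0"
  obtains \<phi> where "\<phi> \<in> C0_infty \<Omega>" "Lp_int p (wmeas \<Omega> (\<mu> + p)) (\<lambda>x. \<phi> x - u x) < e"
    "intA (\<lambda>x. grad \<phi> x - G x) < e" "intA (grad \<phi>) < intA G + e"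
proof -
  obtain \<phi> where \<phi>: "\<And>n. \<phi> n \<in> C0_infty \<Omega>" and lp: "Lp_conv p (wmeas \<Omega> (\<mu> + p)) \<phi> u"
    and gr: "Lp_conv p (wmeas \<Omega> \<mu>) (\<lambda>n. grad (\<phi> n)) G"
    using u unfolding E_def is_W_grad_iff[OF open_\<Omega> p \<mu>p \<mu>pN] by blast
  have "(\<lambda>n. Lp_int p (wmeas \<Omega> (\<mu> + p)) (\<lambda>x. \<phi> n x - u x)) \<longlonglongrightarrow> 0" "(\<lambda>n. intA (\<lambda>x. grad (\<phi> n) x - G x)) \<longlonglongrightarrow> 0"
    using lp gr by (auto simp: Lp_conv_def)
  moreover have "(\<lambda>n. intA (grad (\<phi> n))) \<longlonglongrightarrow> intA G" by (rule Lp_conv_int[OF p_ge_1 gr E_Lp(1)[OF u]])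
  ultimately have "\<forall>\<^sub>F n in sequentially. Lp_int p (wmeas \<Omega> (\<mu> + p)) (\<lambda>x. \<phi> n x - u x) < e
      \<and> intA (\<lambda>x. grad (\<phi> n) x - G x) < e \<and> intA (grad (\<phi> n)) < intA G + e"
    using e by (intro eventually_conj order_tendstoD(2)) auto
  then obtain n where "Lp_int p (wmeas \<Omega> (\<mu> + p)) (\<lambda>x. \<phi> n x - u x) < e"
      "intA (\<lambda>x. grad (\<phi> n) x - G x) < e" "intA (grad (\<phi> n)) < intA G + e" by (auto simp: eventually_sequentially)
  with \<phi> show ?thesis by (rule that)
qed

text \<open>Each \<open>u n\<close> is replaced by a test function close to it. A subsequence of these converges almost
  everywhere to the limit of the \<open>u n\<close> in \<open>L\<^sup>r\<close>, which is what lower semicontinuity asks for.\<close>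

lemma embedding_compact:
  fixes u :: "nat \<Rightarrow> 'a \<Rightarrow> real" and G :: "nat \<Rightarrow> 'a \<Rightarrow> 'a"
  assumes E: "\<And>n. E (u n) (G n)" and A: "\<And>n. intA (G n) \<le> 1" and B: "\<And>n. intB (u n) \<le> 1"
  obtains w H k where "E w H" "intA H \<le> 1" "intB w \<le> 1" "strict_mono (k :: nat \<Rightarrow> nat)" "(\<lambda>n. intD (u (k n))) \<longlonglongrightarrow> intD w"
proof -
  define t where "t = p * \<theta>1 / (1 - \<theta>2)"
  interpret S: subcritical_exponents p \<mu> t "TYPE('a)"
    unfolding t_def by (rule local_exponents_subcritical(1)[OF local_exponents_main])
  define \<epsilon> where "\<epsilon> n = inverse (real (Suc n))" for n
  have \<epsilon>: "\<epsilon> n > 0" "\<epsilon> n \<le> 1" for n by (auto simp: \<epsilon>_def inverse_le_1_iff)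
  have \<epsilon>lim: "\<epsilon> \<longlonglongrightarrow> 0" unfolding \<epsilon>_def[abs_def] by (rule LIMSEQ_inverse_real_of_nat)
  define P where "P n \<psi> \<longleftrightarrow> \<psi> \<in> C0_infty \<Omega> \<and> Lp_int p (wmeas \<Omega> (\<mu> + p)) (\<lambda>x. \<psi> x - u n x) < \<epsilon> n
    \<and> intA (\<lambda>x. grad \<psi> x - G n x) < \<epsilon> n \<and> intA (grad \<psi>) < intA (G n) + \<epsilon> n" for n \<psi>
  have "\<exists>\<psi>. P n \<psi>" for n
    unfolding P_def by (rule E_approx[OF E[of n] \<epsilon>(1)[of n]]) blast
  then have "\<forall>n. \<exists>\<psi>. P n \<psi>" by blast
  then obtain \<phi> where "\<forall>n. P n (\<phi> n)" by (rule exE[OF choice])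
  then have \<phi>: "\<And>n. \<phi> n \<in> C0_infty \<Omega>" "\<And>n. Lp_int p (wmeas \<Omega> (\<mu> + p)) (\<lambda>x. \<phi> n x - u n x) < \<epsilon> n"
    "\<And>n. intA (\<lambda>x. grad (\<phi> n) x - G n x) < \<epsilon> n" "\<And>n. intA (grad (\<phi> n)) < intA (G n) + \<epsilon> n"
    by (auto simp: P_def)
  have gU: "Lp_int p (wmeas UNIV \<mu>) (grad (\<phi> n)) = intA (grad (\<phi> n))" for n
    using Lp_int_C0_infty(2)[OF \<phi>(1) \<Omega>L order_refl, of p \<mu>] p by simp
  have A2: "Lp_int p (wmeas UNIV \<mu>) (grad (\<phi> n)) \<le> 2" for n
    unfolding gU using \<phi>(4)[of n] A[of n] \<epsilon>(2)[of n] by linarith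
  have "\<exists>k :: nat \<Rightarrow> nat. strict_mono k \<and> (\<forall>l>0. \<forall>e>0. \<exists>K. \<forall>m\<ge>K. \<forall>n\<ge>K.
      Lp_int t (wmeas (shell l) 0) (\<lambda>x. \<phi> (k m) x - \<phi> (k n) x) < e)"
  proof (rule S.shell_compactness[of \<phi> \<Omega> 2, OF \<phi>(1) A2])
    fix k :: "nat \<Rightarrow> nat"
    assume k: "strict_mono k" and "\<And>l e. l > 0 \<Longrightarrow> e > 0 \<Longrightarrow> \<exists>K. \<forall>m\<ge>K. \<forall>n\<ge>K.
      Lp_int t (wmeas (shell l) 0) (\<lambda>x. \<phi> (k m) x - \<phi> (k n) x) < e"
    then show ?thesis by (intro exI[of _ k] conjI allI impI)
  qed
  then obtain k where k: "strict_mono (k :: nat \<Rightarrow> nat)" and kC: "\<And>l e. l > 0 \<Longrightarrow> e > 0 \<Longrightarrow> \<exists>K. \<forall>m\<ge>K. \<forall>n\<ge>K.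
      Lp_int t (wmeas (shell l) 0) (\<lambda>x. \<phi> (k m) x - \<phi> (k n) x) < e"
    by metis
  have WT: "is_W_grad \<Omega> p \<mu> (\<lambda>x. \<phi> n x - u n x) (\<lambda>x. grad (\<phi> n) x - G n x)" for n
    using is_W_grad_diff[OF open_\<Omega> p \<mu>p \<mu>pN is_W_grad_test[OF open_\<Omega> p \<mu>p \<mu>pN \<phi>(1)], of "u n" "G n"] E[of n] by (auto simp: E_def)
  have SL: "\<Omega> \<inter> shell l \<in> sets lebesgue" for l using \<Omega>L by (intro sets.Int) auto
  obtain C where C: "C > 0" "\<And>(u :: 'a \<Rightarrow> real) G \<Omega> l. open \<Omega> \<Longrightarrow> is_W_grad \<Omega> p \<mu> u G \<Longrightarrow> l > 0 \<Longrightarrow>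
    Lp_fun t (wmeas (\<Omega> \<inter> shell l) 0) u \<and>
    Lp_int t (wmeas (\<Omega> \<inter> shell l) 0) u
      \<le> C * l powr (real DIM('a) - (real DIM('a) - \<mu> - p) * t / p) * Lp_int p (wmeas \<Omega> \<mu>) G powr (t / p)"
    by (rule S.shell_Sobolev) blast
  have loc: "\<exists>K. \<forall>m\<ge>K. \<forall>n\<ge>K. Lp_int t (wmeas (\<Omega> \<inter> shell l) 0) (\<lambda>x. u (k m) x - u (k n) x) < e"
    if l: "l > 0" and e: "e > 0" for l e
  proof -
    let ?M = "wmeas (\<Omega> \<inter> shell l) 0"
    define w where "w n x = \<phi> (k n) x - u (k n) x" for n x
    have wL: "Lp_fun t ?M (w n)" for n
      unfolding w_def[abs_def] using C(2)[OF open_\<Omega> WT l, of "k n"] by blast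
    have wlim: "(\<lambda>n. Lp_int t ?M (w n)) \<longlonglongrightarrow> 0"
    proof (rule tendsto_sandwich[OF _ _ tendsto_const])
      let ?s = "C * l powr (real DIM('a) - (real DIM('a) - \<mu> - p) * t / p)"
      have "(\<lambda>n. ?s * \<epsilon> (k n) powr (t / p)) \<longlonglongrightarrow> ?s * 0 powr (t / p)"
        using S.t_pos p LIMSEQ_subseq_LIMSEQ[OF \<epsilon>lim k]
        by (intro tendsto_intros tendsto_powr') (auto simp: o_def \<epsilon>(1) less_imp_le)
      then show "(\<lambda>n. ?s * \<epsilon> (k n) powr (t / p)) \<longlonglongrightarrow> 0" by simp
      show "\<forall>\<^sub>F n in sequentially. Lp_int t ?M (w n) \<le> ?s * \<epsilon> (k n) powr (t / p)"
      proof (rule always_eventually, rule allI)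
        fix n
        have "Lp_int t ?M (w n) \<le> ?s * intA (\<lambda>x. grad (\<phi> (k n)) x - G (k n) x) powr (t / p)"
          unfolding w_def[abs_def] using C(2)[OF open_\<Omega> WT l, of "k n"] by blast
        also have "\<dots> \<le> ?s * \<epsilon> (k n) powr (t / p)"
          using C(1) \<phi>(3)[of "k n"] S.t_pos p by (intro mult_left_mono powr_mono2) auto
        finally show "Lp_int t ?M (w n) \<le> ?s * \<epsilon> (k n) powr (t / p)" .
      qed
    qed simp
    have "Lp_conv t ?M w (\<lambda>x. 0)" using wL wlim by (simp add: Lp_conv_def)
    define Q where "Q = (2::real) powr (t - 1)"
    have Q: "Q > 0" by (simp add: Q_def)
    have e2: "e / (2 * Q) > 0" using e Q by simp
    obtain K1 where K1: "\<forall>m\<ge>K1. \<forall>n\<ge>K1. Lp_int t ?M (\<lambda>x. w m x - w n x) < e / (2 * Q)"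
      using Lp_conv_Cauchy[OF S.t_ge_1 \<open>Lp_conv t ?M w (\<lambda>x. 0)\<close> e2] by blast
    obtain K2 where K2: "\<forall>m\<ge>K2. \<forall>n\<ge>K2. Lp_int t (wmeas (shell l) 0) (\<lambda>x. \<phi> (k m) x - \<phi> (k n) x) < e / (2 * Q)"
      using kC[OF l e2] by blast
    have "Lp_int t ?M (\<lambda>x. u (k m) x - u (k n) x) < e" if mn: "m \<ge> max K1 K2" "n \<ge> max K1 K2" for m n
    proof -
      have eq: "(\<lambda>x. u (k m) x - u (k n) x) = (\<lambda>x. (\<phi> (k m) x - \<phi> (k n) x) - (w m x - w n x))" by (auto simp: w_def)
      have df: "(\<lambda>x. \<phi> (k m) x - \<phi> (k n) x) \<in> C0_infty \<Omega>" by (intro C0_infty_diff \<phi>)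
      have dL: "Lp_fun t (wmeas (shell l) 0) (\<lambda>x. \<phi> (k m) x - \<phi> (k n) x)"
        using Lp_fun_C0_infty(1)[OF df, of 0 t "shell l"] S.t_pos by simp
      have d: "Lp_fun t ?M (\<lambda>x. \<phi> (k m) x - \<phi> (k n) x)"
        "Lp_int t ?M (\<lambda>x. \<phi> (k m) x - \<phi> (k n) x) \<le> Lp_int t (wmeas (shell l) 0) (\<lambda>x. \<phi> (k m) x - \<phi> (k n) x)"
        by (rule Lp_wmeas_subset[OF SL _ Int_lower2 dL], simp)+
      have "Lp_int t ?M (\<lambda>x. u (k m) x - u (k n) x)
        \<le> Q * (Lp_int t ?M (\<lambda>x. \<phi> (k m) x - \<phi> (k n) x) + Lp_int t ?M (\<lambda>x. w m x - w n x))"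
        unfolding eq Q_def by (intro Lp_int_diff_le_half S.t_ge_1 d(1) Lp_fun_diff wL)
      also have "\<dots> < Q * (e / (2 * Q) + e / (2 * Q))"
      proof -
        have "Lp_int t ?M (\<lambda>x. \<phi> (k m) x - \<phi> (k n) x) < e / (2 * Q)" using d(2) K2 mn by (auto intro: le_less_trans)
        moreover have "Lp_int t ?M (\<lambda>x. w m x - w n x) < e / (2 * Q)" using K1 mn by auto
        ultimately show ?thesis using Q by (intro mult_strict_left_mono add_strict_mono)
      qed
      also have "\<dots> = e" using Q by (simp add: field_simps)
      finally show ?thesis .
    qed
    then show ?thesis by blast
  qed
  have Er: "Lp_fun r (wmeas \<Omega> s) (u (k n))" for n by (rule E_Lp_r[OF E])
  have cauchy: "\<exists>K. \<forall>m\<ge>K. \<forall>n\<ge>K. intD (\<lambda>x. u (k m) x - u (k n) x) < e" if "e > 0" for e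
    using embedding_Cauchy[of "\<lambda>n. u (k n)" "\<lambda>n. G (k n)" e] E A B loc that unfolding t_def by blast
  obtain w where w: "Lp_fun r (wmeas \<Omega> s) w" "Lp_conv r (wmeas \<Omega> s) (\<lambda>n. u (k n)) w"
    by (rule Lp_complete[of r "wmeas \<Omega> s" "\<lambda>n. u (k n)", OF r Er cauchy]) blast+
  have r0: "r > 0" and p0: "p > 0" and q0: "q > 0" using r p q by auto
  have Dlim: "(\<lambda>n. intD (u (k n))) \<longlonglongrightarrow> intD w" by (rule Lp_conv_int[OF r w(2,1)])
  obtain k1 where k1: "strict_mono k1" and ae1: "AE x in wmeas \<Omega> s. (\<lambda>n. u (k (k1 n)) x) \<longlonglongrightarrow> w x"
    by (rule Lp_conv_AE_subseq[OF r0 w(2)]) blast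
  have wm: "w \<in> borel_measurable (lebesgue_on \<Omega>)" using w(1) by auto
  have ae1': "AE x in lebesgue. x \<in> \<Omega> \<longrightarrow> (\<lambda>n. u (k (k1 n)) x) \<longlonglongrightarrow> w x"
    using ae1 by (simp add: AE_wmeas[OF \<Omega>L])
  have wB: "Lp_fun q (wmeas \<Omega> \<sigma>) w" "intB w \<le> 1"
    using Lp_Fatou[where f = "\<lambda>n. u (k (k1 n))" and t = q and g = w and M = "wmeas \<Omega> \<sigma>" and c = 1, OF q0 _ _ E_Lp(3)[OF E] B]
      wm ae1' by (auto simp: AE_wmeas[OF \<Omega>L])
  have conv0: "Lp_conv p (wmeas \<Omega> (\<mu> + p)) (\<lambda>n x. \<phi> (k (k1 n)) x - u (k (k1 n)) x) (\<lambda>x. 0)"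
  proof -
    have "Lp_fun p (wmeas \<Omega> (\<mu> + p)) (\<lambda>x. \<phi> n x - u n x)" for n
      using is_W_grad_Lp(2)[OF open_\<Omega> p \<mu>p \<mu>pN WT] .
    moreover have "(\<lambda>n. \<epsilon> (k (k1 n))) \<longlonglongrightarrow> 0"
      using LIMSEQ_subseq_LIMSEQ[OF \<epsilon>lim strict_mono_o[OF k k1]] by (simp add: o_def)
    then have "(\<lambda>n. Lp_int p (wmeas \<Omega> (\<mu> + p)) (\<lambda>x. \<phi> (k (k1 n)) x - u (k (k1 n)) x)) \<longlonglongrightarrow> 0"
      by (rule tendsto_sandwich[OF _ _ tendsto_const, rotated 2]) (use \<phi>(2) in \<open>auto intro!: always_eventually less_imp_le\<close>)
    ultimately show ?thesis by (simp add: Lp_conv_def)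
  qed
  obtain k2 where k2: "strict_mono k2" and ae2: "AE x in wmeas \<Omega> (\<mu> + p). (\<lambda>n. \<phi> (k (k1 (k2 n))) x - u (k (k1 (k2 n))) x) \<longlonglongrightarrow> 0"
    by (rule Lp_conv_AE_subseq[OF p0 conv0]) blast
  define j where "j n = k (k1 (k2 n))" for n
  have j: "strict_mono j" using strict_mono_o[OF k strict_mono_o[OF k1 k2]] by (simp add: j_def[abs_def] o_def)
  have aej: "AE x in lebesgue. x \<in> \<Omega> \<longrightarrow> (\<lambda>n. \<phi> (j n) x) \<longlonglongrightarrow> w x"
    using ae1' ae2[unfolded AE_wmeas[OF \<Omega>L]]
  proof eventually_elim
    case (elim x)
    show ?case
    proof
      assume x: "x \<in> \<Omega>"
      have "(\<lambda>n. u (j n) x) \<longlonglongrightarrow> w x"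
        using LIMSEQ_subseq_LIMSEQ[OF _ k2, of "\<lambda>n. u (k (k1 n)) x" "w x"] elim x by (simp add: o_def j_def)
      moreover have "(\<lambda>n. \<phi> (j n) x - u (j n) x) \<longlonglongrightarrow> 0" using elim x by (simp add: j_def)
      ultimately have "(\<lambda>n. (\<phi> (j n) x - u (j n) x) + u (j n) x) \<longlonglongrightarrow> 0 + w x" by (intro tendsto_add)
      then show "(\<lambda>n. \<phi> (j n) x) \<longlonglongrightarrow> w x" by simp
    qed
  qed
  have jA: "intA (grad (\<phi> (j n))) \<le> 1 + \<epsilon> (j n)" for n using \<phi>(4)[of "j n"] A[of "j n"] by linarith
  have "(\<lambda>n. 1 + \<epsilon> (j n)) \<longlonglongrightarrow> 1 + 0"
    using LIMSEQ_subseq_LIMSEQ[OF \<epsilon>lim j] by (intro tendsto_intros) (simp add: o_def)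
  then have jlim: "(\<lambda>n. 1 + \<epsilon> (j n)) \<longlonglongrightarrow> 1" by simp
  obtain H where H: "is_W_grad \<Omega> p \<mu> w H" "intA H \<le> 1"
    by (rule is_W_grad_limit[of \<Omega> p \<mu> "\<lambda>n. \<phi> (j n)", OF open_\<Omega> p \<mu>p \<mu>pN \<phi>(1) jA jlim wm aej]) blast
  have "E w H" using H(1) wB(1) by (simp add: E_def)
  then show ?thesis using H(2) wB(2) k Dlim by (rule that)
qed

end

section \<open>The extremal problem\<close>

text \<open>The constant is chosen such that the left-hand side has the factor \<open>1\<close>.\<close>

lemma weighted_Young:
  fixes A B w1 w2 c :: real
  assumes w: "0 < w1" "0 < w2" "w1 + w2 = 1" and c: "c > 0" "c powr w2 = w1 powr w1 * w2 powr w2"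
    and AB: "0 \<le> A" "0 \<le> B"
  shows "A powr w1 * B powr w2 \<le> A + c * B"
proof (cases "A = 0 \<or> B = 0")
  case True
  then show ?thesis using AB c w by auto
next
  case False
  then have A: "A > 0" and B: "B > 0" using AB by auto
  have "(A / w1) powr w1 * (c * B / w2) powr w2 = (A powr w1 * B powr w2) * (c powr w2 / (w1 powr w1 * w2 powr w2))"
    using A B c w by (simp add: powr_divide powr_mult)
  also have "\<dots> = A powr w1 * B powr w2" unfolding c(2) using w by simp
  finally have "A powr w1 * B powr w2 = (A / w1) powr w1 * (c * B / w2) powr w2" ..
  also have "\<dots> \<le> w1 * (A / w1) + w2 * (c * B / w2)"
    using w A B c by (intro Youngs_inequality_0) auto
  also have "\<dots> = A + c * B" using w by simp
  finally show ?thesis .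
qed

locale ckn_cone = ckn +
  assumes nonempty: "\<Omega> \<noteq> {}" and cone: "\<And>x c. x \<in> \<Omega> \<Longrightarrow> c > 0 \<Longrightarrow> c *\<^sub>R x \<in> \<Omega>"
begin

lemma cone_iff: "l > 0 \<Longrightarrow> x \<in> \<Omega> \<longleftrightarrow> l *\<^sub>R x \<in> \<Omega>"
  using cone[of x l] cone[of "l *\<^sub>R x" "inverse l"] by auto

lemma Lp_rescale:
  fixes f :: "'a \<Rightarrow> 'b::euclidean_space"
  assumes l: "l > 0" and f: "Lp_fun t (wmeas \<Omega> m) f"
  shows "Lp_fun t (wmeas \<Omega> m) (\<lambda>x. c *\<^sub>R f (l *\<^sub>R x))"
    "Lp_int t (wmeas \<Omega> m) (\<lambda>x. c *\<^sub>R f (l *\<^sub>R x)) = \<bar>c\<bar> powr t * l powr (m - real DIM('a)) * Lp_int t (wmeas \<Omega> m) f"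
  using Lp_scale[OF l \<Omega>L \<Omega>L cone_iff[OF l] f] by (auto intro: Lp_fun_scaleR simp: Lp_int_scaleR)

lemma Lp_conv_rescale:
  fixes f :: "nat \<Rightarrow> 'a \<Rightarrow> 'b::euclidean_space"
  assumes l: "l > 0" and f: "Lp_conv t (wmeas \<Omega> m) f g"
  shows "Lp_conv t (wmeas \<Omega> m) (\<lambda>n x. c *\<^sub>R f n (l *\<^sub>R x)) (\<lambda>x. c *\<^sub>R g (l *\<^sub>R x))"
proof -
  have fL: "Lp_fun t (wmeas \<Omega> m) (\<lambda>x. f n x - g x)" for n using f by (simp add: Lp_conv_def)
  have lim: "(\<lambda>n. Lp_int t (wmeas \<Omega> m) (\<lambda>x. f n x - g x)) \<longlonglongrightarrow> 0" using f by (simp add: Lp_conv_def)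
  show ?thesis
    unfolding Lp_conv_def scaleR_diff_right[symmetric] Lp_rescale(2)[OF l fL]
    using Lp_rescale(1)[OF l fL] tendsto_mult_right_zero[OF lim] by auto
qed

lemma E_rescale:
  assumes u: "E u G" and c: "c > 0" and l: "l > 0"
  shows "E (\<lambda>x. c * u (l *\<^sub>R x)) (\<lambda>x. (c * l) *\<^sub>R G (l *\<^sub>R x))"
    "intA (\<lambda>x. (c * l) *\<^sub>R G (l *\<^sub>R x)) = (c powr p * l powr (- \<alpha>)) * intA G"
    "intB (\<lambda>x. c * u (l *\<^sub>R x)) = (c powr q * l powr (- \<beta>)) * intB u"
    "intD (\<lambda>x. c * u (l *\<^sub>R x)) = (c powr r * l powr (- \<gamma>)) * intD u"
proof -
  obtain \<phi> where \<phi>: "\<And>n. \<phi> n \<in> C0_infty \<Omega>" and lp: "Lp_conv p (wmeas \<Omega> (\<mu> + p)) \<phi> u"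
    and gr: "Lp_conv p (wmeas \<Omega> \<mu>) (\<lambda>n. grad (\<phi> n)) G"
    using u unfolding E_def is_W_grad_iff[OF open_\<Omega> p \<mu>p \<mu>pN] by blast
  define \<psi> where "\<psi> n x = c * \<phi> n (l *\<^sub>R x)" for n x
  have dil: "(\<lambda>x. \<phi> n (l *\<^sub>R x)) \<in> C0_infty \<Omega>" for n by (rule C0_infty_scaled_arg[OF \<phi> l cone])
  have "\<psi> n \<in> C0_infty \<Omega>" for n
    unfolding \<psi>_def[abs_def] by (rule C0_infty_cmult[OF dil])
  moreover have "grad (\<psi> n) = (\<lambda>x. (c * l) *\<^sub>R grad (\<phi> n) (l *\<^sub>R x))" for n
    by (rule ext) (simp only: \<psi>_def[abs_def] grad_cmult[OF dil] grad_scaled_arg[OF \<phi>] scaleR_scaleR)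
  then have "Lp_conv p (wmeas \<Omega> \<mu>) (\<lambda>n. grad (\<psi> n)) (\<lambda>x. (c * l) *\<^sub>R G (l *\<^sub>R x))"
    using Lp_conv_rescale[OF l gr, of "c * l"] by simp
  moreover have "Lp_conv p (wmeas \<Omega> (\<mu> + p)) \<psi> (\<lambda>x. c * u (l *\<^sub>R x))"
    using Lp_conv_rescale[OF l lp, of c] by (simp add: \<psi>_def[abs_def])
  ultimately have "is_W_grad \<Omega> p \<mu> (\<lambda>x. c * u (l *\<^sub>R x)) (\<lambda>x. (c * l) *\<^sub>R G (l *\<^sub>R x))"
    unfolding is_W_grad_iff[OF open_\<Omega> p \<mu>p \<mu>pN] by blast
  then show "E (\<lambda>x. c * u (l *\<^sub>R x)) (\<lambda>x. (c * l) *\<^sub>R G (l *\<^sub>R x))"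
    using Lp_rescale(1)[OF l E_Lp(3)[OF u], of c] by (simp add: E_def)
  have "(c * l) powr p * l powr (\<mu> - real DIM('a)) = c powr p * (l powr p * l powr (\<mu> - real DIM('a)))"
    using c l by (simp add: powr_mult)
  also have "l powr p * l powr (\<mu> - real DIM('a)) = l powr (- \<alpha>)"
    unfolding powr_add[symmetric] by (rule arg_cong[where f = "\<lambda>z. l powr z"]) (simp add: \<alpha>_eq)
  finally show "intA (\<lambda>x. (c * l) *\<^sub>R G (l *\<^sub>R x)) = (c powr p * l powr (- \<alpha>)) * intA G"
    using Lp_rescale(2)[OF l E_Lp(1)[OF u], of "c * l"] c l by simp
  show "intB (\<lambda>x. c * u (l *\<^sub>R x)) = (c powr q * l powr (- \<beta>)) * intB u"
    using Lp_rescale(2)[OF l E_Lp(3)[OF u], of c] c by (simp add: \<beta>_eq)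
  show "intD (\<lambda>x. c * u (l *\<^sub>R x)) = (c powr r * l powr (- \<gamma>)) * intD u"
    using Lp_rescale(2)[OF l E_Lp_r[OF u], of c] c by (simp add: \<gamma>_eq)
qed

text \<open>Amplitude and dilation are two parameters, and the condition on the determinant lets them
  prescribe both \<open>intA\<close> and \<open>intB\<close>; \<open>intD\<close> then changes exactly as the right-hand side of the
  inequality does.\<close>

lemma E_normalize:
  assumes u: "E u G" and pos: "intA G > 0" "intB u > 0" and A: "A > 0" and B: "B > 0"
  obtains v H where "E v H" "intA H = A" "intB v = B"
    "intD v * (intA G powr \<theta>1 * intB u powr \<theta>2) = intD u * (A powr \<theta>1 * B powr \<theta>2)"
proof -
  define \<Delta> where "\<Delta> = \<beta> * p - \<alpha> * q"
  define x where "x = ln (A / intA G)"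
  define y where "y = ln (B / intB u)"
  \<comment> \<open>Cramer's rule for \<open>p * k - \<alpha> * j = x\<close> and \<open>q * k - \<beta> * j = y\<close>\<close>
  define k where "k = (\<beta> * x - \<alpha> * y) / \<Delta>"
  define j where "j = (q * x - p * y) / \<Delta>"
  have \<Delta>: "\<Delta> \<noteq> 0" using det by (simp add: \<Delta>_def)
  have "p * k - \<alpha> * j = (\<Delta> * x) / \<Delta>" unfolding k_def j_def \<Delta>_def
    by (simp add: diff_divide_distrib[symmetric] algebra_simps)
  then have kx: "p * k - \<alpha> * j = x" using \<Delta> by simp
  have "q * k - \<beta> * j = (\<Delta> * y) / \<Delta>" unfolding k_def j_def \<Delta>_def
    by (simp add: diff_divide_distrib[symmetric] algebra_simps)
  then have ky: "q * k - \<beta> * j = y" using \<Delta> by simp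
  have ex: "exp k powr a * exp j powr (- b) = exp (a * k - b * j)" for a b
    by (simp add: powr_def exp_add[symmetric])
  have fA: "exp k powr p * exp j powr (- \<alpha>) = A / intA G" unfolding ex kx x_def using A pos by simp
  have fB: "exp k powr q * exp j powr (- \<beta>) = B / intB u" unfolding ex ky y_def using B pos by simp
  have "r * k - \<gamma> * j = (p * k - \<alpha> * j) * \<theta>1 + (q * k - \<beta> * j) * \<theta>2"
    unfolding amplitude[symmetric] dilation[symmetric] by (simp add: algebra_simps)
  then have "exp k powr r * exp j powr (- \<gamma>) = exp (x * \<theta>1) * exp (y * \<theta>2)"
    unfolding ex kx ky by (simp add: exp_add)
  also have "\<dots> = (A / intA G) powr \<theta>1 * (B / intB u) powr \<theta>2"
    using A B pos by (simp add: powr_def x_def y_def mult.commute)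
  finally have fD: "exp k powr r * exp j powr (- \<gamma>) = (A / intA G) powr \<theta>1 * (B / intB u) powr \<theta>2" .
  show ?thesis
  proof (rule that)
    note R = E_rescale[OF u exp_gt_zero[of k] exp_gt_zero[of j]]
    show "E (\<lambda>x. exp k * u (exp j *\<^sub>R x)) (\<lambda>x. (exp k * exp j) *\<^sub>R G (exp j *\<^sub>R x))" by (rule R(1))
    show "intA (\<lambda>x. (exp k * exp j) *\<^sub>R G (exp j *\<^sub>R x)) = A" unfolding R(2) fA using pos by simp
    show "intB (\<lambda>x. exp k * u (exp j *\<^sub>R x)) = B" unfolding R(3) fB using pos by simp
    show "intD (\<lambda>x. exp k * u (exp j *\<^sub>R x)) * (intA G powr \<theta>1 * intB u powr \<theta>2) = intD u * (A powr \<theta>1 * B powr \<theta>2)"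
      unfolding R(4) fD using pos A B by (simp add: powr_divide)
  qed
qed

text \<open>In this case the bound on each shell is \<open>0\<close>.\<close>

lemma intD_eq_0:
  assumes u: "E u G" and zero: "intA G = 0 \<or> intB u = 0"
  shows "intD u = 0"
proof -
  obtain C where C: "\<And>u G l. E u G \<Longrightarrow> l > 0 \<Longrightarrow>
    Lp_int r (wmeas (\<Omega> \<inter> shell l) s) u \<le> C * l powr (\<gamma> - \<alpha> * \<theta>1 - \<beta> * \<theta>2) * (intA G powr \<theta>1 * intB u powr \<theta>2)"
    by (rule shell_bound[OF local_exponents_main]) blast
  have SL: "\<Omega> \<inter> shell l \<in> sets lebesgue" for l using \<Omega>L by (intro sets.Int) auto
  have "Lp_int r (wmeas (\<Omega> \<inter> shell (radius i)) s) u \<le> 0" for i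
    using C[OF u radius_pos[of i]] zero by auto
  from Lp_countable_union(2)[OF \<Omega>L SL radius_cover E_Lp(4)[OF u] shell_bound_2(1)[OF local_exponents_main radius_pos u] this summable_zero]
  show ?thesis by (simp add: antisym)
qed

lemma intD_pos_exists:
  obtains u G where "E u G" "intD u > 0"
proof -
  obtain \<xi> where \<xi>: "\<And>k. \<xi> k \<in> C0_infty \<Omega>" and lim: "\<And>x. x \<in> \<Omega> \<Longrightarrow> (\<lambda>k. \<xi> k x) \<longlonglongrightarrow> 1"
    by (rule C0_infty_exhaustion[OF open_\<Omega>]) blast
  have E: "E (\<xi> k) (grad (\<xi> k))" for k
    unfolding E_def using is_W_grad_test[OF open_\<Omega> p \<mu>p \<mu>pN \<xi>] Lp_fun_C0_infty(1)[OF \<xi> _ _ \<Omega>L] q \<beta>0 \<beta>_eq by auto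
  show ?thesis
  proof (cases "\<exists>k. intD (\<xi> k) > 0")
    case True
    then show ?thesis using E that by blast
  next
    case False
    then have 0: "intD (\<xi> k) = 0" for k by (metis Lp_int_nonneg order_le_less)
    have "AE x in wmeas \<Omega> s. norm (\<xi> k x) powr r = 0" for k
      using 0[of k] E_Lp_r[OF E[of k]] unfolding Lp_int_def
      by (subst (asm) integral_nonneg_eq_0_iff_AE) auto
    then have "AE x in lebesgue. x \<in> \<Omega> \<longrightarrow> \<xi> k x = 0" for k by (simp add: AE_wmeas[OF \<Omega>L])
    then have "AE x in lebesgue. \<forall>k. x \<in> \<Omega> \<longrightarrow> \<xi> k x = 0" unfolding AE_all_countable by blast
    moreover have "x \<notin> \<Omega>" if "\<forall>k. x \<in> \<Omega> \<longrightarrow> \<xi> k x = 0" for x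
      using lim[of x] that LIMSEQ_unique[of "\<lambda>k. 0::real" 0 1] by auto
    ultimately have "AE x in lebesgue. x \<notin> \<Omega>" by (rule eventually_mono)
    then have "negligible \<Omega>" using \<Omega>L by (simp add: AE_iff_null negligible_iff_null_sets)
    then show ?thesis using open_not_negligible[OF open_\<Omega> nonempty] by blast
  qed
qed

text \<open>The supremum of \<open>intD\<close> over \<open>intA \<le> 1\<close>, \<open>intB \<le> 1\<close> is attained by compactness, and
  every function with positive \<open>intA\<close> and \<open>intB\<close> can be normalised to lie in this set.\<close>

theorem sharp_inequality:
  obtains K w H where "K > 0" "\<And>u G. E u G \<Longrightarrow> intD u \<le> K * (intA G powr \<theta>1 * intB u powr \<theta>2)"
    "E w H" "intA H > 0" "intB w > 0" "intD w = K * (intA H powr \<theta>1 * intB w powr \<theta>2)"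
proof -
  define S where "S = {intD u | u G. E u G \<and> intA G \<le> 1 \<and> intB u \<le> 1}"
  define K where "K = Sup S"
  obtain C where "\<And>u G. E u G \<Longrightarrow> intA G \<le> 1 \<Longrightarrow> intB u \<le> 1 \<Longrightarrow> intD u \<le> C"
    by (rule E_Lr) blast
  then have bdd: "bdd_above S" by (auto simp: S_def intro!: bdd_aboveI)
  have le_K: "intD u \<le> K" if "E u G" "intA G \<le> 1" "intB u \<le> 1" for u G
    unfolding K_def using that by (intro cSup_upper[OF _ bdd]) (auto simp: S_def)
  obtain v V where v: "E v V" "intD v > 0" by (rule intD_pos_exists)
  have S0: "\<exists>u G. E u G \<and> intA G \<le> 1 \<and> intB u \<le> 1 \<and> intD u > 0"
  proof -
    have pos: "intA V > 0" "intB v > 0"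
      using intD_eq_0[OF v(1)] v(2) by (auto simp: order_less_le)
    obtain u G where u: "E u G" "intA G = 1" "intB u = 1"
      "intD u * (intA V powr \<theta>1 * intB v powr \<theta>2) = intD v * (1 powr \<theta>1 * 1 powr \<theta>2)"
      by (rule E_normalize[OF v(1) pos zero_less_one zero_less_one])
    have "intD u \<noteq> 0" using u(4) v(2) by auto
    then have "intD u > 0" by (simp add: order_less_le)
    then show ?thesis using u by (intro exI[of _ u] exI[of _ G]) auto
  qed
  then have K: "K > 0" using le_K by (meson less_le_trans)
  have "S \<noteq> {}" using S0 by (auto simp: S_def)
  then have "\<exists>x\<in>S. K - inverse (real (Suc n)) < x" for n
    unfolding K_def using less_cSup_iff[OF _ bdd, of "Sup S - inverse (real (Suc n))"] by simp
  then have "\<forall>n. \<exists>z. E (fst z) (snd z) \<and> intA (snd z) \<le> 1 \<and> intB (fst z) \<le> 1 \<and> K - inverse (real (Suc n)) < intD (fst z)"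
    unfolding S_def by fastforce
  then obtain z where z: "\<And>n. E (fst (z n)) (snd (z n))" "\<And>n. intA (snd (z n)) \<le> 1" "\<And>n. intB (fst (z n)) \<le> 1"
    "\<And>n. K - inverse (real (Suc n)) < intD (fst (z n))" by metis
  obtain w H k where w: "E w H" "intA H \<le> 1" "intB w \<le> 1" and k: "strict_mono (k :: nat \<Rightarrow> nat)"
    and lim: "(\<lambda>n. intD (fst (z (k n)))) \<longlonglongrightarrow> intD w"
    by (rule embedding_compact[OF z(1-3)])
  have "(\<lambda>n. intD (fst (z n))) \<longlonglongrightarrow> K"
  proof (rule tendsto_sandwich[OF _ _ _ tendsto_const])
    show "(\<lambda>n. K - inverse (real (Suc n))) \<longlonglongrightarrow> K"
      using tendsto_diff[OF tendsto_const LIMSEQ_inverse_real_of_nat, of K] by simp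
    show "\<forall>\<^sub>F n in sequentially. K - inverse (real (Suc n)) \<le> intD (fst (z n))"
      using z(4) by (auto intro!: always_eventually less_imp_le)
    show "\<forall>\<^sub>F n in sequentially. intD (fst (z n)) \<le> K"
      using le_K[OF z(1-3)] by auto
  qed
  from LIMSEQ_unique[OF lim LIMSEQ_subseq_LIMSEQ[OF this k, unfolded o_def]]
  have wK: "intD w = K" .
  have ineq: "intD u \<le> K * (intA G powr \<theta>1 * intB u powr \<theta>2)" if u: "E u G" for u G
  proof (cases "intA G = 0 \<or> intB u = 0")
    case True
    then show ?thesis using intD_eq_0[OF u] by auto
  next
    case False
    then have pos: "intA G > 0" "intB u > 0" by (auto simp: order_less_le)
    obtain v V where v: "E v V" "intA V = 1" "intB v = 1"
      "intD v * (intA G powr \<theta>1 * intB u powr \<theta>2) = intD u * (1 powr \<theta>1 * 1 powr \<theta>2)"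
      by (rule E_normalize[OF u pos zero_less_one zero_less_one])
    have "intD v \<le> K" using v by (intro le_K) auto
    then have "intD v * (intA G powr \<theta>1 * intB u powr \<theta>2) \<le> K * (intA G powr \<theta>1 * intB u powr \<theta>2)"
      by (intro mult_right_mono) auto
    then show ?thesis unfolding v(4) by simp
  qed
  have pos: "intA H > 0" "intB w > 0"
    using intD_eq_0[OF w(1)] wK K by (auto simp: order_less_le)
  have "intA H powr \<theta>1 * intB w powr \<theta>2 \<le> 1 powr \<theta>1 * 1 powr \<theta>2"
    using w \<theta>1 \<theta>2 by (intro mult_mono powr_mono2) auto
  then have "K * (intA H powr \<theta>1 * intB w powr \<theta>2) \<le> intD w"
    using K unfolding wK by simp
  then have "intD w = K * (intA H powr \<theta>1 * intB w powr \<theta>2)"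
    using ineq[OF w(1)] by simp
  from that[OF K ineq w(1) pos this] show ?thesis .
qed

end

section \<open>The sharp constant and the minimal energy\<close>

context ckn_cone
begin

text \<open>The parameters \<open>a\<close> and \<open>\<lambda>\<^sup>*\<close> and the exponent of the formula for the constant, in terms
  of \<open>\<theta>1\<close> and \<open>\<theta>2\<close>: Cramer's rule for the two equations of the locale.\<close>

lemma Cramer:
  "\<beta> * r - \<gamma> * q = \<theta>1 * (\<beta> * p - \<alpha> * q)" "\<gamma> * p - \<alpha> * r = \<theta>2 * (\<beta> * p - \<alpha> * q)"
  "(\<beta> - \<alpha>) * r + (p - q) * \<gamma> = (\<theta>1 + \<theta>2) * (\<beta> * p - \<alpha> * q)"
  unfolding amplitude[symmetric] dilation[symmetric] by (simp_all add: algebra_simps)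

lemma exponent_identities:
  "(real DIM('a) - \<sigma>) * r - (real DIM('a) - s) * q = \<theta>1 * (\<beta> * p - \<alpha> * q)"
  "p * (real DIM('a) - s) - (real DIM('a) - \<mu> - p) * r = \<theta>2 * (\<beta> * p - \<alpha> * q)"
  "(real DIM('a) - s) * p - (real DIM('a) - \<mu> - p) * r = \<theta>2 * (\<beta> * p - \<alpha> * q)"
  "(\<mu> + p - \<sigma>) * r + (p - q) * (real DIM('a) - s) = (\<theta>1 + \<theta>2) * (\<beta> * p - \<alpha> * q)"
  "(real DIM('a) - \<sigma>) * p - (real DIM('a) - \<mu> - p) * q = \<beta> * p - \<alpha> * q"
proof -
  have "\<mu> + p - \<sigma> = \<beta> - \<alpha>" by (simp add: \<alpha>_eq \<beta>_eq)
  then show "(\<mu> + p - \<sigma>) * r + (p - q) * (real DIM('a) - s) = (\<theta>1 + \<theta>2) * (\<beta> * p - \<alpha> * q)"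
    using Cramer(3) \<gamma>_eq by simp
qed (use Cramer(1,2) in \<open>simp_all only: \<alpha>_eq[symmetric] \<beta>_eq[symmetric] \<gamma>_eq[symmetric] mult.commute[of p]\<close>)

lemma a_exp_eq: "a_exp (real DIM('a)) p q r \<mu> \<sigma> s = p * \<theta>1 / r"
  unfolding a_exp_def exponent_identities using det r by (simp add: mult.commute)

lemma lambda_star_eq:
  "lambda_star (real DIM('a)) p q r \<mu> \<sigma> s
    = (\<theta>2 / (\<theta>1 + \<theta>2)) powr ((\<theta>1 + \<theta>2) / \<theta>2) * (\<theta>1 / \<theta>2) powr (\<theta>1 / \<theta>2)"
  unfolding lambda_star_def exponent_identities using det by simp

lemma lambda_star_powr:
  defines "w1 \<equiv> \<theta>1 / (\<theta>1 + \<theta>2)" and "w2 \<equiv> \<theta>2 / (\<theta>1 + \<theta>2)"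
  shows "lambda_star (real DIM('a)) p q r \<mu> \<sigma> s powr w2 = w1 powr w1 * w2 powr w2"
proof -
  have w: "w1 > 0" "w2 > 0" "w1 + w2 = 1"
    using \<theta>1 \<theta>2 by (auto simp: w1_def w2_def add_divide_distrib[symmetric])
  have e: "\<theta>1 / \<theta>2 = w1 / w2" "(\<theta>1 + \<theta>2) / \<theta>2 = 1 / w2"
    using \<theta>1 \<theta>2 by (auto simp: w1_def w2_def)
  have "lambda_star (real DIM('a)) p q r \<mu> \<sigma> s powr w2 = (w2 powr (1 / w2) * (w1 / w2) powr (w1 / w2)) powr w2"
    unfolding lambda_star_eq e w2_def[symmetric] ..
  also have "\<dots> = w2 powr (1 / w2 * w2) * (w1 / w2) powr (w1 / w2 * w2)"
    by (simp only: powr_mult powr_powr)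
  also have "\<dots> = w2 powr 1 * (w1 / w2) powr w1" using w by simp
  also have "\<dots> = w2 powr (w1 + w2) * (w1 powr w1 / w2 powr w1)" using w by (simp add: powr_divide)
  also have "\<dots> = w1 powr w1 * w2 powr w2" unfolding powr_add using w by simp
  finally show ?thesis .
qed

lemma lambda_star_pos: "lambda_star (real DIM('a)) p q r \<mu> \<sigma> s > 0"
  unfolding lambda_star_eq using \<theta>1 \<theta>2 by simp

lemma weighted_int_E:
  assumes "E u G"
  shows "weighted_int \<Omega> r s u = intD u" "weighted_int \<Omega> q \<sigma> u = intB u" "weighted_Lp \<Omega> r s u"
  using weighted_int_eq[OF \<Omega>L E_Lp(4)[OF assms]] E_Lp_r[OF assms] by (auto simp: weighted_Lp_iff[OF \<Omega>L])

lemma intD_root: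
  assumes "E u G"
  shows "(K * (intA G powr \<theta>1 * intB u powr \<theta>2)) powr (1 / r)
      = K powr (1 / r) * grad_int \<Omega> p \<mu> u powr (a_exp (real DIM('a)) p q r \<mu> \<sigma> s / p)
        * weighted_int \<Omega> q \<sigma> u powr ((1 - a_exp (real DIM('a)) p q r \<mu> \<sigma> s) / q)"
proof -
  have "a_exp (real DIM('a)) p q r \<mu> \<sigma> s / p = \<theta>1 * (1 / r)" unfolding a_exp_eq using p by simp
  moreover have "(1 - a_exp (real DIM('a)) p q r \<mu> \<sigma> s) / q = \<theta>2 * (1 / r)"
  proof -
    have "1 - p * \<theta>1 / r = (r - p * \<theta>1) / r" using r by (simp add: diff_divide_distrib)
    also have "r - p * \<theta>1 = q * \<theta>2" using amplitude by simp
    finally show ?thesis unfolding a_exp_eq using q by simp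
  qed
  ultimately show ?thesis
    by (simp only: grad_int_eq[OF assms] weighted_int_E[OF assms] powr_mult powr_powr mult.assoc)
qed

theorem sharp_constant:
  fixes C :: real
  defines "a \<equiv> a_exp (real DIM('a)) p q r \<mu> \<sigma> s" and "C \<equiv> CKN_sharp \<Omega> p q r \<mu> \<sigma> s"
  shows "C \<in> CKN_constants \<Omega> p q r \<mu> \<sigma> s"
    and "\<exists>u \<in> E_space \<Omega> p q \<mu> \<sigma>. \<not> (AE x in lebesgue. x \<in> \<Omega> \<longrightarrow> u x = 0) \<and>
           weighted_int \<Omega> r s u powr (1 / r)
             = C * grad_int \<Omega> p \<mu> u powr (a / p) * weighted_int \<Omega> q \<sigma> u powr ((1 - a) / q)"
    and "C = (1 / rho \<Omega> p q r \<mu> \<sigma> s) powr ((\<theta>1 + \<theta>2) / r)"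
    and "\<exists>u \<in> admissible \<Omega> p q r \<mu> \<sigma> s. energy \<Omega> p q r \<mu> \<sigma> s u = rho \<Omega> p q r \<mu> \<sigma> s"
proof -
  obtain K w H where K: "K > 0" and ineq: "\<And>u G. E u G \<Longrightarrow> intD u \<le> K * (intA G powr \<theta>1 * intB u powr \<theta>2)"
    and w: "E w H" and pos: "intA H > 0" "intB w > 0" and eq: "intD w = K * (intA H powr \<theta>1 * intB w powr \<theta>2)"
    by (rule sharp_inequality) blast
  have r0: "r > 0" using r by simp
  have root: "(K * (intA G powr \<theta>1 * intB u powr \<theta>2)) powr (1 / r)
      = K powr (1 / r) * grad_int \<Omega> p \<mu> u powr (a / p) * weighted_int \<Omega> q \<sigma> u powr ((1 - a) / q)" if "E u G" for u G
    unfolding a_def by (rule intD_root[OF that])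
  have weq: "weighted_int \<Omega> r s w powr (1 / r)
      = K powr (1 / r) * grad_int \<Omega> p \<mu> w powr (a / p) * weighted_int \<Omega> q \<sigma> w powr ((1 - a) / q)"
    unfolding weighted_int_E(1)[OF w] eq by (rule root[OF w])
  have mem: "K powr (1 / r) \<in> CKN_constants \<Omega> p q r \<mu> \<sigma> s"
    unfolding CKN_constants_def Let_def a_def[symmetric]
  proof (rule CollectI, rule ballI)
    fix u assume "u \<in> E_space \<Omega> p q \<mu> \<sigma>"
    then obtain G where u: "E u G" by (auto simp: E_space_iff)
    have "weighted_int \<Omega> r s u powr (1 / r) \<le> (K * (intA G powr \<theta>1 * intB u powr \<theta>2)) powr (1 / r)"
      unfolding weighted_int_E(1)[OF u] using ineq[OF u] r0 by (intro powr_mono2) auto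
    then show "weighted_Lp \<Omega> r s u \<and> weighted_int \<Omega> r s u powr (1 / r)
       \<le> K powr (1 / r) * grad_int \<Omega> p \<mu> u powr (a / p) * weighted_int \<Omega> q \<sigma> u powr ((1 - a) / q)"
      using weighted_int_E(3)[OF u] unfolding root[OF u] by blast
  qed
  have least: "K powr (1 / r) \<le> c" if "c \<in> CKN_constants \<Omega> p q r \<mu> \<sigma> s" for c
  proof -
    let ?X = "grad_int \<Omega> p \<mu> w powr (a / p) * weighted_int \<Omega> q \<sigma> w powr ((1 - a) / q)"
    have "w \<in> E_space \<Omega> p q \<mu> \<sigma>" using w by (auto simp: E_space_iff)
    then have "weighted_int \<Omega> r s w powr (1 / r) \<le> c * grad_int \<Omega> p \<mu> w powr (a / p) * weighted_int \<Omega> q \<sigma> w powr ((1 - a) / q)"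
      using that unfolding CKN_constants_def Let_def a_def[symmetric] by blast
    then have "K powr (1 / r) * ?X \<le> c * ?X" unfolding weq by (simp only: mult.assoc)
    moreover have "?X > 0" using pos by (simp add: grad_int_eq[OF w] weighted_int_E[OF w])
    ultimately show ?thesis by (rule mult_right_le_imp_le)
  qed
  have C: "C = K powr (1 / r)"
    unfolding C_def CKN_sharp_def using mem least by (rule cInf_eq_minimum)
  show "C \<in> CKN_constants \<Omega> p q r \<mu> \<sigma> s" unfolding C by (rule mem)
  have "intD w > 0" unfolding eq using K pos by simp
  moreover have "intD w = 0" if "AE x in lebesgue. x \<in> \<Omega> \<longrightarrow> w x = 0"
    using Lp_cong_AE(1)[OF \<Omega>L E_Lp(4)[OF w] borel_measurable_const that, of r s] by (simp add: Lp_int_def)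
  ultimately have "\<not> (AE x in lebesgue. x \<in> \<Omega> \<longrightarrow> w x = 0)" by auto
  then show "\<exists>u \<in> E_space \<Omega> p q \<mu> \<sigma>. \<not> (AE x in lebesgue. x \<in> \<Omega> \<longrightarrow> u x = 0) \<and>
           weighted_int \<Omega> r s u powr (1 / r)
             = C * grad_int \<Omega> p \<mu> u powr (a / p) * weighted_int \<Omega> q \<sigma> u powr ((1 - a) / q)"
    unfolding C using weq E_space_iff[of w] w by blast
  define \<Theta> where "\<Theta> = \<theta>1 + \<theta>2"
  define w1 where "w1 = \<theta>1 / \<Theta>"
  define w2 where "w2 = \<theta>2 / \<Theta>"
  define \<Lambda> where "\<Lambda> = lambda_star (real DIM('a)) p q r \<mu> \<sigma> s"
  have \<Theta>: "\<Theta> > 0" using \<theta>_gt by (simp add: \<Theta>_def)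
  have w12: "0 < w1" "0 < w2" "w1 + w2 = 1"
    using \<theta>1 \<theta>2 \<Theta> by (auto simp: w1_def w2_def \<Theta>_def add_divide_distrib[symmetric])
  have \<theta>w: "\<theta>1 = w1 * \<Theta>" "\<theta>2 = w2 * \<Theta>" using \<Theta> by (auto simp: w1_def w2_def)
  have \<Lambda>: "\<Lambda> > 0" "\<Lambda> powr w2 = w1 powr w1 * w2 powr w2"
    using lambda_star_pos lambda_star_powr by (auto simp: \<Lambda>_def w1_def w2_def \<Theta>_def)
  define R where "R = K powr (- (1 / \<Theta>))"
  have R: "R > 0" using K by (simp add: R_def)
  have energy: "energy \<Omega> p q r \<mu> \<sigma> s u = intA G + \<Lambda> * intB u" if "E u G" for u G
    by (simp add: energy_def \<Lambda>_def grad_int_eq[OF that] weighted_int_E[OF that])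
  have low: "R \<le> energy \<Omega> p q r \<mu> \<sigma> s u" if adm: "u \<in> admissible \<Omega> p q r \<mu> \<sigma> s" for u
  proof -
    obtain G where u: "E u G" using adm by (auto simp: admissible_def E_space_iff)
    have D: "intD u = 1" using adm weighted_int_E(1)[OF u] by (simp add: admissible_def)
    have "1 powr (1 / \<Theta>) \<le> (K * (intA G powr (w1 * \<Theta>) * intB u powr (w2 * \<Theta>))) powr (1 / \<Theta>)"
      using ineq[OF u] D \<Theta> unfolding \<theta>w by (intro powr_mono2) auto
    also have "\<dots> = K powr (1 / \<Theta>) * (intA G powr (w1 * \<Theta> * (1 / \<Theta>)) * intB u powr (w2 * \<Theta> * (1 / \<Theta>)))"
      by (simp only: powr_mult powr_powr)
    also have "\<dots> = K powr (1 / \<Theta>) * (intA G powr w1 * intB u powr w2)" using \<Theta> by simp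
    finally have "R * 1 \<le> R * (K powr (1 / \<Theta>) * (intA G powr w1 * intB u powr w2))"
      using R by (intro mult_left_mono) auto
    also have "\<dots> = intA G powr w1 * intB u powr w2"
      unfolding mult.assoc[symmetric] using K by (simp add: R_def powr_minus)
    also have "\<dots> \<le> intA G + \<Lambda> * intB u"
      by (rule weighted_Young[OF w12 \<Lambda>]) auto
    finally show ?thesis unfolding energy[OF u] by simp
  qed
  \<comment> \<open>the values for which Young's inequality is an equality\<close>
  obtain v V where v: "E v V" "intA V = w1 * R" "intB v = w2 * R / \<Lambda>"
    "intD v * (intA H powr \<theta>1 * intB w powr \<theta>2) = intD w * ((w1 * R) powr \<theta>1 * (w2 * R / \<Lambda>) powr \<theta>2)"
    by (rule E_normalize[OF w pos, of "w1 * R" "w2 * R / \<Lambda>"]) (use w12 R \<Lambda> in auto)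
  have "(w1 * R) powr w1 * (w2 * R / \<Lambda>) powr w2 = (w1 powr w1 * w2 powr w2 / \<Lambda> powr w2) * (R powr w1 * R powr w2)"
    using w12 R \<Lambda>(1) by (simp add: powr_mult powr_divide)
  also have "\<dots> = R" unfolding powr_add[symmetric] \<Lambda>(2) using w12 R by simp
  finally have "((w1 * R) powr w1 * (w2 * R / \<Lambda>) powr w2) powr \<Theta> = R powr \<Theta>" by simp
  also have "\<dots> = inverse K" unfolding R_def powr_powr using \<Theta> K by (simp add: powr_minus)
  finally have "(w1 * R) powr \<theta>1 * (w2 * R / \<Lambda>) powr \<theta>2 = inverse K"
    unfolding \<theta>w by (simp only: powr_mult powr_powr)
  then have "intD v * (intA H powr \<theta>1 * intB w powr \<theta>2) = intA H powr \<theta>1 * intB w powr \<theta>2"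
    using v(4) eq K by simp
  then have "intD v = 1" using pos by simp
  then have adm: "v \<in> admissible \<Omega> p q r \<mu> \<sigma> s"
    using v(1) by (auto simp: admissible_def E_space_iff weighted_int_E)
  have en: "energy \<Omega> p q r \<mu> \<sigma> s v = R"
    unfolding energy[OF v(1)] v(2,3) using w12(3) \<Lambda>(1) by (simp add: distrib_right[symmetric])
  have rho: "rho \<Omega> p q r \<mu> \<sigma> s = R"
    unfolding rho_def by (rule cInf_eq_minimum) (use adm en low in auto)
  show "\<exists>u \<in> admissible \<Omega> p q r \<mu> \<sigma> s. energy \<Omega> p q r \<mu> \<sigma> s u = rho \<Omega> p q r \<mu> \<sigma> s"
    using adm en rho by auto
  have "1 / R = K powr (1 / \<Theta>)" by (simp add: R_def powr_minus_divide)
  then have "(1 / R) powr (\<Theta> / r) = K powr (1 / \<Theta> * (\<Theta> / r))" by (simp only: powr_powr)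
  also have "\<dots> = K powr (1 / r)" using \<Theta> by simp
  finally show "C = (1 / rho \<Omega> p q r \<mu> \<sigma> s) powr ((\<theta>1 + \<theta>2) / r)" unfolding C rho \<Theta>_def by simp
qed

end

theorem theorem1p1:
  fixes \<Omega> :: "(real ^ 'n) set" and p q r \<mu> \<sigma> s N a C :: real
  defines "N \<equiv> real CARD('n)"
    and "a \<equiv> a_exp N p q r \<mu> \<sigma> s"
    and "C \<equiv> CKN_sharp \<Omega> p q r \<mu> \<sigma> s"
  assumes "CARD('n) \<ge> 2"
    and "open \<Omega>" and "\<Omega> \<noteq> {}" and "\<And>x c. x \<in> \<Omega> \<Longrightarrow> c > 0 \<Longrightarrow> c *\<^sub>R x \<in> \<Omega>"
    and "p > 1" and "s > 0"
    and "max \<sigma> s < \<mu> + p" and "\<mu> + p < N"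
    and "r \<ge> 1" and "1 \<le> q"
    and "ereal q < min (p_star N p) (ereal (p_star_w N p \<sigma> \<mu>))"
    and "max (p * (\<sigma> - s) / (N - \<mu> - p) + q) ((\<sigma> - s) / (N - \<sigma>) * q + q) < r"
    and "ereal r < min (p_star N p) (ereal (p_star_w N p s \<mu>))"
    and "p * (s - \<sigma>) + q * (\<mu> + p - s) < r * (\<mu> + p - \<sigma>)"
    and "(N * p - N * r + p * r) * (s - \<sigma>) > (N * \<mu> - N * s + p * s) * (r - q)"
  shows "C \<in> CKN_constants \<Omega> p q r \<mu> \<sigma> s \<and>
         (\<exists>u \<in> E_space \<Omega> p q \<mu> \<sigma>. \<not> (AE x in lebesgue. x \<in> \<Omega> \<longrightarrow> u x = 0) \<and>
           weighted_int \<Omega> r s u powr (1 / r)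
             = C * grad_int \<Omega> p \<mu> u powr (a / p) * weighted_int \<Omega> q \<sigma> u powr ((1 - a) / q)) \<and>
         C = (1 / rho \<Omega> p q r \<mu> \<sigma> s)
           powr (((\<mu> + p - \<sigma>) * r + (p - q) * (N - s)) / (r * ((N - \<sigma>) * p - (N - \<mu> - p) * q))) \<and>
         (\<exists>u \<in> admissible \<Omega> p q r \<mu> \<sigma> s. energy \<Omega> p q r \<mu> \<sigma> s u = rho \<Omega> p q r \<mu> \<sigma> s)"
proof -
  define \<alpha> where "\<alpha> = N - \<mu> - p"
  define \<beta> where "\<beta> = N - \<sigma>"
  define \<gamma> where "\<gamma> = N - s"
  define \<Delta> where "\<Delta> = \<beta> * p - \<alpha> * q"
  define \<theta>1 where "\<theta>1 = (\<beta> * r - \<gamma> * q) / \<Delta>"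
  define \<theta>2 where "\<theta>2 = (\<gamma> * p - \<alpha> * r) / \<Delta>"
  have \<alpha>: "\<alpha> > 0" and \<mu>p: "\<mu> + p > 0" and \<beta>: "\<beta> > 0"
    using \<open>max \<sigma> s < \<mu> + p\<close> \<open>\<mu> + p < N\<close> \<open>s > 0\<close> by (auto simp: \<alpha>_def \<beta>_def)
  have star: "t < p * (N - m) / \<alpha> \<Longrightarrow> \<alpha> * t < (N - m) * p" for t m
    using \<alpha> by (simp add: pos_less_divide_eq mult.commute)
  have "q < p * (N - \<sigma>) / \<alpha>" using \<open>ereal q < _\<close> by (simp add: p_star_w_def \<alpha>_def algebra_simps)
  from star[OF this] have \<Delta>: "\<Delta> > 0" by (simp add: \<Delta>_def \<beta>_def)
  have "r < p * (N - s) / \<alpha>" using \<open>ereal r < _\<close> by (simp add: p_star_w_def \<alpha>_def algebra_simps)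
  from star[OF this] have \<theta>2: "\<theta>2 > 0" using \<Delta> by (simp add: \<theta>2_def \<gamma>_def)
  have m: "p * (\<sigma> - s) / \<alpha> + q < r" "(\<sigma> - s) / \<beta> * q + q < r"
    using \<open>max _ _ < r\<close> by (auto simp: \<alpha>_def \<beta>_def)
  have "\<theta>2 < 1"
  proof -
    have "\<alpha> * (p * (\<sigma> - s) / \<alpha> + q) < \<alpha> * r" using m(1) \<alpha> by (rule mult_strict_left_mono)
    then have "p * (\<sigma> - s) + \<alpha> * q < \<alpha> * r" using \<alpha> by (simp add: distrib_left)
    then have "\<gamma> * p - \<alpha> * r < \<Delta>" by (simp add: \<Delta>_def \<beta>_def \<gamma>_def algebra_simps)
    then show ?thesis using \<Delta> by (simp add: \<theta>2_def)
  qed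
  have \<theta>1: "\<theta>1 > 0"
  proof -
    have "\<beta> * ((\<sigma> - s) / \<beta> * q + q) < \<beta> * r" using m(2) \<beta> by (rule mult_strict_left_mono)
    then have "(\<sigma> - s) * q + \<beta> * q < \<beta> * r" using \<beta> by (simp add: distrib_left)
    then have "0 < \<beta> * r - \<gamma> * q" by (simp add: \<beta>_def \<gamma>_def algebra_simps)
    then show ?thesis using \<Delta> by (simp add: \<theta>1_def)
  qed
  have \<theta>\<Delta>: "\<theta>1 * \<Delta> = \<beta> * r - \<gamma> * q" "\<theta>2 * \<Delta> = \<gamma> * p - \<alpha> * r" using \<Delta> by (auto simp: \<theta>1_def \<theta>2_def)
  have "(p * \<theta>1 + q * \<theta>2) * \<Delta> = p * (\<theta>1 * \<Delta>) + q * (\<theta>2 * \<Delta>)" by (simp add: algebra_simps)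
  also have "\<dots> = r * \<Delta>" unfolding \<theta>\<Delta> by (simp add: \<Delta>_def algebra_simps)
  finally have amp: "p * \<theta>1 + q * \<theta>2 = r" using \<Delta> by simp
  have "(\<alpha> * \<theta>1 + \<beta> * \<theta>2) * \<Delta> = \<alpha> * (\<theta>1 * \<Delta>) + \<beta> * (\<theta>2 * \<Delta>)" by (simp add: algebra_simps)
  also have "\<dots> = \<gamma> * \<Delta>" unfolding \<theta>\<Delta> by (simp add: \<Delta>_def algebra_simps)
  finally have dil: "\<alpha> * \<theta>1 + \<beta> * \<theta>2 = \<gamma>" using \<Delta> by simp
  have "0 < (\<theta>1 + \<theta>2 - 1) * \<Delta>"
  proof -
    have "(\<theta>1 + \<theta>2 - 1) * \<Delta> = \<theta>1 * \<Delta> + \<theta>2 * \<Delta> - \<Delta>" by (simp add: algebra_simps)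
    also have "\<dots> = r * (\<mu> + p - \<sigma>) - (p * (s - \<sigma>) + q * (\<mu> + p - s))"
      unfolding \<theta>\<Delta> by (simp add: \<Delta>_def \<alpha>_def \<beta>_def \<gamma>_def algebra_simps)
    finally show ?thesis using \<open>p * (s - \<sigma>) + _ < _\<close> by simp
  qed
  then have gt: "1 < \<theta>1 + \<theta>2" using \<Delta> by (simp add: zero_less_mult_iff)
  have "0 < (p * \<theta>1 - N * (\<theta>1 + \<theta>2 - 1)) * \<Delta>"
  proof -
    have "(p * \<theta>1 - N * (\<theta>1 + \<theta>2 - 1)) * \<Delta> = p * (\<theta>1 * \<Delta>) - N * (\<theta>1 * \<Delta> + \<theta>2 * \<Delta> - \<Delta>)" by (simp add: algebra_simps)
    also have "\<dots> = (N * p - N * r + p * r) * (s - \<sigma>) - (N * \<mu> - N * s + p * s) * (r - q)"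
      unfolding \<theta>\<Delta> by (simp add: \<Delta>_def \<alpha>_def \<beta>_def \<gamma>_def algebra_simps)
    finally show ?thesis using \<open>(N * p - N * r + p * r) * (s - \<sigma>) > _\<close> by simp
  qed
  then have conc: "N * (\<theta>1 + \<theta>2 - 1) < p * \<theta>1" using \<Delta> by (simp add: zero_less_mult_iff)
  have dim: "real DIM(real ^ 'n) = N" by (simp add: N_def)
  interpret ckn_cone \<Omega> p q r \<mu> \<sigma> s \<alpha> \<beta> \<gamma> \<theta>1 \<theta>2
    by unfold_locales (use assms \<alpha> \<beta> \<mu>p \<Delta> \<theta>1 \<theta>2 \<open>\<theta>2 < 1\<close> amp dil gt conc dim in
      \<open>simp_all add: \<alpha>_def \<beta>_def \<gamma>_def \<Delta>_def\<close>)
  have "((\<mu> + p - \<sigma>) * r + (p - q) * (N - s)) / (r * ((N - \<sigma>) * p - (N - \<mu> - p) * q)) = (\<theta>1 + \<theta>2) / r"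
    using exponent_identities(4,5) \<Delta> unfolding dim \<Delta>_def by simp
  then show ?thesis
    using sharp_constant unfolding dim a_def[symmetric] C_def[symmetric] by simp
qed

end
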